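(* Let $\varphi\in\mathcal{AC}$ satisfy the Zachrisson equation with unilateral constraints. Then, for every $t_0\in[0,T]$ and every $i_0\in\mathcal{S}$, $$\operatorname{Val}^+(t_0,i_0)=\operatorname{Val}^-(t_0,i_0)=\varphi(t_0,i_0).$$
   Context: **Data and standing assumptions.** $T>0$; $\mathcal{S}=\{1,\dots,d\}$; $U,V$ are the control spaces of the first and second player; for $(t,u,v)\in[0,T]\times U\times V$, $Q(t,u,v)=(Q_{i,j}(t,u,v))_{i,j=1}^d$ is a Kolmogorov matrix, i.e. $Q_{i,j}(t,u,v)\ge 0$ for $i\ne j$ and $\sum_{j\in\mathcal{S}}Q_{i,j}(t,u,v)=0$; $g:[0,T]\times\mathcal{S}\to\mathbb{R}$ and $h:[0,T]\times\mathcal{S}\times U\times V\to\mathbb{R}$. It is assumed that: (1) $U$ and $V$ are compact; (2) $Q_{i,j}$, $g(\cdot,i)$ and $h(\cdot,i,\cdot,\cdot)$ are continuous for all $i,j$; (3) $g$ is Lipschitz continuous in the time variable; (4) for all $t\in[0,T]$, $i\in\mathcal{S}$, $w\in\mathbb{R}^d$, $$\min_{u\in U}\max_{v\in V}\Bigl[\sum_{j\in\mathcal{S}}Q_{i,j}(t,u,v)w_j+h(t,i,u,v)\Bigr]=\max_{v\in V}\min_{u\in U}\Bigl[\sum_{j\in\mathcal{S}}Q_{i,j}(t,u,v)w_j+h(t,i,u,v)\Bigr].$$ The common value is denoted $H_i(t,w)$. **Path space.** For $t_0\in[0,T]$, $\Omega_{t_0}=D([t_0,T],\mathcal{S})$ is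 the space of càdlàg functions from $[t_0,T]$ to $\mathcal{S}$, with Borel $\sigma$-algebra $\mathcal{F}_{t_0}$. For $t\in[t_0,T]$, $\mathcal{F}_{t_0,t}$ is the $\sigma$-algebra of all sets $\{\omega\in\Omega_{t_0}:\omega|_{[t_0,t]}\in B\}$ with $B$ Borel in $D([t_0,t],\mathcal{S})$, and $\mathbb{F}_{t_0}=\{\mathcal{F}_{t_0,t}\}_{t\in[t_0,T]}$. $\mathcal{T}_{t_0}$ is the set of stopping times w.r.t. $\mathbb{F}_{t_0}$ with values in $[t_0,T]$. **Function class.** $\mathcal{AC}$ is the set of functions $\phi:[0,T]\times\mathcal{S}\to\mathbb{R}$ such that $t\mapsto\phi(t,i)$ is absolutely continuous for each $i$; $\phi(t)$ denotes the vector $(\phi(t,1),\dots,\phi(t,d))^T$. $\frac{\partial}{\partial t}\phi(s,\omega(s))$ denotes the time derivative of $\phi(\cdot,i)$ at $s$ with $i=\omega(s)$. **Strategies.** $\mathcal{U}_{\mathrm{fb}}$ (resp. $\mathcal{V}_{\mathrm{fb}}$) is the set of feedback strategies: maps $[0,T]\times\mathcal{S}\to U$ (resp. $V$) measurable in time. $\mathcal{T}_{\mathrm{fb}}$ is the set of stopping rules: functions $\vartheta:[0,T]\times\mathcal{S}\to\{0,1\}$ that are càdlàg in time; the corresponding stopping time is $\bar\tau_{t_0}[\vartheta](\omega)=\min\{t\in[t_0,T]:\vartheta(t,\omega(t))=1\}$ (equal to $T$ if the set is empty). $\mathcal{U}_{t_0}$ (resp. $\mathcal{V}_{t_0}$)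 is the set of strategies with memory: $\mathbb{F}_{t_0}$-progressively measurable processes on $[t_0,T]\times\Omega_{t_0}$ with values in $U$ (resp. $V$). A feedback strategy $u$ (resp. $v$) is identified with the strategy with memory $(t,\omega)\mapsto u(t,\omega(t))$ (resp. $v(t,\omega(t))$). **Probability and payoff.** For $\alpha\in\mathcal{U}_{t_0}$, $\beta\in\mathcal{V}_{t_0}$, $i_0\in\mathcal{S}$, $\mathbb{P}^{\alpha,\beta}_{t_0,i_0}$ is the probability on $\mathcal{F}_{t_0}$ generated by $\alpha,\beta,t_0,i_0$, i.e. such that $\mathbb{P}^{\alpha,\beta}_{t_0,i_0}(\omega(t_0)=i_0)=1$ and, for every $\phi\in\mathcal{AC}$, the process $$\phi(t,\omega(t))-\int_{t_0}^t\Bigl[\tfrac{\partial}{\partial t}\phi(t',\omega(t'))+\sum_{j\in\mathcal{S}}Q_{\omega(t'),j}(t',\alpha(t',\omega),\beta(t',\omega))\phi(t',j)\Bigr]dt'$$ is a $(\mathbb{P}^{\alpha,\beta}_{t_0,i_0},\mathbb{F}_{t_0})$-martingale. $\mathbb{E}^{\alpha,\beta}_{t_0,i_0}$ is the corresponding expectation. Put $G^{\alpha,\beta}_{t_0}(t,\omega)=g(t,\omega(t))+\int_{t_0}^t h(t',\omega(t'),\alpha(t',\omega),\beta(t',\omega))\,dt'$; for a stopping time $\tau$, $G^{\alpha,\beta}_{t_0}(\tau)$ denotes $\omega\mapsto G^{\alpha,\beta}_{t_0}(\tau(\omega),\omega)$. **Values.** $$\operatorname{Val}^+(t_0,i_0)=\inf_{u\in\mathcal{U}_{\mathrm{fb}}}\inf_{\vartheta\in\mathcal{T}_{\mathrm{fb}}}\sup_{\beta\in\mathcal{V}_{t_0}}\mathbb{E}^{u,\beta}_{t_0,i_0}G^{u,\beta}_{t_0}(\bar\tau_{t_0}[\vartheta]),\qquad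 \operatorname{Val}^-(t_0,i_0)=\sup_{v\in\mathcal{V}_{\mathrm{fb}}}\inf_{\alpha\in\mathcal{U}_{t_0}}\inf_{\tau\in\mathcal{T}_{t_0}}\mathbb{E}^{\alpha,v}_{t_0,i_0}G^{\alpha,v}_{t_0}(\tau).$$ **Zachrisson equation with unilateral constraints.** $\varphi\in\mathcal{AC}$ satisfies it if for each $i\in\mathcal{S}$: (Z1) $\varphi(T,i)=g(T,i)$; (Z2) $\varphi(t,i)\le g(t,i)$ for $t\in[0,T]$; (Z3) at every $t\in[0,T]$ where $\frac{d}{dt}\varphi(t,i)$ exists and $\varphi(t,i)<g(t,i)$, one has $\frac{d}{dt}\varphi(t,i)\le -H_i(t,\varphi(t))$; (Z4) at every $t\in[0,T]$ where $\varphi(\cdot,i)$ is differentiable, $\frac{d}{dt}\varphi(t,i)\ge -H_i(t,\varphi(t))$. *)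

theory Defs
  imports "HOL-Probability.Probability"
begin

section \<open>Path space\<close>

definition cadlag_on :: "'a topology \<Rightarrow> real \<Rightarrow> real \<Rightarrow> (real \<Rightarrow> 'a) \<Rightarrow> bool" where
  "cadlag_on X a b f \<longleftrightarrow>
     (\<forall>t\<in>{a..b}. f t \<in> topspace X) \<and>
     (\<forall>t\<in>{a..<b}. limitin X f (f t) (at_right t)) \<and>
     (\<forall>t\<in>{a<..b}. \<exists>l. limitin X f l (at_left t))"

text \<open>Functions on $[a,b]$ are represented by their extensional extensions, so that
  equality of paths is equality on $[a,b]$. The state space is the finite type \<open>'s\<close>
  with its discrete topology.\<close>

definition path_space :: "real \<Rightarrow> real \<Rightarrow> (real \<Rightarrow> 's) set" where
  "path_space a b = {\<omega> \<in> extensional {a..b}. cadlag_on (discrete_topology UNIV) a b \<omega>}"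

definition time_changes :: "real \<Rightarrow> real \<Rightarrow> (real \<Rightarrow> real) set" where
  "time_changes a b = {r. strict_mono_on {a..b} r \<and> r ` {a..b} = {a..b}}"

text \<open>Skorokhod's J1 metric; the state space carries the metric that is 1 on distinct points.\<close>

definition skorokhod_bounds :: "real \<Rightarrow> real \<Rightarrow> (real \<Rightarrow> 's) \<Rightarrow> (real \<Rightarrow> 's) \<Rightarrow> real set" where
  "skorokhod_bounds a b \<omega> \<omega>' =
     {e. \<exists>r\<in>time_changes a b. \<forall>t\<in>{a..b}. \<bar>r t - t\<bar> \<le> e \<and> of_bool (\<omega> (r t) \<noteq> \<omega>' t) \<le> e}"

definition skorokhod_dist :: "real \<Rightarrow> real \<Rightarrow> (real \<Rightarrow> 's) \<Rightarrow> (real \<Rightarrow> 's) \<Rightarrow> real" where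
  "skorokhod_dist a b \<omega> \<omega>' = Inf (skorokhod_bounds a b \<omega> \<omega>')"

definition skorokhod_topology :: "real \<Rightarrow> real \<Rightarrow> (real \<Rightarrow> 's) topology" where
  "skorokhod_topology a b = Metric_space.mtopology (path_space a b) (skorokhod_dist a b)"

definition path_borel :: "real \<Rightarrow> real \<Rightarrow> (real \<Rightarrow> 's) measure" where
  "path_borel a b = sigma (path_space a b) {A. openin (skorokhod_topology a b) A}"

subsection \<open>The J1 metric is a metric\<close>

lemma time_changes_D:
  assumes "r \<in> time_changes a b"
  shows "strict_mono_on {a..b} r" "r ` {a..b} = {a..b}" "bij_betw r {a..b} {a..b}"
  using assms
  by (auto simp: time_changes_def bij_betw_def intro: strict_mono_on_imp_inj_on)

lemma time_changes_mem: "r \<in> time_changes a b \<Longrightarrow> t \<in> {a..b} \<Longrightarrow> r t \<in> {a..b}"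
  using time_changes_D(2) by blast

lemma id_time_change: "(\<lambda>t. t) \<in> time_changes a b"
  by (auto simp: time_changes_def strict_mono_on_def)

lemma comp_time_change:
  assumes r: "r \<in> time_changes a b" and s: "s \<in> time_changes a b"
  shows "(\<lambda>t. r (s t)) \<in> time_changes a b"
proof -
  have "strict_mono_on {a..b} (\<lambda>t. r (s t))"
    using time_changes_D(1)[OF r] time_changes_D(1)[OF s] time_changes_mem[OF s]
    unfolding strict_mono_on_def by blast
  moreover have "(\<lambda>t. r (s t)) ` {a..b} = {a..b}"
    using time_changes_D(2)[OF r] time_changes_D(2)[OF s] by (metis image_image)
  ultimately show ?thesis by (simp add: time_changes_def)
qed

lemma inv_time_change:
  assumes r: "r \<in> time_changes a b"
  shows "inv_into {a..b} r \<in> time_changes a b"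
proof -
  let ?s = "inv_into {a..b} r"
  have inj: "inj_on r {a..b}" and im: "r ` {a..b} = {a..b}"
    using time_changes_D(3)[OF r] by (auto simp: bij_betw_def)
  have "bij_betw ?s {a..b} {a..b}"
    using time_changes_D(3)[OF r] by (rule bij_betw_inv_into)
  then have im': "?s ` {a..b} = {a..b}" by (simp add: bij_betw_def)
  have "?s x < ?s y" if xy: "x \<in> {a..b}" "y \<in> {a..b}" "x < y" for x y
  proof (rule ccontr)
    assume "\<not> ?s x < ?s y"
    then have "?s y \<le> ?s x" by simp
    moreover have "?s x \<in> {a..b}" "?s y \<in> {a..b}" using im' xy by blast+
    ultimately have "r (?s y) \<le> r (?s x)"
      using strict_mono_on_leD[OF time_changes_D(1)[OF r]] by blast
    moreover have "r (?s y) = y" "r (?s x) = x"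
      using xy im by (simp_all add: f_inv_into_f)
    ultimately show False using xy by simp
  qed
  then have "strict_mono_on {a..b} ?s" by (auto simp: strict_mono_on_def)
  with im' show ?thesis by (simp add: time_changes_def)
qed

lemma skorokhod_bounds_nonneg: "a \<le> b \<Longrightarrow> e \<in> skorokhod_bounds a b \<omega> \<omega>' \<Longrightarrow> 0 \<le> e"
  unfolding skorokhod_bounds_def by (force dest: bspec[of _ _ a])

lemma skorokhod_bounds_bdd: "a \<le> b \<Longrightarrow> bdd_below (skorokhod_bounds a b \<omega> \<omega>')"
  using skorokhod_bounds_nonneg by (metis bdd_below.I)

lemma skorokhod_bounds_nonempty: "skorokhod_bounds a b \<omega> \<omega>' \<noteq> {}"
proof -
  have "1 \<in> skorokhod_bounds a b \<omega> \<omega>'"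
    unfolding skorokhod_bounds_def using id_time_change[of a b] by (force intro!: bexI[OF _ id_time_change])
  then show ?thesis by blast
qed

lemma skorokhod_bounds_commute_le:
  assumes "e \<in> skorokhod_bounds a b \<omega> \<omega>'"
  shows "e \<in> skorokhod_bounds a b \<omega>' \<omega>"
proof -
  obtain r where r: "r \<in> time_changes a b"
    and e: "\<And>t. t \<in> {a..b} \<Longrightarrow> \<bar>r t - t\<bar> \<le> e \<and> of_bool (\<omega> (r t) \<noteq> \<omega>' t) \<le> e"
    using assms unfolding skorokhod_bounds_def by blast
  let ?s = "inv_into {a..b} r"
  have "\<bar>?s t - t\<bar> \<le> e \<and> of_bool (\<omega>' (?s t) \<noteq> \<omega> t) \<le> e" if "t \<in> {a..b}" for t
  proof -
    have "?s t \<in> {a..b}" using time_changes_mem[OF inv_time_change[OF r] that] .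
    moreover have "r (?s t) = t"
      using that time_changes_D(2)[OF r] by (simp add: f_inv_into_f)
    ultimately show ?thesis using e[of "?s t"] by (auto simp: abs_minus_commute eq_commute)
  qed
  then show ?thesis using inv_time_change[OF r] unfolding skorokhod_bounds_def by blast
qed

lemma skorokhod_bounds_triangle:
  assumes ab: "a \<le> b"
    and 1: "e1 \<in> skorokhod_bounds a b x y" and 2: "e2 \<in> skorokhod_bounds a b y z"
  shows "e1 + e2 \<in> skorokhod_bounds a b x z"
proof -
  obtain r where r: "r \<in> time_changes a b"
    and e: "\<And>t. t \<in> {a..b} \<Longrightarrow> \<bar>r t - t\<bar> \<le> e1 \<and> of_bool (x (r t) \<noteq> y t) \<le> e1"
    using 1 unfolding skorokhod_bounds_def by blast
  obtain s where s: "s \<in> time_changes a b"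
    and f: "\<And>t. t \<in> {a..b} \<Longrightarrow> \<bar>s t - t\<bar> \<le> e2 \<and> of_bool (y (s t) \<noteq> z t) \<le> e2"
    using 2 unfolding skorokhod_bounds_def by blast
  have nn: "0 \<le> e1" "0 \<le> e2" using skorokhod_bounds_nonneg ab 1 2 by blast+
  have "\<bar>r (s t) - t\<bar> \<le> e1 + e2 \<and> of_bool (x (r (s t)) \<noteq> z t) \<le> e1 + e2" if "t \<in> {a..b}" for t
    using e[OF time_changes_mem[OF s that]] f[OF that] nn by (auto split: if_splits simp: of_bool_def)
  then show ?thesis
    unfolding skorokhod_bounds_def by (intro CollectI bexI[OF _ comp_time_change[OF r s]] ballI)
qed

lemma path_space_right_const:
  assumes "\<omega> \<in> path_space a b" "a \<le> t" "t < b"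
  shows "eventually (\<lambda>s. \<omega> s = \<omega> t) (at_right t)"
proof -
  have "limitin (discrete_topology UNIV) \<omega> (\<omega> t) (at_right t)"
    using assms by (auto simp: path_space_def cadlag_on_def)
  then show ?thesis by (auto simp: limitin_def dest: spec[of _ "{\<omega> t}"])
qed

lemma skorokhod_dist_zero_imp_eq:
  assumes ab: "a \<le> b" and x: "x \<in> path_space a b" and y: "y \<in> path_space a b"
    and 0: "skorokhod_dist a b x y = 0"
  shows "x = y"
proof (rule extensionalityI[of _ "{a..b}"])
  show "x \<in> extensional {a..b}" "y \<in> extensional {a..b}"
    using x y by (auto simp: path_space_def)
  have small: "\<exists>r\<in>time_changes a b. \<forall>t\<in>{a..b}. \<bar>r t - t\<bar> < e \<and> x (r t) = y t" if e: "e > 0" for e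
  proof -
    have "Inf (skorokhod_bounds a b x y) < min e 1"
      using 0 e by (simp add: skorokhod_dist_def)
    then obtain f where "f \<in> skorokhod_bounds a b x y" "f < min e 1"
      using cInf_lessD[OF skorokhod_bounds_nonempty] by blast
    then show ?thesis unfolding skorokhod_bounds_def by (force split: if_splits simp: of_bool_def)
  qed
  fix t assume t: "t \<in> {a..b}"
  show "x t = y t"
  proof (cases "t = b")
    case True
    obtain r where r: "r \<in> time_changes a b" "\<forall>t\<in>{a..b}. x (r t) = y t"
      using small[of 1] by auto
    obtain c where c: "c \<in> {a..b}" "r c = b"
      using time_changes_D(2)[OF r(1)] ab by (metis atLeastAtMost_iff imageE order_refl)
    have "r c \<le> r b"
      using strict_mono_on_leD[OF time_changes_D(1)[OF r(1)]] c ab by auto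
    moreover have "r b \<in> {a..b}" using time_changes_mem[OF r(1)] ab by auto
    ultimately have "r b = b" using c by auto
    then show ?thesis using r ab True by force
  next
    case False
    then have tb: "a \<le> t" "t < b" using t by auto
    have "eventually (\<lambda>s. x s = x t \<and> y s = y t) (at_right t)"
      using path_space_right_const[OF x tb] path_space_right_const[OF y tb]
      by (rule eventually_conj)
    then obtain c where c: "c > t" "\<And>s. t < s \<Longrightarrow> s < c \<Longrightarrow> x s = x t \<and> y s = y t"
      unfolding eventually_at_right_field by blast
    define m where "m = (min b c - t) / 2"
    have "m > 0" "t + 2 * m = min b c" using c tb by (auto simp: m_def field_simps)
    then have m: "m > 0" "t + 2 * m \<le> b" "t + 2 * m \<le> c" by auto
    obtain r where r: "r \<in> time_changes a b" "\<forall>s\<in>{a..b}. \<bar>r s - s\<bar> < m \<and> x (r s) = y s"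
      using small[OF m(1)] by blast
    have "t + m \<in> {a..b}" using m tb by auto
    then have "\<bar>r (t + m) - (t + m)\<bar> < m" "x (r (t + m)) = y (t + m)" using r(2) by blast+
    moreover from this have "x (r (t + m)) = x t" using m by (intro c(2)[THEN conjunct1]) auto
    moreover have "y (t + m) = y t" using m by (intro c(2)[THEN conjunct2]) auto
    ultimately show ?thesis by simp
  qed
qed

lemma Metric_space_skorokhod:
  assumes ab: "a \<le> b"
  shows "Metric_space (path_space a b) (skorokhod_dist a b)"
proof
  fix x y z :: "real \<Rightarrow> 's"
  show "0 \<le> skorokhod_dist a b x y"
    unfolding skorokhod_dist_def
    using skorokhod_bounds_nonneg[OF ab] by (intro cInf_greatest skorokhod_bounds_nonempty)
  have "skorokhod_bounds a b x y = skorokhod_bounds a b y x"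
    using skorokhod_bounds_commute_le by blast
  then show "skorokhod_dist a b x y = skorokhod_dist a b y x"
    by (simp add: skorokhod_dist_def)
  show "skorokhod_dist a b x z \<le> skorokhod_dist a b x y + skorokhod_dist a b y z"
  proof -
    have "skorokhod_dist a b x z \<le> e1 + e2"
      if "e1 \<in> skorokhod_bounds a b x y" "e2 \<in> skorokhod_bounds a b y z" for e1 e2
      unfolding skorokhod_dist_def
      by (rule cInf_lower[OF skorokhod_bounds_triangle[OF ab that] skorokhod_bounds_bdd[OF ab]])
    then have "skorokhod_dist a b x z - e2 \<le> skorokhod_dist a b x y"
      if "e2 \<in> skorokhod_bounds a b y z" for e2
      unfolding skorokhod_dist_def[of a b x y] using that
      by (intro cInf_greatest skorokhod_bounds_nonempty) (force simp: algebra_simps)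
    then have "skorokhod_dist a b x z - skorokhod_dist a b x y \<le> skorokhod_dist a b y z"
      unfolding skorokhod_dist_def[of a b y z]
      by (intro cInf_greatest skorokhod_bounds_nonempty) (force simp: algebra_simps)
    then show ?thesis by simp
  qed
  show "(skorokhod_dist a b x y = 0) = (x = y)"
    if "x \<in> path_space a b" "y \<in> path_space a b"
  proof
    assume "x = y"
    then have "0 \<in> skorokhod_bounds a b x y"
      unfolding skorokhod_bounds_def using id_time_change[of a b] by (force intro!: bexI[OF _ id_time_change])
    then have "skorokhod_dist a b x y \<le> 0"
      unfolding skorokhod_dist_def by (rule cInf_lower[OF _ skorokhod_bounds_bdd[OF ab]])
    moreover have "0 \<le> skorokhod_dist a b x y"
      unfolding skorokhod_dist_def
      using skorokhod_bounds_nonneg[OF ab] by (intro cInf_greatest skorokhod_bounds_nonempty)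
    ultimately show "skorokhod_dist a b x y = 0" by simp
  qed (use skorokhod_dist_zero_imp_eq[OF ab that] in simp)
qed

section \<open>Filtration, stopping times, martingales\<close>

definition path_filtration :: "real \<Rightarrow> real \<Rightarrow> real \<Rightarrow> (real \<Rightarrow> 's) measure" where
  "path_filtration T t0 t =
     vimage_algebra (path_space t0 T) (\<lambda>\<omega>. restrict \<omega> {t0..t}) (path_borel t0 t)"

definition stopping_times :: "real \<Rightarrow> real \<Rightarrow> ((real \<Rightarrow> 's) \<Rightarrow> real) set" where
  "stopping_times T t0 =
     {\<tau> \<in> path_space t0 T \<rightarrow> {t0..T}.
        \<forall>t\<in>{t0..T}. Measurable.pred (path_filtration T t0 t) (\<lambda>\<omega>. \<tau> \<omega> \<le> t)}"

definition is_martingale ::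
  "'a measure \<Rightarrow> (real \<Rightarrow> 'a measure) \<Rightarrow> real \<Rightarrow> real \<Rightarrow> (real \<Rightarrow> 'a \<Rightarrow> real) \<Rightarrow> bool" where
  "is_martingale P F a b X \<longleftrightarrow>
     (\<forall>t\<in>{a..b}. X t \<in> borel_measurable (F t) \<and> integrable P (X t)) \<and>
     (\<forall>s\<in>{a..b}. \<forall>t\<in>{s..b}. AE \<omega> in P. real_cond_exp P (F s) (X t) \<omega> = X s \<omega>)"

section \<open>Absolutely continuous functions\<close>

definition abs_continuous_on :: "real \<Rightarrow> real \<Rightarrow> (real \<Rightarrow> real) \<Rightarrow> bool" where
  "abs_continuous_on a b f \<longleftrightarrow>
     (\<forall>e>0. \<exists>\<delta>>0. \<forall>I. finite I \<longrightarrow> (\<forall>(x, y)\<in>I. a \<le> x \<and> x \<le> y \<and> y \<le> b) \<longrightarrow>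
        disjoint_family_on (\<lambda>(x, y). {x<..<y}) I \<longrightarrow>
        (\<Sum>(x, y)\<in>I. y - x) < \<delta> \<longrightarrow> (\<Sum>(x, y)\<in>I. \<bar>f y - f x\<bar>) < e)"

definition AC :: "real \<Rightarrow> (real \<Rightarrow> 's \<Rightarrow> real) set" where
  "AC T = {\<phi>. \<forall>i. abs_continuous_on 0 T (\<lambda>t. \<phi> t i)}"

section \<open>Kolmogorov matrices and the Hamiltonian\<close>

definition kolmogorov_matrix :: "real^'s^'s \<Rightarrow> bool" where
  "kolmogorov_matrix A \<longleftrightarrow>
     (\<forall>i j. i \<noteq> j \<longrightarrow> 0 \<le> A $ i $ j) \<and> (\<forall>i. (\<Sum>j\<in>UNIV. A $ i $ j) = 0)"

definition pre_hamiltonian ::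
  "(real \<Rightarrow> 'u \<Rightarrow> 'v \<Rightarrow> real^'s^'s) \<Rightarrow> (real \<Rightarrow> 's \<Rightarrow> 'u \<Rightarrow> 'v \<Rightarrow> real)
     \<Rightarrow> real \<Rightarrow> 's \<Rightarrow> real^'s \<Rightarrow> 'u \<Rightarrow> 'v \<Rightarrow> real" where
  "pre_hamiltonian Q h t i w u v = (\<Sum>j\<in>UNIV. Q t u v $ i $ j * w $ j) + h t i u v"

text \<open>Under the standing assumptions (\<open>U\<close>, \<open>V\<close> compact and nonempty, \<open>Q\<close> and \<open>h\<close> continuous)
  the infima and suprema are attained, i.e. they are the minima and maxima.\<close>

definition hamiltonian ::
  "'u set \<Rightarrow> 'v set \<Rightarrow> (real \<Rightarrow> 'u \<Rightarrow> 'v \<Rightarrow> real^'s^'s) \<Rightarrow> (real \<Rightarrow> 's \<Rightarrow> 'u \<Rightarrow> 'v \<Rightarrow> real)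
     \<Rightarrow> real \<Rightarrow> 's \<Rightarrow> real^'s \<Rightarrow> real" where
  "hamiltonian U V Q h t i w = (INF u\<in>U. SUP v\<in>V. pre_hamiltonian Q h t i w u v)"

definition lower_hamiltonian ::
  "'u set \<Rightarrow> 'v set \<Rightarrow> (real \<Rightarrow> 'u \<Rightarrow> 'v \<Rightarrow> real^'s^'s) \<Rightarrow> (real \<Rightarrow> 's \<Rightarrow> 'u \<Rightarrow> 'v \<Rightarrow> real)
     \<Rightarrow> real \<Rightarrow> 's \<Rightarrow> real^'s \<Rightarrow> real" where
  "lower_hamiltonian U V Q h t i w = (SUP v\<in>V. INF u\<in>U. pre_hamiltonian Q h t i w u v)"

section \<open>Strategies\<close>

definition feedback_strategies :: "real \<Rightarrow> 'c::topological_space set \<Rightarrow> (real \<Rightarrow> 's \<Rightarrow> 'c) set" where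
  "feedback_strategies T A =
     {u. \<forall>i. (\<lambda>t. u t i) \<in> restrict_space borel {0..T} \<rightarrow>\<^sub>M restrict_space borel A}"

definition memory_strategies ::
  "real \<Rightarrow> real \<Rightarrow> 'c::topological_space set \<Rightarrow> (real \<Rightarrow> (real \<Rightarrow> 's) \<Rightarrow> 'c) set" where
  "memory_strategies T t0 A =
     {\<alpha>. \<forall>t\<in>{t0..T}. (\<lambda>(s, \<omega>). \<alpha> s \<omega>) \<in>
        restrict_space borel {t0..t} \<Otimes>\<^sub>M path_filtration T t0 t \<rightarrow>\<^sub>M restrict_space borel A}"

definition with_memory :: "(real \<Rightarrow> 's \<Rightarrow> 'c) \<Rightarrow> real \<Rightarrow> (real \<Rightarrow> 's) \<Rightarrow> 'c" where
  "with_memory u t \<omega> = u t (\<omega> t)"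

definition stopping_rules :: "real \<Rightarrow> (real \<Rightarrow> 's \<Rightarrow> nat) set" where
  "stopping_rules T = {\<theta>. \<forall>i. cadlag_on (discrete_topology {0, 1}) 0 T (\<lambda>t. \<theta> t i)}"

definition rule_time :: "real \<Rightarrow> real \<Rightarrow> (real \<Rightarrow> 's \<Rightarrow> nat) \<Rightarrow> (real \<Rightarrow> 's) \<Rightarrow> real" where
  "rule_time T t0 \<theta> \<omega> =
     (if \<exists>t\<in>{t0..T}. \<theta> t (\<omega> t) = 1 then LEAST t. t \<in> {t0..T} \<and> \<theta> t (\<omega> t) = 1 else T)"

section \<open>Controlled probabilities, payoff and values\<close>

text \<open>The derivative of an absolutely continuous function exists almost everywhere, so that the
  values of \<open>deriv\<close> at the remaining times do not affect the integral.\<close>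

definition compensated_process ::
  "(real \<Rightarrow> 'u \<Rightarrow> 'v \<Rightarrow> real^'s^'s) \<Rightarrow> real \<Rightarrow> (real \<Rightarrow> (real \<Rightarrow> 's) \<Rightarrow> 'u)
     \<Rightarrow> (real \<Rightarrow> (real \<Rightarrow> 's) \<Rightarrow> 'v) \<Rightarrow> (real \<Rightarrow> 's \<Rightarrow> real) \<Rightarrow> real \<Rightarrow> (real \<Rightarrow> 's) \<Rightarrow> real" where
  "compensated_process Q t0 \<alpha> \<beta> \<phi> t \<omega> =
     \<phi> t (\<omega> t) -
     (LINT s:{t0..t}|lebesgue. deriv (\<lambda>r. \<phi> r (\<omega> s)) s +
        (\<Sum>j\<in>UNIV. Q s (\<alpha> s \<omega>) (\<beta> s \<omega>) $ \<omega> s $ j * \<phi> s j))"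

definition generated_by ::
  "real \<Rightarrow> (real \<Rightarrow> 'u \<Rightarrow> 'v \<Rightarrow> real^'s^'s) \<Rightarrow> real \<Rightarrow> 's \<Rightarrow> (real \<Rightarrow> (real \<Rightarrow> 's) \<Rightarrow> 'u)
     \<Rightarrow> (real \<Rightarrow> (real \<Rightarrow> 's) \<Rightarrow> 'v) \<Rightarrow> (real \<Rightarrow> 's) measure \<Rightarrow> bool" where
  "generated_by T Q t0 i0 \<alpha> \<beta> P \<longleftrightarrow>
     prob_space P \<and> space P = path_space t0 T \<and> sets P = sets (path_borel t0 T) \<and>
     measure P {\<omega> \<in> path_space t0 T. \<omega> t0 = i0} = 1 \<and>
     (\<forall>\<phi>\<in>AC T. is_martingale P (path_filtration T t0) t0 T (compensated_process Q t0 \<alpha> \<beta> \<phi>))"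

text \<open>The martingale problem has exactly one solution for strategies with memory, so that
  the choice operator denotes that solution.\<close>

definition game_prob ::
  "real \<Rightarrow> (real \<Rightarrow> 'u \<Rightarrow> 'v \<Rightarrow> real^'s^'s) \<Rightarrow> real \<Rightarrow> 's \<Rightarrow> (real \<Rightarrow> (real \<Rightarrow> 's) \<Rightarrow> 'u)
     \<Rightarrow> (real \<Rightarrow> (real \<Rightarrow> 's) \<Rightarrow> 'v) \<Rightarrow> (real \<Rightarrow> 's) measure" where
  "game_prob T Q t0 i0 \<alpha> \<beta> = (SOME P. generated_by T Q t0 i0 \<alpha> \<beta> P)"

definition payoff ::
  "(real \<Rightarrow> 's \<Rightarrow> real) \<Rightarrow> (real \<Rightarrow> 's \<Rightarrow> 'u \<Rightarrow> 'v \<Rightarrow> real) \<Rightarrow> real \<Rightarrow> (real \<Rightarrow> (real \<Rightarrow> 's) \<Rightarrow> 'u)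
     \<Rightarrow> (real \<Rightarrow> (real \<Rightarrow> 's) \<Rightarrow> 'v) \<Rightarrow> real \<Rightarrow> (real \<Rightarrow> 's) \<Rightarrow> real" where
  "payoff g h t0 \<alpha> \<beta> t \<omega> =
     g t (\<omega> t) + (LINT s:{t0..t}|lebesgue. h s (\<omega> s) (\<alpha> s \<omega>) (\<beta> s \<omega>))"

definition expected_payoff ::
  "real \<Rightarrow> (real \<Rightarrow> 'u \<Rightarrow> 'v \<Rightarrow> real^'s^'s) \<Rightarrow> (real \<Rightarrow> 's \<Rightarrow> real) \<Rightarrow> (real \<Rightarrow> 's \<Rightarrow> 'u \<Rightarrow> 'v \<Rightarrow> real)
     \<Rightarrow> real \<Rightarrow> 's \<Rightarrow> (real \<Rightarrow> (real \<Rightarrow> 's) \<Rightarrow> 'u) \<Rightarrow> (real \<Rightarrow> (real \<Rightarrow> 's) \<Rightarrow> 'v)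
     \<Rightarrow> ((real \<Rightarrow> 's) \<Rightarrow> real) \<Rightarrow> real" where
  "expected_payoff T Q g h t0 i0 \<alpha> \<beta> \<tau> =
     (LINT \<omega>|game_prob T Q t0 i0 \<alpha> \<beta>. payoff g h t0 \<alpha> \<beta> (\<tau> \<omega>) \<omega>)"

text \<open>All payoffs are bounded by a constant depending only on \<open>T\<close>, \<open>g\<close> and \<open>h\<close>, so that the
  real-valued infima and suprema below are the usual ones.\<close>

definition upper_value ::
  "real \<Rightarrow> 'u::topological_space set \<Rightarrow> 'v::topological_space set \<Rightarrow> (real \<Rightarrow> 'u \<Rightarrow> 'v \<Rightarrow> real^'s^'s)
     \<Rightarrow> (real \<Rightarrow> 's \<Rightarrow> real) \<Rightarrow> (real \<Rightarrow> 's \<Rightarrow> 'u \<Rightarrow> 'v \<Rightarrow> real) \<Rightarrow> real \<Rightarrow> 's \<Rightarrow> real" where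
  "upper_value T U V Q g h t0 i0 =
     (INF u\<in>feedback_strategies T U. INF \<theta>\<in>stopping_rules T. SUP \<beta>\<in>memory_strategies T t0 V.
        expected_payoff T Q g h t0 i0 (with_memory u) \<beta> (rule_time T t0 \<theta>))"

definition lower_value ::
  "real \<Rightarrow> 'u::topological_space set \<Rightarrow> 'v::topological_space set \<Rightarrow> (real \<Rightarrow> 'u \<Rightarrow> 'v \<Rightarrow> real^'s^'s)
     \<Rightarrow> (real \<Rightarrow> 's \<Rightarrow> real) \<Rightarrow> (real \<Rightarrow> 's \<Rightarrow> 'u \<Rightarrow> 'v \<Rightarrow> real) \<Rightarrow> real \<Rightarrow> 's \<Rightarrow> real" where
  "lower_value T U V Q g h t0 i0 =
     (SUP v\<in>feedback_strategies T V. INF \<alpha>\<in>memory_strategies T t0 U. INF \<tau>\<in>stopping_times T t0.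
        expected_payoff T Q g h t0 i0 \<alpha> (with_memory v) \<tau>)"

section \<open>Zachrisson equation with unilateral constraints\<close>

text \<open>Derivatives at the endpoints of $[0,T]$ are one-sided.\<close>

definition zachrisson ::
  "real \<Rightarrow> 'u set \<Rightarrow> 'v set \<Rightarrow> (real \<Rightarrow> 'u \<Rightarrow> 'v \<Rightarrow> real^'s^'s) \<Rightarrow> (real \<Rightarrow> 's \<Rightarrow> real)
     \<Rightarrow> (real \<Rightarrow> 's \<Rightarrow> 'u \<Rightarrow> 'v \<Rightarrow> real) \<Rightarrow> (real \<Rightarrow> 's \<Rightarrow> real) \<Rightarrow> bool" where
  "zachrisson T U V Q g h \<phi> \<longleftrightarrow> (\<forall>i.
     \<phi> T i = g T i \<and>
     (\<forall>t\<in>{0..T}. \<phi> t i \<le> g t i) \<and>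
     (\<forall>t\<in>{0..T}. \<forall>D. ((\<lambda>s. \<phi> s i) has_real_derivative D) (at t within {0..T}) \<longrightarrow>
        \<phi> t i < g t i \<longrightarrow> D \<le> - hamiltonian U V Q h t i (\<chi> j. \<phi> t j)) \<and>
     (\<forall>t\<in>{0..T}. \<forall>D. ((\<lambda>s. \<phi> s i) has_real_derivative D) (at t within {0..T}) \<longrightarrow>
        D \<ge> - hamiltonian U V Q h t i (\<chi> j. \<phi> t j)))"

end

theory Submission imports Defs
begin

text \<open>
  The theorem is a verification argument. Fix a solution \<open>\<phi>\<close> of the Zachrisson equation. Whatever the players do,
  the payoff at time \<open>t\<close> differs from the compensated process of \<open>\<phi>\<close> by \<open>g - \<phi>\<close> at the current state plus the integral over
  \<open>[t0, t]\<close> of the time derivative of \<open>\<phi>\<close> plus the expression under the min-max of the Hamiltonian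
  (\<open>payoff_compensated\<close>). If the second player uses a feedback within \<open>e\<close> of the max-min, the inequality
  \<open>\<phi>' \<ge> - H\<close> makes the integrand at least \<open>- e\<close> almost everywhere, and \<open>\<phi> \<le> g\<close>; so at every stopping time the payoff is
  at least the compensated process minus \<open>e T\<close>. If the first player uses a feedback within \<open>e\<close> of the min-max and stops
  as soon as \<open>\<phi>\<close> is about to touch \<open>g\<close>, then \<open>\<phi> < g\<close> before stopping, so \<open>\<phi>' \<le> - H\<close> makes the integrand at most \<open>e\<close>, while
  \<open>g - \<phi> \<le> e\<close> when the game is stopped. The compensated process is a bounded right-continuous martingale started at
  \<open>\<phi>(t0, i0)\<close>, and optional stopping (\<open>stopped_compensated_process\<close>) turns the two pathwise comparisons into bounds for
  expectations. Hence these strategies form an approximate saddle point with value \<open>\<phi>(t0, i0)\<close>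
  (\<open>epsilon_saddle_point\<close>), and both values equal \<open>\<phi>(t0, i0)\<close> (\<open>values_eq\<close>).

  The near-optimal feedbacks are constant on the cells of a fine time grid: by uniform continuity a choice that is good at
  the left end of a cell is good on the whole cell, and a function of finitely many grid points is measurable
  without any selection theorem. The stopping rule is equal to 1 on exactly the cells in which \<open>\<phi>\<close> meets \<open>g\<close>, which makes it
  cadlag.

  The expectations refer to a chosen solution of the martingale problem, so the existence of a solution carries the whole
  argument (\<open>martingale_problem_solvable\<close>). It is obtained by thinning. Scatter a Poisson number of independent uniform points
  (time, target state, mark) over a box, go through them in the order of time, and let the chain jump to the target
  when the mark is below the current rate divided by a common bound \<open>C\<close> of all rates. Rates depending on the past are
  harmless, because at each point the past path is already built. The compensator is computed from
  the Mecke formula (\<open>Mecke\<close>): a point of the configuration may be treated as an independent extra point, and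
  the path strictly before a point is the path built from the other points.

  Two facts make the objects tractable: the Borel sets of Skorokhod's topology are generated by the evaluations
  (\<open>sets_path_borel_eval\<close>), and an absolutely continuous function is the integral of its almost everywhere
  existing derivative (\<open>abs_continuous_derivative\<close>).
\<close>

section \<open>Absolutely continuous functions\<close>

text \<open>Degenerate intervals are excluded: they could belong to the families inside two adjacent intervals, and a sum over the union of
  these families would not split.\<close>
definition interval_families :: "real \<Rightarrow> real \<Rightarrow> (real \<times> real) set set" where
  "interval_families a b = {I. finite I \<and> (\<forall>(x, y)\<in>I. a \<le> x \<and> x < y \<and> y \<le> b) \<and>
     disjoint_family_on (\<lambda>(x, y). {x<..<y}) I}"

definition increment_sum :: "(real \<Rightarrow> real) \<Rightarrow> (real \<times> real) set \<Rightarrow> real" where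
  "increment_sum f I = (\<Sum>(x, y)\<in>I. f y - f x)"

lemma interval_families_eq:
  assumes I: "I \<in> interval_families a b" and p: "(x, y) \<in> I" "(x', y') \<in> I" "max x x' < min y y'"
  shows "(x, y) = (x', y')"
proof (rule ccontr)
  assume "(x, y) \<noteq> (x', y')"
  with I p have "{x<..<y} \<inter> {x'<..<y'} = {}"
    using disjoint_family_onD[of "\<lambda>(x, y). {x<..<y}" I "(x, y)" "(x', y')"] by (simp add: interval_families_def)
  moreover have "(max x x' + min y y') / 2 \<in> {x<..<y} \<inter> {x'<..<y'}" using p by auto
  ultimately show False by blast
qed

lemma interval_familiesI:
  assumes "finite I" "\<And>x y. (x, y) \<in> I \<Longrightarrow> a \<le> x \<and> x < y \<and> y \<le> b"
    and "\<And>x y x' y'. (x, y) \<in> I \<Longrightarrow> (x', y') \<in> I \<Longrightarrow> max x x' < min y y' \<Longrightarrow> (x, y) = (x', y')"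
  shows "I \<in> interval_families a b"
proof -
  have "disjoint_family_on (\<lambda>(x, y). {x<..<y}) I"
    unfolding disjoint_family_on_def
  proof (intro ballI impI)
    fix p p' assume h: "p \<in> I" "p' \<in> I" "p \<noteq> p'"
    obtain x y x' y' where e: "p = (x, y)" "p' = (x', y')" by force
    have "\<not> max x x' < min y y'" using assms(3)[of x y x' y'] h e by blast
    then show "(case p of (x, y) \<Rightarrow> {x<..<y}) \<inter> (case p' of (x, y) \<Rightarrow> {x<..<y}) = {}" by (auto simp: e)
  qed
  then show ?thesis using assms(1,2) by (auto simp: interval_families_def)
qed

lemma interval_familiesD:
  assumes "I \<in> interval_families a b"
  shows "finite I" "(x, y) \<in> I \<Longrightarrow> a \<le> x" "(x, y) \<in> I \<Longrightarrow> x < y" "(x, y) \<in> I \<Longrightarrow> y \<le> b"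
  using assms by (auto simp: interval_families_def)

lemma interval_families_length:
  assumes I: "I \<in> interval_families a b" and "a \<le> b"
  shows "(\<Sum>(x, y)\<in>I. y - x) \<le> b - a"
proof -
  have fin: "finite I" using I by (simp add: interval_families_def)
  have "ennreal (\<Sum>(x, y)\<in>I. y - x) = (\<Sum>p\<in>I. emeasure lborel ((\<lambda>(x, y). {x<..<y}) p))"
    using I by (subst sum_ennreal[symmetric]) (auto simp: interval_families_def split: prod.splits intro!: sum.cong)
  also have "\<dots> = emeasure lborel (\<Union>p\<in>I. (\<lambda>(x, y). {x<..<y}) p)"
    using fin I by (intro sum_emeasure) (auto simp: interval_families_def)
  also have "\<dots> \<le> emeasure lborel {a..b}"
    using interval_familiesD[OF I] by (intro emeasure_mono) (auto, force+)
  also have "\<dots> = ennreal (b - a)" using \<open>a \<le> b\<close> by simp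
  finally show ?thesis using \<open>a \<le> b\<close> by (simp add: ennreal_le_iff)
qed

text \<open>An interval that contains \<open>c\<close> in its interior is cut in two, which does not change the sum of the increments.\<close>
lemma interval_families_split:
  assumes I: "I \<in> interval_families a b" and c: "a \<le> c" "c \<le> b"
  obtains I1 I2 where "I1 \<in> interval_families a c" "I2 \<in> interval_families c b"
    "increment_sum f I = increment_sum f I1 + increment_sum f I2"
proof -
  note D = interval_familiesD[OF I] and inj = interval_families_eq[OF I]
  let ?A = "{p\<in>I. fst p < c}" and ?B = "{p\<in>I. c < snd p}"
  let ?l = "\<lambda>(x, y). (x, min y c)" and ?r = "\<lambda>(x, y). (max x c, y)"
  have fin: "finite I" by (rule D)
  have injl: "inj_on ?l ?A"
    by (rule inj_onI, clarsimp) (meson D(3) inj max.idem min_less_iff_conj max_less_iff_conj prod.inject)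
  have injr: "inj_on ?r ?B"
    by (rule inj_onI, clarsimp) (metis D(3) inj min.idem max_less_iff_conj prod.inject)
  have 1: "?l ` ?A \<in> interval_families a c"
  proof (rule interval_familiesI)
    fix x y x' y' assume "(x, y) \<in> ?l ` ?A" "(x', y') \<in> ?l ` ?A" "max x x' < min y y'"
    then obtain z z' where "(x, z) \<in> I" "(x', z') \<in> I" "y = min z c" "y' = min z' c" by auto
    with inj[of x z x' z'] \<open>max x x' < min y y'\<close> show "(x, y) = (x', y')" by auto
  qed (use D in \<open>auto\<close>)
  have 2: "?r ` ?B \<in> interval_families c b"
  proof (rule interval_familiesI)
    fix x y x' y' assume "(x, y) \<in> ?r ` ?B" "(x', y') \<in> ?r ` ?B" "max x x' < min y y'"
    then obtain z z' where "(z, y) \<in> I" "(z', y') \<in> I" "x = max z c" "x' = max z' c" by auto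
    with inj[of z y z' y'] \<open>max x x' < min y y'\<close> show "(x, y) = (x', y')" by auto
  qed (use D in \<open>auto\<close>)
  have "increment_sum f I = (\<Sum>(x, y)\<in>I. (if x < c then f (min y c) - f x else 0) + (if c < y then f y - f (max x c) else 0))"
    unfolding increment_sum_def
    by (intro sum.cong refl) (use D(3) in \<open>fastforce simp: max_def min_def split: prod.splits\<close>)
  also have "\<dots> = (\<Sum>(x, y)\<in>I. if x < c then f (min y c) - f x else 0) + (\<Sum>(x, y)\<in>I. if c < y then f y - f (max x c) else 0)"
    by (simp add: case_prod_unfold sum.distrib)
  also have "(\<Sum>(x, y)\<in>I. if x < c then f (min y c) - f x else 0) = (\<Sum>(x, y)\<in>?A. f (min y c) - f x)"
    using fin by (intro sum.mono_neutral_cong_right) (auto split: if_splits)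
  also have "\<dots> = increment_sum f (?l ` ?A)"
    unfolding increment_sum_def by (subst sum.reindex[OF injl]) (simp add: case_prod_unfold)
  also have "(\<Sum>(x, y)\<in>I. if c < y then f y - f (max x c) else 0) = (\<Sum>(x, y)\<in>?B. f y - f (max x c))"
    using fin by (intro sum.mono_neutral_cong_right) (auto split: if_splits)
  also have "\<dots> = increment_sum f (?r ` ?B)"
    unfolding increment_sum_def by (subst sum.reindex[OF injr]) (simp add: case_prod_unfold)
  finally show thesis using 1 2 that by blast
qed

lemma interval_families_UN:
  assumes J: "J \<in> interval_families a b" and I: "\<And>x y. (x, y) \<in> J \<Longrightarrow> I (x, y) \<in> interval_families x y"
  shows "(\<Union>p\<in>J. I p) \<in> interval_families a b"
    and "(\<Sum>q\<in>(\<Union>p\<in>J. I p). h q) = (\<Sum>p\<in>J. \<Sum>q\<in>I p. h q)"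
proof -
  have same: "p = p'" if "p \<in> J" "p' \<in> J" "(x, y) \<in> I p" "(x', y') \<in> I p'" "max x x' < min y y'" for p p' x y x' y'
  proof -
    obtain u v u' v' where e: "p = (u, v)" "p' = (u', v')" by force
    have "u \<le> x" "y \<le> v" "u' \<le> x'" "y' \<le> v'"
      using interval_familiesD[OF I] that e by auto
    then show ?thesis using interval_families_eq[OF J, of u v u' v'] that e by auto
  qed
  show "(\<Union>p\<in>J. I p) \<in> interval_families a b"
  proof (rule interval_familiesI)
    show "finite (\<Union>p\<in>J. I p)" using interval_familiesD(1)[OF J] interval_familiesD(1)[OF I] by auto
    fix x y assume "(x, y) \<in> (\<Union>p\<in>J. I p)"
    then obtain u v where uv: "(u, v) \<in> J" "(x, y) \<in> I (u, v)" by force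
    show "a \<le> x \<and> x < y \<and> y \<le> b"
      using interval_familiesD(2-4)[OF J uv(1)] interval_familiesD(2-4)[OF I[OF uv(1)] uv(2)] by linarith
  next
    fix x y x' y' assume "(x, y) \<in> (\<Union>p\<in>J. I p)" "(x', y') \<in> (\<Union>p\<in>J. I p)" and m: "max x x' < min y y'"
    then obtain p p' where p: "p \<in> J" "p' \<in> J" "(x, y) \<in> I p" "(x', y') \<in> I p'" by blast
    then have "p = p'" using same m by blast
    then show "(x, y) = (x', y')" using interval_families_eq[OF I] p m by (cases p) fast
  qed
  show "(\<Sum>q\<in>(\<Union>p\<in>J. I p). h q) = (\<Sum>p\<in>J. \<Sum>q\<in>I p. h q)"
  proof (rule sum.UNION_disjoint)
    show "\<forall>p\<in>J. \<forall>p'\<in>J. p \<noteq> p' \<longrightarrow> I p \<inter> I p' = {}"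
    proof (intro ballI impI)
      fix p p' assume p: "p \<in> J" "p' \<in> J" "p \<noteq> p'"
      have False if "(x, y) \<in> I p \<inter> I p'" for x y
      proof -
        have "x < y" using interval_familiesD(3)[OF I] p that by (cases p) blast
        then show False using same[of p p' x y x y] p that by auto
      qed
      then show "I p \<inter> I p' = {}" by fast
    qed
  qed (use interval_familiesD(1)[OF J] interval_familiesD(1)[OF I] in auto)
qed

lemma abs_continuous_families:
  assumes "abs_continuous_on a b f" "e > 0"
  obtains \<delta> where "\<delta> > 0"
    "\<And>I. I \<in> interval_families a b \<Longrightarrow> (\<Sum>(x, y)\<in>I. y - x) < \<delta> \<Longrightarrow> (\<Sum>(x, y)\<in>I. \<bar>f y - f x\<bar>) < e"
proof -
  obtain \<delta> where "\<delta> > 0" and d: "\<And>I. finite I \<longrightarrow> (\<forall>(x, y)\<in>I. a \<le> x \<and> x \<le> y \<and> y \<le> b) \<longrightarrow>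
        disjoint_family_on (\<lambda>(x, y). {x<..<y}) I \<longrightarrow>
        (\<Sum>(x, y)\<in>I. y - x) < \<delta> \<longrightarrow> (\<Sum>(x, y)\<in>I. \<bar>f y - f x\<bar>) < e"
    using assms unfolding abs_continuous_on_def by blast
  show thesis
  proof (rule that[OF \<open>\<delta> > 0\<close>])
    fix I assume "I \<in> interval_families a b" "(\<Sum>(x, y)\<in>I. y - x) < \<delta>"
    then show "(\<Sum>(x, y)\<in>I. \<bar>f y - f x\<bar>) < e"
      using d[of I] by (auto simp: interval_families_def less_imp_le)
  qed
qed

lemma increment_sum_le_abs: "increment_sum f I \<le> (\<Sum>(x, y)\<in>I. \<bar>f y - f x\<bar>)"
  unfolding increment_sum_def by (intro sum_mono) auto

lemma interval_families_mono: "a' \<le> a \<Longrightarrow> b \<le> b' \<Longrightarrow> interval_families a b \<subseteq> interval_families a' b'"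
  unfolding interval_families_def by fastforce

text \<open>Within a subinterval shorter than the \<open>\<delta>\<close> of absolute continuity the sums stay below 1, and sums over adjacent
  intervals add up; Bolzano's bisection principle passes from short intervals to \<open>[a, b]\<close>.\<close>
lemma increment_sums_bounded:
  assumes ac: "abs_continuous_on a b f" and "a \<le> b"
  shows "\<exists>B. \<forall>I\<in>interval_families a b. increment_sum f I \<le> B"
proof -
  obtain \<delta> where d: "\<delta> > 0"
    "\<And>I. I \<in> interval_families a b \<Longrightarrow> (\<Sum>(x, y)\<in>I. y - x) < \<delta> \<Longrightarrow> (\<Sum>(x, y)\<in>I. \<bar>f y - f x\<bar>) < 1"
    using abs_continuous_families[OF ac, of 1] by auto
  have "a \<le> a \<longrightarrow> b \<le> b \<longrightarrow> (\<exists>B. \<forall>I\<in>interval_families a b. increment_sum f I \<le> B)"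
    using \<open>a \<le> b\<close>
  proof (rule Bolzano[where P="\<lambda>c d. a \<le> c \<longrightarrow> d \<le> b \<longrightarrow> (\<exists>B. \<forall>I\<in>interval_families c d. increment_sum f I \<le> B)"], goal_cases)
    case (1 u v w)
    show ?case
    proof (intro impI)
      assume "a \<le> u" "w \<le> b"
      then obtain B1 B2 where B: "\<forall>I\<in>interval_families u v. increment_sum f I \<le> B1"
        "\<forall>I\<in>interval_families v w. increment_sum f I \<le> B2" using 1 by force
      have "increment_sum f I \<le> B1 + B2" if "I \<in> interval_families u w" for I
        by (rule interval_families_split[OF that \<open>u \<le> v\<close> \<open>v \<le> w\<close>, of f]) (use B in \<open>auto intro: add_mono\<close>)
      then show "\<exists>B. \<forall>I\<in>interval_families u w. increment_sum f I \<le> B" by blast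
    qed
  next
    case (2 x)
    have "increment_sum f I \<le> 1" if "u \<le> v" "v - u < \<delta>" "a \<le> u" "v \<le> b" "I \<in> interval_families u v" for u v I
    proof -
      have "I \<in> interval_families a b" using interval_families_mono that by blast
      then have "(\<Sum>(x, y)\<in>I. \<bar>f y - f x\<bar>) < 1"
        using interval_families_length[OF that(5,1)] that d(2) by force
      then show ?thesis using increment_sum_le_abs[of f I] by linarith
    qed
    then show ?case by (rule_tac x=\<delta> in exI, intro conjI allI impI d(1), rule_tac x=1 in exI, intro ballI, elim conjE)
        (metis order_trans)
  qed
  then show ?thesis by simp
qed

text \<open>One summand of the Jordan decomposition; both it and its difference with \<open>f\<close> are increasing, so that
  densities need to be found for increasing functions only.\<close>
definition positive_variation :: "real \<Rightarrow> (real \<Rightarrow> real) \<Rightarrow> real \<Rightarrow> real" where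
  "positive_variation a f t = (SUP I\<in>interval_families a t. increment_sum f I)"

lemma empty_interval_family: "{} \<in> interval_families a b"
  by (simp add: interval_families_def disjoint_family_on_def)

context
  fixes a b :: real and f :: "real \<Rightarrow> real"
  assumes ac: "abs_continuous_on a b f" and ab: "a \<le> b"
begin

lemma abs_continuous_subinterval: "a \<le> u \<Longrightarrow> v \<le> b \<Longrightarrow> abs_continuous_on u v f"
  unfolding abs_continuous_on_def
proof (intro allI impI)
  fix e :: real assume h: "e > 0" "a \<le> u" "v \<le> b"
  then obtain \<delta> where "\<delta> > 0" and d: "\<And>I. finite I \<longrightarrow> (\<forall>(x, y)\<in>I. a \<le> x \<and> x \<le> y \<and> y \<le> b) \<longrightarrow>
        disjoint_family_on (\<lambda>(x, y). {x<..<y}) I \<longrightarrow>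
        (\<Sum>(x, y)\<in>I. y - x) < \<delta> \<longrightarrow> (\<Sum>(x, y)\<in>I. \<bar>f y - f x\<bar>) < e"
    using ac unfolding abs_continuous_on_def by blast
  then show "\<exists>\<delta>>0. \<forall>I. finite I \<longrightarrow> (\<forall>(x, y)\<in>I. u \<le> x \<and> x \<le> y \<and> y \<le> v) \<longrightarrow>
        disjoint_family_on (\<lambda>(x, y). {x<..<y}) I \<longrightarrow>
        (\<Sum>(x, y)\<in>I. y - x) < \<delta> \<longrightarrow> (\<Sum>(x, y)\<in>I. \<bar>f y - f x\<bar>) < e"
  proof (intro exI[of _ \<delta>] conjI allI impI)
    fix I assume "finite I" "\<forall>(x, y)\<in>I. u \<le> x \<and> x \<le> y \<and> y \<le> v"
      "disjoint_family_on (\<lambda>(x, y). {x<..<y}) I" "(\<Sum>(x, y)\<in>I. y - x) < \<delta>"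
    moreover from this(2) have "\<forall>(x, y)\<in>I. a \<le> x \<and> x \<le> y \<and> y \<le> b"
    proof (intro ballI, clarify)
      fix x y assume "(x, y) \<in> I"
      then have "u \<le> x \<and> x \<le> y \<and> y \<le> v" using \<open>\<forall>(x, y)\<in>I. u \<le> x \<and> x \<le> y \<and> y \<le> v\<close> by blast
      then show "a \<le> x \<and> x \<le> y \<and> y \<le> b" using h by linarith
    qed
    ultimately show "(\<Sum>(x, y)\<in>I. \<bar>f y - f x\<bar>) < e" using d by blast
  qed
qed

lemma positive_variation_upper:
  assumes "t \<in> {a..b}" "I \<in> interval_families a t"
  shows "increment_sum f I \<le> positive_variation a f t"
proof -
  have "abs_continuous_on a t f" using abs_continuous_subinterval assms by auto
  then obtain B where "\<forall>I\<in>interval_families a t. increment_sum f I \<le> B"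
    using increment_sums_bounded assms by (metis atLeastAtMost_iff)
  then show ?thesis unfolding positive_variation_def using assms by (intro cSUP_upper bdd_aboveI2) auto
qed

lemma positive_variation_add:
  assumes st: "a \<le> s" "s \<le> t" "t \<le> b" and I: "I \<in> interval_families s t"
  shows "positive_variation a f s + increment_sum f I \<le> positive_variation a f t"
proof -
  have "increment_sum f J \<le> positive_variation a f t - increment_sum f I" if J: "J \<in> interval_families a s" for J
  proof -
    have disj: "J \<inter> I = {}"
    proof -
      have False if "(x, y) \<in> J" "(x, y) \<in> I" for x y
        using interval_familiesD(3,4)[OF J that(1)] interval_familiesD(2)[OF I that(2)] by linarith
      then show ?thesis by fast
    qed
    have "J \<union> I \<in> interval_families a t"
    proof (rule interval_familiesI)
      fix x y x' y' assume h: "(x, y) \<in> J \<union> I" "(x', y') \<in> J \<union> I" "max x x' < min y y'"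
      show "(x, y) = (x', y')"
        using h(1,2)
      proof (elim UnE)
        assume "(x, y) \<in> J" "(x', y') \<in> I"
        then show ?thesis using interval_familiesD(4)[OF J, of x y] interval_familiesD(2)[OF I, of x' y'] h(3) by linarith
      next
        assume "(x, y) \<in> I" "(x', y') \<in> J"
        then show ?thesis using interval_familiesD(4)[OF J, of x' y'] interval_familiesD(2)[OF I, of x y] h(3) by linarith
      qed (use interval_families_eq[OF J] interval_families_eq[OF I] h(3) in \<open>blast+\<close>)
    qed (use st interval_familiesD[OF J] interval_familiesD[OF I] in \<open>auto, fastforce+\<close>)
    moreover have "increment_sum f (J \<union> I) = increment_sum f J + increment_sum f I"
      unfolding increment_sum_def using disj interval_familiesD(1)[OF J] interval_familiesD(1)[OF I] by (intro sum.union_disjoint)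
    ultimately show ?thesis using positive_variation_upper[of t "J \<union> I"] st by simp
  qed
  then have "positive_variation a f s \<le> positive_variation a f t - increment_sum f I"
    unfolding positive_variation_def[of a f s] using empty_interval_family by (intro cSUP_least) auto
  then show ?thesis by simp
qed

lemma positive_variation_approx:
  assumes st: "a \<le> s" "s \<le> t" "t \<le> b" and "e > 0"
  shows "\<exists>I\<in>interval_families s t. positive_variation a f t - positive_variation a f s < increment_sum f I + e"
proof -
  have "\<exists>I\<in>interval_families a t. positive_variation a f t - e < increment_sum f I"
    unfolding positive_variation_def using assms
    by (intro less_cSUP_iff[THEN iffD1] bdd_aboveI2[where M="positive_variation a f t"] positive_variation_upper)
       (use empty_interval_family in \<open>auto simp: positive_variation_def[symmetric]\<close>)
  then obtain I where I: "I \<in> interval_families a t" "positive_variation a f t - e < increment_sum f I" by blast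
  obtain I1 I2 where "I1 \<in> interval_families a s" "I2 \<in> interval_families s t"
    "increment_sum f I = increment_sum f I1 + increment_sum f I2"
    using interval_families_split[OF I(1) st(1,2)] by blast
  moreover have "increment_sum f I1 \<le> positive_variation a f s" using calculation st by (intro positive_variation_upper) auto
  ultimately show ?thesis using I by (intro bexI[of _ I2]) auto
qed

lemma positive_variation_mono: "a \<le> s \<Longrightarrow> s \<le> t \<Longrightarrow> t \<le> b \<Longrightarrow> positive_variation a f s \<le> positive_variation a f t"
  using positive_variation_add[of s t "{}"] empty_interval_family by (simp add: increment_sum_def)

lemma positive_variation_increment: "a \<le> s \<Longrightarrow> s \<le> t \<Longrightarrow> t \<le> b \<Longrightarrow> f t - f s \<le> positive_variation a f t - positive_variation a f s"
proof (cases "s = t")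
  case False
  assume h: "a \<le> s" "s \<le> t" "t \<le> b"
  have "{(s, t)} \<in> interval_families s t" using False h by (intro interval_familiesI) auto
  then show ?thesis using positive_variation_add[OF h, of "{(s, t)}"] by (simp add: increment_sum_def)
qed simp

text \<open>Absolute continuity is inherited: refine each interval of the family by a nearly optimal one. The refinement has at
  most the same total length, and its sum of increments of \<open>f\<close> is small.\<close>
lemma positive_variation_families:
  assumes "e > 0"
  obtains \<delta> where "\<delta> > 0" "\<And>J. J \<in> interval_families a b \<Longrightarrow> (\<Sum>(x, y)\<in>J. y - x) < \<delta> \<Longrightarrow>
    increment_sum (positive_variation a f) J \<le> e"
proof -
  obtain \<delta> where d: "\<delta> > 0"
    "\<And>I. I \<in> interval_families a b \<Longrightarrow> (\<Sum>(x, y)\<in>I. y - x) < \<delta> \<Longrightarrow> (\<Sum>(x, y)\<in>I. \<bar>f y - f x\<bar>) < e/2"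
    using abs_continuous_families[OF ac, of "e/2"] assms by auto
  have "increment_sum (positive_variation a f) J \<le> e"
    if J: "J \<in> interval_families a b" and s: "(\<Sum>(x, y)\<in>J. y - x) < \<delta>" for J
  proof -
    define \<eta> where "\<eta> = e / (2 * (card J + 1))"
    have eta: "\<eta> > 0" "card J * \<eta> \<le> e/2" using assms by (auto simp: \<eta>_def field_simps)
    have "\<exists>I. \<forall>p\<in>J. I p \<in> interval_families (fst p) (snd p) \<and>
        positive_variation a f (snd p) - positive_variation a f (fst p) < increment_sum f (I p) + \<eta>"
    proof (intro bchoice ballI)
      fix p assume "p \<in> J"
      then have "(fst p, snd p) \<in> J" by simp
      then show "\<exists>I. I \<in> interval_families (fst p) (snd p) \<and>
          positive_variation a f (snd p) - positive_variation a f (fst p) < increment_sum f I + \<eta>"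
        using positive_variation_approx[OF _ _ _ eta(1), of "fst p" "snd p"] interval_familiesD(2-4)[OF J, of "fst p" "snd p"]
        unfolding Bex_def by (meson less_imp_le)
    qed
    then obtain I where I: "\<And>p. p \<in> J \<Longrightarrow> I p \<in> interval_families (fst p) (snd p)"
      "\<And>p. p \<in> J \<Longrightarrow> positive_variation a f (snd p) - positive_variation a f (fst p) < increment_sum f (I p) + \<eta>" by blast
    note U = interval_families_UN[OF J, of I]
    have Uf: "(\<Union>p\<in>J. I p) \<in> interval_families a b" using U(1) I(1) by fastforce
    have "(\<Sum>(x, y)\<in>(\<Union>p\<in>J. I p). y - x) = (\<Sum>p\<in>J. \<Sum>(x, y)\<in>I p. y - x)"
      using U(2) I(1) by fastforce
    also have "\<dots> \<le> (\<Sum>(x, y)\<in>J. y - x)"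
      unfolding case_prod_unfold using I(1) interval_familiesD(3)[OF J]
      by (intro sum_mono interval_families_length[unfolded case_prod_unfold]) (fastforce simp: less_imp_le)+
    finally have "(\<Sum>(x, y)\<in>(\<Union>p\<in>J. I p). \<bar>f y - f x\<bar>) < e/2" using d(2)[OF Uf] s by simp
    then have le: "increment_sum f (\<Union>p\<in>J. I p) \<le> e/2" using increment_sum_le_abs[of f] by (meson less_imp_le order_trans)
    have "increment_sum (positive_variation a f) J \<le> (\<Sum>p\<in>J. increment_sum f (I p) + \<eta>)"
      unfolding increment_sum_def[of "positive_variation a f"] case_prod_unfold using I(2) by (intro sum_mono less_imp_le)
    also have "\<dots> = (\<Sum>p\<in>J. increment_sum f (I p)) + card J * \<eta>" by (simp add: sum.distrib)
    also have "(\<Sum>p\<in>J. increment_sum f (I p)) = increment_sum f (\<Union>p\<in>J. I p)"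
      unfolding increment_sum_def using I(1) by (intro U(2)[symmetric]) fastforce
    finally show ?thesis using le eta by linarith
  qed
  then show thesis using that d(1) by blast
qed

end

lemma abs_continuous_continuous:
  assumes "abs_continuous_on a b f"
  shows "continuous_on {a..b} f"
  unfolding continuous_on_iff
proof (intro ballI allI impI)
  fix x e :: real assume x: "x \<in> {a..b}" and "0 < e"
  then obtain \<delta> where d: "\<delta> > 0"
    "\<And>I. I \<in> interval_families a b \<Longrightarrow> (\<Sum>(x, y)\<in>I. y - x) < \<delta> \<Longrightarrow> (\<Sum>(x, y)\<in>I. \<bar>f y - f x\<bar>) < e"
    using abs_continuous_families[OF assms] by blast
  show "\<exists>d>0. \<forall>x'\<in>{a..b}. dist x' x < d \<longrightarrow> dist (f x') (f x) < e"
  proof (intro exI[of _ \<delta>] conjI ballI impI d(1))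
    fix y assume y: "y \<in> {a..b}" "dist y x < \<delta>"
    show "dist (f y) (f x) < e"
    proof (cases "x = y")
      case False
      have "{(min x y, max x y)} \<in> interval_families a b"
        using x y False by (intro interval_familiesI) auto
      moreover have "max x y - min x y < \<delta>" using y by (auto simp: dist_real_def)
      ultimately have "\<bar>f (max x y) - f (min x y)\<bar> < e" using d(2) by force
      then show ?thesis by (auto simp: dist_real_def min_def max_def split: if_splits)
    qed (use \<open>0 < e\<close> in simp)
  qed
qed

text \<open>A compact Lebesgue null set lies in an open set of small measure and has positive distance to its complement. The cells
  of a fine uniform grid that meet the compact set therefore have small total length, and absolute continuity bounds their Stieltjes
  measure.\<close>
lemma Stieltjes_null:
  fixes F :: "real \<Rightarrow> real"
  assumes ab: "a < b" and mono: "\<And>x y. x \<le> y \<Longrightarrow> F x \<le> F y" and rc: "\<And>x. continuous (at_right x) F"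
    and ac: "\<And>e. e > 0 \<Longrightarrow> \<exists>\<delta>>0. \<forall>J\<in>interval_families a b. (\<Sum>(x, y)\<in>J. y - x) < \<delta> \<longrightarrow> increment_sum F J \<le> e"
    and K: "compact K" "emeasure lborel K = 0"
  shows "emeasure (interval_measure F) (K \<inter> {a<..b}) = 0"
proof -
  have small: "emeasure (interval_measure F) (K \<inter> {a<..b}) \<le> ennreal e" if "e > 0" for e
  proof -
    obtain \<delta> where d: "\<delta> > 0" "\<And>J. J\<in>interval_families a b \<Longrightarrow> (\<Sum>(x, y)\<in>J. y - x) < \<delta> \<Longrightarrow> increment_sum F J \<le> e"
      using ac[OF \<open>e > 0\<close>] by blast
    have "K \<in> sets borel" using K(1) by (simp add: borel_compact)
    then obtain W where W: "open W" "K \<subseteq> W" "emeasure lborel (W - K) < \<delta>"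
      using outer_regular_lborel \<open>\<delta> > 0\<close> by metis
    have Om: "emeasure lborel W < \<delta>"
    proof -
      have "emeasure lborel W \<le> emeasure lborel K + emeasure lborel (W - K)"
        using W \<open>K \<in> sets borel\<close> by (subst plus_emeasure) (auto intro!: emeasure_mono)
      then show ?thesis using K W by simp
    qed
    obtain r where r: "r > 0" "\<And>x. x \<in> K \<Longrightarrow> cball x r \<subseteq> W"
    proof (cases "K = {}")
      case False
      then obtain r where "r > 0" "{x. infdist x K \<le> r} \<subseteq> W"
        using compact_in_open_separated[OF False K(1) W(1,2)] by blast
      moreover have "cball x r \<subseteq> {x. infdist x K \<le> r}" if "x \<in> K" for x
        using infdist_le2[OF that] by (auto simp: dist_commute)
      ultimately show thesis using that by blast
    qed (use that[of 1] in auto)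
    obtain n :: nat where n: "(b - a) / r < n" using reals_Archimedean2 by blast
    then have "n > 0" using ab r(1) by (metis divide_pos_pos diff_gt_0_iff_gt gr0I of_nat_0 order_less_asym)
    define h where "h = (b - a) / n"
    have h: "h > 0" "h < r" "a + n * h = b"
      using n ab r(1) \<open>n > 0\<close> by (auto simp: h_def field_simps)
    define cell where "cell k = {a + real k * h <.. a + real (Suc k) * h}" for k
    define J where "J = {k. k < n \<and> cell k \<inter> K \<noteq> {}}"
    have fin: "finite J" by (simp add: J_def)
    have inj: "inj_on (\<lambda>k. (a + real k * h, a + real (Suc k) * h)) J"
      using h(1) by (auto simp: inj_on_def)
    define I where "I = (\<lambda>k. (a + real k * h, a + real (Suc k) * h)) ` J"
    have disj: "k = l" if "max (a + real k * h) (a + real l * h) < min (a + real (Suc k) * h) (a + real (Suc l) * h)" for k l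
    proof -
      have "real k * h < real (Suc l) * h" "real l * h < real (Suc k) * h" using that by auto
      then have "k < Suc l" "l < Suc k" using h(1) by (auto simp: mult_less_cancel_right of_nat_less_iff simp del: of_nat_Suc)
      then show ?thesis by simp
    qed
    have If: "I \<in> interval_families a b"
    proof (rule interval_familiesI)
      show "finite I" using fin by (simp add: I_def)
      fix x y assume "(x, y) \<in> I"
      then obtain k where k: "k < n" "x = a + real k * h" "y = a + real (Suc k) * h" by (auto simp: I_def J_def)
      have "real (Suc k) * h \<le> real n * h" using k h(1) by (intro mult_right_mono) auto
      then show "a \<le> x \<and> x < y \<and> y \<le> b" using k h by (auto simp: algebra_simps)
    qed (use disj in \<open>auto simp: I_def\<close>)
    have "ennreal (\<Sum>(x, y)\<in>I. y - x) = (\<Sum>k\<in>J. emeasure lborel (cell k))"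
      unfolding I_def using h(1)
      by (subst sum.reindex[OF inj], subst sum_ennreal[symmetric]) (auto simp: cell_def intro!: sum.cong mult_right_mono)
    also have "\<dots> = emeasure lborel (\<Union>k\<in>J. cell k)"
    proof (rule sum_emeasure)
      have "cell k \<inter> cell l = {}" if "k \<noteq> l" for k l
      proof (rule ccontr)
        assume "cell k \<inter> cell l \<noteq> {}"
        then obtain x where x: "x \<in> cell k" "x \<in> cell l" by blast
        have "max (a + real k * h) (a + real l * h) < x" "x \<le> min (a + real (Suc k) * h) (a + real (Suc l) * h)"
          using x by (auto simp: cell_def)
        then have "max (a + real k * h) (a + real l * h) < min (a + real (Suc k) * h) (a + real (Suc l) * h)" by linarith
        from disj[OF this] show False using that by simp
      qed
      then show "disjoint_family_on cell J" by (auto simp: disjoint_family_on_def)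
    qed (use fin in \<open>auto simp: cell_def\<close>)
    also have "\<dots> \<le> emeasure lborel W"
    proof (rule emeasure_mono)
      show "(\<Union>k\<in>J. cell k) \<subseteq> W"
      proof clarify
        fix x k assume x: "x \<in> cell k" and "k \<in> J"
        then obtain z where z: "z \<in> cell k" "z \<in> K" by (auto simp: J_def)
        have "\<bar>z - x\<bar> \<le> h" using x z by (auto simp: cell_def algebra_simps)
        then have "x \<in> cball z r" using h by (auto simp: dist_real_def)
        then show "x \<in> W" using r(2)[OF z(2)] by blast
      qed
    qed (use W in auto)
    finally have "ennreal (\<Sum>(x, y)\<in>I. y - x) < ennreal \<delta>" using Om by simp
    then have "(\<Sum>(x, y)\<in>I. y - x) < \<delta>" using d(1) interval_familiesD(3)[OF If]
      by (subst (asm) ennreal_less_iff) (auto intro!: sum_nonneg simp: less_imp_le)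
    then have le: "increment_sum F I \<le> e" using d(2)[OF If] by simp
    have "K \<inter> {a<..b} \<subseteq> (\<Union>k\<in>J. cell k)"
    proof
      fix x assume x: "x \<in> K \<inter> {a<..b}"
      define k where "k = nat \<lceil>(x - a) / h\<rceil> - 1"
      have p: "(x - a) / h > 0" using x h by auto
      then have "\<lceil>(x - a) / h\<rceil> \<ge> 1" by linarith
      then have k: "real k = of_int \<lceil>(x - a) / h\<rceil> - 1" unfolding k_def by linarith
      have "real k < (x - a) / h" "(x - a) / h \<le> real k + 1" unfolding k by linarith+
      then have xk: "x \<in> cell k" using h(1) by (auto simp: cell_def field_simps)
      have "real k * h < real n * h" using xk x h(3) by (auto simp: cell_def)
      then have "k < n" using h(1) by simp
      then show "x \<in> (\<Union>k\<in>J. cell k)" using xk x by (auto simp: J_def)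
    qed
    then have "emeasure (interval_measure F) (K \<inter> {a<..b}) \<le> emeasure (interval_measure F) (\<Union>k\<in>J. cell k)"
      using fin by (intro emeasure_mono) (auto simp: cell_def)
    also have "\<dots> \<le> (\<Sum>k\<in>J. emeasure (interval_measure F) (cell k))"
      using fin by (intro emeasure_subadditive_finite) (auto simp: cell_def)
    also have "\<dots> = (\<Sum>k\<in>J. ennreal (F (a + real (Suc k) * h) - F (a + real k * h)))"
    proof (intro sum.cong refl)
      fix k
      have "a + real k * h \<le> a + real (Suc k) * h" using h(1) by (auto intro!: mult_right_mono)
      then show "emeasure (interval_measure F) (cell k) = ennreal (F (a + real (Suc k) * h) - F (a + real k * h))"
        unfolding cell_def by (rule emeasure_interval_measure_Ioc[OF _ mono rc])
    qed
    also have "\<dots> = ennreal (\<Sum>k\<in>J. F (a + real (Suc k) * h) - F (a + real k * h))"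
    proof (rule sum_ennreal)
      fix k
      have "a + real k * h \<le> a + real (Suc k) * h" using h(1) by (auto intro!: mult_right_mono)
      then show "0 \<le> F (a + real (Suc k) * h) - F (a + real k * h)" using mono by fastforce
    qed
    also have "\<dots> = ennreal (increment_sum F I)"
      unfolding increment_sum_def I_def by (subst sum.reindex[OF inj]) simp
    finally show ?thesis using le by (meson ennreal_leI order_trans)
  qed
  have "emeasure (interval_measure F) (K \<inter> {a<..b}) \<le> 0"
  proof (rule ennreal_le_epsilon)
    fix e :: real assume "0 < e"
    then show "emeasure (interval_measure F) (K \<inter> {a<..b}) \<le> 0 + ennreal e" using small[of e] by simp
  qed
  then show ?thesis by simp
qed

text \<open>The density is the Radon-Nikodym derivative of the Stieltjes measure. Inner regularity reduces absolute continuity of that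
  measure to compact null sets.\<close>
lemma mono_density:
  fixes F :: "real \<Rightarrow> real"
  assumes ab: "a < b" and mono: "\<And>x y. a \<le> x \<Longrightarrow> x \<le> y \<Longrightarrow> y \<le> b \<Longrightarrow> F x \<le> F y" and cont: "continuous_on {a..b} F"
    and ac: "\<And>e. e > 0 \<Longrightarrow> \<exists>\<delta>>0. \<forall>J\<in>interval_families a b. (\<Sum>(x, y)\<in>J. y - x) < \<delta> \<longrightarrow> increment_sum F J \<le> e"
  shows "\<exists>d. integrable lborel d \<and> (\<forall>s t. a \<le> s \<longrightarrow> s \<le> t \<longrightarrow> t \<le> b \<longrightarrow> F t - F s = (LINT x:{s..t}|lborel. d x))"
proof -
  define G where "G x = F (max a (min b x))" for x
  have Gmono: "G x \<le> G y" if "x \<le> y" for x y unfolding G_def using ab that by (intro mono) auto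
  have "continuous_on UNIV G"
    unfolding G_def using ab by (intro continuous_on_compose2[OF cont] continuous_intros) auto
  then have Grc: "continuous (at_right x) G" for x
    using continuous_on_eq_continuous_within continuous_within_subset by (metis UNIV_I subset_UNIV)
  have GF: "G x = F x" if "x \<in> {a..b}" for x using that by (auto simp: G_def max_def min_def)
  have acG: "\<exists>\<delta>>0. \<forall>J\<in>interval_families a b. (\<Sum>(x, y)\<in>J. y - x) < \<delta> \<longrightarrow> increment_sum G J \<le> e" if "e > 0" for e
  proof -
    have "increment_sum G J = increment_sum F J" if "J \<in> interval_families a b" for J
      unfolding increment_sum_def using interval_familiesD[OF that] by (intro sum.cong refl) (fastforce simp: GF less_imp_le)
    then show ?thesis using ac[OF \<open>e > 0\<close>] by auto
  qed
  let ?\<mu> = "density (interval_measure G) (indicator {a<..b})"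
  have em: "emeasure ?\<mu> A = emeasure (interval_measure G) (A \<inter> {a<..b})" if "A \<in> sets borel" for A
    using that by (subst emeasure_density) (auto simp: mult.commute indicator_inter_arith[symmetric] Int_commute)
  have tot: "emeasure ?\<mu> (space ?\<mu>) = ennreal (G b - G a)"
    using em[of UNIV] emeasure_interval_measure_Ioc[OF _ Gmono Grc, of a b] ab by simp
  have "absolutely_continuous lborel ?\<mu>"
    unfolding absolutely_continuous_def
  proof
    fix N assume N: "N \<in> null_sets (lborel :: real measure)"
    have "emeasure ?\<mu> N = (SUP K\<in>{K. K \<subseteq> N \<and> compact K}. emeasure ?\<mu> K)"
      using N tot by (intro inner_regular) (auto simp: null_sets_def)
    also have "\<dots> \<le> 0"
    proof (rule SUP_least)
      fix K assume K: "K \<in> {K. K \<subseteq> N \<and> compact K}"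
      then have "K \<in> sets borel" by (auto simp: borel_compact)
      moreover have "emeasure lborel K = 0" using K N \<open>K \<in> sets borel\<close>
        by (metis emeasure_mono le_zero_eq mem_Collect_eq null_setsD1 null_setsD2)
      ultimately show "emeasure ?\<mu> K \<le> 0"
        using Stieltjes_null[OF ab Gmono Grc acG] K em by auto
    qed
    finally show "N \<in> null_sets ?\<mu>" using N by (auto simp: null_sets_def)
  qed
  then obtain g where g: "g \<in> borel_measurable lborel" "density lborel g = ?\<mu>"
    using sigma_finite_measure.Radon_Nikodym[OF sigma_finite_lborel, of ?\<mu>] by auto
  have gA: "(\<integral>\<^sup>+x\<in>A. g x \<partial>lborel) = emeasure (interval_measure G) (A \<inter> {a<..b})" if "A \<in> sets borel" for A
    using emeasure_density[OF g(1), of A] em[OF that] that g(2) by simp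
  have gfin: "(\<integral>\<^sup>+x. g x \<partial>lborel) < \<infinity>"
    using gA[of UNIV] em[of UNIV] tot by simp
  then have AEg: "AE x in lborel. g x \<noteq> \<infinity>"
    using g(1) by (intro nn_integral_noteq_infinite) auto
  define d where "d x = enn2real (g x)" for x
  have deq: "d = (\<lambda>x. enn2real (g x))" by (auto simp: d_def)
  have dm[measurable]: "d \<in> borel_measurable lborel" unfolding deq using g(1) by (rule borel_measurable_enn2real)
  have dg: "AE x in lborel. ennreal (d x) = g x" using AEg by (auto simp: d_def less_top)
  have dint: "integrable lborel d"
  proof (rule integrableI_bounded[OF dm])
    have "(\<integral>\<^sup>+x. ennreal (norm (d x)) \<partial>lborel) = (\<integral>\<^sup>+x. g x \<partial>lborel)"
      using dg by (intro nn_integral_cong_AE) (auto simp: d_def)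
    then show "(\<integral>\<^sup>+x. ennreal (norm (d x)) \<partial>lborel) < \<infinity>" using gfin by simp
  qed
  have "F t - F s = (LINT x:{s..t}|lborel. d x)" if st: "a \<le> s" "s \<le> t" "t \<le> b" for s t
  proof -
    have "(LINT x:{s..t}|lborel. d x) = (LINT x:{s<..t}|lborel. d x)"
      unfolding set_lebesgue_integral_def
      by (intro integral_cong_AE) (use AE_lborel_singleton[of s] in \<open>auto split: split_indicator\<close>)
    also have "\<dots> = enn2real (\<integral>\<^sup>+x\<in>{s<..t}. g x \<partial>lborel)"
      unfolding set_lebesgue_integral_def
    proof (subst integral_eq_nn_integral)
      show "enn2real (\<integral>\<^sup>+x. ennreal (indicator {s<..t} x *\<^sub>R d x) \<partial>lborel) = enn2real (\<integral>\<^sup>+x\<in>{s<..t}. g x \<partial>lborel)"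
        by (intro arg_cong[where f=enn2real] nn_integral_cong_AE) (use dg in \<open>auto split: split_indicator\<close>)
      show "(\<lambda>x. indicator {s<..t} x *\<^sub>R d x) \<in> borel_measurable lborel" by measurable
    qed (auto simp: d_def)
    also have "(\<integral>\<^sup>+x\<in>{s<..t}. g x \<partial>lborel) = emeasure (interval_measure G) {s<..t}"
      using gA[of "{s<..t}"] st by (simp add: Int_absorb2 greaterThanAtMost_def) (metis Int_absorb2 Ioc_subset_iff greaterThanAtMost_def order.trans)
    also have "\<dots> = ennreal (G t - G s)" using st by (intro emeasure_interval_measure_Ioc Gmono Grc)
    finally show ?thesis using st Gmono[of s t] GF by simp
  qed
  then show ?thesis using dint by blast
qed

lemma abs_continuous_density:
  assumes ac: "abs_continuous_on a b f" and ab: "a < b"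
  shows "\<exists>d. integrable lborel d \<and> (\<forall>s t. a \<le> s \<longrightarrow> s \<le> t \<longrightarrow> t \<le> b \<longrightarrow> f t - f s = (LINT x:{s..t}|lborel. d x))"
proof -
  let ?P = "positive_variation a f"
  note ab' = less_imp_le[OF ab]
  have P1: "\<exists>\<delta>>0. \<forall>J\<in>interval_families a b. (\<Sum>(x, y)\<in>J. y - x) < \<delta> \<longrightarrow> increment_sum ?P J \<le> e" if "e > 0" for e
    using positive_variation_families[OF ac ab' that] by metis
  have cont: "continuous_on {a..b} g"
    if m: "\<And>x y. a \<le> x \<Longrightarrow> x \<le> y \<Longrightarrow> y \<le> b \<Longrightarrow> g x \<le> g y" and
      P: "\<And>e. e > 0 \<Longrightarrow> \<exists>\<delta>>0. \<forall>J\<in>interval_families a b. (\<Sum>(x, y)\<in>J. y - x) < \<delta> \<longrightarrow> increment_sum g J \<le> e" for g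
    unfolding continuous_on_iff
  proof (intro ballI allI impI)
    fix x e :: real assume x: "x \<in> {a..b}" and "0 < e"
    then obtain \<delta> where d: "\<delta> > 0"
      "\<And>I. I \<in> interval_families a b \<Longrightarrow> (\<Sum>(x, y)\<in>I. y - x) < \<delta> \<Longrightarrow> increment_sum g I \<le> e/2"
      using P[of "e/2"] by auto
    show "\<exists>d>0. \<forall>x'\<in>{a..b}. dist x' x < d \<longrightarrow> dist (g x') (g x) < e"
    proof (intro exI[of _ \<delta>] conjI ballI impI d(1))
      fix y assume y: "y \<in> {a..b}" "dist y x < \<delta>"
      show "dist (g y) (g x) < e"
      proof (cases "x = y")
        case False
        have "{(min x y, max x y)} \<in> interval_families a b"
          using x y False by (intro interval_familiesI) auto
        from d(2)[OF this] have "g (max x y) - g (min x y) \<le> e/2" using y by (auto simp: dist_real_def increment_sum_def)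
        moreover have "g (min x y) \<le> g (max x y)" using x y by (intro m) auto
        ultimately show ?thesis using \<open>0 < e\<close> by (auto simp: dist_real_def min_def max_def split: if_splits)
      qed (use \<open>0 < e\<close> in simp)
    qed
  qed
  let ?N = "\<lambda>x. ?P x - f x"
  have N1: "\<exists>\<delta>>0. \<forall>J\<in>interval_families a b. (\<Sum>(x, y)\<in>J. y - x) < \<delta> \<longrightarrow> increment_sum ?N J \<le> e" if e0: "e > 0" for e
  proof -
    obtain \<delta>1 where 1: "\<delta>1 > 0" "\<And>J. J\<in>interval_families a b \<Longrightarrow> (\<Sum>(x, y)\<in>J. y - x) < \<delta>1 \<Longrightarrow> increment_sum ?P J \<le> e/2"
      using P1[of "e/2"] half_gt_zero[OF e0] by metis
    obtain \<delta>2 where 2: "\<delta>2 > 0" "\<And>J. J\<in>interval_families a b \<Longrightarrow> (\<Sum>(x, y)\<in>J. y - x) < \<delta>2 \<Longrightarrow> (\<Sum>(x, y)\<in>J. \<bar>f y - f x\<bar>) < e/2"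
      using abs_continuous_families[OF ac half_gt_zero[OF e0]] by metis
    have "increment_sum ?N J \<le> increment_sum ?P J + (\<Sum>(x, y)\<in>J. \<bar>f y - f x\<bar>)" for J
      unfolding increment_sum_def by (subst sum.distrib[symmetric]) (auto intro!: sum_mono)
    then have "increment_sum ?N J \<le> e" if "J\<in>interval_families a b" "(\<Sum>(x, y)\<in>J. y - x) < min \<delta>1 \<delta>2" for J
    proof -
      have "increment_sum ?P J \<le> e/2" "(\<Sum>(x, y)\<in>J. \<bar>f y - f x\<bar>) < e/2"
        using that 1(2)[of J] 2(2)[of J] by auto
      moreover have "increment_sum ?N J \<le> increment_sum ?P J + (\<Sum>(x, y)\<in>J. \<bar>f y - f x\<bar>)" by fact
      ultimately show ?thesis by linarith
    qed
    then show ?thesis using 1(1) 2(1) by (intro exI[of _ "min \<delta>1 \<delta>2"]) auto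
  qed
  note Pm = positive_variation_mono[OF ac ab']
  have Nm: "?N x \<le> ?N y" if "a \<le> x" "x \<le> y" "y \<le> b" for x y
    using positive_variation_increment[OF ac ab' that] by simp
  obtain d1 where d1: "integrable lborel d1" "\<And>s t. a \<le> s \<Longrightarrow> s \<le> t \<Longrightarrow> t \<le> b \<Longrightarrow> ?P t - ?P s = (LINT x:{s..t}|lborel. d1 x)"
    using mono_density[OF ab Pm cont[OF Pm P1] P1] by blast
  obtain d2 where d2: "integrable lborel d2" "\<And>s t. a \<le> s \<Longrightarrow> s \<le> t \<Longrightarrow> t \<le> b \<Longrightarrow> ?N t - ?N s = (LINT x:{s..t}|lborel. d2 x)"
    using mono_density[OF ab Nm cont[OF Nm N1] N1] by blast
  have si: "set_integrable lborel {s..t} d" if "integrable lborel d" for s t and d :: "real \<Rightarrow> real"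
    using that unfolding set_integrable_def by (intro integrable_mult_indicator) auto
  show ?thesis
  proof (intro exI[of _ "\<lambda>x. d1 x - d2 x"] conjI allI impI)
    fix s t assume st: "a \<le> s" "s \<le> t" "t \<le> b"
    show "f t - f s = (LINT x:{s..t}|lborel. d1 x - d2 x)"
      using d1(2)[OF st] d2(2)[OF st] set_integral_diff(2)[OF si[OF d1(1)] si[OF d2(1)], of s t] by simp
  qed (use d1 d2 in auto)
qed

text \<open>The right derivative of an indefinite integral is the integrand outside a negligible set
  (\<open>integrable_ccontinuous_explicit\<close>). The same statement for the reflected function gives the left derivative.\<close>
lemma abs_continuous_derivative:
  assumes ac: "abs_continuous_on a b f" and ab: "a < b"
  obtains d where "integrable lborel d"
    "\<And>s t. a \<le> s \<Longrightarrow> s \<le> t \<Longrightarrow> t \<le> b \<Longrightarrow> f t - f s = (LINT x:{s..t}|lborel. d x)"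
    "AE x in lborel. a < x \<longrightarrow> x < b \<longrightarrow> (f has_real_derivative d x) (at x)"
proof -
  obtain d where d: "integrable lborel d"
    "\<And>s t. a \<le> s \<Longrightarrow> s \<le> t \<Longrightarrow> t \<le> b \<Longrightarrow> f t - f s = (LINT x:{s..t}|lborel. d x)"
    using abs_continuous_density[OF ac ab] by blast
  have si: "set_integrable lborel {s..t} d" for s t
    using d(1) unfolding set_integrable_def by (intro integrable_mult_indicator) auto
  have int: "integral {s..t} d = f t - f s" if "a \<le> s" "s \<le> t" "t \<le> b" for s t
    using d(2)[OF that] set_borel_integral_eq_integral(2)[OF si[of s t]] by simp
  have intc: "d integrable_on cbox s t" for s t
    using set_borel_integral_eq_integral(1)[OF si[of s t]] by simp
  have intc': "(\<lambda>x. d (- x)) integrable_on cbox s t" for s t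
    using intc[of "-t" "-s"] Henstock_Kurzweil_Integration.integrable_reflect_real[where f=d and a="-t" and b="-s"] by simp
  obtain N1 where N1: "negligible N1"
    "\<And>x e. x \<notin> N1 \<Longrightarrow> 0 < e \<Longrightarrow> \<exists>\<delta>>0. \<forall>h. 0 < h \<and> h < \<delta> \<longrightarrow> \<bar>integral {x..x + h} d / h - d x\<bar> < e"
    using integrable_ccontinuous_explicit[of d, OF intc] by (auto simp: divide_inverse mult.commute)
  obtain N2 where N2: "negligible N2"
    "\<And>x e. x \<notin> N2 \<Longrightarrow> 0 < e \<Longrightarrow> \<exists>\<delta>>0. \<forall>h. 0 < h \<and> h < \<delta> \<longrightarrow> \<bar>integral {x..x + h} (\<lambda>x. d (- x)) / h - d (- x)\<bar> < e"
    using integrable_ccontinuous_explicit[of "\<lambda>x. d (- x)", OF intc'] by (auto simp: divide_inverse mult.commute)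
  have "negligible (uminus ` N2)" using N2(1)
    by (intro negligible_differentiable_image_negligible) (auto intro!: derivative_intros)
  with N1(1) have "negligible (N1 \<union> uminus ` N2)" by (rule negligible_Un)
  then have "AE x in lebesgue. x \<notin> N1 \<union> uminus ` N2"
    by (intro AE_not_in) (simp add: negligible_iff_null_sets)
  then have "AE x in lborel. x \<notin> N1 \<union> uminus ` N2" by (simp add: AE_completion_iff)
  then have "AE x in lborel. a < x \<longrightarrow> x < b \<longrightarrow> (f has_real_derivative d x) (at x)"
  proof (rule AE_mp, intro AE_I2 impI)
    fix x assume x: "x \<notin> N1 \<union> uminus ` N2" "a < x" "x < b"
    then have x2: "- x \<notin> N2" by force
    show "(f has_real_derivative d x) (at x)"
      unfolding DERIV_def
    proof (rule LIM_I)
      fix e :: real assume "e > 0"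
      obtain \<delta>1 where 1: "\<delta>1 > 0" "\<And>h. 0 < h \<Longrightarrow> h < \<delta>1 \<Longrightarrow> \<bar>integral {x..x + h} d / h - d x\<bar> < e"
        using N1(2)[OF _ \<open>e > 0\<close>] x by blast
      obtain \<delta>2 where 2: "\<delta>2 > 0" "\<And>h. 0 < h \<Longrightarrow> h < \<delta>2 \<Longrightarrow> \<bar>integral {-x..-x + h} (\<lambda>x. d (- x)) / h - d x\<bar> < e"
        using N2(2)[OF x2 \<open>e > 0\<close>] by auto
      let ?s = "min (min \<delta>1 \<delta>2) (min (b - x) (x - a))"
      have "norm ((f (x + h) - f x) / h - d x) < e" if h: "h \<noteq> 0" "norm (h - 0) < ?s" for h
      proof (cases "h > 0")
        case True
        then show ?thesis using 1(2)[of h] h x int[of x "x + h"] by simp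
      next
        case False
        then have "integral {-x..-x + (- h)} (\<lambda>x. d (- x)) = f x - f (x + h)"
          using Henstock_Kurzweil_Integration.integral_reflect_real[where f=d and a="x + h" and b=x] int[of "x + h" x] h x by simp
        then show ?thesis using 2(2)[of "- h"] h False by (simp add: field_simps)
      qed
      then show "\<exists>s>0. \<forall>h. h \<noteq> 0 \<and> norm (h - 0) < s \<longrightarrow> norm ((f (x + h) - f x) / h - d x) < e"
        using 1(1) 2(1) x by (intro exI[of _ ?s]) auto
    qed
  qed
  then show thesis using that d by blast
qed

section \<open>The Borel sets of the path space\<close>

definition grid_floor :: "real \<Rightarrow> real \<Rightarrow> nat \<Rightarrow> real \<Rightarrow> real" where
  "grid_floor a b n t = a + (b - a) / Suc n * of_int \<lfloor>(t - a) / (b - a) * Suc n\<rfloor>"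

definition grid_ceil :: "real \<Rightarrow> real \<Rightarrow> nat \<Rightarrow> real \<Rightarrow> real" where
  "grid_ceil a b n t = a + (b - a) / Suc n * of_int \<lceil>(t - a) / (b - a) * Suc n\<rceil>"

definition grid :: "real \<Rightarrow> real \<Rightarrow> nat \<Rightarrow> real set" where
  "grid a b n = (\<lambda>k. a + (b - a) / Suc n * real k) ` {..Suc n}"

text \<open>Keeping only the values at the grid points turns a path into a function of finitely many evaluations.\<close>
definition discretise :: "real \<Rightarrow> real \<Rightarrow> nat \<Rightarrow> (real \<Rightarrow> 's) \<Rightarrow> real \<Rightarrow> 's" where
  "discretise a b n \<omega> = restrict (\<lambda>t. \<omega> (grid_floor a b n t)) {a..b}"

context
  fixes a b :: real
  assumes ab: "a < b"
begin

lemma grid_coordinate: "t = a + (b - a) / Suc n * ((t - a) / (b - a) * Suc n)"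
proof -
  have "(b - a) / Suc n * ((t - a) / (b - a) * Suc n) = ((b - a) / (b - a)) * (Suc n / Suc n) * (t - a)"
    by (simp only: divide_inverse mult_ac)
  then show ?thesis using ab by (simp del: of_nat_Suc)
qed

lemma grid_floor_bounds:
  "grid_floor a b n t \<le> t" "t < grid_floor a b n t + (b - a) / Suc n"
proof -
  define q where "q = (t - a) / (b - a) * Suc n"
  have t: "t = a + (b - a) / Suc n * q" using grid_coordinate by (auto simp only: q_def)
  have c: "(b - a) / Suc n > 0" using ab by simp
  have "(b - a) / Suc n * of_int \<lfloor>q\<rfloor> \<le> (b - a) / Suc n * q" using c by (intro mult_left_mono) auto
  then show "grid_floor a b n t \<le> t" unfolding grid_floor_def q_def[symmetric] using t by linarith
  have "(b - a) / Suc n * q < (b - a) / Suc n * (of_int \<lfloor>q\<rfloor> + 1)"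
    using c by (intro mult_strict_left_mono) linarith+
  then show "t < grid_floor a b n t + (b - a) / Suc n"
    unfolding grid_floor_def q_def[symmetric] distrib_left using t by linarith
qed

lemma grid_ceil_bounds:
  "t \<le> grid_ceil a b n t" "grid_ceil a b n t < t + (b - a) / Suc n"
proof -
  define q where "q = (t - a) / (b - a) * Suc n"
  have t: "t = a + (b - a) / Suc n * q" using grid_coordinate by (auto simp only: q_def)
  have c: "(b - a) / Suc n > 0" using ab by simp
  have "(b - a) / Suc n * q \<le> (b - a) / Suc n * of_int \<lceil>q\<rceil>" using c by (intro mult_left_mono) auto
  then show "t \<le> grid_ceil a b n t" unfolding grid_ceil_def q_def[symmetric] using t by linarith
  have "(b - a) / Suc n * of_int \<lceil>q\<rceil> < (b - a) / Suc n * (q + 1)"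
    using c by (intro mult_strict_left_mono) linarith+
  then show "grid_ceil a b n t < t + (b - a) / Suc n"
    unfolding grid_ceil_def q_def[symmetric] distrib_left using t by linarith
qed

lemma grid_ceil_le_iff: "grid_ceil a b n u \<le> t \<longleftrightarrow> u \<le> grid_floor a b n t"
proof -
  define q where "q = (u - a) / (b - a) * Suc n"
  define p where "p = (t - a) / (b - a) * Suc n"
  have t: "u = a + (b - a) / Suc n * q" "t = a + (b - a) / Suc n * p" using grid_coordinate by (auto simp only: q_def p_def)
  have c: "(b - a) / Suc n > 0" using ab by simp
  have "grid_ceil a b n u \<le> t \<longleftrightarrow> of_int \<lceil>q\<rceil> \<le> p"
    unfolding grid_ceil_def q_def[symmetric] using c by (subst t(2)) (simp only: add_le_cancel_left mult_le_cancel_left_pos)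
  also have "\<dots> \<longleftrightarrow> q \<le> of_int \<lfloor>p\<rfloor>" by (metis ceiling_le_iff le_floor_iff)
  also have "\<dots> \<longleftrightarrow> u \<le> grid_floor a b n t"
    unfolding grid_floor_def p_def[symmetric] using c by (subst t(1)) (simp only: add_le_cancel_left mult_le_cancel_left_pos)
  finally show ?thesis .
qed

lemma grid_ends [simp]: "grid_floor a b n a = a" "grid_floor a b n b = b" "grid_ceil a b n a = a" "grid_ceil a b n b = b"
  using ab by (auto simp: grid_floor_def grid_ceil_def simp del: of_nat_Suc)

lemma grid_floor_mono: "s \<le> t \<Longrightarrow> grid_floor a b n s \<le> grid_floor a b n t"
  using grid_ceil_le_iff grid_ceil_bounds(1) grid_floor_bounds(1)
  by (metis dual_order.trans dual_order.refl)

lemma grid_floor_in_grid: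
  assumes "t \<in> {a..b}" shows "grid_floor a b n t \<in> grid a b n"
proof -
  define p where "p = (t - a) / (b - a) * Suc n"
  have "0 \<le> p" "p \<le> Suc n" using ab assms by (auto simp: p_def field_simps simp del: of_nat_Suc)
  then have "\<lfloor>p\<rfloor> = int (nat \<lfloor>p\<rfloor>)" "nat \<lfloor>p\<rfloor> \<le> Suc n" by linarith+
  then show ?thesis unfolding grid_floor_def grid_def p_def[symmetric]
    by (intro image_eqI[of _ _ "nat \<lfloor>p\<rfloor>"]) (metis of_int_of_nat_eq, simp)
qed

lemma grid_ceil_in_grid:
  assumes "t \<in> {a..b}" shows "grid_ceil a b n t \<in> grid a b n"
proof -
  define p where "p = (t - a) / (b - a) * Suc n"
  have "0 \<le> p" "p \<le> Suc n" using ab assms by (auto simp: p_def field_simps simp del: of_nat_Suc)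
  then have "\<lceil>p\<rceil> = int (nat \<lceil>p\<rceil>)" "nat \<lceil>p\<rceil> \<le> Suc n" by linarith+
  then show ?thesis unfolding grid_ceil_def grid_def p_def[symmetric]
    by (intro image_eqI[of _ _ "nat \<lceil>p\<rceil>"]) (metis of_int_of_nat_eq, simp)
qed

lemma grid_subset: "grid a b n \<subseteq> {a..b}"
proof
  fix t assume "t \<in> grid a b n"
  then obtain k where k: "k \<le> Suc n" "t = a + (b - a) / Suc n * real k" by (auto simp: grid_def)
  have "(b - a) / Suc n * real k \<le> (b - a) / Suc n * real (Suc n)" using ab k by (intro mult_left_mono) auto
  then show "t \<in> {a..b}" using k ab by (auto simp: simp del: of_nat_Suc)
qed

lemma grid_floor_mem: "t \<in> {a..b} \<Longrightarrow> grid_floor a b n t \<in> {a..b}"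
  using grid_floor_in_grid grid_subset by blast

lemma grid_floor_right_const: "\<exists>u>t. \<forall>s. t \<le> s \<longrightarrow> s < u \<longrightarrow> grid_floor a b n s = grid_floor a b n t"
proof (intro exI[of _ "grid_floor a b n t + (b - a) / Suc n"] conjI allI impI grid_floor_bounds)
  fix s assume s: "t \<le> s" "s < grid_floor a b n t + (b - a) / Suc n"
  define q where "q = (t - a) / (b - a) * Suc n"
  define p where "p = (s - a) / (b - a) * Suc n"
  have t: "s = a + (b - a) / Suc n * p" using grid_coordinate by (auto simp only: p_def)
  have c: "(b - a) / Suc n > 0" using ab by simp
  have "(b - a) / Suc n * p < (b - a) / Suc n * (of_int \<lfloor>q\<rfloor> + 1)"
    using s(2) t unfolding grid_floor_def q_def[symmetric] distrib_left by linarith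
  then have "p < of_int \<lfloor>q\<rfloor> + 1" using c by (simp only: mult_less_cancel_left_pos)
  moreover have "q \<le> p" using s(1) ab by (auto simp: q_def p_def intro!: mult_right_mono divide_right_mono)
  ultimately have "\<lfloor>p\<rfloor> = \<lfloor>q\<rfloor>" by linarith
  then show "grid_floor a b n s = grid_floor a b n t" by (simp add: grid_floor_def p_def q_def)
qed

lemma grid_floor_left_const: "\<exists>u<t. \<exists>l. \<forall>s. u < s \<longrightarrow> s < t \<longrightarrow> grid_floor a b n s = l"
proof -
  define q where "q = (t - a) / (b - a) * Suc n"
  define u where "u = a + (b - a) / Suc n * (of_int (\<lceil>q\<rceil> - 1))"
  have t: "t = a + (b - a) / Suc n * q" using grid_coordinate by (auto simp only: q_def)
  have c: "(b - a) / Suc n > 0" using ab by simp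
  have "(b - a) / Suc n * of_int (\<lceil>q\<rceil> - 1) < (b - a) / Suc n * q"
    using c by (intro mult_strict_left_mono) linarith+
  then have "u < t" using t by (simp add: u_def)
  moreover have "grid_floor a b n s = u" if s: "u < s" "s < t" for s
  proof -
    define p where "p = (s - a) / (b - a) * Suc n"
    have s': "s = a + (b - a) / Suc n * p" using grid_coordinate by (auto simp only: p_def)
    have "of_int (\<lceil>q\<rceil> - 1) < p" "p < q"
      using s c unfolding u_def s' t by (simp_all only: add_less_cancel_left mult_less_cancel_left_pos)
    then have "\<lfloor>p\<rfloor> = \<lceil>q\<rceil> - 1" by linarith
    then show ?thesis by (simp add: grid_floor_def p_def u_def)
  qed
  ultimately show ?thesis by blast
qed

end

lemma discretise_path:
  assumes ab: "a < b"
  shows "discretise a b n \<omega> \<in> path_space a b"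
proof -
  have "limitin (discrete_topology UNIV) (discretise a b n \<omega>) (discretise a b n \<omega> t) (at_right t)" if "t \<in> {a..<b}" for t
  proof -
    obtain u where u: "u > t" "\<forall>s. t \<le> s \<longrightarrow> s < u \<longrightarrow> grid_floor a b n s = grid_floor a b n t"
      using grid_floor_right_const[OF ab] by blast
    have "\<forall>\<^sub>F s in at_right t. discretise a b n \<omega> s = discretise a b n \<omega> t"
      unfolding eventually_at_right_field
    proof (intro exI[of _ "min u b"] conjI allI impI)
      fix s assume "s > t" "s < min u b"
      then have "s \<in> {a..b}" "t \<in> {a..b}" "grid_floor a b n s = grid_floor a b n t" using that u(2)[rule_format, of s] by auto
      then show "discretise a b n \<omega> s = discretise a b n \<omega> t" by (simp only: discretise_def restrict_apply' if_True)
    qed (use that u(1) in auto)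
    then show ?thesis by (rule limitin_eventually[rotated]) simp
  qed
  moreover have "\<exists>l. limitin (discrete_topology UNIV) (discretise a b n \<omega>) l (at_left t)" if "t \<in> {a<..b}" for t
  proof -
    obtain u l where "u < t" "\<And>s. u < s \<Longrightarrow> s < t \<Longrightarrow> grid_floor a b n s = l"
      using grid_floor_left_const[OF ab] by blast
    then have "\<forall>\<^sub>F s in at_left t. discretise a b n \<omega> s = \<omega> l"
      unfolding eventually_at_left_field using that
      by (intro exI[of _ "max u a"]) (auto simp: discretise_def)
    then have "limitin (discrete_topology UNIV) (discretise a b n \<omega>) (\<omega> l) (at_left t)"
      by (rule limitin_eventually[rotated]) simp
    then show ?thesis by blast
  qed
  ultimately show ?thesis by (auto simp: path_space_def cadlag_on_def discretise_def)
qed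

lemma path_space_right:
  assumes "\<omega> \<in> path_space a b" "a \<le> t" "t < b"
  shows "\<exists>u>t. \<forall>s. t \<le> s \<longrightarrow> s < u \<longrightarrow> \<omega> s = \<omega> t"
  using path_space_right_const[OF assms] unfolding eventually_at_right_field
  by (metis order_le_less)

lemma path_space_left:
  assumes "\<omega> \<in> path_space a b" "a < t" "t \<le> b"
  shows "\<exists>u<t. \<exists>i. \<forall>s. u < s \<longrightarrow> s < t \<longrightarrow> \<omega> s = i"
proof -
  have "\<forall>t\<in>{a<..b}. \<exists>l. limitin (discrete_topology UNIV) \<omega> l (at_left t)"
    using assms(1) unfolding path_space_def cadlag_on_def by blast
  with assms(2,3) obtain l where "limitin (discrete_topology UNIV) \<omega> l (at_left t)"
    by (meson greaterThanAtMost_iff)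
  then have "\<forall>\<^sub>F s in at_left t. \<omega> s \<in> {l}" unfolding limitin_def by (metis insertI1 openin_discrete_topology subset_UNIV)
  then have "\<forall>\<^sub>F s in at_left t. \<omega> s = l" by simp
  then show ?thesis unfolding eventually_at_left_field by blast
qed

lemma linear_change:
  fixes c d c' d' :: real
  assumes "c < d" "c' < d'"
  obtains r where "strict_mono_on {c'..d'} r" "r ` {c'..d'} = {c..d}" "r d' = d"
    "\<And>t e. t \<in> {c'..d'} \<Longrightarrow> \<bar>c - c'\<bar> \<le> e \<Longrightarrow> \<bar>d - d'\<bar> \<le> e \<Longrightarrow> \<bar>r t - t\<bar> \<le> e"
proof -
  define m where "m t = (t - c') / (d' - c')" for t
  define r where "r t = c + (d - c) * m t" for t
  have m: "t = c' + (d' - c') * m t" for t using assms by (simp add: m_def)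
  have m01: "0 \<le> m t" "m t \<le> 1" if "t \<in> {c'..d'}" for t using that assms by (auto simp: m_def)
  have mm: "m s < m t" if "s < t" for s t using that assms by (auto simp: m_def divide_strict_right_mono)
  have md: "m d' = 1" using assms by (simp add: m_def)
  show thesis
  proof (rule that[of r])
    show "strict_mono_on {c'..d'} r"
      using mm assms by (auto simp: r_def strict_mono_on_def)
    show "r d' = d" by (simp add: r_def md)
    show "r ` {c'..d'} = {c..d}"
    proof
      show "r ` {c'..d'} \<subseteq> {c..d}"
      proof clarify
        fix t assume "t \<in> {c'..d'}"
        then have "(d - c) * m t \<le> (d - c) * 1" "0 \<le> (d - c) * m t" using m01[of t] assms by (auto intro!: mult_left_mono simp del: mult_1_right)
        then show "r t \<in> {c..d}" by (simp add: r_def)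
      qed
      show "{c..d} \<subseteq> r ` {c'..d'}"
      proof
        fix y assume y: "y \<in> {c..d}"
        define k where "k = (y - c) / (d - c)"
        have k: "0 \<le> k" "k \<le> 1" "(d - c) * k = y - c" using y assms by (auto simp: k_def)
        have "(d' - c') * k \<le> (d' - c') * 1" "0 \<le> (d' - c') * k" using k assms by (auto intro!: mult_left_mono simp del: mult_1_right)
        then have "c' + (d' - c') * k \<in> {c'..d'}" by auto
        moreover have "m (c' + (d' - c') * k) = k" using assms by (simp add: m_def)
        then have "r (c' + (d' - c') * k) = y" using k by (simp add: r_def)
        ultimately show "y \<in> r ` {c'..d'}" by (metis image_eqI)
      qed
    qed
    fix t e assume t: "t \<in> {c'..d'}" "\<bar>c - c'\<bar> \<le> e" "\<bar>d - d'\<bar> \<le> e"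
    have "r t - t = (1 - m t) * (c - c') + m t * (d - d')"
      by (subst (2) m) (simp add: r_def algebra_simps)
    also have "\<bar>\<dots>\<bar> \<le> (1 - m t) * e + m t * e"
      using m01[OF t(1)] t by (intro order_trans[OF abs_triangle_ineq] add_mono) (auto simp: abs_mult intro: mult_left_mono)
    finally show "\<bar>r t - t\<bar> \<le> e" by (simp add: algebra_simps)
  qed
qed

text \<open>On an interval on which the path is constant a linear change of time moves the interval to the grid points that follow its
  ends, and such time changes can be glued. Every point has a neighbourhood on which the path is constant on either side, so
  Bolzano's bisection principle gives a time change of the whole interval within the mesh of the grid.\<close>
lemma discretise_converges:
  assumes ab: "a < b" and w: "\<omega> \<in> path_space a b"
  shows "\<exists>N. \<forall>n\<ge>N. (b - a) / Suc n \<in> skorokhod_bounds a b \<omega> (discretise a b n \<omega>)"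
proof -
  let ?c = "grid_ceil a b" and ?f = "grid_floor a b"
  \<comment> \<open>The half-open interval leaves the value at the right end to the next piece, where the path may jump.\<close>
  define good where "good c d n r \<longleftrightarrow> strict_mono_on {?c n c..?c n d} r \<and> r ` {?c n c..?c n d} = {c..d} \<and>
      (\<forall>t\<in>{?c n c..?c n d}. \<bar>r t - t\<bar> \<le> (b - a) / Suc n) \<and> (\<forall>t\<in>{?c n c..<?c n d}. \<omega> (r t) = \<omega> (?f n t))"
    for c d n and r :: "real \<Rightarrow> real"
  define P where "P c d \<longleftrightarrow> (a \<le> c \<longrightarrow> c < d \<longrightarrow> d \<le> b \<longrightarrow> (\<exists>N. \<forall>n\<ge>N. ?c n c < ?c n d \<and> (\<exists>r. good c d n r)))" for c d
  have const: "P c d" if const: "\<And>t. t \<in> {c..<d} \<Longrightarrow> \<omega> t = i" for c d i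
    unfolding P_def
  proof (intro impI)
    assume cd: "a \<le> c" "c < d" "d \<le> b"
    obtain N :: nat where N: "(b - a) / (d - c) < N" using reals_Archimedean2 by blast
    show "\<exists>N. \<forall>n\<ge>N. ?c n c < ?c n d \<and> (\<exists>r. good c d n r)"
    proof (intro exI[of _ N] allI impI conjI)
      fix n assume "N \<le> n"
      then have "(b - a) / (d - c) < Suc n" using N by linarith
      then have m: "(b - a) / Suc n < d - c" using cd by (simp add: field_simps)
      then show lt: "?c n c < ?c n d"
        using grid_ceil_bounds(2)[OF ab, where n=n and t=c] grid_ceil_bounds(1)[OF ab, where n=n and t=d] by linarith
      have close: "\<bar>c - ?c n c\<bar> \<le> (b - a) / Suc n" "\<bar>d - ?c n d\<bar> \<le> (b - a) / Suc n"
        using grid_ceil_bounds[OF ab, where n=n and t=c] grid_ceil_bounds[OF ab, where n=n and t=d] by linarith+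
      obtain r where L: "strict_mono_on {?c n c..?c n d} r" "r ` {?c n c..?c n d} = {c..d}" "r (?c n d) = d"
        "\<And>t e. t \<in> {?c n c..?c n d} \<Longrightarrow> \<bar>c - ?c n c\<bar> \<le> e \<Longrightarrow> \<bar>d - ?c n d\<bar> \<le> e \<Longrightarrow> \<bar>r t - t\<bar> \<le> e"
        using linear_change[OF cd(2) lt] by metis
      have "\<omega> (r t) = \<omega> (?f n t)" if t: "t \<in> {?c n c..<?c n d}" for t
      proof -
        have "r t \<in> {c..d}" using L(2) t by (metis atLeastAtMost_iff atLeastLessThan_iff image_eqI less_imp_le)
        moreover have "r t < r (?c n d)" using L(1) t lt by (intro strict_mono_onD[OF L(1)]) auto
        ultimately have "\<omega> (r t) = i" using L(3) by (intro const) auto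
        moreover have "c \<le> ?f n t" "?f n t < d"
          using t grid_ceil_le_iff[OF ab] by (auto simp: not_le[symmetric])
        ultimately show ?thesis using const by simp
      qed
      then show "\<exists>r. good c d n r" unfolding good_def using L(1,2) L(4)[OF _ close] by (intro exI[of _ r]) blast
    qed
  qed
  have glue: "P c e" if Pcd: "P c d" and Pde: "P d e" and "c \<le> d" "d \<le> e" for c d e
  proof (cases "c = d \<or> d = e")
    case False
    show ?thesis unfolding P_def
    proof (intro impI)
      assume "a \<le> c" "c < e" "e \<le> b"
      obtain N1 where N1: "\<And>n. n \<ge> N1 \<Longrightarrow> ?c n c < ?c n d \<and> (\<exists>r. good c d n r)"
        using Pcd False \<open>a \<le> c\<close> \<open>c \<le> d\<close> \<open>d \<le> e\<close> \<open>e \<le> b\<close> unfolding P_def by force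
      obtain N2 where N2: "\<And>n. n \<ge> N2 \<Longrightarrow> ?c n d < ?c n e \<and> (\<exists>r. good d e n r)"
        using Pde False \<open>a \<le> c\<close> \<open>c \<le> d\<close> \<open>d \<le> e\<close> \<open>e \<le> b\<close> unfolding P_def by force
      show "\<exists>N. \<forall>n\<ge>N. ?c n c < ?c n e \<and> (\<exists>r. good c e n r)"
      proof (intro exI[of _ "max N1 N2"] allI impI conjI)
        fix n assume n: "max N1 N2 \<le> n"
        obtain r1 r2 where lt: "?c n c < ?c n d" "?c n d < ?c n e" and g: "good c d n r1" "good d e n r2"
          using N1[of n] N2[of n] n by auto
        show "?c n c < ?c n e" using lt by simp
        define r where "r t = (if t < ?c n d then r1 t else r2 t)" for t
        have r1: "strict_mono_on {?c n c..?c n d} r1" "r1 ` {?c n c..?c n d} = {c..d}"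
          and r2: "strict_mono_on {?c n d..?c n e} r2" "r2 ` {?c n d..?c n e} = {d..e}"
          using g by (auto simp: good_def)
        have r2d: "r2 (?c n d) = d"
        proof -
          obtain x where x: "x \<in> {?c n d..?c n e}" "r2 x = d" using r2(2) \<open>d \<le> e\<close> by (metis atLeastAtMost_iff imageE order_refl)
          have "r2 (?c n d) \<le> r2 x" using strict_mono_on_leD[OF r2(1)] x lt by auto
          moreover have "r2 (?c n d) \<in> {d..e}" using r2(2) lt by (metis atLeastAtMost_iff image_eqI less_imp_le order_refl)
          ultimately show ?thesis using x by simp
        qed
        have r1d: "r1 (?c n d) = d"
        proof -
          obtain x where x: "x \<in> {?c n c..?c n d}" "r1 x = d" using r1(2) \<open>c \<le> d\<close> by (metis atLeastAtMost_iff imageE order_refl)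
          have "r1 x \<le> r1 (?c n d)" using strict_mono_on_leD[OF r1(1)] x lt by auto
          moreover have "r1 (?c n d) \<in> {c..d}" using r1(2) lt by (metis atLeastAtMost_iff image_eqI less_imp_le order_refl)
          ultimately show ?thesis using x by simp
        qed
        have r1': "r t = r1 t" if "t \<in> {?c n c..?c n d}" for t using that r1d r2d by (auto simp: r_def)
        have r2': "r t = r2 t" if "t \<in> {?c n d..?c n e}" for t using that by (auto simp: r_def)
        have un: "{?c n c..?c n e} = {?c n c..?c n d} \<union> {?c n d..?c n e}" using lt by auto
        have "strict_mono_on {?c n c..?c n e} r"
        proof (rule strict_mono_onI)
          fix s t assume st: "s \<in> {?c n c..?c n e}" "t \<in> {?c n c..?c n e}" "s < t"
          consider "t \<le> ?c n d" | "?c n d \<le> s" | "s < ?c n d" "?c n d < t" by linarith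
          then show "r s < r t"
          proof cases
            case 1 then show ?thesis using st r1' strict_mono_onD[OF r1(1)] by auto
          next
            case 2 then show ?thesis using st r2' strict_mono_onD[OF r2(1)] by auto
          next
            case 3
            then have "r s < d" using st r1' strict_mono_onD[OF r1(1), of s "?c n d"] r1d lt by auto
            also have "d < r t" using 3 st r2' strict_mono_onD[OF r2(1), of "?c n d" t] r2d lt by auto
            finally show ?thesis .
          qed
        qed
        moreover have "r ` {?c n c..?c n e} = {c..e}"
        proof -
          have "r ` {?c n c..?c n e} = {c..d} \<union> {d..e}"
            unfolding un image_Un r1(2)[symmetric] r2(2)[symmetric] using r1' r2' by (intro arg_cong2[where f="(\<union>)"] image_cong) auto
          then show ?thesis using \<open>c \<le> d\<close> \<open>d \<le> e\<close> by auto
        qed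
        moreover have "\<bar>r t - t\<bar> \<le> (b - a) / Suc n" if "t \<in> {?c n c..?c n e}" for t
          using that g r1' r2' unfolding un good_def by auto
        moreover have "\<omega> (r t) = \<omega> (?f n t)" if "t \<in> {?c n c..<?c n e}" for t
          using that g unfolding good_def r_def by auto
        ultimately show "\<exists>r. good c e n r" unfolding good_def by blast
      qed
    qed
  qed (use that in auto)
  have "P a b"
    using less_imp_le[OF ab]
  proof (induct rule: Bolzano)
    case (trans x y z)
    then show ?case using glue by blast
  next
    case (local x)
    obtain u i where u: "u > x" "\<forall>s. x \<le> s \<longrightarrow> s < min u b \<longrightarrow> \<omega> s = i"
    proof (cases "x < b")
      case True
      then show thesis using path_space_right[OF w local(1) True] that[of _ "\<omega> x"] by (metis min_less_iff_conj)
    qed (use that[of "x + 1"] in auto)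
    obtain v i' where v: "v < x" "\<forall>s. max a v \<le> s \<longrightarrow> s < x \<longrightarrow> \<omega> s = i'"
    proof (cases "a < x")
      case True
      then obtain v' i where "v' < x" "\<forall>s. v' < s \<longrightarrow> s < x \<longrightarrow> \<omega> s = i" using path_space_left[OF w True local(2)] by blast
      then show thesis using that[of "(v' + x) / 2" i] by auto
    qed (use that[of "x - 1"] in auto)
    show ?case
    proof (intro exI[of _ "min (u - x) (x - v)"] conjI allI impI)
      fix c d assume h: "c \<le> x \<and> x \<le> d \<and> d - c < min (u - x) (x - v)"
      show "P c d"
      proof (cases "a \<le> c \<and> d \<le> b")
        case True
        have "P c x" using h v True by (intro const[of c x i']) auto
        moreover have "P x d" using h u True by (intro const[of x d i]) auto
        ultimately show ?thesis using glue h by blast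
      qed (auto simp: P_def)
    qed (use u(1) v(1) in auto)
  qed
  then obtain N where N: "\<And>n. n \<ge> N \<Longrightarrow> \<exists>r. good a b n r" unfolding P_def using ab by blast
  show ?thesis
  proof (intro exI[of _ N] allI impI)
    fix n assume "N \<le> n"
    then obtain r where g: "good a b n r" using N by blast
    then have r: "r \<in> time_changes a b" using grid_ends[OF ab] by (simp add: good_def time_changes_def)
    have "r b = b"
    proof -
      obtain x where x: "x \<in> {a..b}" "r x = b" using time_changes_D(2)[OF r] ab by (metis atLeastAtMost_iff imageE less_imp_le order_refl)
      have "r x \<le> r b" using strict_mono_on_leD[OF time_changes_D(1)[OF r]] x ab by auto
      moreover have "r b \<in> {a..b}" using time_changes_mem[OF r] ab by simp
      ultimately show ?thesis using x by simp
    qed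
    then have "\<omega> (r t) = discretise a b n \<omega> t" if "t \<in> {a..b}" for t
      using that g grid_ends[OF ab] by (cases "t = b") (auto simp: good_def discretise_def)
    then show "(b - a) / Suc n \<in> skorokhod_bounds a b \<omega> (discretise a b n \<omega>)"
      unfolding skorokhod_bounds_def using r g grid_ends[OF ab] ab by (auto simp: good_def intro!: bexI[of _ r])
  qed
qed

definition evaluation_sets :: "real \<Rightarrow> real \<Rightarrow> (real \<Rightarrow> 's) set set" where
  "evaluation_sets a b = {{\<omega> \<in> path_space a b. \<omega> t = i} | t i. t \<in> {a..b}}"

definition path_eval :: "real \<Rightarrow> real \<Rightarrow> (real \<Rightarrow> 's) measure" where
  "path_eval a b = sigma (path_space a b) (evaluation_sets a b)"

lemma space_path_eval [simp]: "space (path_eval a b) = path_space a b"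
  by (simp add: path_eval_def space_measure_of_conv)

lemma sets_path_eval: "sets (path_eval a b) = sigma_sets (path_space a b) (evaluation_sets a b)"
  unfolding path_eval_def by (rule sets_measure_of) (auto simp: evaluation_sets_def)

lemma path_eval_sets: "t \<in> {a..b} \<Longrightarrow> {\<omega> \<in> path_space a b. \<omega> t = i} \<in> sets (path_eval a b)"
  unfolding sets_path_eval by (intro sigma_sets.Basic) (auto simp: evaluation_sets_def)

lemma space_path_borel [simp]: "space (path_borel a b) = path_space a b"
  by (simp add: path_borel_def space_measure_of_conv)

lemma openin_skorokhod:
  assumes "a \<le> b"
  shows "openin (skorokhod_topology a b) G \<longleftrightarrow> G \<subseteq> path_space a b \<and>
    (\<forall>\<omega>\<in>G. \<exists>r>0. \<forall>\<omega>'\<in>path_space a b. skorokhod_dist a b \<omega> \<omega>' < r \<longrightarrow> \<omega>' \<in> G)"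
proof -
  interpret Metric_space "path_space a b" "skorokhod_dist a b" by (rule Metric_space_skorokhod[OF assms])
  have ball: "mball \<omega> r \<subseteq> G \<longleftrightarrow> (\<forall>\<omega>'\<in>path_space a b. skorokhod_dist a b \<omega> \<omega>' < r \<longrightarrow> \<omega>' \<in> G)"
    if "\<omega> \<in> path_space a b" for \<omega> r
    using that by (auto simp: in_mball)
  show ?thesis unfolding skorokhod_topology_def openin_mtopology Ball_def
  proof (intro conj_cong refl all_cong1 imp_cong ex_cong1)
    fix \<omega> r assume "G \<subseteq> path_space a b" "\<omega> \<in> G"
    then show "mball \<omega> r \<subseteq> G \<longleftrightarrow> (\<forall>\<omega>'. \<omega>' \<in> path_space a b \<longrightarrow> skorokhod_dist a b \<omega> \<omega>' < r \<longrightarrow> \<omega>' \<in> G)"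
      using ball by blast
  qed
qed

lemma sets_path_borel:
  assumes "a \<le> b"
  shows "sets (path_borel a b) = sigma_sets (path_space a b) {A. openin (skorokhod_topology a b) A}"
  unfolding path_borel_def by (rule sets_measure_of) (use openin_skorokhod[OF assms] in auto)

lemma skorokhod_close:
  assumes "skorokhod_dist a b \<omega> \<omega>' < e" "e \<le> 1"
  obtains r where "r \<in> time_changes a b" "\<And>t. t \<in> {a..b} \<Longrightarrow> \<bar>r t - t\<bar> < e" "\<And>t. t \<in> {a..b} \<Longrightarrow> \<omega> (r t) = \<omega>' t"
proof -
  obtain f where f: "f \<in> skorokhod_bounds a b \<omega> \<omega>'" "f < e"
    using assms cInf_lessD[OF skorokhod_bounds_nonempty] unfolding skorokhod_dist_def by blast
  then obtain r where r: "r \<in> time_changes a b" "\<And>t. t \<in> {a..b} \<Longrightarrow> \<bar>r t - t\<bar> \<le> f \<and> of_bool (\<omega> (r t) \<noteq> \<omega>' t) \<le> f"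
    unfolding skorokhod_bounds_def by blast
  show thesis
  proof (rule that[OF r(1)])
    fix t assume "t \<in> {a..b}"
    from r(2)[OF this] f(2) assms(2) show "\<bar>r t - t\<bar> < e" "\<omega> (r t) = \<omega>' t"
      by (auto simp: of_bool_def split: if_splits)
  qed
qed

lemma time_change_end:
  assumes r: "r \<in> time_changes a b" and "a \<le> b"
  shows "r b = b"
proof -
  obtain x where x: "x \<in> {a..b}" "r x = b" using time_changes_D(2)[OF r] assms by (metis atLeastAtMost_iff imageE order_refl)
  have "r x \<le> r b" using strict_mono_on_leD[OF time_changes_D(1)[OF r]] x assms by auto
  moreover have "r b \<in> {a..b}" using time_changes_mem[OF r] assms by simp
  ultimately show ?thesis using x by simp
qed

text \<open>To be equal to \<open>i\<close> on a neighbourhood of \<open>[p, q]\<close> is an open condition on a path, and by right continuity \<open>\<omega> t = i\<close> means that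
  this holds for some rational \<open>q > t\<close> and all rational \<open>p\<close> between \<open>t\<close> and \<open>q\<close>. At the right end time changes are fixed,
  so evaluation there is itself continuous.\<close>
lemma evaluation_sets_borel:
  assumes ab: "a \<le> b" and t: "t \<in> {a..b}"
  shows "{\<omega> \<in> path_space a b. \<omega> t = i} \<in> sets (path_borel a b)"
proof (cases "t = b")
  case True
  have "openin (skorokhod_topology a b) {\<omega> \<in> path_space a b. \<omega> b = i}"
    unfolding openin_skorokhod[OF ab]
  proof (intro conjI ballI)
    fix \<omega> assume "\<omega> \<in> {\<omega> \<in> path_space a b. \<omega> b = i}"
    moreover have "\<omega> b = \<omega>' b" if d: "skorokhod_dist a b \<omega> \<omega>' < 1" for \<omega>'
    proof -
      obtain r where "r \<in> time_changes a b" "\<And>t. t \<in> {a..b} \<Longrightarrow> \<omega> (r t) = \<omega>' t"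
        using skorokhod_close[OF d order_refl] by metis
      then show ?thesis using time_change_end[of r a b] ab by (metis atLeastAtMost_iff order_refl)
    qed
    ultimately show "\<exists>r>0. \<forall>\<omega>'\<in>path_space a b. skorokhod_dist a b \<omega> \<omega>' < r \<longrightarrow> \<omega>' \<in> {\<omega> \<in> path_space a b. \<omega> b = i}"
      by (intro exI[of _ 1]) auto
  qed auto
  then show ?thesis using True unfolding sets_path_borel[OF ab] by auto
next
  case False
  define C where "C p q = {\<omega> \<in> path_space a b. \<exists>e>0. \<forall>s\<in>{a..b}. p - e < s \<longrightarrow> s < q + e \<longrightarrow> \<omega> s = i}" for p q
  have "openin (skorokhod_topology a b) (C p q)" for p q
    unfolding openin_skorokhod[OF ab]
  proof (intro conjI ballI)
    fix \<omega> assume "\<omega> \<in> C p q"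
    then obtain e where e: "e > 0" "\<And>s. s\<in>{a..b} \<Longrightarrow> p - e < s \<Longrightarrow> s < q + e \<Longrightarrow> \<omega> s = i" by (auto simp: C_def)
    show "\<exists>r>0. \<forall>\<omega>'\<in>path_space a b. skorokhod_dist a b \<omega> \<omega>' < r \<longrightarrow> \<omega>' \<in> C p q"
    proof (intro exI[of _ "min (e/2) 1"] conjI ballI impI)
      fix \<omega>' assume w': "\<omega>' \<in> path_space a b" and d: "skorokhod_dist a b \<omega> \<omega>' < min (e/2) 1"
      obtain r where r: "r \<in> time_changes a b" "\<And>t. t \<in> {a..b} \<Longrightarrow> \<bar>r t - t\<bar> < min (e/2) 1"
        "\<And>t. t \<in> {a..b} \<Longrightarrow> \<omega> (r t) = \<omega>' t" using skorokhod_close[OF d] by auto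
      have "\<omega>' s = i" if "s\<in>{a..b}" "p - e/2 < s" "s < q + e/2" for s
      proof -
        have "\<bar>r s - s\<bar> < e/2" "r s \<in> {a..b}" using r(2)[OF that(1)] time_changes_mem[OF r(1) that(1)] by auto
        then have "\<omega> (r s) = i" using that by (intro e(2)) (auto simp: abs_if split: if_splits)
        then show ?thesis using r(3)[OF that(1)] by simp
      qed
      then show "\<omega>' \<in> C p q" using w' e(1) by (auto simp: C_def intro!: exI[of _ "e/2"])
    qed (use e in auto)
  qed (auto simp: C_def)
  then have C: "C p q \<in> sets (path_borel a b)" for p q unfolding sets_path_borel[OF ab] by auto
  have tb: "t < b" using t False by auto
  have "{\<omega> \<in> path_space a b. \<omega> t = i} =
      (\<Union>q\<in>\<rat> \<inter> {t<..<b}. \<Inter>p\<in>\<rat> \<inter> {t<..<q}. C p q)" (is "?L = ?R")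
  proof (intro set_eqI iffI)
    fix \<omega> assume w: "\<omega> \<in> ?L"
    then have w1: "\<omega> \<in> path_space a b" "\<omega> t = i" by auto
    obtain u where u: "u > t" "\<And>s. t \<le> s \<Longrightarrow> s < u \<Longrightarrow> \<omega> s = i"
      using path_space_right[OF w1(1), of t] t tb w1(2) by (metis atLeastAtMost_iff)
    obtain q where q: "q \<in> \<rat>" "t < q" "q < min u b" using Rats_dense_in_real[of t "min u b"] u tb by auto
    have "\<omega> \<in> C p q" if "p \<in> \<rat> \<inter> {t<..<q}" for p
      using that w1 q u(2) by (auto simp: C_def intro!: exI[of _ "min (p - t) (u - q)"])
    then show "\<omega> \<in> ?R" using q by (intro UN_I[of q] INT_I) auto
  next
    fix \<omega> assume "\<omega> \<in> ?R"
    then obtain q where q: "q \<in> \<rat>" "t < q" "q < b" and Cq: "\<And>p. p \<in> \<rat> \<Longrightarrow> t < p \<Longrightarrow> p < q \<Longrightarrow> \<omega> \<in> C p q" by auto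
    obtain p0 where "p0 \<in> \<rat>" "t < p0" "p0 < q" using Rats_dense_in_real[OF q(2)] by auto
    then have w: "\<omega> \<in> path_space a b" using Cq by (auto simp: C_def)
    obtain u where u: "u > t" "\<And>s. t \<le> s \<Longrightarrow> s < u \<Longrightarrow> \<omega> s = \<omega> t"
      using path_space_right[OF w] t tb by auto
    obtain p where p: "p \<in> \<rat>" "t < p" "p < min u q" using Rats_dense_in_real[of t "min u q"] u q by auto
    then have "\<omega> \<in> C p q" using Cq by auto
    then have "\<omega> p = i" using p q t by (auto simp: C_def)
    then show "\<omega> \<in> ?L" using u(2)[of p] p w by simp
  qed
  also have "\<dots> \<in> sets (path_borel a b)"
  proof (rule sets.countable_UN'')
    show "countable (\<rat> \<inter> {t<..<b})" by (simp add: countable_rat)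
    fix q assume q: "q \<in> \<rat> \<inter> {t<..<b}"
    then obtain p where "p \<in> \<rat>" "t < p" "p < q" using Rats_dense_in_real[of t q] by auto
    then show "(\<Inter>p\<in>\<rat> \<inter> {t<..<q}. C p q) \<in> sets (path_borel a b)"
      using C by (intro sets.countable_INT' image_subsetI) (auto simp: countable_rat)
  qed
  finally show ?thesis .
qed

text \<open>The discretisations of a path converge to it, so an open set consists of the paths whose discretisations
  eventually have distance at least \<open>1 / Suc m\<close> from the complement, for some \<open>m\<close>. Any condition on a discretised path is
  a condition on finitely many evaluations.\<close>
lemma open_in_evaluations:
  fixes G :: "(real \<Rightarrow> 's::finite) set"
  assumes ab: "a \<le> b" and G: "openin (skorokhod_topology a b) G"
  shows "G \<in> sets (path_eval a b)"
proof (cases "a = b")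
  case True
  have eq: "\<omega> = \<omega>'" if "\<omega> \<in> path_space a b" "\<omega>' \<in> path_space a b" "\<omega> a = \<omega>' a" for \<omega> \<omega>' :: "real \<Rightarrow> 's"
    by (rule extensionalityI[of _ "{a..b}"]) (use that True in \<open>auto simp: path_space_def\<close>)
  have "G \<subseteq> path_space a b" using G openin_skorokhod[OF ab] by blast
  then have "G = (\<Union>i\<in>(\<lambda>\<omega>. \<omega> a) ` G. {\<omega> \<in> path_space a b. \<omega> a = i})"
    using eq by auto
  also have "\<dots> \<in> sets (path_eval a b)"
    using True by (intro sets.finite_UN path_eval_sets) auto
  finally show ?thesis .
next
  case False
  then have ab': "a < b" using ab by simp
  have Gs: "G \<subseteq> path_space a b" using G openin_skorokhod[OF ab] by blast
  define Gm where "Gm m = {w \<in> path_space a b. \<forall>\<omega>\<in>path_space a b. skorokhod_dist a b w \<omega> < 1 / Suc m \<longrightarrow> \<omega> \<in> G}" for m :: nat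
  interpret Metric_space "path_space a b" "skorokhod_dist a b" by (rule Metric_space_skorokhod[OF ab])
  have conv: "\<exists>N. \<forall>n\<ge>N. skorokhod_dist a b \<omega> (discretise a b n \<omega>) < e" if w: "\<omega> \<in> path_space a b" and "e > 0" for \<omega> e
  proof -
    obtain N where N: "\<And>n. n \<ge> N \<Longrightarrow> (b - a) / Suc n \<in> skorokhod_bounds a b \<omega> (discretise a b n \<omega>)"
      using discretise_converges[OF ab' w] by blast
    obtain M :: nat where M: "(b - a) / e < M" using reals_Archimedean2 by blast
    show ?thesis
    proof (intro exI[of _ "max N M"] allI impI)
      fix n assume n: "max N M \<le> n"
      then have "skorokhod_dist a b \<omega> (discretise a b n \<omega>) \<le> (b - a) / Suc n"
        unfolding skorokhod_dist_def using N by (intro cInf_lower skorokhod_bounds_bdd[OF ab]) auto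
      also have "(b - a) / e < Suc n" using M n by linarith
      then have "(b - a) / Suc n < e" using \<open>e > 0\<close> by (simp add: field_simps)
      finally show "skorokhod_dist a b \<omega> (discretise a b n \<omega>) < e" .
    qed
  qed
  have G_eq: "G = (\<Union>m. \<Union>N. \<Inter>n\<in>{N..}. {\<omega> \<in> path_space a b. discretise a b n \<omega> \<in> Gm m})" (is "G = ?R")
  proof (intro set_eqI iffI)
    fix \<omega> assume w: "\<omega> \<in> G"
    then obtain r where r: "r > 0" "\<And>\<omega>'. \<omega>'\<in>path_space a b \<Longrightarrow> skorokhod_dist a b \<omega> \<omega>' < r \<Longrightarrow> \<omega>' \<in> G"
      using conjunct2[OF G[unfolded openin_skorokhod[OF ab]]] by blast
    obtain m where m: "1 / Suc m < r / 2" using reals_Archimedean[of "r/2"] r(1) by (auto simp: inverse_eq_divide)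
    obtain N where N: "\<And>n. n \<ge> N \<Longrightarrow> skorokhod_dist a b \<omega> (discretise a b n \<omega>) < r / 2" using conv[of \<omega> "r/2"] half_gt_zero[OF r(1)] w Gs by blast
    have "discretise a b n \<omega> \<in> Gm m" if "n \<ge> N" for n
      unfolding Gm_def
    proof (intro CollectI conjI ballI impI discretise_path[OF ab'])
      fix \<omega>' assume w': "\<omega>' \<in> path_space a b" "skorokhod_dist a b (discretise a b n \<omega>) \<omega>' < 1 / Suc m"
      have "skorokhod_dist a b \<omega> \<omega>' \<le> skorokhod_dist a b \<omega> (discretise a b n \<omega>) + skorokhod_dist a b (discretise a b n \<omega>) \<omega>'"
        using w' w Gs by (intro triangle discretise_path[OF ab']) auto
      then show "\<omega>' \<in> G" using N[OF that] m w' by (intro r(2)) auto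
    qed
    then show "\<omega> \<in> ?R" using w Gs by auto
  next
    fix \<omega> assume "\<omega> \<in> ?R"
    then obtain m N where w: "\<And>n. n \<ge> N \<Longrightarrow> \<omega> \<in> path_space a b \<and> discretise a b n \<omega> \<in> Gm m" by auto
    obtain N' where N': "\<And>n. n \<ge> N' \<Longrightarrow> skorokhod_dist a b \<omega> (discretise a b n \<omega>) < 1 / Suc m" using conv[of \<omega> "1 / Suc m"] w[OF order_refl] by auto
    have "skorokhod_dist a b (discretise a b (max N N') \<omega>) \<omega> < 1 / Suc m"
      using N'[of "max N N'"] by (simp add: commute)
    then show "\<omega> \<in> G" using w[of "max N N'"] unfolding Gm_def by auto
  qed
  have cyl: "{\<omega> \<in> path_space a b. discretise a b n \<omega> \<in> A} \<in> sets (path_eval a b)" for n and A :: "(real \<Rightarrow> 's) set"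
  proof -
    let ?V = "{v \<in> grid a b n \<rightarrow>\<^sub>E (UNIV :: 's set). discretise a b n v \<in> A}"
    have fin: "finite (grid a b n)" by (simp add: grid_def)
    have gne: "grid a b n \<noteq> {}" by (simp add: grid_def)
    have d: "discretise a b n \<omega> = discretise a b n v" if "\<And>t. t \<in> grid a b n \<Longrightarrow> \<omega> t = v t" for \<omega> v :: "real \<Rightarrow> 's"
      using that grid_floor_in_grid[OF ab'] by (auto simp: discretise_def fun_eq_iff)
    have "{\<omega> \<in> path_space a b. discretise a b n \<omega> \<in> A} =
        (\<Union>v\<in>?V. \<Inter>t\<in>grid a b n. {\<omega> \<in> path_space a b. \<omega> t = v t})" (is "?L = ?R")
    proof (intro set_eqI iffI)
      fix \<omega> assume w: "\<omega> \<in> ?L"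
      then have "restrict \<omega> (grid a b n) \<in> ?V" using d[of "restrict \<omega> (grid a b n)" \<omega>] by auto
      then show "\<omega> \<in> ?R" using w by (intro UN_I[of "restrict \<omega> (grid a b n)"] INT_I) auto
    next
      fix \<omega> assume "\<omega> \<in> ?R"
      then obtain v where v: "v \<in> ?V" "\<And>t. t \<in> grid a b n \<Longrightarrow> \<omega> \<in> path_space a b \<and> \<omega> t = v t" by blast
      have "discretise a b n \<omega> = discretise a b n v" using v(2) by (intro d) blast
      moreover obtain t where "t \<in> grid a b n" using gne by blast
      ultimately show "\<omega> \<in> ?L" using v by simp
    qed
    also have "\<dots> \<in> sets (path_eval a b)"
    proof (rule sets.finite_UN)
      show "finite ?V" by (rule finite_subset[OF Collect_restrict finite_PiE[OF fin]]) simp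
      fix v
      show "(\<Inter>t\<in>grid a b n. {\<omega> \<in> path_space a b. \<omega> t = v t}) \<in> sets (path_eval a b)"
        by (rule sets.finite_INT[OF fin gne]) (use grid_subset[OF ab'] in \<open>auto intro!: path_eval_sets\<close>)
    qed
    finally show ?thesis .
  qed
  show ?thesis
    unfolding G_eq by (intro sets.countable_UN sets.countable_INT' cyl image_subsetI) auto
qed

theorem sets_path_borel_eval:
  assumes "a \<le> b"
  shows "sets (path_borel a b :: (real \<Rightarrow> 's::finite) measure) = sets (path_eval a b)"
proof
  show "sets (path_borel a b :: (real \<Rightarrow> 's) measure) \<subseteq> sets (path_eval a b)"
    unfolding sets_path_borel[OF assms]
    by (rule sets.sigma_sets_subset[of _ "path_eval a b :: (real \<Rightarrow> 's) measure", simplified])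
      (use open_in_evaluations[OF assms] in blast)
  show "sets (path_eval a b :: (real \<Rightarrow> 's) measure) \<subseteq> sets (path_borel a b)"
    unfolding sets_path_eval
    by (rule sets.sigma_sets_subset[of _ "path_borel a b :: (real \<Rightarrow> 's) measure", simplified])
      (auto simp: evaluation_sets_def intro!: evaluation_sets_borel[OF assms])
qed

lemma measurable_path_space:
  assumes "a \<le> b" "X \<in> space M \<rightarrow> path_space a b"
    and "\<And>t i. t \<in> {a..b} \<Longrightarrow> {x \<in> space M. X x t = i} \<in> sets M"
  shows "X \<in> M \<rightarrow>\<^sub>M (path_borel a b :: (real \<Rightarrow> 's::finite) measure)"
proof -
  have "X \<in> M \<rightarrow>\<^sub>M path_eval a b"
    unfolding path_eval_def
  proof (rule measurable_measure_of)
    fix A :: "(real \<Rightarrow> 's) set" assume "A \<in> evaluation_sets a b"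
    then obtain t i where "t \<in> {a..b}" "A = {\<omega> \<in> path_space a b. \<omega> t = i}" by (auto simp: evaluation_sets_def)
    moreover from this assms(2) have "X -` A \<inter> space M = {x \<in> space M. X x t = i}" by auto
    ultimately show "X -` A \<inter> space M \<in> sets M" using assms(3) by simp
  qed (use assms in \<open>auto simp: evaluation_sets_def\<close>)
  then show ?thesis using measurable_cong_sets[OF refl sets_path_borel_eval[OF assms(1)]] by blast
qed

lemma restrict_path:
  assumes "\<omega> \<in> path_space a b" "t \<in> {a..b}"
  shows "restrict \<omega> {a..t} \<in> path_space a t"
proof -
  have "limitin (discrete_topology UNIV) (restrict \<omega> {a..t}) (restrict \<omega> {a..t} s) (at_right s)" if s: "s \<in> {a..<t}" for s
  proof -
    have "a \<le> s" "s < b" using s assms(2) by auto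
    then obtain u where u: "u > s" "\<forall>r. s \<le> r \<longrightarrow> r < u \<longrightarrow> \<omega> r = \<omega> s" using path_space_right[OF assms(1)] by blast
    have "\<forall>\<^sub>F r in at_right s. restrict \<omega> {a..t} r = restrict \<omega> {a..t} s"
      unfolding eventually_at_right_field
    proof (intro exI[of _ "min u t"] conjI allI impI)
      fix r assume "s < r" "r < min u t"
      then show "restrict \<omega> {a..t} r = restrict \<omega> {a..t} s" using u(2)[rule_format, of r] s by auto
    qed (use u(1) s in auto)
    then show ?thesis by (rule limitin_eventually[rotated]) simp
  qed
  moreover have "\<exists>l. limitin (discrete_topology UNIV) (restrict \<omega> {a..t}) l (at_left s)" if s: "s \<in> {a<..t}" for s
  proof -
    have "a < s" "s \<le> b" using s assms(2) by auto
    then obtain u l where "u < s" "\<forall>r. u < r \<longrightarrow> r < s \<longrightarrow> \<omega> r = l" using path_space_left[OF assms(1)] by blast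
    then have "\<forall>\<^sub>F r in at_left s. restrict \<omega> {a..t} r = l"
      unfolding eventually_at_left_field using s by (intro exI[of _ "max u a"]) auto
    then have "limitin (discrete_topology UNIV) (restrict \<omega> {a..t}) l (at_left s)"
      by (rule limitin_eventually[rotated]) simp
    then show ?thesis by blast
  qed
  ultimately show ?thesis by (auto simp: path_space_def cadlag_on_def)
qed

context
  fixes t0 T :: real
  assumes t0T: "t0 \<le> T"
begin

lemma space_path_filtration [simp]: "space (path_filtration T t0 t) = path_space t0 T"
  by (simp add: path_filtration_def)

lemma path_filtration_sets:
  assumes "t \<in> {t0..T}"
  shows "sets (path_filtration T t0 t) = {{\<omega> \<in> path_space t0 T. restrict \<omega> {t0..t} \<in> B} | B. B \<in> sets (path_borel t0 t)}"
  unfolding path_filtration_def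
  by (subst sets_vimage_algebra2) (use restrict_path[OF _ assms] in auto)

lemma path_filtration_eval:
  assumes "s \<in> {t0..t}" "t \<le> T"
  shows "{\<omega> \<in> path_space t0 T. \<omega> s = (i :: 's::finite)} \<in> sets (path_filtration T t0 t)"
proof -
  have "{\<omega> \<in> path_space t0 t. \<omega> s = i} \<in> sets (path_borel t0 t)"
    using assms by (intro evaluation_sets_borel) auto
  moreover have "{\<omega> \<in> path_space t0 T. \<omega> s = i} = {\<omega> \<in> path_space t0 T. restrict \<omega> {t0..t} \<in> {\<omega> \<in> path_space t0 t. \<omega> s = i}}"
    using assms restrict_path[of _ t0 T t] by auto
  moreover have "t \<in> {t0..T}" using assms by auto
  ultimately show ?thesis using path_filtration_sets[of t] by blast
qed

lemma path_filtration_subset: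
  assumes "s \<in> {t0..t}" "t \<le> T"
  shows "sets (path_filtration T t0 s :: (real \<Rightarrow> 's::finite) measure) \<subseteq> sets (path_filtration T t0 t)"
proof -
  have "(\<lambda>\<omega>. restrict \<omega> {t0..s}) \<in> path_filtration T t0 t \<rightarrow>\<^sub>M (path_borel t0 s :: (real \<Rightarrow> 's) measure)"
  proof (rule measurable_path_space)
    fix r i assume "r \<in> {t0..s}"
    then show "{\<omega> \<in> space (path_filtration T t0 t). restrict \<omega> {t0..s} r = (i::'s)} \<in> sets (path_filtration T t0 t)"
      using path_filtration_eval[of r t i] assms by simp
  qed (use assms restrict_path[of _ t0 T s] in auto)
  from measurable_sets[OF this] have "{\<omega> \<in> path_space t0 T. restrict \<omega> {t0..s} \<in> B} \<in> sets (path_filtration T t0 t)"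
    if "B \<in> sets (path_borel t0 s)" for B :: "(real \<Rightarrow> 's) set"
    using that by (simp add: vimage_def Int_def conj_commute)
  moreover have "s \<in> {t0..T}" using assms by auto
  ultimately show ?thesis by (subst path_filtration_sets) blast+
qed

lemma path_filtration_borel:
  assumes "t \<in> {t0..T}"
  shows "sets (path_filtration T t0 t :: (real \<Rightarrow> 's::finite) measure) \<subseteq> sets (path_borel t0 T)"
proof -
  have "(\<lambda>\<omega>. restrict \<omega> {t0..t}) \<in> path_borel t0 T \<rightarrow>\<^sub>M (path_borel t0 t :: (real \<Rightarrow> 's) measure)"
  proof (rule measurable_path_space)
    fix r i assume "r \<in> {t0..t}"
    then show "{\<omega> \<in> space (path_borel t0 T). restrict \<omega> {t0..t} r = (i::'s)} \<in> sets (path_borel t0 T)"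
      using evaluation_sets_borel[of t0 T r i] assms by simp
  qed (use assms restrict_path[of _ t0 T t] in auto)
  from measurable_sets[OF this] have "{\<omega> \<in> path_space t0 T. restrict \<omega> {t0..t} \<in> B} \<in> sets (path_borel t0 T)"
    if "B \<in> sets (path_borel t0 t)" for B :: "(real \<Rightarrow> 's) set"
    using that by (simp add: vimage_def Int_def conj_commute)
  then show ?thesis by (subst path_filtration_sets[OF assms]) blast
qed

lemma path_filtration_T: "sets (path_filtration T t0 T :: (real \<Rightarrow> 's::finite) measure) = sets (path_borel t0 T)"
proof
  show "sets (path_borel t0 T :: (real \<Rightarrow> 's) measure) \<subseteq> sets (path_filtration T t0 T)"
    unfolding sets_path_borel_eval[OF t0T] sets_path_eval
    by (rule sets.sigma_sets_subset[of _ "path_filtration T t0 T :: (real \<Rightarrow> 's) measure", simplified])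
      (use path_filtration_eval[of _ T] in \<open>auto simp: evaluation_sets_def\<close>)
qed (use path_filtration_borel t0T in auto)

lemma path_filtration_determined:
  assumes "A \<in> sets (path_filtration T t0 t)" "t \<in> {t0..T}"
    and "\<omega> \<in> path_space t0 T" "\<omega>' \<in> path_space t0 T" "\<And>s. s \<in> {t0..t} \<Longrightarrow> \<omega> s = \<omega>' s"
  shows "\<omega> \<in> A \<longleftrightarrow> \<omega>' \<in> A"
proof -
  have "restrict \<omega> {t0..t} = restrict \<omega>' {t0..t}" using assms(5) by (auto simp: fun_eq_iff)
  moreover obtain B where "A = {\<omega> \<in> path_space t0 T. restrict \<omega> {t0..t} \<in> B}"
    using assms(1) unfolding path_filtration_sets[OF assms(2)] by blast
  ultimately show ?thesis using assms(3,4) by simp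
qed

text \<open>A set of the filtration at time \<open>t\<close> cannot separate paths that agree up to \<open>t\<close>, and the target space is \<open>T1\<close>.
  This is what makes rates that depend on the past computable while the path is being built.\<close>
lemma progressive_determined:
  fixes f :: "real \<Rightarrow> (real \<Rightarrow> 's::finite) \<Rightarrow> 'c::t1_space"
  assumes f: "(\<lambda>(s, \<omega>). f s \<omega>) \<in> restrict_space borel {t0..t} \<Otimes>\<^sub>M path_filtration T t0 t \<rightarrow>\<^sub>M borel" and t: "t \<in> {t0..T}"
    and w: "\<omega> \<in> path_space t0 T" "\<omega>' \<in> path_space t0 T" "\<And>s. s \<in> {t0..t} \<Longrightarrow> \<omega> s = \<omega>' s"
  shows "f t \<omega> = f t \<omega>'"
proof -
  have "(\<lambda>\<omega>. f t \<omega>) \<in> path_filtration T t0 t \<rightarrow>\<^sub>M borel"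
    using t measurable_compose[OF measurable_Pair1' f, of t] by (simp add: space_restrict_space)
  then have "f t -` {f t \<omega>} \<inter> space (path_filtration T t0 t) \<in> sets (path_filtration T t0 t)"
    by (rule measurable_sets) auto
  from path_filtration_determined[OF this t w] w show ?thesis by simp
qed

text \<open>Approximate the time from the right by grid points of \<open>[t0, t]\<close>; on such points the evaluation is a finite case distinction, and
  right continuity makes the values eventually constant. The grid ends at \<open>t\<close>, so that no value after \<open>t\<close> is used.\<close>
lemma joint_evaluation:
  assumes t: "t \<in> {t0..T}"
  shows "(\<lambda>(s, \<omega>). \<omega> s) \<in> restrict_space borel {t0..t} \<Otimes>\<^sub>M path_filtration T t0 t \<rightarrow>\<^sub>M count_space (UNIV :: 's::finite set)"
unfolding measurable_count_space_eq2[OF finite_class.finite_UNIV]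
proof (intro conjI ballI)
  let ?M = "restrict_space borel {t0..t} \<Otimes>\<^sub>M (path_filtration T t0 t :: (real \<Rightarrow> 's) measure)"
  fix i :: 's
  have sp: "space ?M = {t0..t} \<times> path_space t0 T" by (auto simp: space_pair_measure space_restrict_space)
  have ev: "{p \<in> space ?M. snd p s = i} \<in> sets ?M" if "s \<in> {t0..t}" for s
  proof -
    have "{p \<in> space ?M. snd p s = i} = {t0..t} \<times> {\<omega> \<in> path_space t0 T. \<omega> s = i}" by (auto simp: sp)
    also have "\<dots> \<in> sets ?M"
      using path_filtration_eval[of s t i] that t by (intro pair_measureI) (auto simp: sets_restrict_space)
    finally show ?thesis .
  qed
  have "{p \<in> space ?M. snd p (fst p) = i} \<in> sets ?M"
  proof (cases "t0 = t")
    case True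
    then have "{p \<in> space ?M. snd p (fst p) = i} = {p \<in> space ?M. snd p t = i}" unfolding sp by auto
    then show ?thesis using ev[of t] True by simp
  next
    case False
    then have t0t: "t0 < t" using t by auto
    have eq: "{p \<in> space ?M. snd p (fst p) = i} =
      (\<Union>N. \<Inter>n\<in>{N..}. \<Union>g\<in>grid t0 t n. {p \<in> space ?M. grid_ceil t0 t n (fst p) = g} \<inter> {p \<in> space ?M. snd p g = i})" (is "?L = ?R")
    proof -
      have lim: "\<exists>N. \<forall>n\<ge>N. \<omega> (grid_ceil t0 t n s) = \<omega> s" if w: "\<omega> \<in> path_space t0 T" and s: "s \<in> {t0..t}" for \<omega> :: "real \<Rightarrow> 's" and s
      proof (cases "s = t")
        case False
        then obtain u where u: "u > s" "\<forall>r. s \<le> r \<longrightarrow> r < u \<longrightarrow> \<omega> r = \<omega> s"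
          using path_space_right[OF w, of s] s t by auto
        obtain N :: nat where N: "(t - t0) / (u - s) < N" using reals_Archimedean2 by blast
        show ?thesis
        proof (intro exI[of _ N] allI impI)
          fix n assume "N \<le> n"
          then have "(t - t0) / (u - s) < Suc n" using N by linarith
          then have "(t - t0) / Suc n < u - s" using u(1) by (simp add: field_simps)
          then show "\<omega> (grid_ceil t0 t n s) = \<omega> s"
            using grid_ceil_bounds[OF t0t, where t=s and n=n] by (intro u(2)[rule_format]) linarith+
        qed
      qed (use t0t in simp)
      have g: "grid_ceil t0 t n s \<in> grid t0 t n" if "s \<in> {t0..t}" for n s by (rule grid_ceil_in_grid[OF t0t that])
      show ?thesis
      proof (intro set_eqI iffI)
        fix p assume p: "p \<in> ?L"
        then have "snd p \<in> path_space t0 T" "fst p \<in> {t0..t}" by (auto simp: sp)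
        from lim[OF this] obtain N where "\<forall>n\<ge>N. snd p (grid_ceil t0 t n (fst p)) = i" using p by auto
        then show "p \<in> ?R" using p g[of "fst p"] by (auto simp: sp)
      next
        fix p assume p: "p \<in> ?R"
        then obtain N where N: "\<And>n. n \<ge> N \<Longrightarrow> p \<in> space ?M \<and> snd p (grid_ceil t0 t n (fst p)) = i" by auto
        then have "p \<in> space ?M" by blast
        then have "snd p \<in> path_space t0 T" "fst p \<in> {t0..t}" by (auto simp: sp)
        from lim[OF this] obtain N' where "\<forall>n\<ge>N'. snd p (grid_ceil t0 t n (fst p)) = snd p (fst p)" by blast
        then show "p \<in> ?L" using N[of "max N N'"] by auto
      qed
    qed
    have gm: "{p \<in> space ?M. grid_ceil t0 t n (fst p) = g} \<in> sets ?M" for n g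
    proof -
      have [measurable]: "fst \<in> borel_measurable ?M"
        by (rule measurable_compose[OF measurable_fst, of "\<lambda>x. x", simplified]) (rule measurable_restrict_space1, simp)
      have "(\<lambda>p. grid_ceil t0 t n (fst p)) \<in> borel_measurable ?M"
        unfolding grid_ceil_def by measurable
      then show ?thesis by measurable
    qed
    show ?thesis
      unfolding eq
    proof (intro sets.countable_UN image_subsetI sets.countable_INT' sets.finite_UN sets.Int gm ev)
      show "finite (grid t0 t n)" for n by (simp add: grid_def)
      show "g \<in> {t0..t}" if "g \<in> grid t0 t n" for g n using that grid_subset[OF t0t] by blast
    qed auto
  qed
  then show "(\<lambda>(s, \<omega>). \<omega> s) -` {i} \<inter> space ?M \<in> sets ?M"
    by (simp add: vimage_def Int_def conj_commute case_prod_unfold)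
qed auto

lemma memory_strategy_in:
  fixes \<alpha> :: "real \<Rightarrow> (real \<Rightarrow> 's::finite) \<Rightarrow> 'c::metric_space"
  assumes \<alpha>: "\<alpha> \<in> memory_strategies T t0 A" and t: "t \<in> {t0..T}" and w: "\<omega> \<in> path_space t0 T"
  shows "\<alpha> t \<omega> \<in> A"
proof -
  have "(\<lambda>(s, \<omega>). \<alpha> s \<omega>) \<in> restrict_space borel {t0..t} \<Otimes>\<^sub>M path_filtration T t0 t \<rightarrow>\<^sub>M restrict_space borel A"
    using \<alpha> t by (auto simp: memory_strategies_def)
  from measurable_space[OF this, of "(t, \<omega>)"] w t show ?thesis
    by (simp add: space_pair_measure space_restrict_space)
qed

end

section \<open>Poisson configurations and the Mecke formula\<close>

text \<open>The enumeration of the indices other than \<open>k\<close>; composing with it deletes the \<open>k\<close>-th point of a sequence.\<close>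
definition skip_index :: "nat \<Rightarrow> nat \<Rightarrow> nat" where
  "skip_index k i = (if i < k then i else Suc i)"

lemma measurable_reindex: "(\<lambda>x i. x (p i)) \<in> PiM UNIV (\<lambda>_. M) \<rightarrow>\<^sub>M PiM UNIV (\<lambda>_. M)"
  by (rule measurable_abs_UNIV) (rule measurable_component_singleton, simp)

text \<open>One coordinate of an independent sequence is independent of the sequence of the others, which has again the same law.\<close>
lemma nn_integral_split_point:
  assumes "prob_space \<nu>" and F[measurable]: "F \<in> borel_measurable (\<nu> \<Otimes>\<^sub>M PiM UNIV (\<lambda>_::nat. \<nu>))"
  shows "(\<integral>\<^sup>+x. F (x k, x \<circ> skip_index k) \<partial>PiM UNIV (\<lambda>_::nat. \<nu>)) = (\<integral>\<^sup>+x. \<integral>\<^sup>+y. F (y, x) \<partial>\<nu> \<partial>PiM UNIV (\<lambda>_::nat. \<nu>))"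
proof -
  interpret \<nu>: prob_space \<nu> by fact
  interpret sequence_space \<nu> by standard
  let ?p = "case_nat k (skip_index k)"
  let ?G = "\<lambda>x. F (x 0, \<lambda>i. x (Suc i))"
  have [measurable]: "(\<lambda>x i. x (Suc i)) \<in> S \<rightarrow>\<^sub>M S" by (rule measurable_reindex)
  have G[measurable]: "?G \<in> borel_measurable S" by measurable
  have inj: "inj ?p" by (auto simp: inj_def skip_index_def split: nat.splits if_splits)
  have "distr S S (\<lambda>x. \<lambda>n\<in>UNIV. x (?p n)) = S"
    using distr_PiM_reindex[of UNIV "\<lambda>_. \<nu>" ?p UNIV] inj \<nu>.prob_space_axioms by auto
  then have "(\<integral>\<^sup>+x. ?G x \<partial>S) = (\<integral>\<^sup>+x. ?G x \<partial>distr S S (\<lambda>x. \<lambda>n\<in>UNIV. x (?p n)))" by simp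
  also have "\<dots> = (\<integral>\<^sup>+x. ?G (\<lambda>n. x (?p n)) \<partial>S)"
    by (subst nn_integral_distr) auto
  also have "\<dots> = (\<integral>\<^sup>+x. F (x k, x \<circ> skip_index k) \<partial>S)" by (simp add: comp_def)
  finally have "(\<integral>\<^sup>+x. F (x k, x \<circ> skip_index k) \<partial>S) = (\<integral>\<^sup>+x. ?G x \<partial>S)" by simp
  also have "\<dots> = (\<integral>\<^sup>+x. ?G x \<partial>distr (\<nu> \<Otimes>\<^sub>M S) S (\<lambda>(s, \<omega>). case_nat s \<omega>))" by (simp add: PiM_iter)
  also have "\<dots> = (\<integral>\<^sup>+p. F p \<partial>(\<nu> \<Otimes>\<^sub>M S))"
    by (subst nn_integral_distr) (auto simp: case_prod_unfold)
  also have "\<dots> = (\<integral>\<^sup>+x. \<integral>\<^sup>+y. F (y, x) \<partial>\<nu> \<partial>S)"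
  proof -
    interpret pair_sigma_finite \<nu> S by unfold_locales
    show ?thesis by (subst nn_integral_snd) auto
  qed
  finally show ?thesis .
qed

lemma inj_iff_distinct: "inj g \<longleftrightarrow> (\<forall>i j. i \<noteq> j \<longrightarrow> g i \<noteq> g j)"
  by (simp add: inj_def) blast

text \<open>A Poisson process of finite intensity \<open>c \<nu>\<close>: of the pair \<open>(n, x)\<close> only the first \<open>n\<close> points of the sequence \<open>x\<close> belong to
  the configuration. The infinite sequence keeps all configurations in one product space.\<close>
definition poisson_configuration :: "real \<Rightarrow> 'p measure \<Rightarrow> (nat \<times> (nat \<Rightarrow> 'p)) measure" where
  "poisson_configuration c \<nu> = measure_pmf (poisson_pmf c) \<Otimes>\<^sub>M PiM UNIV (\<lambda>_. \<nu>)"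

context
  fixes c :: real and \<nu> :: "'p measure"
  assumes c: "c > 0" and nu: "prob_space \<nu>"
begin

interpretation nu: prob_space \<nu> by (rule nu)
interpretation sequence_space \<nu> by standard
interpretation pmf_S: pair_sigma_finite "measure_pmf (poisson_pmf c)" S by unfold_locales

lemma prob_space_poisson_configuration: "prob_space (poisson_configuration c \<nu>)"
  unfolding poisson_configuration_def by (intro prob_space_pair) (unfold_locales)

lemma measurable_poisson_configuration:
  assumes "\<And>n. (\<lambda>x. F n x) \<in> PiM UNIV (\<lambda>_. \<nu>) \<rightarrow>\<^sub>M N"
  shows "(\<lambda>(n, x). F n x) \<in> poisson_configuration c \<nu> \<rightarrow>\<^sub>M N"
proof -
  have "(\<lambda>p. F (fst p) (snd p)) \<in> poisson_configuration c \<nu> \<rightarrow>\<^sub>M N"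
    unfolding poisson_configuration_def
    by (rule measurable_compose_countable'[where I=UNIV and g=fst])
       (auto intro!: measurable_compose[OF measurable_snd assms] measurable_compose[OF measurable_fst])
  then show ?thesis by (simp add: case_prod_unfold)
qed

lemma nn_integral_poisson_configuration:
  assumes [measurable]: "\<And>n. F n \<in> borel_measurable S"
  shows "(\<integral>\<^sup>+(n, x). F n x \<partial>poisson_configuration c \<nu>) = (\<Sum>n. ennreal (pmf (poisson_pmf c) n) * (\<integral>\<^sup>+x. F n x \<partial>S))"
proof -
  have "(\<lambda>(n, x). F n x) \<in> borel_measurable (measure_pmf (poisson_pmf c) \<Otimes>\<^sub>M S)"
    using measurable_poisson_configuration[of F] assms by (simp add: poisson_configuration_def)
  then have "(\<integral>\<^sup>+(n, x). F n x \<partial>poisson_configuration c \<nu>) = (\<integral>\<^sup>+n. \<integral>\<^sup>+x. F n x \<partial>S \<partial>measure_pmf (poisson_pmf c))"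
    unfolding poisson_configuration_def by (subst P.nn_integral_fst[symmetric]) auto
  also have "\<dots> = (\<integral>\<^sup>+n. ennreal (pmf (poisson_pmf c) n) * (\<integral>\<^sup>+x. F n x \<partial>S) \<partial>count_space UNIV)"
    by (rule nn_integral_measure_pmf)
  also have "\<dots> = (\<Sum>n. ennreal (pmf (poisson_pmf c) n) * (\<integral>\<^sup>+x. F n x \<partial>S))"
    by (rule nn_integral_count_space_nat)
  finally show ?thesis .
qed

text \<open>With \<open>n\<close> points, each of the \<open>n\<close> summands has the same expectation as one extra point next to \<open>n - 1\<close> points, and the
  Poisson weights satisfy \<open>n p(n) = c p(n - 1)\<close>.\<close>
theorem Mecke_nn:
  assumes F: "\<And>n. (\<lambda>(y, x). F y n x) \<in> borel_measurable (\<nu> \<Otimes>\<^sub>M S)"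
  shows "(\<integral>\<^sup>+(n, x). (\<Sum>k<n. F (x k) (n - 1) (x \<circ> skip_index k)) \<partial>poisson_configuration c \<nu>) =
    ennreal c * (\<integral>\<^sup>+(n, x). (\<integral>\<^sup>+y. F y n x \<partial>\<nu>) \<partial>poisson_configuration c \<nu>)"
proof -
  note [measurable] = F
  have skm[measurable]: "(\<lambda>x. x \<circ> skip_index k) \<in> S \<rightarrow>\<^sub>M S" for k
    unfolding comp_def by (rule measurable_reindex)
  have m: "(\<lambda>x. F (x k) n (x \<circ> skip_index k)) \<in> borel_measurable S" for k n
  proof -
    have "(\<lambda>x. (x k, x \<circ> skip_index k)) \<in> S \<rightarrow>\<^sub>M \<nu> \<Otimes>\<^sub>M S" by measurable
    from measurable_compose[OF this F[of n]] show ?thesis by simp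
  qed
  interpret pair_sigma_finite \<nu> S by unfold_locales
  have m2: "(\<lambda>x. \<integral>\<^sup>+y. F y n x \<partial>\<nu>) \<in> borel_measurable S" for n by measurable
  define a where "a n = (\<integral>\<^sup>+x. \<integral>\<^sup>+y. F y n x \<partial>\<nu> \<partial>S)" for n
  have "(\<integral>\<^sup>+(n, x). (\<Sum>k<n. F (x k) (n - 1) (x \<circ> skip_index k)) \<partial>poisson_configuration c \<nu>) =
      (\<Sum>n. ennreal (pmf (poisson_pmf c) n) * (\<integral>\<^sup>+x. (\<Sum>k<n. F (x k) (n - 1) (x \<circ> skip_index k)) \<partial>S))"
    using m by (intro nn_integral_poisson_configuration) auto
  also have "\<dots> = (\<Sum>n. ennreal (pmf (poisson_pmf c) n) * (of_nat n * a (n - 1)))"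
    using m nn_integral_split_point[OF nu F] by (simp add: nn_integral_sum a_def)
  also have "\<dots> = ennreal (pmf (poisson_pmf c) 0) * (of_nat 0 * a (0 - 1)) +
      (\<Sum>n. ennreal (pmf (poisson_pmf c) (Suc n)) * (of_nat (Suc n) * a (Suc n - 1)))"
    using suminf_offset[of "\<lambda>n. ennreal (pmf (poisson_pmf c) n) * (of_nat n * a (n - 1))" 1] by simp
  also have "\<dots> = (\<Sum>n. ennreal c * (ennreal (pmf (poisson_pmf c) n) * a n))"
  proof -
    have "ennreal (pmf (poisson_pmf c) (Suc n)) * (of_nat (Suc n) * a (Suc n - 1)) = ennreal c * (ennreal (pmf (poisson_pmf c) n) * a n)" for n
    proof -
      have "pmf (poisson_pmf c) (Suc n) * real (Suc n) = c * pmf (poisson_pmf c) n"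
        using c by (simp add: field_simps del: of_nat_Suc)
      then have "ennreal (pmf (poisson_pmf c) (Suc n)) * ennreal (real (Suc n)) = ennreal c * ennreal (pmf (poisson_pmf c) n)"
        using c by (simp only: ennreal_mult'[symmetric] ennreal_mult[symmetric] pmf_nonneg of_nat_0_le_iff less_imp_le)
      then show ?thesis by (simp add: mult.assoc[symmetric] ennreal_of_nat_eq_real_of_nat del: of_nat_Suc)
    qed
    then show ?thesis by simp
  qed
  also have "\<dots> = ennreal c * (\<Sum>n. ennreal (pmf (poisson_pmf c) n) * a n)" by (rule ennreal_suminf_cmult)
  also have "(\<Sum>n. ennreal (pmf (poisson_pmf c) n) * a n) = (\<integral>\<^sup>+(n, x). (\<integral>\<^sup>+y. F y n x \<partial>\<nu>) \<partial>poisson_configuration c \<nu>)"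
    unfolding a_def using m2 by (intro nn_integral_poisson_configuration[symmetric])
  finally show ?thesis .
qed

lemma measurable_skip_sum:
  assumes F: "\<And>n. (\<lambda>(y, x). F y n x) \<in> borel_measurable (\<nu> \<Otimes>\<^sub>M S)"
  shows "(\<lambda>(n, x). (\<Sum>k<n. F (x k) (n - 1) (x \<circ> skip_index k) :: real)) \<in> borel_measurable (poisson_configuration c \<nu>)"
proof (rule measurable_poisson_configuration, rule borel_measurable_sum)
  fix n k
  have "(\<lambda>x. (x k, x \<circ> skip_index k)) \<in> S \<rightarrow>\<^sub>M \<nu> \<Otimes>\<^sub>M S" unfolding comp_def by (intro measurable_Pair measurable_reindex) measurable
  from measurable_compose[OF this F[of "n - 1"]] show "(\<lambda>x. F (x k) (n - 1) (x \<circ> skip_index k)) \<in> borel_measurable S" by simp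
qed

lemma Mecke_nonneg:
  assumes F: "\<And>n. (\<lambda>(y, x). F y n x) \<in> borel_measurable (\<nu> \<Otimes>\<^sub>M S)"
    and B: "\<And>y n x. y \<in> space \<nu> \<Longrightarrow> x \<in> space S \<Longrightarrow> 0 \<le> F y n x \<and> F y n x \<le> B"
  shows "has_bochner_integral (poisson_configuration c \<nu>) (\<lambda>(n, x). (\<Sum>k<n. F (x k) (n - 1) (x \<circ> skip_index k)))
      (c * (LINT (n, x)|poisson_configuration c \<nu>. LINT y|\<nu>. F y n x))"
proof -
  interpret PC: prob_space "poisson_configuration c \<nu>" by (rule prob_space_poisson_configuration)
  have sp: "p \<in> space (poisson_configuration c \<nu>) \<Longrightarrow> snd p \<in> space S" for p
    by (auto simp: poisson_configuration_def space_pair_measure)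
  have B0: "0 \<le> B"
  proof -
    obtain y where "y \<in> space \<nu>" using nu.not_empty by blast
    moreover obtain x where "x \<in> space S" using P.not_empty by blast
    ultimately show ?thesis using B[of y x 0] by force
  qed
  have Fe: "\<And>n. (\<lambda>(y, x). ennreal (F y n x)) \<in> borel_measurable (\<nu> \<Otimes>\<^sub>M S)"
    using measurable_compose[OF F measurable_ennreal] by (simp add: case_prod_unfold)
  have Fx: "(\<lambda>y. F y n x) \<in> borel_measurable \<nu>" if "x \<in> space S" for n x
    using measurable_compose[OF measurable_Pair2'[OF that] F[of n]] by simp
  have int: "integrable \<nu> (\<lambda>y. F y n x)" if "x \<in> space S" for n x
    using Fx[OF that] B that by (intro nu.integrable_const_bound[where B=B]) auto
  have inner: "(\<integral>\<^sup>+y. ennreal (F y n x) \<partial>\<nu>) = ennreal (LINT y|\<nu>. F y n x)" if "x \<in> space S" for n x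
    using B that int by (intro nn_integral_eq_integral) auto
  have innerB: "0 \<le> (LINT y|\<nu>. F y n x)" "(LINT y|\<nu>. F y n x) \<le> B" if "x \<in> space S" for n x
  proof -
    show "0 \<le> (LINT y|\<nu>. F y n x)" using B that by (intro Bochner_Integration.integral_nonneg_AE) auto
    have "(LINT y|\<nu>. F y n x) \<le> (LINT y|\<nu>. B)"
      using B that int by (intro integral_mono) auto
    then show "(LINT y|\<nu>. F y n x) \<le> B" by (simp add: nu.prob_space)
  qed
  have im: "(\<lambda>(n, x). LINT y|\<nu>. F y n x) \<in> borel_measurable (poisson_configuration c \<nu>)"
  proof (rule measurable_poisson_configuration)
    fix n
    have "(\<lambda>(x, y). F y n x) \<in> borel_measurable (S \<Otimes>\<^sub>M \<nu>)" using measurable_pair_swap[OF F[of n]] by simp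
    then show "(\<lambda>x. LINT y|\<nu>. F y n x) \<in> borel_measurable S" by (rule nu.borel_measurable_lebesgue_integral)
  qed
  have iint: "integrable (poisson_configuration c \<nu>) (\<lambda>(n, x). LINT y|\<nu>. F y n x)"
    using im innerB sp by (intro PC.integrable_const_bound[where B=B]) (auto simp: case_prod_unfold intro!: AE_I2)
  have "(\<integral>\<^sup>+p. ennreal ((\<lambda>(n, x). (\<Sum>k<n. F (x k) (n - 1) (x \<circ> skip_index k))) p) \<partial>poisson_configuration c \<nu>) =
     (\<integral>\<^sup>+(n, x). (\<Sum>k<n. ennreal (F (x k) (n - 1) (x \<circ> skip_index k))) \<partial>poisson_configuration c \<nu>)"
  proof (rule nn_integral_cong, clarsimp)
    fix n x assume "(n, x) \<in> space (poisson_configuration c \<nu>)"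
    then have x: "x \<in> space S" using sp by force
    have "F (x k) (n - 1) (x \<circ> skip_index k) \<ge> 0" for k using x by (intro B[THEN conjunct1]) (auto simp: space_PiM)
    then show "ennreal (\<Sum>k<n. F (x k) (n - Suc 0) (x \<circ> skip_index k)) = (\<Sum>k<n. ennreal (F (x k) (n - Suc 0) (x \<circ> skip_index k)))"
      by (simp add: sum_ennreal)
  qed
  also have "\<dots> = ennreal c * (\<integral>\<^sup>+(n, x). (\<integral>\<^sup>+y. ennreal (F y n x) \<partial>\<nu>) \<partial>poisson_configuration c \<nu>)"
    by (rule Mecke_nn[OF Fe])
  also have "(\<integral>\<^sup>+(n, x). (\<integral>\<^sup>+y. ennreal (F y n x) \<partial>\<nu>) \<partial>poisson_configuration c \<nu>) =
      (\<integral>\<^sup>+p. ennreal ((\<lambda>(n, x). LINT y|\<nu>. F y n x) p) \<partial>poisson_configuration c \<nu>)"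
    using inner sp by (intro nn_integral_cong) (auto simp: case_prod_unfold)
  also have "\<dots> = ennreal (LINT (n, x)|poisson_configuration c \<nu>. LINT y|\<nu>. F y n x)"
    using iint innerB sp by (intro nn_integral_eq_integral) (auto simp: case_prod_unfold intro!: AE_I2)
  also have "ennreal c * \<dots> = ennreal (c * (LINT (n, x)|poisson_configuration c \<nu>. LINT y|\<nu>. F y n x))"
    using c by (simp add: ennreal_mult')
  finally have eq: "(\<integral>\<^sup>+p. ennreal ((\<lambda>(n, x). (\<Sum>k<n. F (x k) (n - 1) (x \<circ> skip_index k))) p) \<partial>poisson_configuration c \<nu>) =
    ennreal (c * (LINT (n, x)|poisson_configuration c \<nu>. LINT y|\<nu>. F y n x))" .
  have nonneg: "0 \<le> (\<lambda>(n, x). (\<Sum>k<n. F (x k) (n - 1) (x \<circ> skip_index k))) p" if "p \<in> space (poisson_configuration c \<nu>)" for p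
  proof -
    have "snd p \<in> space S" using sp that by blast
    then have "F (snd p k) m (snd p \<circ> skip_index k) \<ge> 0" for k m by (intro B[THEN conjunct1]) (auto simp: space_PiM)
    then show ?thesis by (auto simp: case_prod_unfold intro!: sum_nonneg)
  qed
  have "0 \<le> (LINT (n, x)|poisson_configuration c \<nu>. LINT y|\<nu>. F y n x)"
    using innerB sp by (intro Bochner_Integration.integral_nonneg_AE) (auto simp: case_prod_unfold intro!: AE_I2)
  then show ?thesis
    using c nonneg by (intro has_bochner_integral_nn_integral[OF measurable_skip_sum[OF F] _ _ eq]) auto
qed

text \<open>Adding the constant \<open>B\<close> makes the function nonnegative; the share of the constant is finite and can be subtracted.\<close>
theorem Mecke:
  assumes F: "\<And>n. (\<lambda>(y, x). F y n x) \<in> borel_measurable (\<nu> \<Otimes>\<^sub>M S)"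
    and B: "\<And>y n x. y \<in> space \<nu> \<Longrightarrow> x \<in> space S \<Longrightarrow> \<bar>F y n x\<bar> \<le> B"
  shows "has_bochner_integral (poisson_configuration c \<nu>) (\<lambda>(n, x). (\<Sum>k<n. F (x k) (n - 1) (x \<circ> skip_index k)))
      (c * (LINT (n, x)|poisson_configuration c \<nu>. LINT y|\<nu>. F y n x))"
proof -
  interpret PC: prob_space "poisson_configuration c \<nu>" by (rule prob_space_poisson_configuration)
  have sp: "p \<in> space (poisson_configuration c \<nu>) \<Longrightarrow> snd p \<in> space S" for p
    by (auto simp: poisson_configuration_def space_pair_measure)
  have B0: "0 \<le> B"
  proof -
    obtain y where "y \<in> space \<nu>" using nu.not_empty by blast
    moreover obtain x where "x \<in> space S" using P.not_empty by blast
    ultimately show ?thesis using B[of y x 0] by force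
  qed
  have Fx: "(\<lambda>y. F y n x) \<in> borel_measurable \<nu>" if "x \<in> space S" for n x
    using measurable_compose[OF measurable_Pair2'[OF that] F[of n]] by simp
  have int: "integrable \<nu> (\<lambda>y. F y n x)" if "x \<in> space S" for n x
    using Fx[OF that] B that by (intro nu.integrable_const_bound[where B=B]) auto
  have innerB: "\<bar>LINT y|\<nu>. F y n x\<bar> \<le> B" if "x \<in> space S" for n x
  proof -
    have "\<bar>LINT y|\<nu>. F y n x\<bar> \<le> (LINT y|\<nu>. \<bar>F y n x\<bar>)" by (rule integral_abs_bound)
    also have "\<dots> \<le> (LINT y|\<nu>. B)"
      using B that int by (intro integral_mono) auto
    finally show ?thesis by (simp add: nu.prob_space)
  qed
  have im: "(\<lambda>(n, x). LINT y|\<nu>. F y n x) \<in> borel_measurable (poisson_configuration c \<nu>)"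
  proof (rule measurable_poisson_configuration)
    fix n
    have "(\<lambda>(x, y). F y n x) \<in> borel_measurable (S \<Otimes>\<^sub>M \<nu>)" using measurable_pair_swap[OF F[of n]] by simp
    then show "(\<lambda>x. LINT y|\<nu>. F y n x) \<in> borel_measurable S" by (rule nu.borel_measurable_lebesgue_integral)
  qed
  have iint: "integrable (poisson_configuration c \<nu>) (\<lambda>(n, x). LINT y|\<nu>. F y n x)"
    using im innerB sp by (intro PC.integrable_const_bound[where B=B]) (auto simp: case_prod_unfold intro!: AE_I2)
  have 1: "has_bochner_integral (poisson_configuration c \<nu>) (\<lambda>(n, x). (\<Sum>k<n. F (x k) (n - 1) (x \<circ> skip_index k) + B))
      (c * (LINT (n, x)|poisson_configuration c \<nu>. LINT y|\<nu>. F y n x + B))"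
  proof (rule Mecke_nonneg[where B="2 * B"])
    show "(\<lambda>(y, x). F y n x + B) \<in> borel_measurable (\<nu> \<Otimes>\<^sub>M S)" for n
      using borel_measurable_add[OF F[of n] borel_measurable_const[of B]] by (simp add: case_prod_unfold)
    show "0 \<le> F y n x + B \<and> F y n x + B \<le> 2 * B" if "y \<in> space \<nu>" "x \<in> space S" for y n x
      using B[OF that, of n] by linarith
  qed
  have 2: "has_bochner_integral (poisson_configuration c \<nu>) (\<lambda>(n, x). (\<Sum>k<n. B))
      (c * (LINT (n, x)|poisson_configuration c \<nu>. LINT y|\<nu>. B))"
    using B0 by (intro Mecke_nonneg[where B=B and F="\<lambda>_ _ _. B"]) auto
  have e: "(LINT (n, x)|poisson_configuration c \<nu>. LINT y|\<nu>. F y n x + B) =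
     (LINT (n, x)|poisson_configuration c \<nu>. LINT y|\<nu>. F y n x) + (LINT (n, x)|poisson_configuration c \<nu>. LINT y|\<nu>. B)"
  proof -
    have "(LINT (n, x)|poisson_configuration c \<nu>. LINT y|\<nu>. F y n x + B) =
      (LINT p|poisson_configuration c \<nu>. (\<lambda>(n, x). LINT y|\<nu>. F y n x) p + B)"
      using int sp by (intro Bochner_Integration.integral_cong refl) (auto simp: case_prod_unfold nu.prob_space)
    also have "\<dots> = (LINT (n, x)|poisson_configuration c \<nu>. LINT y|\<nu>. F y n x) + B"
      using iint by (subst Bochner_Integration.integral_add) (auto simp: PC.prob_space)
    finally show ?thesis by (simp add: nu.prob_space PC.prob_space case_prod_unfold)
  qed
  have "has_bochner_integral (poisson_configuration c \<nu>)
     (\<lambda>p. (\<lambda>(n, x). (\<Sum>k<n. F (x k) (n - 1) (x \<circ> skip_index k) + B)) p - (\<lambda>(n, x). (\<Sum>k<n. B)) p)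
     (c * (LINT (n, x)|poisson_configuration c \<nu>. LINT y|\<nu>. F y n x + B) - c * (LINT (n, x)|poisson_configuration c \<nu>. LINT y|\<nu>. B))"
    using 1 2 by (rule has_bochner_integral_diff)
  also have "c * (LINT (n, x)|poisson_configuration c \<nu>. LINT y|\<nu>. F y n x + B) - c * (LINT (n, x)|poisson_configuration c \<nu>. LINT y|\<nu>. B) =
     c * (LINT (n, x)|poisson_configuration c \<nu>. LINT y|\<nu>. F y n x)"
    unfolding e by (simp add: algebra_simps)
  finally show ?thesis by (simp add: case_prod_unfold sum.distrib comp_def)
qed

text \<open>By independence and Fubini, because a diffuse variable almost surely avoids each given value.\<close>
lemma AE_poisson_configuration_distinct:
  assumes f[measurable]: "f \<in> borel_measurable \<nu>" and diffuse: "\<And>a :: real. AE y in \<nu>. f y \<noteq> a"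
  shows "AE (n, x) in poisson_configuration c \<nu>. inj_on (\<lambda>i. f (x i)) {..<n}"
proof -
  interpret nuS: pair_sigma_finite \<nu> S by unfold_locales
  have two: "AE x in S. f (x k) \<noteq> f ((x \<circ> skip_index k) i)" for k i
  proof -
    let ?F = "\<lambda>(y, x). indicator {0} (f y - f (x i)) :: ennreal"
    have Fm: "?F \<in> borel_measurable (\<nu> \<Otimes>\<^sub>M S)" by measurable
    have inner: "(\<integral>\<^sup>+y. ?F (y, x) \<partial>\<nu>) = 0" for x
    proof -
      have "(\<integral>\<^sup>+y. ?F (y, x) \<partial>\<nu>) = (\<integral>\<^sup>+y. 0 \<partial>\<nu>)"
        using diffuse[of "f (x i)"] by (intro nn_integral_cong_AE) (auto elim!: eventually_mono split: split_indicator)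
      then show ?thesis by simp
    qed
    have "(\<integral>\<^sup>+x. ?F (x k, x \<circ> skip_index k) \<partial>S) = (\<integral>\<^sup>+x. 0 \<partial>S)"
      by (subst nn_integral_split_point[OF nu Fm]) (intro nn_integral_cong inner)
    moreover have [measurable]: "(\<lambda>x. x \<circ> skip_index k) \<in> S \<rightarrow>\<^sub>M S" unfolding comp_def by (rule measurable_reindex)
    have "(\<lambda>x. ?F (x k, x \<circ> skip_index k)) \<in> borel_measurable S"
      unfolding case_prod_conv by measurable
    ultimately have "AE x in S. ?F (x k, x \<circ> skip_index k) = 0" by (simp add: nn_integral_0_iff_AE)
    then show ?thesis by eventually_elim (auto split: split_indicator_asm)
  qed
  then have "AE x in S. \<forall>k i. f (x k) \<noteq> f ((x \<circ> skip_index k) i)" by (simp add: AE_all_countable)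
  then have AEx: "AE x in S. inj (\<lambda>i. f (x i))"
  proof eventually_elim
    case (elim x)
    have "f (x i) \<noteq> f (x j)" if "i < j" for i j
      using elim[rule_format, of j i] that by (auto simp: skip_index_def)
    then show ?case by (metis injI linorder_neqE_nat)
  qed
  have "AE p in measure_pmf (poisson_pmf c) \<Otimes>\<^sub>M S. inj (\<lambda>i. f (snd p i))"
  proof (rule pmf_S.AE_pair_measure)
    have fm: "(\<lambda>x. f (x i)) \<in> borel_measurable S" for i
      by (rule measurable_compose[of "\<lambda>x. x i" S \<nu> f borel]) (simp_all add: f)
    have "Measurable.pred S (\<lambda>x. \<forall>i j. i \<noteq> j \<longrightarrow> f (x i) \<noteq> f (x j))"
      by (intro pred_intros_countable pred_intros_imp') (unfold pred_def, rule borel_measurable_neq[OF fm fm])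
    then have "Measurable.pred (poisson_configuration c \<nu>) (\<lambda>(n, x). \<forall>i j. i \<noteq> j \<longrightarrow> f (x i) \<noteq> f (x j))"
      by (rule measurable_poisson_configuration)
    then show "{p \<in> space (measure_pmf (poisson_pmf c) \<Otimes>\<^sub>M S). inj (\<lambda>i. f (snd p i))} \<in> sets (measure_pmf (poisson_pmf c) \<Otimes>\<^sub>M S)"
    proof -
      assume p: "Measurable.pred (poisson_configuration c \<nu>) (\<lambda>(n, x). \<forall>i j. i \<noteq> j \<longrightarrow> f (x i) \<noteq> f (x j))"
      have e: "inj (\<lambda>i. f (snd p i)) \<longleftrightarrow> (\<lambda>(n, x). \<forall>i j. i \<noteq> j \<longrightarrow> f (x i) \<noteq> f (x j)) p" for p :: "nat \<times> (nat \<Rightarrow> 'p)"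
        unfolding case_prod_unfold by (rule inj_iff_distinct)
      show ?thesis unfolding e using p by (simp only: pred_def poisson_configuration_def)
    qed
  qed (use AEx in auto)
  then show ?thesis unfolding poisson_configuration_def
    by eventually_elim (auto intro: inj_on_subset)
qed

end

section \<open>Paths built from marked points\<close>

lemma const_path: "(\<lambda>t\<in>{a..b}. i) \<in> path_space a b"
proof -
  have "limitin (discrete_topology UNIV) (\<lambda>t\<in>{a..b}. i) i (at_right t)" if "t \<in> {a..<b}" for t
  proof (rule limitin_eventually)
    show "\<forall>\<^sub>F s in at_right t. (\<lambda>t\<in>{a..b}. i) s = i"
      unfolding eventually_at_right_field using that by (intro exI[of _ b]) auto
  qed simp
  moreover have "\<exists>l. limitin (discrete_topology UNIV) (\<lambda>t\<in>{a..b}. i) l (at_left t)" if "t \<in> {a<..b}" for t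
  proof (rule exI, rule limitin_eventually)
    show "\<forall>\<^sub>F s in at_left t. (\<lambda>t\<in>{a..b}. i) s = i"
      unfolding eventually_at_left_field using that by (intro exI[of _ a]) auto
  qed simp
  ultimately show ?thesis by (auto simp: path_space_def cadlag_on_def)
qed

lemma splice_path:
  assumes w: "\<omega> \<in> path_space a b" and r: "a < r" "r \<le> b"
  shows "(\<lambda>t\<in>{a..b}. if t < r then \<omega> t else j) \<in> path_space a b" (is "?w \<in> _")
proof -
  have "limitin (discrete_topology UNIV) ?w (?w t) (at_right t)" if t: "t \<in> {a..<b}" for t
  proof (rule limitin_eventually)
    show "\<forall>\<^sub>F s in at_right t. ?w s = ?w t"
    proof (cases "t < r")
      case True
      have "a \<le> t" "t < b" using t by auto
      then obtain u where u: "u > t" "\<forall>s. t \<le> s \<longrightarrow> s < u \<longrightarrow> \<omega> s = \<omega> t"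
        using path_space_right[OF w] by blast
      show ?thesis unfolding eventually_at_right_field
      proof (intro exI[of _ "min u (min r b)"] conjI allI impI)
        fix s assume "t < s" "s < min u (min r b)"
        then show "?w s = ?w t" using u(2)[rule_format, of s] t True by auto
      qed (use u(1) t True in auto)
    next
      case False
      then show ?thesis unfolding eventually_at_right_field using t by (intro exI[of _ b]) auto
    qed
  qed simp
  moreover have "\<exists>l. limitin (discrete_topology UNIV) ?w l (at_left t)" if t: "t \<in> {a<..b}" for t
  proof (cases "t \<le> r")
    case True
    have "a < t" "t \<le> b" using t by auto
    then obtain u l where u: "u < t" "\<forall>s. u < s \<longrightarrow> s < t \<longrightarrow> \<omega> s = l"
      using path_space_left[OF w] by blast
    have "\<forall>\<^sub>F s in at_left t. ?w s = l" unfolding eventually_at_left_field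
    proof (intro exI[of _ "max u a"] conjI allI impI)
      fix s assume "max u a < s" "s < t"
      then show "?w s = l" using u(2)[rule_format, of s] t True by auto
    qed (use u(1) t True in auto)
    then have "limitin (discrete_topology UNIV) ?w l (at_left t)" by (rule limitin_eventually[rotated]) simp
    then show ?thesis by blast
  next
    case False
    then have "\<forall>\<^sub>F s in at_left t. ?w s = j" unfolding eventually_at_left_field using t
      by (intro exI[of _ "max r a"]) auto
    then have "limitin (discrete_topology UNIV) ?w j (at_left t)" by (rule limitin_eventually[rotated]) simp
    then show ?thesis by blast
  qed
  ultimately show ?thesis by (auto simp: path_space_def cadlag_on_def)
qed

lemma integral_split:
  fixes f :: "real \<Rightarrow> real"
  assumes f: "set_integrable lborel {s..t} f" and r: "s \<le> r" "r \<le> t"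
  shows "(LINT x:{s..t}|lborel. f x) = (LINT x:{s..r}|lborel. f x) + (LINT x:{r..t}|lborel. f x)"
proof -
  have 1: "set_integrable lborel {s..r} f" "set_integrable lborel {r..t} f"
    using r by (auto intro!: set_integrable_subset[OF f])
  have "(LINT x:{s..r} \<union> {r..t}|lborel. f x) = (LINT x:{s..r}|lborel. f x) + (LINT x:{r..t}|lborel. f x)"
  proof (rule set_integral_Un_AE)
    show "AE x in lborel. \<not> (x \<in> {s..r} \<and> x \<in> {r..t})"
      using AE_lborel_singleton[of r] by eventually_elim auto
  qed (use 1 in auto)
  moreover have "{s..r} \<union> {r..t} = {s..t}" using r by auto
  ultimately show ?thesis by simp
qed

text \<open>Used with paths that differ by a jump at \<open>t\<close> and hence agree only before \<open>t\<close>.\<close>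
lemma integral_cong_halfopen:
  fixes f g :: "real \<Rightarrow> real"
  assumes "\<And>x. s \<le> x \<Longrightarrow> x < t \<Longrightarrow> f x = g x" "set_integrable lborel {s..t} f" "set_integrable lborel {s..t} g"
  shows "(LINT x:{s..t}|lborel. f x) = (LINT x:{s..t}|lborel. g x)"
  using assms AE_lborel_singleton[of t] unfolding set_lebesgue_integral_def set_integrable_def
  by (intro integral_cong_AE borel_measurable_integrable) (auto split: split_indicator elim!: eventually_mono)

text \<open>The order is a list of indices rather than of points, so that it takes countably many values and its measurability is a matter of
  countable case distinction.\<close>
definition time_order :: "nat \<Rightarrow> (nat \<Rightarrow> real \<times> 'b) \<Rightarrow> nat list" where
  "time_order n x = sort_key (\<lambda>i. fst (x i)) [0..<n]"

lemma time_order_perm: "set (time_order n x) = {..<n}" "distinct (time_order n x)" "length (time_order n x) = n"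
  by (auto simp: time_order_def)

lemma time_order_sorted:
  assumes "inj_on (\<lambda>i. fst (x i)) {..<n}"
  shows "sorted_wrt (\<lambda>p p'. fst p < fst p') (map x (time_order n x))"
proof -
  have "sorted (map (\<lambda>i. fst (x i)) (time_order n x))" by (simp add: time_order_def)
  moreover have "distinct (map (\<lambda>i. fst (x i)) (time_order n x))"
    using assms time_order_perm[of n x] by (simp add: distinct_map)
  ultimately have "sorted_wrt (<) (map (\<lambda>i. fst (x i)) (time_order n x))"
    by (simp add: strict_sorted_iff)
  then show ?thesis by (simp add: sorted_wrt_map)
qed

lemma time_sorted_unique:
  fixes xs ys :: "(real \<times> 'b) list"
  assumes "sorted_wrt (\<lambda>p p'. fst p < fst p') xs" "sorted_wrt (\<lambda>p p'. fst p < fst p') ys" "set xs = set ys"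
  shows "xs = ys"
  using assms
proof (induction xs arbitrary: ys)
  case (Cons a xs)
  then obtain b ys' where ys: "ys = b # ys'" by (cases ys) auto
  have ab: "a = b"
  proof (rule ccontr)
    assume "a \<noteq> b"
    then have "a \<in> set ys'" "b \<in> set xs" using Cons.prems(3) ys by auto
    then have "fst b < fst a" "fst a < fst b" using Cons.prems(1,2) ys by auto
    then show False by simp
  qed
  moreover have "a \<notin> set xs" "a \<notin> set ys'" using Cons.prems(1,2) ys ab by auto
  then have "set xs = set ys'" using Cons.prems(3) ys ab by auto
  ultimately show ?case using Cons ys by auto
qed simp

lemma measurable_insort_index:
  assumes [measurable]: "\<And>i. (\<lambda>x. f x i) \<in> borel_measurable M"
  shows "(\<lambda>x. insort_key (f x :: nat \<Rightarrow> real) a l) \<in> M \<rightarrow>\<^sub>M count_space UNIV"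
proof (induction l)
  case (Cons b l)
  have "(\<lambda>x. b # insort_key (f x) a l) \<in> M \<rightarrow>\<^sub>M count_space UNIV"
    by (rule measurable_compose[OF Cons]) simp
  then show ?case by (simp del: insort_key.simps add: insort_key.simps)
qed simp

lemma measurable_time_order:
  assumes f: "\<And>i. (\<lambda>x. fst (x i)) \<in> borel_measurable M"
  shows "time_order n \<in> M \<rightarrow>\<^sub>M count_space UNIV"
proof -
  have "(\<lambda>x. foldr (insort_key (\<lambda>i. fst (x i))) l []) \<in> M \<rightarrow>\<^sub>M count_space UNIV" for l
  proof (induction l)
    case (Cons a l)
    have "(\<lambda>x. insort_key (\<lambda>i. fst (x i)) a (foldr (insort_key (\<lambda>i. fst (x i))) l [])) \<in> M \<rightarrow>\<^sub>M count_space UNIV"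
      by (rule measurable_compose_countable[OF measurable_insort_index[OF f] Cons])
    then show ?case by simp
  qed simp
  then show ?thesis unfolding time_order_def[abs_def] sort_key_def .
qed

lemma measurable_compose_finite:
  assumes "\<And>i. f i \<in> M \<rightarrow>\<^sub>M N" "g \<in> M \<rightarrow>\<^sub>M count_space (UNIV :: 's::finite set)"
  shows "(\<lambda>x. f (g x) x) \<in> M \<rightarrow>\<^sub>M N"
  by (rule measurable_compose_countable'[where I=UNIV, OF _ assms(2)]) (simp_all add: assms(1) countable_finite)

section \<open>Chains with path-dependent rates\<close>

text \<open>The rate \<open>q s \<omega> i j\<close> of a jump from \<open>i\<close> to \<open>j\<close> may depend on the past of the path. The state \<open>i\<close> is a separate argument,
  so that the rate is also defined for states other than \<open>\<omega> s\<close>.\<close>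
locale rate_control =
  fixes T t0 C :: real and i0 :: "'s::finite" and q :: "real \<Rightarrow> (real \<Rightarrow> 's) \<Rightarrow> 's \<Rightarrow> 's \<Rightarrow> real"
  assumes t0T: "t0 \<le> T" and C: "C > 0"
    and progressive: "\<And>t i j. t \<in> {t0..T} \<Longrightarrow>
      (\<lambda>(s, \<omega>). q s \<omega> i j) \<in> restrict_space borel {t0..t} \<Otimes>\<^sub>M path_filtration T t0 t \<rightarrow>\<^sub>M borel"
    and rate_nonneg: "\<And>s \<omega> i j. s \<in> {t0..T} \<Longrightarrow> \<omega> \<in> path_space t0 T \<Longrightarrow> i \<noteq> j \<Longrightarrow> 0 \<le> q s \<omega> i j"
    and rate_sum: "\<And>s \<omega> i. s \<in> {t0..T} \<Longrightarrow> \<omega> \<in> path_space t0 T \<Longrightarrow> (\<Sum>j\<in>UNIV. q s \<omega> i j) = 0"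
    and rate_bound: "\<And>s \<omega> i j. s \<in> {t0..T} \<Longrightarrow> \<omega> \<in> path_space t0 T \<Longrightarrow> \<bar>q s \<omega> i j\<bar> \<le> C"
begin

text \<open>The thinning rule for a point (time, target, mark). The rate is read along the path without the point, which at
  the time of the point still has its value before the jump.\<close>
definition accepts :: "real \<times> 's \<times> real \<Rightarrow> (real \<Rightarrow> 's) \<Rightarrow> bool" where
  "accepts p \<omega> \<longleftrightarrow> t0 < fst p \<and> fst p \<le> T \<and> fst (snd p) \<noteq> \<omega> (fst p) \<and>
     snd (snd p) * C \<le> q (fst p) \<omega> (\<omega> (fst p)) (fst (snd p))"

definition jump_step :: "real \<times> 's \<times> real \<Rightarrow> (real \<Rightarrow> 's) \<Rightarrow> real \<Rightarrow> 's" where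
  "jump_step p \<omega> = (if accepts p \<omega> then (\<lambda>t\<in>{t0..T}. if t < fst p then \<omega> t else fst (snd p)) else \<omega>)"

definition build_path :: "(real \<times> 's \<times> real) list \<Rightarrow> real \<Rightarrow> 's" where
  "build_path L = fold jump_step L (\<lambda>t\<in>{t0..T}. i0)"

definition config_path :: "nat \<Rightarrow> (nat \<Rightarrow> real \<times> 's \<times> real) \<Rightarrow> real \<Rightarrow> 's" where
  "config_path n x = build_path (map x (time_order n x))"

lemma jump_step_path: "\<omega> \<in> path_space t0 T \<Longrightarrow> jump_step p \<omega> \<in> path_space t0 T"
  by (auto simp: jump_step_def accepts_def intro!: splice_path)

lemma fold_path: "\<omega> \<in> path_space t0 T \<Longrightarrow> fold jump_step L \<omega> \<in> path_space t0 T"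
  by (induction L arbitrary: \<omega>) (auto intro: jump_step_path)

lemma build_path_mem: "build_path L \<in> path_space t0 T"
  unfolding build_path_def by (intro fold_path const_path)

lemma config_path_mem: "config_path n x \<in> path_space t0 T"
  unfolding config_path_def by (rule build_path_mem)

lemma jump_step_before: "s \<in> {t0..T} \<Longrightarrow> s < fst p \<or> s = t0 \<Longrightarrow> jump_step p \<omega> s = \<omega> s"
  by (auto simp: jump_step_def accepts_def)

lemma fold_before:
  "s \<in> {t0..T} \<Longrightarrow> (\<And>p. p \<in> set L \<Longrightarrow> s < fst p \<or> s = t0) \<Longrightarrow> fold jump_step L \<omega> s = \<omega> s"
  by (induction L arbitrary: \<omega>) (auto simp: jump_step_before)

lemma build_path_before:
  "s \<in> {t0..T} \<Longrightarrow> (\<And>p. p \<in> set B \<Longrightarrow> s < fst p) \<Longrightarrow> build_path (A @ B) s = build_path A s"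
  unfolding build_path_def by (simp add: fold_before)

lemma build_path_start: "build_path L t0 = i0"
  unfolding build_path_def using t0T by (subst fold_before) auto

lemma build_path_snoc: "build_path (L @ [p]) = jump_step p (build_path L)"
  by (simp add: build_path_def)

lemma rate_determined:
  assumes "t \<in> {t0..T}" "\<omega> \<in> path_space t0 T" "\<omega>' \<in> path_space t0 T" "\<And>s. s \<in> {t0..t} \<Longrightarrow> \<omega> s = \<omega>' s"
  shows "q t \<omega> i j = q t \<omega>' i j"
  using progressive_determined[OF t0T progressive[OF assms(1)] assms] .

text \<open>Extends functions of time from \<open>[t0, T]\<close> to the real line, on which points of time are random variables.\<close>
definition clamp_time :: "real \<Rightarrow> real" where
  "clamp_time r = max t0 (min T r)"

lemma clamp_time: "clamp_time r \<in> {t0..T}" "r \<in> {t0..T} \<Longrightarrow> clamp_time r = r"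
  using t0T by (auto simp: clamp_time_def)

lemma measurable_clamp: "clamp_time \<in> borel \<rightarrow>\<^sub>M restrict_space borel {t0..T}"
  using clamp_time(1) by (intro measurable_restrict_space2) (auto simp: clamp_time_def[abs_def])

lemma measurable_clamp_pair:
  "(\<lambda>(r, \<omega>). (clamp_time r, \<omega>)) \<in> borel \<Otimes>\<^sub>M path_borel t0 T \<rightarrow>\<^sub>M
     restrict_space borel {t0..T} \<Otimes>\<^sub>M (path_filtration T t0 T :: (real \<Rightarrow> 's) measure)"
proof -
  have "snd \<in> borel \<Otimes>\<^sub>M path_borel t0 T \<rightarrow>\<^sub>M (path_filtration T t0 T :: (real \<Rightarrow> 's) measure)"
    using measurable_snd measurable_cong_sets[OF refl path_filtration_T[OF t0T]] by blast
  then show ?thesis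
    unfolding case_prod_unfold by (intro measurable_Pair measurable_compose[OF measurable_fst measurable_clamp])
qed

lemma measurable_rate: "(\<lambda>(r, \<omega>). q (clamp_time r) \<omega> i j) \<in> borel_measurable (borel \<Otimes>\<^sub>M path_borel t0 T)"
  using measurable_compose[OF measurable_clamp_pair progressive[of T i j]] t0T by (simp add: case_prod_unfold)

lemma measurable_state:
  "(\<lambda>(r, \<omega>). \<omega> (clamp_time r)) \<in> borel \<Otimes>\<^sub>M path_borel t0 T \<rightarrow>\<^sub>M count_space (UNIV :: 's set)"
  using measurable_compose[OF measurable_clamp_pair joint_evaluation[OF t0T, of T]] t0T by (simp add: case_prod_unfold)

abbreviation point_space :: "(real \<times> 's \<times> real) measure" where
  "point_space \<equiv> borel \<Otimes>\<^sub>M (count_space UNIV \<Otimes>\<^sub>M borel)"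

lemma measurable_time_path: "(\<lambda>(p, \<omega>). (fst p, \<omega>)) \<in> point_space \<Otimes>\<^sub>M path_borel t0 T \<rightarrow>\<^sub>M borel \<Otimes>\<^sub>M path_borel t0 T"
  by measurable

lemma measurable_point_state:
  "(\<lambda>(p, \<omega>). \<omega> (clamp_time (fst p))) \<in> point_space \<Otimes>\<^sub>M path_borel t0 T \<rightarrow>\<^sub>M count_space (UNIV :: 's set)"
  using measurable_compose[OF measurable_time_path measurable_state] by (simp add: case_prod_unfold)

lemma measurable_mark: "(\<lambda>(p, \<omega>). fst (snd p)) \<in> point_space \<Otimes>\<^sub>M path_borel t0 T \<rightarrow>\<^sub>M count_space (UNIV :: 's set)"
  by measurable

lemma measurable_point_rate:
  "(\<lambda>(p, \<omega>). q (clamp_time (fst p)) \<omega> (\<omega> (clamp_time (fst p))) (fst (snd p))) \<in>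
     borel_measurable (point_space \<Otimes>\<^sub>M path_borel t0 T)"
proof -
  let ?M = "point_space \<Otimes>\<^sub>M (path_borel t0 T :: (real \<Rightarrow> 's) measure)"
  have "(\<lambda>x. q (clamp_time (fst (fst x))) (snd x) i j) \<in> borel_measurable ?M" for i j
    using measurable_compose[OF measurable_time_path measurable_rate[of i j]] by (simp add: case_prod_unfold)
  then have "(\<lambda>x. q (clamp_time (fst (fst x))) (snd x) i (fst (snd (fst x)))) \<in> borel_measurable ?M" for i
    using measurable_mark[unfolded case_prod_unfold] by (rule measurable_compose_finite)
  then have "(\<lambda>x. q (clamp_time (fst (fst x))) (snd x) (snd x (clamp_time (fst (fst x)))) (fst (snd (fst x)))) \<in> borel_measurable ?M"
    using measurable_point_state[unfolded case_prod_unfold] by (rule measurable_compose_finite)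
  then show ?thesis by (simp add: case_prod_unfold)
qed

lemma accepts_clamp:
  "accepts p \<omega> \<longleftrightarrow> t0 < fst p \<and> fst p \<le> T \<and> fst (snd p) \<noteq> \<omega> (clamp_time (fst p)) \<and>
     snd (snd p) * C \<le> q (clamp_time (fst p)) \<omega> (\<omega> (clamp_time (fst p))) (fst (snd p))"
proof (cases "t0 < fst p \<and> fst p \<le> T")
  case True
  then have "clamp_time (fst p) = fst p" by (intro clamp_time) auto
  then show ?thesis by (simp add: accepts_def)
qed (auto simp: accepts_def)

lemma measurable_neq_finite:
  assumes "f \<in> M \<rightarrow>\<^sub>M count_space (UNIV :: 's set)" "g \<in> M \<rightarrow>\<^sub>M count_space UNIV"
  shows "Measurable.pred M (\<lambda>x. f x \<noteq> g x)"
proof -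
  have "(\<lambda>x. i \<noteq> g x) \<in> M \<rightarrow>\<^sub>M count_space UNIV" for i
    by (rule measurable_compose[OF assms(2)]) simp
  then have "(\<lambda>x. f x \<noteq> g x) \<in> M \<rightarrow>\<^sub>M count_space UNIV"
    using assms(1) by (rule measurable_compose_finite)
  then show ?thesis .
qed

lemma measurable_accepts: "Measurable.pred (point_space \<Otimes>\<^sub>M path_borel t0 T) (\<lambda>(p, \<omega>). accepts p \<omega>)"
proof -
  let ?M = "point_space \<Otimes>\<^sub>M (path_borel t0 T :: (real \<Rightarrow> 's) measure)"
  have [measurable]: "(\<lambda>x. q (clamp_time (fst (fst x))) (snd x) (snd x (clamp_time (fst (fst x)))) (fst (snd (fst x)))) \<in> borel_measurable ?M"
    using measurable_point_rate by (simp add: case_prod_unfold)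
  have [measurable]: "Measurable.pred ?M (\<lambda>x. fst (snd (fst x)) \<noteq> snd x (clamp_time (fst (fst x))))"
    using measurable_point_state measurable_mark by (intro measurable_neq_finite) (auto simp: case_prod_unfold)
  show ?thesis unfolding accepts_clamp case_prod_unfold by measurable
qed

lemma measurable_jump_step:
  "(\<lambda>(p, \<omega>). jump_step p \<omega>) \<in> point_space \<Otimes>\<^sub>M path_borel t0 T \<rightarrow>\<^sub>M path_borel t0 T"
proof (rule measurable_path_space[OF t0T])
  let ?M = "point_space \<Otimes>\<^sub>M (path_borel t0 T :: (real \<Rightarrow> 's) measure)"
  show "(\<lambda>(p, \<omega>). jump_step p \<omega>) \<in> space ?M \<rightarrow> path_space t0 T"
    by (auto simp: space_pair_measure intro: jump_step_path)
  fix t i assume t: "t \<in> {t0..T}"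
  note [measurable] = measurable_accepts[unfolded case_prod_unfold]
  have ev: "(\<lambda>x. snd x t) \<in> ?M \<rightarrow>\<^sub>M count_space UNIV"
    unfolding measurable_count_space_eq2[OF finite_class.finite_UNIV]
  proof (intro conjI ballI)
    fix i :: 's
    have "snd -` {\<omega> \<in> path_space t0 T. \<omega> t = i} \<inter> space ?M \<in> sets ?M"
      by (intro measurable_sets[OF measurable_snd] evaluation_sets_borel[OF t0T t])
    also have "snd -` {\<omega> \<in> path_space t0 T. \<omega> t = i} \<inter> space ?M = (\<lambda>x. snd x t) -` {i} \<inter> space ?M"
      by (auto simp: space_pair_measure)
    finally show "(\<lambda>x. snd x t) -` {i} \<inter> space ?M \<in> sets ?M" .
  qed auto
  have [measurable]: "Measurable.pred ?M (\<lambda>x. snd x t = i)"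
    by (rule measurable_compose[OF ev]) simp
  have [measurable]: "Measurable.pred ?M (\<lambda>x. fst (snd (fst x)) = i)"
    by (rule measurable_compose[OF measurable_mark[unfolded case_prod_unfold]]) simp
  have "{x \<in> space ?M. (case x of (p, \<omega>) \<Rightarrow> jump_step p \<omega>) t = i} =
    {x \<in> space ?M. if accepts (fst x) (snd x) \<and> fst (fst x) \<le> t then fst (snd (fst x)) = i else snd x t = i}"
    using t by (auto simp: jump_step_def case_prod_unfold)
  also have "\<dots> \<in> sets ?M" by measurable
  finally show "{x \<in> space ?M. (case x of (p, \<omega>) \<Rightarrow> jump_step p \<omega>) t = i} \<in> sets ?M" .
qed

lemma measurable_config_path:
  assumes nu: "sets \<nu> = sets point_space"
  shows "config_path n \<in> PiM UNIV (\<lambda>_. \<nu>) \<rightarrow>\<^sub>M path_borel t0 T"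
proof -
  let ?S = "PiM UNIV (\<lambda>_::nat. \<nu>)"
  have comp: "(\<lambda>x. x i) \<in> ?S \<rightarrow>\<^sub>M point_space" for i
    by (subst measurable_cong_sets[OF refl nu[symmetric]]) (rule measurable_component_singleton, simp)
  have fold: "(\<lambda>x. fold jump_step (map x l) (g x)) \<in> ?S \<rightarrow>\<^sub>M path_borel t0 T" if "g \<in> ?S \<rightarrow>\<^sub>M path_borel t0 T" for l g
    using that
  proof (induction l arbitrary: g)
    case (Cons a l)
    have "(\<lambda>x. (x a, g x)) \<in> ?S \<rightarrow>\<^sub>M point_space \<Otimes>\<^sub>M path_borel t0 T"
      using comp Cons.prems by (rule measurable_Pair)
    from Cons.IH[OF measurable_compose[OF this measurable_jump_step]] show ?case by simp
  qed simp
  have "(\<lambda>x. build_path (map x l)) \<in> ?S \<rightarrow>\<^sub>M path_borel t0 T" for l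
    unfolding build_path_def by (rule fold) (simp add: const_path)
  moreover have "time_order n \<in> ?S \<rightarrow>\<^sub>M count_space UNIV"
    by (rule measurable_time_order) (rule measurable_compose[OF comp], simp)
  ultimately show ?thesis unfolding config_path_def[abs_def] by (rule measurable_compose_countable)
qed

end

text \<open>The time derivative of the test function enters only through densities \<open>d i\<close>, which are Borel functions defined everywhere.\<close>
locale test_process = rate_control T t0 C i0 q
  for T t0 C :: real and i0 :: "'s::finite" and q +
  fixes \<phi> :: "real \<Rightarrow> 's \<Rightarrow> real" and d :: "'s \<Rightarrow> real \<Rightarrow> real"
  assumes density: "\<And>i. integrable lborel (d i)"
    and increment: "\<And>i s t. t0 \<le> s \<Longrightarrow> s \<le> t \<Longrightarrow> t \<le> T \<Longrightarrow> \<phi> t i - \<phi> s i = (LINT r:{s..t}|lborel. d i r)"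
    and \<phi>_cont: "\<And>i. continuous_on {t0..T} (\<lambda>t. \<phi> t i)"
begin

lemma path_clamp_measurable:
  assumes w: "\<omega> \<in> path_space t0 T"
  shows "(\<lambda>r. \<omega> (clamp_time r)) \<in> borel \<rightarrow>\<^sub>M count_space (UNIV :: 's set)"
  using measurable_compose[OF measurable_Pair2' measurable_state, of \<omega>] w by simp

lemma drift_integrable:
  assumes w: "\<omega> \<in> path_space t0 T" and st: "t0 \<le> s" "t \<le> T"
  shows "set_integrable lborel {s..t} (\<lambda>r. d (\<omega> r) r)"
proof -
  have m: "(\<lambda>r. d (\<omega> (clamp_time r)) r) \<in> borel_measurable borel"
    using borel_measurable_integrable[OF density]
    by (intro measurable_compose_finite[where f=d, OF _ path_clamp_measurable[OF w]]) simp
  have "integrable lborel (\<lambda>r. indicator {s..t} r *\<^sub>R d (\<omega> (clamp_time r)) r)"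
  proof (rule Bochner_Integration.integrable_bound[of _ "\<lambda>r. \<Sum>i\<in>UNIV. \<bar>d i r\<bar>"])
    show "AE r in lborel. norm (indicator {s..t} r *\<^sub>R d (\<omega> (clamp_time r)) r) \<le> norm (\<Sum>i\<in>UNIV. \<bar>d i r\<bar>)"
    proof (rule AE_I2)
      fix r
      have "\<bar>d (\<omega> (clamp_time r)) r\<bar> \<le> (\<Sum>i\<in>UNIV. \<bar>d i r\<bar>)" by (rule member_le_sum) auto
      then show "norm (indicator {s..t} r *\<^sub>R d (\<omega> (clamp_time r)) r) \<le> norm (\<Sum>i\<in>UNIV. \<bar>d i r\<bar>)"
        by (auto split: split_indicator intro: sum_nonneg)
    qed
  qed (use density m in auto)
  also have "(\<lambda>r. indicator {s..t} r *\<^sub>R d (\<omega> (clamp_time r)) r) = (\<lambda>r. indicator {s..t} r *\<^sub>R d (\<omega> r) r)"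
    using st clamp_time(2) by (auto split: split_indicator)
  finally show ?thesis by (simp add: set_integrable_def)
qed

text \<open>The jump of \<open>\<phi>\<close> caused by a point, and zero when the point is rejected.\<close>
definition jump_gain :: "real \<times> 's \<times> real \<Rightarrow> (real \<Rightarrow> 's) \<Rightarrow> real" where
  "jump_gain p \<omega> = (if accepts p \<omega> then \<phi> (fst p) (fst (snd p)) - \<phi> (fst p) (\<omega> (fst p)) else 0)"

lemma increment_const:
  assumes "t0 \<le> s" "s \<le> t" "t \<le> T" "\<omega> \<in> path_space t0 T" "\<And>r. s \<le> r \<Longrightarrow> r \<le> t \<Longrightarrow> \<omega> r = i"
  shows "\<phi> t (\<omega> t) - \<phi> s (\<omega> s) = (LINT r:{s..t}|lborel. d (\<omega> r) r)"
proof -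
  have "(LINT r:{s..t}|lborel. d (\<omega> r) r) = (LINT r:{s..t}|lborel. d i r)"
    using assms by (intro set_lebesgue_integral_cong) auto
  then show ?thesis using increment assms by simp
qed

text \<open>Induction on the last point: before its time the path is the one without it, and if it is accepted the path is constant from its time on, so
  that \<open>\<phi>\<close> gains the jump and then its integral.\<close>
lemma build_path_increment:
  assumes "sorted_wrt (\<lambda>p p'. fst p < fst p') L" "t0 \<le> s" "s \<le> t" "t \<le> T"
  shows "\<phi> t (build_path L t) - \<phi> s (build_path L s) = (LINT r:{s..t}|lborel. d (build_path L r) r) +
    (\<Sum>k<length L. if s < fst (L ! k) \<and> fst (L ! k) \<le> t then jump_gain (L ! k) (build_path (take k L)) else 0)"
  using assms
proof (induction L arbitrary: s t rule: rev_induct)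
  case Nil
  then show ?case by (simp, intro increment_const[where i=i0] build_path_mem) (auto simp: build_path_def)
next
  case (snoc p L)
  define w where "w = build_path L"
  define w' where "w' = build_path (L @ [p])"
  have w'_eq: "w' = jump_step p w" by (simp add: w_def w'_def build_path_snoc)
  have ws: "w \<in> path_space t0 T" "w' \<in> path_space t0 T" by (simp_all add: w_def w'_def build_path_mem)
  let ?S = "\<lambda>s t. (\<Sum>k<length L. if s < fst (L ! k) \<and> fst (L ! k) \<le> t then jump_gain (L ! k) (build_path (take k L)) else 0)"
  have IH: "\<phi> t (w t) - \<phi> s (w s) = (LINT r:{s..t}|lborel. d (w r) r) + ?S s t" if "t0 \<le> s" "s \<le> t" "t \<le> T" for s t
    unfolding w_def using snoc.IH[OF _ that] snoc.prems(1) by (simp add: sorted_wrt_append)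
  have before: "fst (L ! k) < fst p" if "k < length L" for k
    using snoc.prems(1) that by (auto simp: sorted_wrt_append)
  have S: "(\<Sum>k<length (L @ [p]). if s < fst ((L @ [p]) ! k) \<and> fst ((L @ [p]) ! k) \<le> t then jump_gain ((L @ [p]) ! k) (build_path (take k (L @ [p]))) else 0) =
     ?S s t + (if s < fst p \<and> fst p \<le> t then jump_gain p w else 0)"
  proof -
    have "(\<Sum>k<length L. if s < fst ((L @ [p]) ! k) \<and> fst ((L @ [p]) ! k) \<le> t then jump_gain ((L @ [p]) ! k) (build_path (take k (L @ [p]))) else 0) = ?S s t"
      by (intro sum.cong refl) (auto simp: nth_append)
    then show ?thesis by (simp add: w_def)
  qed
  note st = snoc.prems(2-4)
  have "\<phi> t (w' t) - \<phi> s (w' s) = (LINT r:{s..t}|lborel. d (w' r) r) + (?S s t + (if s < fst p \<and> fst p \<le> t then jump_gain p w else 0))"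
  proof (cases "accepts p w")
    case False
    then have "w' = w" by (simp add: w'_eq jump_step_def)
    then show ?thesis using IH[OF st] False by (simp add: jump_gain_def)
  next
    case True
    define r j where "r = fst p" and "j = fst (snd p)"
    have r: "t0 < r" "r \<le> T" using True by (auto simp: accepts_def r_def)
    have w': "w' u = (if u < r then w u else j)" if "u \<in> {t0..T}" for u
      using True that by (simp add: w'_eq jump_step_def r_def j_def)
    consider "t < r" | "r \<le> s" | "s < r" "r \<le> t" using st by linarith
    then show ?thesis
    proof cases
      case 1
      then have "(LINT r:{s..t}|lborel. d (w' r) r) = (LINT r:{s..t}|lborel. d (w r) r)"
        using w' st by (intro set_lebesgue_integral_cong) auto
      then show ?thesis using IH[OF st] 1 w'[of t] w'[of s] st by (simp add: r_def[symmetric])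
    next
      case 2
      have "\<not> s < fst (L ! k)" if "k < length L" for k using before[OF that] 2 by (simp add: r_def)
      then have "?S s t = 0" by (intro sum.neutral) auto
      moreover have "\<phi> t (w' t) - \<phi> s (w' s) = (LINT r:{s..t}|lborel. d (w' r) r)"
        using 2 st w' ws by (intro increment_const[where i=j]) auto
      ultimately show ?thesis using 2 by (simp add: r_def[symmetric])
    next
      case 3
      have "?S s r = ?S s t"
        using before 3 by (intro sum.cong refl) (force simp: r_def)
      then have 1: "\<phi> r (w r) - \<phi> s (w s) = (LINT r:{s..r}|lborel. d (w r) r) + ?S s t"
        using IH[of s r] 3 st r by simp
      have 2: "\<phi> t j - \<phi> r j = (LINT u:{r..t}|lborel. d (w' u) u)"
        using increment_const[of r t w' j] 3 st r w' ws by auto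
      have "(LINT u:{s..r}|lborel. d (w' u) u) = (LINT u:{s..r}|lborel. d (w u) u)"
        using st 3 r w' ws by (intro integral_cong_halfopen drift_integrable) auto
      then have "(LINT u:{s..t}|lborel. d (w' u) u) = (LINT u:{s..r}|lborel. d (w u) u) + (LINT u:{r..t}|lborel. d (w' u) u)"
        using integral_split[OF drift_integrable[OF ws(2)], of s t r] st 3 by simp
      moreover have "jump_gain p w = \<phi> r j - \<phi> r (w r)" using True by (simp add: jump_gain_def r_def j_def)
      moreover have "w' t = j" "w' s = w s" using w' st 3 by auto
      ultimately show ?thesis using 1 2 3 by (simp add: r_def[symmetric])
    qed
  qed
  then show ?case unfolding S w'_def .
qed

lemma jump_gain_determined:
  assumes w: "\<omega> \<in> path_space t0 T" "\<omega>' \<in> path_space t0 T" and e: "\<And>s. s \<in> {t0..T} \<Longrightarrow> s \<le> fst p \<Longrightarrow> \<omega> s = \<omega>' s"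
  shows "jump_gain p \<omega> = jump_gain p \<omega>'"
proof (cases "t0 < fst p \<and> fst p \<le> T")
  case True
  then have "\<omega> (fst p) = \<omega>' (fst p)" "q (fst p) \<omega> i j = q (fst p) \<omega>' i j" for i j
    using e by (auto intro!: rate_determined w)
  then show ?thesis by (simp add: jump_gain_def accepts_def)
qed (auto simp: jump_gain_def accepts_def)

text \<open>Deleting a point changes the path only from the time of that point on, or not at all; up to that time both paths
  are built from the earlier points. At the time itself the path without the point still has the state before the jump.\<close>
lemma config_path_skip:
  assumes inj: "inj_on (\<lambda>i. fst (x i)) {..<n}" and m: "m < n"
  defines "L \<equiv> map x (time_order n x)"
  defines "k \<equiv> time_order n x ! m"
  shows "s \<in> {t0..T} \<Longrightarrow> s \<le> fst (x k) \<Longrightarrow> config_path (n - 1) (x \<circ> skip_index k) s = build_path (take m L) s"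
    and "s \<in> {t0..T} \<Longrightarrow> s < fst (x k) \<Longrightarrow> config_path n x s = build_path (take m L) s"
proof -
  let ?lt = "\<lambda>p p' :: real \<times> 's \<times> real. fst p < fst p'"
  have len: "length L = n" by (simp add: L_def time_order_perm)
  have sL: "sorted_wrt ?lt L" unfolding L_def by (rule time_order_sorted[OF inj])
  have k: "k < n" using m time_order_perm[of n x] nth_mem[of m "time_order n x"] by (simp add: k_def)
  have Lm: "L ! m = x k" using m time_order_perm(3)[of n x] by (simp add: L_def k_def)
  have L: "L = take m L @ x k # drop (Suc m) L"
    using id_take_nth_drop[of m L] m len Lm by simp
  have sM: "sorted_wrt ?lt (take m L @ drop (Suc m) L)"
    using sL by (subst (asm) L) (auto simp: sorted_wrt_append)
  have after: "fst (x k) < fst p" if "p \<in> set (drop (Suc m) L)" for p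
    using sL that by (subst (asm) L) (auto simp: sorted_wrt_append)
  have xi: "inj_on x {..<n}" using inj by (auto simp: inj_on_def)
  have sk: "skip_index k ` {..<n - 1} = {..<n} - {k}"
  proof
    show "skip_index k ` {..<n - 1} \<subseteq> {..<n} - {k}" by (auto simp: skip_index_def)
    show "{..<n} - {k} \<subseteq> skip_index k ` {..<n - 1}"
    proof
      fix i assume i: "i \<in> {..<n} - {k}"
      then have "i = skip_index k (if i < k then i else i - 1)" "(if i < k then i else i - 1) < n - 1"
        using k by (auto simp: skip_index_def)
      then show "i \<in> skip_index k ` {..<n - 1}" by blast
    qed
  qed
  have injs: "inj (skip_index k)" by (auto simp: inj_def skip_index_def split: if_splits)
  have "inj_on ((\<lambda>i. fst (x i)) \<circ> skip_index k) {..<n - 1}"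
    by (rule comp_inj_on[OF inj_on_subset[OF injs subset_UNIV] inj_on_subset[OF inj]]) (unfold sk, blast)
  then have "inj_on (\<lambda>i. fst ((x \<circ> skip_index k) i)) {..<n - 1}" by (simp add: comp_def)
  then have s': "sorted_wrt ?lt (map (x \<circ> skip_index k) (time_order (n - 1) (x \<circ> skip_index k)))"
    by (rule time_order_sorted)
  have "set (map (x \<circ> skip_index k) (time_order (n - 1) (x \<circ> skip_index k))) = x ` ({..<n} - {k})"
    by (simp only: set_map time_order_perm image_comp[symmetric] sk)
  also have "\<dots> = x ` {..<n} - {x k}" using xi k by (auto simp: inj_on_def)
  also have "x ` {..<n} = set L" by (simp add: L_def time_order_perm)
  also have "set L - {x k} = set (take m L @ drop (Suc m) L)"
  proof -
    have "distinct L" using xi by (simp add: L_def distinct_map time_order_perm)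
    then have "distinct (take m L @ x k # drop (Suc m) L)" using L by metis
    moreover have "set L = set (take m L @ x k # drop (Suc m) L)" using L by metis
    ultimately show ?thesis by auto
  qed
  finally have "map (x \<circ> skip_index k) (time_order (n - 1) (x \<circ> skip_index k)) = take m L @ drop (Suc m) L"
    by (intro time_sorted_unique s' sM)
  then have e: "config_path (n - 1) (x \<circ> skip_index k) = build_path (take m L @ drop (Suc m) L)"
    by (simp add: config_path_def)
  show "config_path (n - 1) (x \<circ> skip_index k) s = build_path (take m L) s" if "s \<in> {t0..T}" "s \<le> fst (x k)"
    unfolding e using that after by (intro build_path_before) force+
  have "config_path n x = build_path (take m L @ x k # drop (Suc m) L)"
    using L by (simp add: config_path_def L_def)
  then show "config_path n x s = build_path (take m L) s" if "s \<in> {t0..T}" "s < fst (x k)"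
  proof -
    have "s < fst p" if "p \<in> set (x k # drop (Suc m) L)" for p
      using that after[of p] \<open>s < fst (x k)\<close> by auto
    with \<open>config_path n x = _\<close> show ?thesis using \<open>s \<in> {t0..T}\<close> by (simp only:, intro build_path_before)
  qed
qed

text \<open>Besides the drift, the increment of \<open>\<phi>\<close> is a sum over the points in which every point is judged by the path of
  the \<^emph>\<open>other\<close> points, as the Mecke formula requires. The event \<open>A\<close> concerns the path up to \<open>s\<close>, and deleting a point after
  \<open>s\<close> does not change it.\<close>
lemma config_path_increment:
  assumes inj: "inj_on (\<lambda>i. fst (x i)) {..<n}" and st: "t0 \<le> s" "s \<le> t" "t \<le> T"
    and A: "A \<in> sets (path_filtration T t0 s)"
  shows "indicator A (config_path n x) * (\<phi> t (config_path n x t) - \<phi> s (config_path n x s) - (LINT r:{s..t}|lborel. d (config_path n x r) r)) =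
    (\<Sum>k<n. indicator A (config_path (n - 1) (x \<circ> skip_index k)) *
       (if s < fst (x k) \<and> fst (x k) \<le> t then jump_gain (x k) (config_path (n - 1) (x \<circ> skip_index k)) else 0))" (is "?I * ?D = ?R")
proof -
  let ?l = "time_order n x" and ?L = "map x (time_order n x)"
  let ?c = "\<lambda>k. config_path (n - 1) (x \<circ> skip_index k)"
  have D: "?D = (\<Sum>m<n. if s < fst (?L ! m) \<and> fst (?L ! m) \<le> t then jump_gain (?L ! m) (build_path (take m ?L)) else 0)"
    using build_path_increment[OF time_order_sorted[OF inj] st] by (simp add: config_path_def time_order_perm)
  have "?I * ?D = (\<Sum>m<n. indicator A (?c (?l ! m)) *
      (if s < fst (x (?l ! m)) \<and> fst (x (?l ! m)) \<le> t then jump_gain (x (?l ! m)) (?c (?l ! m)) else 0))"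
    unfolding D sum_distrib_left
  proof (intro sum.cong refl)
    fix m assume "m \<in> {..<n}"
    then have m: "m < n" by simp
    let ?k = "?l ! m"
    have Lm: "?L ! m = x ?k" using m time_order_perm(3)[of n x] by simp
    show "?I * (if s < fst (?L ! m) \<and> fst (?L ! m) \<le> t then jump_gain (?L ! m) (build_path (take m ?L)) else 0) =
      indicator A (?c ?k) * (if s < fst (x ?k) \<and> fst (x ?k) \<le> t then jump_gain (x ?k) (?c ?k) else 0)"
    proof (cases "s < fst (x ?k) \<and> fst (x ?k) \<le> t")
      case True
      have "config_path n x u = ?c ?k u" if "u \<in> {t0..s}" for u
        using config_path_skip[OF inj m, of u] that True st by simp
      then have "config_path n x \<in> A \<longleftrightarrow> ?c ?k \<in> A"
        using st by (intro path_filtration_determined[OF t0T A] config_path_mem) auto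
      moreover have "jump_gain (x ?k) (build_path (take m ?L)) = jump_gain (x ?k) (?c ?k)"
        using config_path_skip(1)[OF inj m] by (intro jump_gain_determined build_path_mem config_path_mem) simp
      ultimately show ?thesis by (simp add: Lm indicator_def)
    next
      case False
      then show ?thesis by (simp only: Lm False if_False mult_zero_right)
    qed
  qed
  also have "\<dots> = ?R"
  proof (rule sum.reindex_bij_betw)
    show "bij_betw (\<lambda>m. ?l ! m) {..<n} {..<n}"
      using bij_betw_nth[OF time_order_perm(2) refl refl, of n x] by (simp only: time_order_perm)
  qed
  finally show ?thesis .
qed

end

section \<open>Progressive integrands and martingales\<close>

definition progressive_at :: "real \<Rightarrow> real \<Rightarrow> real \<Rightarrow> (real \<Rightarrow> (real \<Rightarrow> 's) \<Rightarrow> real) \<Rightarrow> bool" where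
  "progressive_at T t0 t f \<longleftrightarrow> (\<lambda>(s, \<omega>). f s \<omega>) \<in> restrict_space borel {t0..t} \<Otimes>\<^sub>M path_filtration T t0 t \<rightarrow>\<^sub>M borel"

lemma progressive_clamp:
  fixes f :: "real \<Rightarrow> (real \<Rightarrow> 's::finite) \<Rightarrow> real"
  assumes f: "progressive_at T t0 t f" and t: "t0 \<le> t"
  shows "(\<lambda>(\<omega>, r). f (max t0 (min t r)) \<omega>) \<in> borel_measurable (path_filtration T t0 t \<Otimes>\<^sub>M borel)"
proof -
  have "(\<lambda>r. max t0 (min t r)) \<in> borel \<rightarrow>\<^sub>M restrict_space borel {t0..t}"
    using t by (intro measurable_restrict_space2) auto
  then have "(\<lambda>x. (max t0 (min t (snd x)), fst x)) \<in> path_filtration T t0 t \<Otimes>\<^sub>M borel \<rightarrow>\<^sub>M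
      restrict_space borel {t0..t} \<Otimes>\<^sub>M (path_filtration T t0 t :: (real \<Rightarrow> 's) measure)"
    by (intro measurable_Pair measurable_compose[OF measurable_snd] measurable_fst)
  from measurable_compose[OF this f[unfolded progressive_at_def]] show ?thesis
    by (simp add: case_prod_unfold)
qed

lemma progressive_integral_measurable:
  fixes f :: "real \<Rightarrow> (real \<Rightarrow> 's::finite) \<Rightarrow> real"
  assumes f: "progressive_at T t0 t f" and t: "t0 \<le> t"
  shows "(\<lambda>\<omega>. LINT r:{t0..t}|lborel. f r \<omega>) \<in> borel_measurable (path_filtration T t0 t)"
proof -
  note [measurable] = progressive_clamp[OF f t, unfolded case_prod_unfold]
  have "(\<lambda>x. indicator {t0..t} (snd x) *\<^sub>R f (max t0 (min t (snd x))) (fst x)) \<in> borel_measurable (path_filtration T t0 t \<Otimes>\<^sub>M lborel)"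
    by measurable
  then have "(\<lambda>\<omega>. LINT r|lborel. indicator {t0..t} r *\<^sub>R f (max t0 (min t r)) \<omega>) \<in> borel_measurable (path_filtration T t0 t)"
    by (intro lborel.borel_measurable_lebesgue_integral) (simp add: case_prod_unfold)
  also have "(\<lambda>\<omega>. LINT r|lborel. indicator {t0..t} r *\<^sub>R f (max t0 (min t r)) \<omega>) = (\<lambda>\<omega>. LINT r:{t0..t}|lborel. f r \<omega>)"
    unfolding set_lebesgue_integral_def by (intro ext Bochner_Integration.integral_cong) (auto split: split_indicator simp: max_def min_def)
  finally show ?thesis .
qed

lemma progressive_section:
  fixes f :: "real \<Rightarrow> (real \<Rightarrow> 's::finite) \<Rightarrow> real"
  assumes f: "progressive_at T t0 t f" and t: "t0 \<le> t" and w: "\<omega> \<in> path_space t0 T"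
  shows "(\<lambda>r. indicator {t0..t} r *\<^sub>R f r \<omega>) \<in> borel_measurable borel"
proof -
  have w': "\<omega> \<in> space (path_filtration T t0 t)" using w by (simp add: path_filtration_def)
  have [measurable]: "(\<lambda>r. f (max t0 (min t r)) \<omega>) \<in> borel_measurable borel"
    using measurable_compose[OF measurable_Pair1'[OF w'] progressive_clamp[OF f t]] by simp
  have "(\<lambda>r. indicator {t0..t} r *\<^sub>R f (max t0 (min t r)) \<omega>) \<in> borel_measurable borel" by measurable
  also have "(\<lambda>r. indicator {t0..t} r *\<^sub>R f (max t0 (min t r)) \<omega>) = (\<lambda>r. indicator {t0..t} r *\<^sub>R f r \<omega>)"
    by (intro ext) (auto split: split_indicator simp: max_def min_def)
  finally show ?thesis .
qed

text \<open>The increments only have to be integrated over events of the past, which characterises the conditional expectation.\<close>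
lemma is_martingaleI:
  assumes P: "prob_space P" and sp: "\<And>t. t \<in> {a..b} \<Longrightarrow> space (F t) = space P"
    and sub: "\<And>t. t \<in> {a..b} \<Longrightarrow> sets (F t) \<subseteq> sets P"
    and m: "\<And>t. t \<in> {a..b} \<Longrightarrow> X t \<in> borel_measurable (F t)"
    and i: "\<And>t. t \<in> {a..b} \<Longrightarrow> integrable P (X t)"
    and e: "\<And>s t A. s \<in> {a..b} \<Longrightarrow> t \<in> {s..b} \<Longrightarrow> A \<in> sets (F s) \<Longrightarrow> (LINT x:A|P. X t x - X s x) = 0"
  shows "is_martingale P F a b X"
  unfolding is_martingale_def
proof (intro conjI ballI)
  fix s t assume s: "s \<in> {a..b}" and t: "t \<in> {s..b}"
  then have t': "t \<in> {a..b}" by auto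
  interpret prob_space P by fact
  interpret finite_measure_subalgebra P "F s"
    by unfold_locales (use sp[OF s] sub[OF s] in \<open>auto simp: subalgebra_def\<close>)
  show "AE \<omega> in P. real_cond_exp P (F s) (X t) \<omega> = X s \<omega>"
  proof (rule real_cond_exp_charact)
    fix A assume A: "A \<in> sets (F s)"
    then have AP: "A \<in> sets P" using sub[OF s] by blast
    have si: "set_integrable P A (X u)" if "u \<in> {a..b}" for u
      unfolding set_integrable_def using AP i[OF that] by (rule integrable_mult_indicator)
    show "(LINT x:A|P. X t x) = (LINT x:A|P. X s x)"
      using e[OF s t A] set_integral_diff(2)[OF si[OF t'] si[OF s]] by simp
  qed (use i[OF t'] i[OF s] m[OF s] in auto)
qed (use m i in auto)

section \<open>The law of the chain and its compensators\<close>

context rate_control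
begin

definition point_base :: "(real \<times> 's \<times> real) measure" where
  "point_base = lborel \<Otimes>\<^sub>M (count_space UNIV \<Otimes>\<^sub>M lborel)"

text \<open>Times range up to \<open>T + 1\<close>, which gives the box positive volume also for \<open>t0 = T\<close>; points after \<open>T\<close> are never accepted.\<close>
definition point_box :: "(real \<times> 's \<times> real) set" where
  "point_box = {t0..T + 1} \<times> UNIV \<times> {0..1}"

definition point_law :: "(real \<times> 's \<times> real) measure" where
  "point_law = uniform_measure point_base point_box"

definition box_volume :: real where
  "box_volume = (T + 1 - t0) * CARD('s)"

abbreviation configurations :: "(nat \<times> (nat \<Rightarrow> real \<times> 's \<times> real)) measure" where
  "configurations \<equiv> poisson_configuration (C * box_volume) point_law"

definition chain_law :: "(real \<Rightarrow> 's) measure" where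
  "chain_law = distr configurations (path_borel t0 T) (\<lambda>(n, x). config_path n x)"

lemma sigma_finite_marks: "sigma_finite_measure (count_space UNIV \<Otimes>\<^sub>M lborel :: ('s \<times> real) measure)"
proof -
  interpret cs: sigma_finite_measure "count_space UNIV :: 's measure" by (rule sigma_finite_measure_count_space_finite) simp
  interpret pair_sigma_finite "count_space UNIV :: 's measure" "lborel :: real measure" by unfold_locales
  show ?thesis by unfold_locales
qed

lemma sets_point_base: "sets point_base = sets point_space"
  unfolding point_base_def by (intro sets_pair_measure_cong) auto

lemma sets_point_law: "sets point_law = sets point_space"
  by (simp add: point_law_def sets_point_base)

lemma point_box_sets: "point_box \<in> sets point_base"
  unfolding sets_point_base point_box_def by (intro pair_measureI) auto

lemma box_volume_pos: "0 < box_volume"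
  using t0T by (auto simp: box_volume_def)

lemma emeasure_point_box: "emeasure point_base point_box = ennreal box_volume"
proof -
  interpret marks: sigma_finite_measure "count_space UNIV \<Otimes>\<^sub>M lborel :: ('s \<times> real) measure" by (rule sigma_finite_marks)
  have "emeasure point_base point_box = emeasure lborel {t0..T + 1} * emeasure (count_space UNIV \<Otimes>\<^sub>M lborel) ((UNIV :: 's set) \<times> {0..1::real})"
    unfolding point_base_def point_box_def
    by (intro marks.emeasure_pair_measure_Times pair_measureI) auto
  also have "emeasure (count_space UNIV \<Otimes>\<^sub>M lborel) ((UNIV :: 's set) \<times> {0..1::real}) = emeasure (count_space UNIV) (UNIV :: 's set) * emeasure lborel {0..1::real}"
    by (intro lborel.emeasure_pair_measure_Times) auto
  also have "\<dots> = ennreal CARD('s)"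
    by (simp add: emeasure_count_space_finite ennreal_of_nat_eq_real_of_nat)
  also have "emeasure lborel {t0..T + 1} * ennreal CARD('s) = ennreal box_volume"
    using t0T by (simp add: box_volume_def ennreal_mult')
  finally show ?thesis .
qed

lemma prob_space_point_law: "prob_space point_law"
  unfolding point_law_def
  using box_volume_pos by (intro prob_space_uniform_measure) (auto simp: emeasure_point_box)

lemma point_law_diffuse: "AE y in point_law. fst y \<noteq> (a :: real)"
proof -
  interpret marks: sigma_finite_measure "count_space UNIV \<Otimes>\<^sub>M lborel :: ('s \<times> real) measure" by (rule sigma_finite_marks)
  have "emeasure point_base ({a} \<times> UNIV) = emeasure lborel {a} * emeasure (count_space UNIV \<Otimes>\<^sub>M lborel) (UNIV :: ('s \<times> real) set)"
    unfolding point_base_def by (intro marks.emeasure_pair_measure_Times) (auto simp: space_pair_measure intro: sets.top[of "count_space UNIV \<Otimes>\<^sub>M lborel", simplified])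
  then have "{a} \<times> UNIV \<in> null_sets point_base"
    unfolding point_base_def by (intro null_setsI pair_measureI) (auto intro: sets.top[of "count_space UNIV \<Otimes>\<^sub>M lborel", simplified space_pair_measure, simplified])
  then have "AE y in point_base. y \<notin> {a} \<times> UNIV" by (rule AE_not_in)
  then have "AE y in point_base. y \<in> point_box \<longrightarrow> fst y \<noteq> a" by eventually_elim (auto simp: mem_Times_iff)
  then show ?thesis unfolding point_law_def by (rule AE_uniform_measureI[OF point_box_sets])
qed

lemma integral_point_law:
  assumes f: "f \<in> borel_measurable point_space" and B: "\<And>y. \<bar>f y\<bar> \<le> B"
  shows "C * box_volume * (LINT y|point_law. f y) =
    C * (LINT r:{t0..T + 1}|lborel. (\<Sum>j\<in>UNIV. LINT z:{0..1}|lborel. f (r, j, z)))"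
proof -
  let ?g = "\<lambda>y. indicator point_box y / box_volume :: real"
  interpret marks: sigma_finite_measure "count_space UNIV \<Otimes>\<^sub>M lborel :: ('s \<times> real) measure" by (rule sigma_finite_marks)
  interpret p1: pair_sigma_finite lborel "count_space UNIV \<Otimes>\<^sub>M lborel :: ('s \<times> real) measure" by unfold_locales
  interpret cs: sigma_finite_measure "count_space UNIV :: 's measure" by (rule sigma_finite_measure_count_space_finite) simp
  interpret p2: pair_sigma_finite "count_space UNIV :: 's measure" "lborel :: real measure" by unfold_locales
  have fb: "f \<in> borel_measurable point_base" using f measurable_cong_sets[OF sets_point_base refl] by blast
  have box: "(indicator point_box :: _ \<Rightarrow> real) \<in> borel_measurable point_base" using point_box_sets by simp
  have "point_law = density point_base (\<lambda>y. ennreal (?g y))"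
    unfolding point_law_def uniform_measure_def emeasure_point_box using box_volume_pos
  proof (intro density_cong AE_I2)
    note [measurable] = point_box_sets
    show "(\<lambda>x. indicator point_box x / ennreal box_volume) \<in> borel_measurable point_base" by measurable
    show "(\<lambda>x. ennreal (?g x)) \<in> borel_measurable point_base" by measurable
  qed (auto split: split_indicator simp: divide_ennreal[symmetric])
  then have "(LINT y|point_law. f y) = (LINT y|point_base. ?g y *\<^sub>R f y)"
    using fb box box_volume_pos by (simp only:, subst integral_density) (auto intro!: borel_measurable_divide)
  also have "\<dots> = (LINT y|point_base. indicator point_box y * f y) / box_volume"
    by (simp add: mult.commute)
  finally have 1: "C * box_volume * (LINT y|point_law. f y) = C * (LINT y|point_base. indicator point_box y * f y)"
    using box_volume_pos by simp
  have int: "integrable point_base (\<lambda>y. indicator point_box y * f y)"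
  proof (rule Bochner_Integration.integrable_bound[of _ "\<lambda>y. B * indicator point_box y"])
    show "integrable point_base (\<lambda>y. B * indicator point_box y)"
      using point_box_sets emeasure_point_box by (intro integrable_mult_right integrable_real_indicator) auto
    show "AE y in point_base. norm (indicator point_box y * f y) \<le> norm (B * indicator point_box y)"
      using B by (intro AE_I2) (auto split: split_indicator intro: order_trans[OF _ abs_ge_self])
  qed (use fb box in measurable)
  have "(LINT y|point_base. indicator point_box y * f y) =
      (LINT r|lborel. LINT m|(count_space UNIV \<Otimes>\<^sub>M lborel). indicator point_box (r, m) * f (r, m))"
    using int unfolding point_base_def by (intro p1.integral_fst'[symmetric])
  also have "\<dots> = (LINT r:{t0..T + 1}|lborel. (\<Sum>j\<in>UNIV. LINT z:{0..1}|lborel. f (r, j, z)))"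
    unfolding set_lebesgue_integral_def[of _ "{t0..T + 1}"]
  proof (intro Bochner_Integration.integral_cong refl)
    fix r :: real
    let ?h = "\<lambda>m. indicator point_box (r, m) * f (r, m)"
    have hm: "?h \<in> borel_measurable (count_space UNIV \<Otimes>\<^sub>M lborel)"
      using fb box unfolding point_base_def by measurable
    have "integrable (count_space UNIV \<Otimes>\<^sub>M lborel) ?h"
    proof (rule Bochner_Integration.integrable_bound[of _ "\<lambda>m. B * indicator (UNIV \<times> {0..1}) m"])
      have "emeasure (count_space UNIV \<Otimes>\<^sub>M lborel) ((UNIV :: 's set) \<times> {0..1::real}) = emeasure (count_space UNIV) (UNIV :: 's set) * emeasure lborel {0..1::real}"
        by (intro lborel.emeasure_pair_measure_Times) auto
      then show "integrable (count_space UNIV \<Otimes>\<^sub>M lborel) (\<lambda>m. B * indicator ((UNIV :: 's set) \<times> {0..1::real}) m)"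
        by (intro integrable_mult_right integrable_real_indicator pair_measureI)
          (auto simp: emeasure_count_space_finite ennreal_of_nat_eq_real_of_nat)
      show "AE m in count_space UNIV \<Otimes>\<^sub>M lborel. norm (?h m) \<le> norm (B * indicator (UNIV \<times> {0..1}) m)"
        using B by (intro AE_I2) (auto split: split_indicator simp: point_box_def intro: order_trans[OF _ abs_ge_self])
    qed (rule hm)
    then have "(LINT m|(count_space UNIV \<Otimes>\<^sub>M lborel). ?h m) = (LINT j|count_space UNIV. LINT z|lborel. ?h (j, z))"
      by (intro p2.integral_fst'[symmetric])
    also have "\<dots> = (\<Sum>j\<in>UNIV. LINT z|lborel. ?h (j, z))" by (simp add: lebesgue_integral_count_space_finite)
    also have "\<dots> = indicator {t0..T + 1} r *\<^sub>R (\<Sum>j\<in>UNIV. LINT z:{0..1}|lborel. f (r, j, z))"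
      by (auto simp: set_lebesgue_integral_def point_box_def indicator_def intro!: sum.cong Bochner_Integration.integral_cong)
    finally show "(LINT m|(count_space UNIV \<Otimes>\<^sub>M lborel). ?h m) = indicator {t0..T + 1} r *\<^sub>R (\<Sum>j\<in>UNIV. LINT z:{0..1}|lborel. f (r, j, z))" .
  qed
  finally show ?thesis using 1 by simp
qed

lemma measurable_config: "(\<lambda>(n, x). config_path n x) \<in> configurations \<rightarrow>\<^sub>M path_borel t0 T"
  using C box_volume_pos prob_space_point_law
  by (intro measurable_poisson_configuration measurable_config_path sets_point_law) auto

lemma prob_space_chain_law: "prob_space chain_law"
  unfolding chain_law_def using C box_volume_pos prob_space_point_law
  by (intro prob_space.prob_space_distr prob_space_poisson_configuration measurable_config) auto

lemma sets_chain_law: "sets chain_law = sets (path_borel t0 T)" "space chain_law = path_space t0 T"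
  by (auto simp: chain_law_def)

lemma chain_law_start: "measure chain_law {\<omega> \<in> path_space t0 T. \<omega> t0 = i0} = 1"
proof -
  interpret prob_space chain_law by (rule prob_space_chain_law)
  have "{\<omega> \<in> path_space t0 T. \<omega> t0 = i0} \<in> sets (path_borel t0 T)"
    using t0T by (intro evaluation_sets_borel) auto
  then have "AE \<omega> in chain_law. \<omega> t0 = i0"
    unfolding chain_law_def
    by (subst AE_distr_iff[OF measurable_config]) (auto simp: config_path_def build_path_start)
  then show ?thesis
    using prob_Collect_eq_1[of "\<lambda>\<omega>. \<omega> t0 = i0"] \<open>_ \<in> sets (path_borel t0 T)\<close> by (simp add: sets_chain_law)
qed

end

context test_process
begin

lemma phi_bounded: "\<exists>K. \<forall>t\<in>{t0..T}. \<forall>i. \<bar>\<phi> t i\<bar> \<le> K"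
proof -
  have "\<exists>K. \<forall>t\<in>{t0..T}. \<bar>\<phi> t i\<bar> \<le> K" for i
    using compact_imp_bounded[OF compact_continuous_image[OF \<phi>_cont[of i] compact_Icc]]
    unfolding bounded_iff by auto
  then obtain K where K: "\<And>i t. t\<in>{t0..T} \<Longrightarrow> \<bar>\<phi> t i\<bar> \<le> K i" by metis
  have "\<bar>\<phi> t i\<bar> \<le> (\<Sum>i\<in>UNIV. \<bar>K i\<bar>)" if "t \<in> {t0..T}" for t i
  proof -
    have "\<bar>\<phi> t i\<bar> \<le> \<bar>K i\<bar>" using K[OF that, of i] by linarith
    also have "\<dots> \<le> (\<Sum>i\<in>UNIV. \<bar>K i\<bar>)" by (rule member_le_sum) auto
    finally show ?thesis .
  qed
  then show ?thesis by blast
qed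

definition bound_\<phi> :: real where
  "bound_\<phi> = (SOME K. \<forall>t\<in>{t0..T}. \<forall>i. \<bar>\<phi> t i\<bar> \<le> K)"

lemma bound_\<phi>: "t \<in> {t0..T} \<Longrightarrow> \<bar>\<phi> t i\<bar> \<le> bound_\<phi>"
  using someI_ex[OF phi_bounded] unfolding bound_\<phi>_def by blast

lemma bound_\<phi>_nonneg: "0 \<le> bound_\<phi>"
  using bound_\<phi>[of t0 undefined] t0T by force

definition rate_term :: "real \<Rightarrow> (real \<Rightarrow> 's) \<Rightarrow> real" where
  "rate_term r \<omega> = (\<Sum>j\<in>UNIV. q r \<omega> (\<omega> r) j * \<phi> r j)"

definition generator_term :: "real \<Rightarrow> (real \<Rightarrow> 's) \<Rightarrow> real" where
  "generator_term r \<omega> = d (\<omega> r) r + rate_term r \<omega>"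

definition compensated :: "real \<Rightarrow> (real \<Rightarrow> 's) \<Rightarrow> real" where
  "compensated t \<omega> = \<phi> t (\<omega> t) - (LINT r:{t0..t}|lborel. generator_term r \<omega>)"

lemma phi_measurable: "t \<le> T \<Longrightarrow> (\<lambda>r. \<phi> r i) \<in> borel_measurable (restrict_space borel {t0..t})"
  by (intro borel_measurable_continuous_on_restrict continuous_on_subset[OF \<phi>_cont]) auto

lemma progressive_rate_term:
  assumes t: "t \<in> {t0..T}"
  shows "progressive_at T t0 t rate_term"
proof -
  let ?M = "restrict_space borel {t0..t} \<Otimes>\<^sub>M (path_filtration T t0 t :: (real \<Rightarrow> 's) measure)"
  have "(\<lambda>x. \<Sum>j\<in>UNIV. q (fst x) (snd x) i j * \<phi> (fst x) j) \<in> borel_measurable ?M" for i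
    using progressive[OF t] t
    by (intro borel_measurable_sum borel_measurable_times measurable_compose[OF measurable_fst phi_measurable])
      (auto simp: case_prod_unfold)
  from measurable_compose_finite[OF this joint_evaluation[OF t0T t, unfolded case_prod_unfold]]
  show ?thesis by (simp add: progressive_at_def rate_term_def case_prod_unfold)
qed

lemma progressive_generator_term:
  assumes t: "t \<in> {t0..T}"
  shows "progressive_at T t0 t generator_term"
proof -
  let ?M = "restrict_space borel {t0..t} \<Otimes>\<^sub>M (path_filtration T t0 t :: (real \<Rightarrow> 's) measure)"
  have "d i \<in> borel_measurable (restrict_space borel {t0..t})" for i
    using borel_measurable_integrable[OF density, of i] by (intro measurable_restrict_space1) simp
  then have "(\<lambda>x. d i (fst x)) \<in> borel_measurable ?M" for i
    by (rule measurable_compose[OF measurable_fst])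
  from measurable_compose_finite[OF this joint_evaluation[OF t0T t, unfolded case_prod_unfold]]
  have "(\<lambda>x. d (snd x (fst x)) (fst x)) \<in> borel_measurable ?M" .
  with progressive_rate_term[OF t] show ?thesis
    unfolding progressive_at_def generator_term_def case_prod_unfold by (intro borel_measurable_add)
qed

lemma rate_term_bound:
  assumes "r \<in> {t0..T}" "\<omega> \<in> path_space t0 T"
  shows "\<bar>rate_term r \<omega>\<bar> \<le> CARD('s) * (C * bound_\<phi>)"
proof -
  have "\<bar>rate_term r \<omega>\<bar> \<le> (\<Sum>j\<in>(UNIV :: 's set). C * bound_\<phi>)"
    unfolding rate_term_def
    using rate_bound[OF assms] bound_\<phi>[OF assms(1)] C
    by (intro order_trans[OF sum_abs] sum_mono) (auto simp: abs_mult intro: mult_mono)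
  then show ?thesis by simp
qed

lemma rate_term_integrable:
  assumes w: "\<omega> \<in> path_space t0 T" and st: "t0 \<le> s" "t \<le> T"
  shows "set_integrable lborel {s..t} (\<lambda>r. rate_term r \<omega>)"
proof (rule set_integrable_subset[of lborel "{t0..T}"])
  show "set_integrable lborel {t0..T} (\<lambda>r. rate_term r \<omega>)"
    unfolding set_integrable_def
  proof (rule Bochner_Integration.integrable_bound[of _ "\<lambda>r. CARD('s) * (C * bound_\<phi>) * indicator {t0..T} r"])
    show "(\<lambda>r. indicator {t0..T} r *\<^sub>R rate_term r \<omega>) \<in> borel_measurable lborel"
      using progressive_section[OF progressive_rate_term t0T w] t0T by simp
    show "AE r in lborel. norm (indicator {t0..T} r *\<^sub>R rate_term r \<omega>) \<le> norm (CARD('s) * (C * bound_\<phi>) * indicator {t0..T} r)"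
      using rate_term_bound[OF _ w] by (intro AE_I2) (auto split: split_indicator intro: order_trans[OF _ abs_ge_self])
  qed (intro integrable_mult_right integrable_real_indicator, auto simp: t0T)
qed (use st in auto)

lemma generator_term_integrable:
  assumes w: "\<omega> \<in> path_space t0 T" and st: "t0 \<le> s" "t \<le> T"
  shows "set_integrable lborel {s..t} (\<lambda>r. generator_term r \<omega>)"
  unfolding generator_term_def using drift_integrable[OF assms] rate_term_integrable[OF assms]
  by (rule set_integral_add)

lemma compensated_diff:
  assumes w: "\<omega> \<in> path_space t0 T" and st: "t0 \<le> s" "s \<le> t" "t \<le> T"
  shows "compensated t \<omega> - compensated s \<omega> =
    \<phi> t (\<omega> t) - \<phi> s (\<omega> s) - (LINT r:{s..t}|lborel. d (\<omega> r) r) - (LINT r:{s..t}|lborel. rate_term r \<omega>)"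
proof -
  have "(LINT r:{t0..t}|lborel. generator_term r \<omega>) =
      (LINT r:{t0..s}|lborel. generator_term r \<omega>) + (LINT r:{s..t}|lborel. generator_term r \<omega>)"
    using st by (intro integral_split generator_term_integrable w) auto
  also have "(LINT r:{s..t}|lborel. generator_term r \<omega>) = (LINT r:{s..t}|lborel. d (\<omega> r) r) + (LINT r:{s..t}|lborel. rate_term r \<omega>)"
    unfolding generator_term_def using st by (intro set_integral_add drift_integrable rate_term_integrable w) auto
  finally show ?thesis by (simp add: compensated_def)
qed

lemma clamp_phi_measurable: "(\<lambda>r. \<phi> (clamp_time r) i) \<in> borel_measurable borel"
  by (rule measurable_compose[OF measurable_clamp phi_measurable]) simp

lemma measurable_jump_gain:
  "(\<lambda>(p, \<omega>). jump_gain p \<omega>) \<in> borel_measurable (point_space \<Otimes>\<^sub>M path_borel t0 T)"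
proof -
  let ?M = "point_space \<Otimes>\<^sub>M (path_borel t0 T :: (real \<Rightarrow> 's) measure)"
  have f: "(\<lambda>x. \<phi> (clamp_time (fst (fst x))) i) \<in> borel_measurable ?M" for i
    by (rule measurable_compose[OF _ clamp_phi_measurable]) measurable
  note [measurable] = measurable_compose_finite[OF f measurable_point_state[unfolded case_prod_unfold]]
    measurable_compose_finite[OF f measurable_mark[unfolded case_prod_unfold]] measurable_accepts[unfolded case_prod_unfold]
  have "(\<lambda>x. if accepts (fst x) (snd x) then \<phi> (clamp_time (fst (fst x))) (fst (snd (fst x))) -
      \<phi> (clamp_time (fst (fst x))) (snd x (clamp_time (fst (fst x)))) else 0) \<in> borel_measurable ?M"
    by measurable
  also have "(\<lambda>x. if accepts (fst x) (snd x) then \<phi> (clamp_time (fst (fst x))) (fst (snd (fst x))) -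
      \<phi> (clamp_time (fst (fst x))) (snd x (clamp_time (fst (fst x)))) else 0) = (\<lambda>(p, \<omega>). jump_gain p \<omega>)"
    using clamp_time(2) by (auto simp: jump_gain_def accepts_def fun_eq_iff)
  finally show ?thesis .
qed

lemma jump_gain_bound: "\<bar>jump_gain p \<omega>\<bar> \<le> 2 * bound_\<phi>"
  using bound_\<phi>[of "fst p" "fst (snd p)"] bound_\<phi>[of "fst p" "\<omega> (fst p)"] bound_\<phi>_nonneg
  by (auto simp: jump_gain_def accepts_def)

text \<open>Averaging over the mark turns the acceptance rule into the rate: a target \<open>j\<close> is accepted for a fraction \<open>q / C\<close> of the
  marks. The diagonal entry is minus the sum of the others, which turns increments of \<open>\<phi>\<close> into the generator.\<close>
lemma integral_marks:
  assumes w: "\<omega> \<in> path_space t0 T" and r: "t0 < r" "r \<le> T"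
  shows "C * (\<Sum>j\<in>UNIV. LINT z:{0..1}|lborel. jump_gain (r, j, z) \<omega>) = rate_term r \<omega>"
proof -
  let ?q = "\<lambda>j. q r \<omega> (\<omega> r) j" and ?i = "\<omega> r"
  have r': "r \<in> {t0..T}" using r by auto
  have one: "C * (LINT z:{0..1}|lborel. jump_gain (r, j, z) \<omega>) = ?q j * (\<phi> r j - \<phi> r ?i)" for j
  proof (cases "j = ?i")
    case False
    have q: "0 \<le> ?q j" "?q j \<le> C" using rate_nonneg[OF r' w, of ?i j] rate_bound[OF r' w, of ?i j] False by auto
    have "(LINT z:{0..1}|lborel. jump_gain (r, j, z) \<omega>) = (LINT z|lborel. indicator {0..?q j / C} z * (\<phi> r j - \<phi> r ?i))"
      unfolding set_lebesgue_integral_def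
    proof (intro Bochner_Integration.integral_cong refl)
      fix z :: real
      have "z * C \<le> ?q j \<longleftrightarrow> z \<le> ?q j / C" using C by (simp add: pos_le_divide_eq)
      moreover have "?q j / C \<le> 1" using q C by simp
      ultimately show "indicator {0..1} z *\<^sub>R jump_gain (r, j, z) \<omega> = indicator {0..?q j / C} z * (\<phi> r j - \<phi> r ?i)"
        using False r by (auto simp: jump_gain_def accepts_def indicator_def)
    qed
    also have "\<dots> = ?q j / C * (\<phi> r j - \<phi> r ?i)" using q C by simp
    finally show ?thesis using C by simp
  qed (simp add: jump_gain_def accepts_def set_lebesgue_integral_def)
  have "C * (\<Sum>j\<in>UNIV. LINT z:{0..1}|lborel. jump_gain (r, j, z) \<omega>) = (\<Sum>j\<in>UNIV. ?q j * (\<phi> r j - \<phi> r ?i))"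
    unfolding sum_distrib_left one ..
  also have "\<dots> = rate_term r \<omega> - (\<Sum>j\<in>UNIV. ?q j) * \<phi> r ?i"
    by (simp add: rate_term_def right_diff_distrib sum_subtractf sum_distrib_right)
  finally show ?thesis using rate_sum[OF r' w] by simp
qed

lemma section_jump_gain_measurable:
  assumes w: "\<omega> \<in> path_space t0 T"
  shows "(\<lambda>y. if s < fst y \<and> fst y \<le> t then jump_gain y \<omega> else 0) \<in> borel_measurable point_space"
proof -
  have [measurable]: "(\<lambda>y. jump_gain y \<omega>) \<in> borel_measurable point_space"
    using measurable_compose[OF measurable_Pair2' measurable_jump_gain, of \<omega>] w by simp
  show ?thesis by measurable
qed

lemma integral_point_gain:
  assumes w: "\<omega> \<in> path_space t0 T" and st: "t0 \<le> s" "s \<le> t" "t \<le> T"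
  shows "C * box_volume * (LINT y|point_law. (if s < fst y \<and> fst y \<le> t then jump_gain y \<omega> else 0)) =
    (LINT r:{s..t}|lborel. rate_term r \<omega>)"
proof -
  let ?f = "\<lambda>y. if s < fst y \<and> fst y \<le> t then jump_gain y \<omega> else 0"
  have "C * box_volume * (LINT y|point_law. ?f y) = C * (LINT r:{t0..T + 1}|lborel. (\<Sum>j\<in>UNIV. LINT z:{0..1}|lborel. ?f (r, j, z)))"
    using jump_gain_bound bound_\<phi>_nonneg
    by (intro integral_point_law[where B="2 * bound_\<phi>"] section_jump_gain_measurable w) auto
  also have "\<dots> = (LINT r:{t0..T + 1}|lborel. C * (\<Sum>j\<in>UNIV. LINT z:{0..1}|lborel. ?f (r, j, z)))"
    by simp
  also have "\<dots> = (LINT r|lborel. indicator {s<..t} r *\<^sub>R rate_term r \<omega>)"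
    unfolding set_lebesgue_integral_def[of _ "{t0..T + 1}"]
  proof (intro Bochner_Integration.integral_cong refl)
    fix r
    show "indicator {t0..T + 1} r *\<^sub>R (C * (\<Sum>j\<in>UNIV. LINT z:{0..1}|lborel. ?f (r, j, z))) = indicator {s<..t} r *\<^sub>R rate_term r \<omega>"
      using integral_marks[OF w, of r] st by (cases "s < r \<and> r \<le> t") (auto simp: indicator_def)
  qed
  also have "\<dots> = (LINT r:{s..t}|lborel. rate_term r \<omega>)"
    unfolding set_lebesgue_integral_def
  proof (rule integral_cong_AE)
    have "set_integrable lborel {s<..t} (\<lambda>r. rate_term r \<omega>)"
      using rate_term_integrable[OF w st(1,3)] by (rule set_integrable_subset) auto
    then show "(\<lambda>r. indicator {s<..t} r *\<^sub>R rate_term r \<omega>) \<in> borel_measurable lborel"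
      unfolding set_integrable_def by (rule borel_measurable_integrable)
    show "(\<lambda>r. indicator {s..t} r *\<^sub>R rate_term r \<omega>) \<in> borel_measurable lborel"
      using rate_term_integrable[OF w st(1,3)] unfolding set_integrable_def by (rule borel_measurable_integrable)
    show "AE r in lborel. indicator {s<..t} r *\<^sub>R rate_term r \<omega> = indicator {s..t} r *\<^sub>R rate_term r \<omega>"
      using AE_lborel_singleton[of s] by eventually_elim (auto split: split_indicator)
  qed
  finally show ?thesis .
qed

lemma compensated_measurable:
  assumes t: "t \<in> {t0..T}"
  shows "compensated t \<in> borel_measurable (path_filtration T t0 t)"
proof -
  have "(\<lambda>\<omega>. \<omega> t) \<in> path_filtration T t0 t \<rightarrow>\<^sub>M count_space (UNIV :: 's set)"
    using measurable_compose[OF measurable_Pair1' joint_evaluation[OF t0T t], of t] t by (simp add: space_restrict_space)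
  then have "(\<lambda>\<omega>. \<phi> t (\<omega> t)) \<in> borel_measurable (path_filtration T t0 t)"
    by (rule measurable_compose) simp
  then show ?thesis
    unfolding compensated_def[abs_def] using t
    by (intro borel_measurable_diff progressive_integral_measurable progressive_generator_term) auto
qed

lemma compensated_bounded:
  obtains B where "\<And>t \<omega>. t \<in> {t0..T} \<Longrightarrow> \<omega> \<in> path_space t0 T \<Longrightarrow> \<bar>compensated t \<omega>\<bar> \<le> B"
proof -
  let ?g = "\<lambda>r. (\<Sum>i\<in>UNIV. \<bar>d i r\<bar>) + CARD('s) * (C * bound_\<phi>)"
  have gi: "set_integrable lborel {t0..T} ?g"
  proof (rule set_integral_add(1))
    show "set_integrable lborel {t0..T} (\<lambda>r. \<Sum>i\<in>UNIV. \<bar>d i r\<bar>)"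
      unfolding set_integrable_def using density by (intro integrable_mult_indicator) auto
    have "integrable lborel (\<lambda>r. CARD('s) * (C * bound_\<phi>) * indicator {t0..T} r)"
      by (intro integrable_mult_right integrable_real_indicator) (auto simp: t0T)
    then show "set_integrable lborel {t0..T} (\<lambda>r. CARD('s) * (C * bound_\<phi>))"
      by (simp add: set_integrable_def mult.commute)
  qed
  have "\<bar>compensated t \<omega>\<bar> \<le> bound_\<phi> + (LINT r:{t0..T}|lborel. ?g r)" if t: "t \<in> {t0..T}" and w: "\<omega> \<in> path_space t0 T" for t \<omega>
  proof -
    have gt: "\<bar>generator_term r \<omega>\<bar> \<le> ?g r" if "r \<in> {t0..T}" for r
    proof -
      have "\<bar>d (\<omega> r) r\<bar> \<le> (\<Sum>i\<in>UNIV. \<bar>d i r\<bar>)" by (rule member_le_sum) auto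
      then show ?thesis unfolding generator_term_def using rate_term_bound[OF that w] by linarith
    qed
    have int: "set_integrable lborel {t0..t} (\<lambda>r. generator_term r \<omega>)" using t by (intro generator_term_integrable w) auto
    have "\<bar>LINT r:{t0..t}|lborel. generator_term r \<omega>\<bar> \<le> (LINT r:{t0..t}|lborel. \<bar>generator_term r \<omega>\<bar>)"
      unfolding set_lebesgue_integral_def by (rule order_trans[OF integral_abs_bound]) (simp add: abs_mult)
    also have "\<dots> \<le> (LINT r:{t0..t}|lborel. ?g r)"
      using t gt by (intro set_integral_mono set_integrable_abs int set_integrable_subset[OF gi]) auto
    also have "\<dots> \<le> (LINT r:{t0..T}|lborel. ?g r)"
    proof -
      have "0 \<le> ?g r" for r using bound_\<phi>_nonneg C by (intro add_nonneg_nonneg sum_nonneg) auto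
      then show ?thesis
        using t gi set_integrable_subset[OF gi, of "{t0..t}"] unfolding set_lebesgue_integral_def set_integrable_def
        by (intro integral_mono) (auto split: split_indicator)
    qed
    finally show ?thesis using bound_\<phi>[OF t, of "\<omega> t"] by (auto simp: compensated_def)
  qed
  then show thesis using that by blast
qed

lemma compensated_borel:
  assumes t: "t \<in> {t0..T}"
  shows "compensated t \<in> borel_measurable (path_borel t0 T)"
  using compensated_measurable[OF t] path_filtration_borel[OF t0T t] measurable_mono[of borel borel "path_filtration T t0 t" "path_borel t0 T"]
  by (auto simp: t0T)

lemma compensated_integrable:
  assumes t: "t \<in> {t0..T}"
  shows "integrable chain_law (compensated t)"
proof -
  interpret prob_space chain_law by (rule prob_space_chain_law)
  obtain B where "\<And>t \<omega>. t \<in> {t0..T} \<Longrightarrow> \<omega> \<in> path_space t0 T \<Longrightarrow> \<bar>compensated t \<omega>\<bar> \<le> B" using compensated_bounded by blast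
  then show ?thesis using t compensated_borel[OF t]
    by (intro integrable_const_bound[where B=B]) (auto intro!: AE_I2 simp: sets_chain_law measurable_cong_sets[OF sets_chain_law(1) refl])
qed

text \<open>By the decomposition of the increment, what remains of it after the drift is a sum over the points of the configuration. The Mecke
  formula equates its expectation with that of the integral of \<open>jump_gain\<close> over the intensity, which is the integrated rate term.\<close>
theorem compensated_increment_zero:
  assumes st: "t0 \<le> s" "s \<le> t" "t \<le> T" and A: "A \<in> sets (path_filtration T t0 s)"
  shows "(LINT \<omega>:A|chain_law. compensated t \<omega> - compensated s \<omega>) = 0"
proof -
  have c: "C * box_volume > 0" using C box_volume_pos by simp
  note nu = prob_space_point_law
  interpret PC: prob_space configurations by (rule prob_space_poisson_configuration[OF c nu])
  let ?W = "\<lambda>p. config_path (fst p) (snd p)"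
  have Wm: "?W \<in> configurations \<rightarrow>\<^sub>M path_borel t0 T" using measurable_config by (simp add: case_prod_unfold)
  have s: "s \<in> {t0..T}" and t: "t \<in> {t0..T}" using st by auto
  have Ab: "A \<in> sets (path_borel t0 T)" using A path_filtration_borel[OF t0T s] by blast
  define F where "F y n x = indicator A (config_path n x) * (if s < fst y \<and> fst y \<le> t then jump_gain y (config_path n x) else 0)"
    for y n and x :: "nat \<Rightarrow> real \<times> 's \<times> real"
  have Fm: "(\<lambda>(y, x). F y n x) \<in> borel_measurable (point_law \<Otimes>\<^sub>M PiM UNIV (\<lambda>_. point_law))" for n
  proof -
    let ?N = "point_law \<Otimes>\<^sub>M PiM UNIV (\<lambda>_::nat. point_law)"
    have fst': "fst \<in> ?N \<rightarrow>\<^sub>M point_space"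
      by (subst measurable_cong_sets[OF refl sets_point_law[symmetric]]) (rule measurable_fst)
    have snd': "(\<lambda>z. config_path n (snd z)) \<in> ?N \<rightarrow>\<^sub>M path_borel t0 T"
      by (rule measurable_compose[OF measurable_snd measurable_config_path[OF sets_point_law]])
    have [measurable]: "(\<lambda>z. jump_gain (fst z) (config_path n (snd z))) \<in> borel_measurable ?N"
      using measurable_compose[OF measurable_Pair[OF fst' snd'] measurable_jump_gain] by simp
    have [measurable]: "(\<lambda>z. indicator A (config_path n (snd z)) :: real) \<in> borel_measurable ?N"
      using measurable_compose[OF snd' borel_measurable_indicator[OF Ab]] by simp
    have [measurable]: "(\<lambda>z. fst (fst z)) \<in> borel_measurable ?N"
      by (rule measurable_compose[OF fst']) simp
    show ?thesis unfolding F_def case_prod_unfold by measurable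
  qed
  have Fb: "\<bar>F y n x\<bar> \<le> 2 * bound_\<phi>" for y n x
    using jump_gain_bound[of y "config_path n x"] bound_\<phi>_nonneg by (auto simp: F_def indicator_def)
  let ?S = "\<lambda>p. \<Sum>k<fst p. F (snd p k) (fst p - 1) (snd p \<circ> skip_index k)"
  have M: "has_bochner_integral configurations ?S (C * box_volume * (LINT p|configurations. LINT y|point_law. F y (fst p) (snd p)))"
    using Mecke[OF c nu Fm Fb] by (simp add: case_prod_unfold)
  let ?R = "\<lambda>p. indicator A (?W p) * (LINT r:{s..t}|lborel. rate_term r (?W p))"
  have "C * box_volume * (LINT y|point_law. F y n x) = indicator A (config_path n x) * (LINT r:{s..t}|lborel. rate_term r (config_path n x))" for n x
    using integral_point_gain[OF config_path_mem st, of n x] by (simp add: F_def indicator_def)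
  then have e: "C * box_volume * (LINT p|configurations. LINT y|point_law. F y (fst p) (snd p)) = (LINT p|configurations. ?R p)"
    by (subst Bochner_Integration.integral_mult_right_zero[symmetric]) simp
  have Gm: "(\<lambda>\<omega>. indicator A \<omega> * (compensated t \<omega> - compensated s \<omega>)) \<in> borel_measurable (path_borel t0 T)"
    by (intro borel_measurable_times borel_measurable_indicator Ab borel_measurable_diff compensated_borel s t)
  have Di: "integrable configurations (\<lambda>p. indicator A (?W p) * (compensated t (?W p) - compensated s (?W p)))"
  proof -
    have "integrable chain_law (\<lambda>\<omega>. indicator A \<omega> *\<^sub>R (compensated t \<omega> - compensated s \<omega>))"
      using Ab by (intro integrable_mult_indicator Bochner_Integration.integrable_diff compensated_integrable s t) (simp add: sets_chain_law)
    then show ?thesis unfolding chain_law_def case_prod_unfold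
      by (subst (asm) integrable_distr_eq[OF Wm]) (use Gm in auto)
  qed
  have AE: "AE p in configurations. indicator A (?W p) * (compensated t (?W p) - compensated s (?W p)) = ?S p - ?R p"
  proof -
    have "fst \<in> borel_measurable point_law"
      by (subst measurable_cong_sets[OF sets_point_law refl]) simp
    then have "AE p in configurations. inj_on (\<lambda>i. fst (snd p i)) {..<fst p}"
      using AE_poisson_configuration_distinct[OF c nu _ point_law_diffuse] by (simp add: case_prod_unfold)
    then show ?thesis
    proof eventually_elim
      case (elim p)
      have "indicator A (?W p) * (compensated t (?W p) - compensated s (?W p)) =
          indicator A (?W p) * (\<phi> t (?W p t) - \<phi> s (?W p s) - (LINT r:{s..t}|lborel. d (?W p r) r) - (LINT r:{s..t}|lborel. rate_term r (?W p)))"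
        by (simp only: compensated_diff[OF config_path_mem st])
      also have "\<dots> = indicator A (?W p) * (\<phi> t (?W p t) - \<phi> s (?W p s) - (LINT r:{s..t}|lborel. d (?W p r) r)) - ?R p"
        by (rule right_diff_distrib)
      also have "indicator A (?W p) * (\<phi> t (?W p t) - \<phi> s (?W p s) - (LINT r:{s..t}|lborel. d (?W p r) r)) = ?S p"
        using config_path_increment[OF elim st A] by (simp only: F_def)
      finally show ?case .
    qed
  qed
  have Ri: "integrable configurations ?R"
  proof -
    have "integrable configurations (\<lambda>p. ?S p - indicator A (?W p) * (compensated t (?W p) - compensated s (?W p)))"
      using M Di by (intro Bochner_Integration.integrable_diff) (auto simp: has_bochner_integral_iff)
    moreover have "?R \<in> borel_measurable configurations"
    proof -
      have "(\<lambda>\<omega>. LINT r:{t0..u}|lborel. rate_term r \<omega>) \<in> borel_measurable (path_borel t0 T)" if u: "u \<in> {t0..T}" for u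
        using progressive_integral_measurable[OF progressive_rate_term[OF u]] u path_filtration_borel[OF t0T u]
          measurable_mono[of borel borel "path_filtration T t0 u" "path_borel t0 T"] by (auto simp: t0T)
      note m = this[OF t] this[OF s]
      have "(\<lambda>\<omega>. indicator A \<omega> * ((LINT r:{t0..t}|lborel. rate_term r \<omega>) - (LINT r:{t0..s}|lborel. rate_term r \<omega>))) \<in> borel_measurable (path_borel t0 T)"
        using m Ab by measurable
      then have "(\<lambda>p. indicator A (?W p) * ((LINT r:{t0..t}|lborel. rate_term r (?W p)) - (LINT r:{t0..s}|lborel. rate_term r (?W p)))) \<in> borel_measurable configurations"
        by (rule measurable_compose[OF Wm])
      also have "(\<lambda>p. indicator A (?W p) * ((LINT r:{t0..t}|lborel. rate_term r (?W p)) - (LINT r:{t0..s}|lborel. rate_term r (?W p)))) = ?R"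
      proof
        fix p
        show "indicator A (?W p) * ((LINT r:{t0..t}|lborel. rate_term r (?W p)) - (LINT r:{t0..s}|lborel. rate_term r (?W p))) = ?R p"
          using integral_split[OF rate_term_integrable[OF config_path_mem], of t0 t s "fst p" "snd p"] st by simp
      qed
      finally show ?thesis .
    qed
    ultimately show ?thesis
      by (rule integrable_cong_AE_imp) (use AE in eventually_elim, auto)
  qed
  have "(LINT \<omega>:A|chain_law. compensated t \<omega> - compensated s \<omega>) =
      (LINT p|configurations. indicator A (?W p) * (compensated t (?W p) - compensated s (?W p)))"
    unfolding set_lebesgue_integral_def chain_law_def case_prod_unfold
    by (subst integral_distr[OF Wm]) (use Gm in auto)
  also have "\<dots> = (LINT p|configurations. ?S p - ?R p)"
    using AE Di M Ri by (intro integral_cong_AE borel_measurable_integrable) (auto simp: has_bochner_integral_iff)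
  also have "\<dots> = (LINT p|configurations. ?S p) - (LINT p|configurations. ?R p)"
    using M Ri by (intro Bochner_Integration.integral_diff) (auto simp: has_bochner_integral_iff)
  also have "\<dots> = 0" using M e by (simp add: has_bochner_integral_iff)
  finally show ?thesis .
qed

end

section \<open>Optional stopping\<close>

text \<open>Rounding up to the grid keeps the stopping property: \<open>\<tau>\<close> is rounded to at most \<open>g\<close> iff \<open>\<tau>\<close> is at most \<open>g\<close> rounded down.\<close>
lemma grid_ceil_level_set:
  assumes ab: "a < b" and sub: "\<And>s t. a \<le> s \<Longrightarrow> s \<le> t \<Longrightarrow> t \<le> b \<Longrightarrow> sets (F s) \<subseteq> sets (F t)"
    and sp: "\<And>t. t \<in> {a..b} \<Longrightarrow> space (F t) = \<Omega>"
    and \<tau>: "\<And>t. t \<in> {a..b} \<Longrightarrow> Measurable.pred (F t) (\<lambda>\<omega>. \<tau> \<omega> \<le> t)"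
    and range: "\<And>\<omega>. \<omega> \<in> \<Omega> \<Longrightarrow> \<tau> \<omega> \<in> {a..b}"
    and g: "g \<in> grid a b n"
  shows "{\<omega> \<in> \<Omega>. grid_ceil a b n (\<tau> \<omega>) = g} \<in> sets (F g)"
proof -
  have le: "{\<omega> \<in> \<Omega>. grid_ceil a b n (\<tau> \<omega>) \<le> g'} \<in> sets (F g)" if g': "g' \<in> grid a b n" "g' \<le> g" for g'
  proof -
    have f: "grid_floor a b n g' \<in> {a..b}" "grid_floor a b n g' \<le> g"
      using grid_floor_mem[OF ab subsetD[OF grid_subset[OF ab] g'(1)]] grid_floor_bounds(1)[OF ab, of n g'] g'(2) by auto
    have gb: "g \<le> b" using subsetD[OF grid_subset[OF ab] g] by simp
    have "{\<omega> \<in> \<Omega>. \<tau> \<omega> \<le> grid_floor a b n g'} \<in> sets (F (grid_floor a b n g'))"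
      using \<tau>[OF f(1)] sp[OF f(1)] by (simp add: pred_def)
    then have "{\<omega> \<in> \<Omega>. \<tau> \<omega> \<le> grid_floor a b n g'} \<in> sets (F g)" using sub[of "grid_floor a b n g'" g] f gb by auto
    then show ?thesis by (simp add: grid_ceil_le_iff[OF ab])
  qed
  have "{\<omega> \<in> \<Omega>. grid_ceil a b n (\<tau> \<omega>) = g} = {\<omega> \<in> \<Omega>. grid_ceil a b n (\<tau> \<omega>) \<le> g} -
     (\<Union>g'\<in>{g' \<in> grid a b n. g' < g}. {\<omega> \<in> \<Omega>. grid_ceil a b n (\<tau> \<omega>) \<le> g'})"
  proof (intro set_eqI iffI)
    fix \<omega> assume w: "\<omega> \<in> {\<omega> \<in> \<Omega>. grid_ceil a b n (\<tau> \<omega>) \<le> g} -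
     (\<Union>g'\<in>{g' \<in> grid a b n. g' < g}. {\<omega> \<in> \<Omega>. grid_ceil a b n (\<tau> \<omega>) \<le> g'})"
    then have "grid_ceil a b n (\<tau> \<omega>) \<in> grid a b n" using range by (intro grid_ceil_in_grid[OF ab]) auto
    then have "\<not> grid_ceil a b n (\<tau> \<omega>) < g" using w by blast
    then show "\<omega> \<in> {\<omega> \<in> \<Omega>. grid_ceil a b n (\<tau> \<omega>) = g}" using w by auto
  qed auto
  also have "\<dots> \<in> sets (F g)"
    using le[OF g order_refl] le by (intro sets.Diff sets.finite_UN) (auto simp: grid_def)
  finally show ?thesis .
qed

lemma martingale_set_integral:
  assumes mart: "is_martingale P F a b X" and P: "prob_space P"
    and sp: "\<And>t. t \<in> {a..b} \<Longrightarrow> space (F t) = space P" and sub: "\<And>t. t \<in> {a..b} \<Longrightarrow> sets (F t) \<subseteq> sets P"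
    and st: "s \<in> {a..b}" "t \<in> {s..b}" and A: "A \<in> sets (F s)"
  shows "(LINT x:A|P. X t x) = (LINT x:A|P. X s x)"
proof -
  interpret prob_space P by fact
  interpret finite_measure_subalgebra P "F s"
    by unfold_locales (use sp[OF st(1)] sub[OF st(1)] in \<open>auto simp: subalgebra_def\<close>)
  have i: "integrable P (X t)" "integrable P (X s)" and ce: "AE \<omega> in P. real_cond_exp P (F s) (X t) \<omega> = X s \<omega>"
    using mart st by (auto simp: is_martingale_def)
  have "(LINT x:A|P. X t x) = (LINT x:A|P. real_cond_exp P (F s) (X t) x)"
    by (rule real_cond_exp_intA[OF i(1) A])
  also have "\<dots> = (LINT x:A|P. X s x)"
    using ce i real_cond_exp_int(1)[OF i(1)] A sub[OF st(1)] unfolding set_lebesgue_integral_def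
    by (intro integral_cong_AE) auto
  finally show ?thesis .
qed

text \<open>For a stopping time with values in a finite grid the value at time \<open>b\<close> may replace the value at the stopping time on each of its
  level sets. The stopping time is the limit from above of its roundings to the grid, and the bound on the process allows
  dominated convergence.\<close>
theorem optional_stopping:
  fixes X :: "real \<Rightarrow> 'a \<Rightarrow> real"
  assumes mart: "is_martingale P F a b X" and P: "prob_space P" and ab: "a \<le> b"
    and sp: "\<And>t. t \<in> {a..b} \<Longrightarrow> space (F t) = space P" and sub: "\<And>t. t \<in> {a..b} \<Longrightarrow> sets (F t) \<subseteq> sets P"
    and mono: "\<And>s t. a \<le> s \<Longrightarrow> s \<le> t \<Longrightarrow> t \<le> b \<Longrightarrow> sets (F s) \<subseteq> sets (F t)"
    and \<tau>: "\<And>t. t \<in> {a..b} \<Longrightarrow> Measurable.pred (F t) (\<lambda>\<omega>. \<tau> \<omega> \<le> t)"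
    and \<tau>_range: "\<And>\<omega>. \<omega> \<in> space P \<Longrightarrow> \<tau> \<omega> \<in> {a..b}"
    and right: "\<And>\<omega> t u. \<omega> \<in> space P \<Longrightarrow> t \<in> {a..b} \<Longrightarrow> (\<And>n :: nat. u n \<in> {t..b}) \<Longrightarrow> u \<longlonglongrightarrow> t \<Longrightarrow> (\<lambda>n. X (u n) \<omega>) \<longlonglongrightarrow> X t \<omega>"
    and bound: "\<And>\<omega> t. \<omega> \<in> space P \<Longrightarrow> t \<in> {a..b} \<Longrightarrow> \<bar>X t \<omega>\<bar> \<le> B"
  shows "integrable P (\<lambda>\<omega>. X (\<tau> \<omega>) \<omega>)" and "(LINT \<omega>|P. X (\<tau> \<omega>) \<omega>) = (LINT \<omega>|P. X a \<omega>)"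
proof -
  interpret prob_space P by fact
  have Xi: "integrable P (X t)" if "t \<in> {a..b}" for t using mart that by (auto simp: is_martingale_def)
  have E: "(LINT \<omega>|P. X b \<omega>) = (LINT \<omega>|P. X a \<omega>)"
  proof -
    have "space P \<in> sets (F a)" using sp[of a] ab sets.top[of "F a"] by auto
    from martingale_set_integral[OF mart P sp sub _ _ this, of b] ab show ?thesis
      by (simp add: set_integral_space[OF Xi])
  qed
  have "integrable P (\<lambda>\<omega>. X (\<tau> \<omega>) \<omega>) \<and> (LINT \<omega>|P. X (\<tau> \<omega>) \<omega>) = (LINT \<omega>|P. X a \<omega>)"
  proof (cases "a = b")
    case True
    then have "X (\<tau> \<omega>) \<omega> = X a \<omega>" if "\<omega> \<in> space P" for \<omega> using \<tau>_range[OF that] by simp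
    then show ?thesis using Xi[of a] ab
      by (auto cong: Bochner_Integration.integrable_cong Bochner_Integration.integral_cong)
  next
    case False
    then have ab': "a < b" using ab by simp
    let ?c = "grid_ceil a b" and ?G = "grid a b"
    have finG: "finite (?G n)" for n by (simp add: grid_def)
    have cG: "?c n (\<tau> \<omega>) \<in> ?G n" if "\<omega> \<in> space P" for n \<omega>
      using \<tau>_range[OF that] by (rule grid_ceil_in_grid[OF ab'])
    have Gab: "g \<in> {a..b}" if "g \<in> ?G n" for g n using grid_subset[OF ab'] that by blast
    have lev: "{\<omega> \<in> space P. ?c n (\<tau> \<omega>) = g} \<in> sets (F g)" if "g \<in> ?G n" for n g
      by (rule grid_ceil_level_set[OF ab' mono sp \<tau> \<tau>_range that])
    have levP: "{\<omega> \<in> space P. ?c n (\<tau> \<omega>) = g} \<in> sets P" if "g \<in> ?G n" for n g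
      using lev[OF that] sub[OF Gab[OF that]] by blast
    have step: "X (?c n (\<tau> \<omega>)) \<omega> = (\<Sum>g\<in>?G n. indicator {\<omega> \<in> space P. ?c n (\<tau> \<omega>) = g} \<omega> *\<^sub>R X g \<omega>)" if "\<omega> \<in> space P" for n \<omega>
      using that cG[OF that, of n] finG[of n] by (simp add: indicator_def if_distrib[where f="\<lambda>x. x * _"] sum.delta' cong: if_cong)
    have int1: "integrable P (\<lambda>\<omega>. indicator {\<omega> \<in> space P. ?c n (\<tau> \<omega>) = g} \<omega> *\<^sub>R X u \<omega>)" if "g \<in> ?G n" "u \<in> {a..b}" for n g u
      using levP[OF that(1)] Xi[OF that(2)] by (rule integrable_mult_indicator)
    have intn: "integrable P (\<lambda>\<omega>. X (?c n (\<tau> \<omega>)) \<omega>)" for n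
      using int1 Gab by (subst Bochner_Integration.integrable_cong[OF refl step]) auto
    have En: "(LINT \<omega>|P. X (?c n (\<tau> \<omega>)) \<omega>) = (LINT \<omega>|P. X a \<omega>)" for n
    proof -
      have "(LINT \<omega>|P. X (?c n (\<tau> \<omega>)) \<omega>) = (\<Sum>g\<in>?G n. LINT \<omega>|P. indicator {\<omega> \<in> space P. ?c n (\<tau> \<omega>) = g} \<omega> *\<^sub>R X g \<omega>)"
        using int1 Gab by (subst Bochner_Integration.integral_cong[OF refl step]) (auto intro!: Bochner_Integration.integral_sum)
      also have "\<dots> = (\<Sum>g\<in>?G n. LINT \<omega>|P. indicator {\<omega> \<in> space P. ?c n (\<tau> \<omega>) = g} \<omega> *\<^sub>R X b \<omega>)"
        using martingale_set_integral[OF mart P sp sub _ _ lev, of _ b] Gab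
        by (intro sum.cong refl) (auto simp: set_lebesgue_integral_def)
      also have "\<dots> = (LINT \<omega>|P. (\<Sum>g\<in>?G n. indicator {\<omega> \<in> space P. ?c n (\<tau> \<omega>) = g} \<omega> *\<^sub>R X b \<omega>))"
        using int1 ab by (intro Bochner_Integration.integral_sum[symmetric]) auto
      also have "\<dots> = (LINT \<omega>|P. X b \<omega>)"
      proof (intro Bochner_Integration.integral_cong refl)
        fix \<omega> assume w: "\<omega> \<in> space P"
        show "(\<Sum>g\<in>?G n. indicator {\<omega> \<in> space P. ?c n (\<tau> \<omega>) = g} \<omega> *\<^sub>R X b \<omega>) = X b \<omega>"
          using w cG[OF w, of n] finG[of n] by (simp add: indicator_def if_distrib[where f="\<lambda>x. x * _"] sum.delta' cong: if_cong)
      qed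
      finally show ?thesis using E by simp
    qed
    have conv: "(\<lambda>n. X (?c n (\<tau> \<omega>)) \<omega>) \<longlonglongrightarrow> X (\<tau> \<omega>) \<omega>" if w: "\<omega> \<in> space P" for \<omega>
    proof (rule right[OF w \<tau>_range[OF w]])
      show "?c n (\<tau> \<omega>) \<in> {\<tau> \<omega>..b}" for n
        using grid_ceil_bounds(1)[OF ab', of "\<tau> \<omega>" n] Gab[OF cG[OF w, of n]] by auto
      have "(\<lambda>n. (b - a) / Suc n) \<longlonglongrightarrow> 0" by (rule LIMSEQ_Suc[OF lim_const_over_n])
      then have "(\<lambda>n. \<tau> \<omega> + (b - a) / Suc n) \<longlonglongrightarrow> \<tau> \<omega> + 0" by (intro tendsto_intros)
      then have up: "(\<lambda>n. \<tau> \<omega> + (b - a) / Suc n) \<longlonglongrightarrow> \<tau> \<omega>" by simp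
      show "(\<lambda>n. ?c n (\<tau> \<omega>)) \<longlonglongrightarrow> \<tau> \<omega>"
      proof (rule tendsto_sandwich[OF _ _ tendsto_const up])
        show "\<forall>\<^sub>F n in sequentially. \<tau> \<omega> \<le> ?c n (\<tau> \<omega>)"
          using grid_ceil_bounds(1)[OF ab'] by (rule eventuallyI)
        show "\<forall>\<^sub>F n in sequentially. ?c n (\<tau> \<omega>) \<le> \<tau> \<omega> + (b - a) / Suc n"
          using less_imp_le[OF grid_ceil_bounds(2)[OF ab']] by (rule eventuallyI)
      qed
    qed
    have meas: "(\<lambda>\<omega>. X (\<tau> \<omega>) \<omega>) \<in> borel_measurable P"
      using conv borel_measurable_integrable[OF intn] by (rule borel_measurable_LIMSEQ_real)
    have dom: "AE \<omega> in P. norm (X (?c n (\<tau> \<omega>)) \<omega>) \<le> B" for n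
    proof (rule AE_I2)
      fix \<omega> assume "\<omega> \<in> space P"
      then show "norm (X (?c n (\<tau> \<omega>)) \<omega>) \<le> B" using bound[OF _ Gab[OF cG]] by simp
    qed
    have "integrable P (\<lambda>\<omega>. X (\<tau> \<omega>) \<omega>)"
      using meas bound \<tau>_range by (intro integrable_const_bound[where B=B]) (auto intro!: AE_I2)
    moreover have "(\<lambda>n. LINT \<omega>|P. X (?c n (\<tau> \<omega>)) \<omega>) \<longlonglongrightarrow> (LINT \<omega>|P. X (\<tau> \<omega>) \<omega>)"
      using meas intn conv dom
      by (intro integral_dominated_convergence[where w="\<lambda>_. B"]) (auto intro!: AE_I2)
    then have "(LINT \<omega>|P. X (\<tau> \<omega>) \<omega>) = (LINT \<omega>|P. X a \<omega>)"
      unfolding En using LIMSEQ_unique tendsto_const by blast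
    ultimately show ?thesis by blast
  qed
  then show "integrable P (\<lambda>\<omega>. X (\<tau> \<omega>) \<omega>)" "(LINT \<omega>|P. X (\<tau> \<omega>) \<omega>) = (LINT \<omega>|P. X a \<omega>)" by auto
qed

section \<open>Measurability of continuous functions of controls\<close>

text \<open>The index of the first net point close to \<open>\<alpha> x\<close> depends measurably on \<open>x\<close>. Since a strategy thereby becomes a
  limit of countably valued ones, continuous functions of two strategies are measurable although the Borel sets of a product of
  metric spaces may be larger than the product of the Borel sets.\<close>
lemma compact_control_approx:
  fixes \<alpha> :: "'x \<Rightarrow> 'c::metric_space"
  assumes K: "compact K" "K \<noteq> {}" and \<alpha>: "\<alpha> \<in> M \<rightarrow>\<^sub>M restrict_space borel K"
  obtains k :: "nat \<Rightarrow> nat \<Rightarrow> 'c" and i :: "nat \<Rightarrow> 'x \<Rightarrow> nat" where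
    "\<And>n j. k n j \<in> K" "\<And>n. i n \<in> M \<rightarrow>\<^sub>M count_space UNIV"
    "\<And>x. x \<in> space M \<Longrightarrow> (\<lambda>n. k n (i n x)) \<longlonglongrightarrow> \<alpha> x"
proof -
  have \<alpha>b: "\<alpha> \<in> borel_measurable M" and \<alpha>K: "\<And>x. x \<in> space M \<Longrightarrow> \<alpha> x \<in> K"
    using \<alpha> measurable_space[OF \<alpha>] by (auto simp: measurable_restrict_space2_iff space_restrict_space)
  have "\<exists>k :: nat \<Rightarrow> 'c. range k \<subseteq> K \<and> (\<forall>x\<in>K. \<exists>j. dist x (k j) < 1 / Suc n)" for n :: nat
  proof -
    obtain D where D: "D \<subseteq> K" "finite D" "K \<subseteq> (\<Union>c\<in>D. ball c (1 / Suc n))"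
      by (rule compactE_image[OF K(1), of K "\<lambda>c. ball c (1 / Suc n)"]) auto
    have ne: "D \<noteq> {}" using D(3) K(2) by auto
    have r: "range (from_nat_into D) = D" using ne D(2) by (intro range_from_nat_into countable_finite)
    show ?thesis
    proof (intro exI[of _ "from_nat_into D"] conjI ballI)
      show "range (from_nat_into D) \<subseteq> K" using r D(1) by simp
      fix x assume "x \<in> K"
      then obtain c where c: "c \<in> D" "dist c x < 1 / Suc n" using D(3) by auto
      then obtain j where "c = from_nat_into D j" using r by (metis rangeE)
      then show "\<exists>j. dist x (from_nat_into D j) < 1 / Suc n" using c by (auto simp: dist_commute)
    qed
  qed
  then have "\<forall>n. \<exists>k :: nat \<Rightarrow> 'c. range k \<subseteq> K \<and> (\<forall>x\<in>K. \<exists>j. dist x (k j) < 1 / Suc n)" by blast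
  then obtain k :: "nat \<Rightarrow> nat \<Rightarrow> 'c" where "\<forall>n. range (k n) \<subseteq> K \<and> (\<forall>x\<in>K. \<exists>j. dist x (k n j) < 1 / Suc n)" by (rule choice[THEN exE])
  then have k: "\<And>n. range (k n) \<subseteq> K" "\<And>n x. x \<in> K \<Longrightarrow> \<exists>j. dist x (k n j) < 1 / Suc n" by blast+
  define i where "i n x = (LEAST j. dist (\<alpha> x) (k n j) < 1 / real (Suc n))" for n x
  show thesis
  proof (rule that[of k i])
    show "k n j \<in> K" for n j using k(1) by blast
    show "i n \<in> M \<rightarrow>\<^sub>M count_space UNIV" for n
    proof -
      have "Measurable.pred M (\<lambda>x. dist (\<alpha> x) (k n j) < 1 / Suc n)" for j
      proof -
        have "\<alpha> -` ball (k n j) (1 / Suc n) \<inter> space M \<in> sets M" by (rule measurable_sets[OF \<alpha>b]) auto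
        moreover have "\<alpha> -` ball (k n j) (1 / Suc n) \<inter> space M = {x \<in> space M. dist (\<alpha> x) (k n j) < 1 / Suc n}"
          by (auto simp: dist_commute)
        ultimately show ?thesis by (simp add: pred_def)
      qed
      then show ?thesis unfolding i_def[abs_def] by (rule measurable_Least)
    qed
    fix x assume "x \<in> space M"
    then have "dist (\<alpha> x) (k n (i n x)) < 1 / Suc n" for n
      unfolding i_def by (rule LeastI_ex[OF k(2)[OF \<alpha>K]])
    then have le: "dist (k n (i n x)) (\<alpha> x) \<le> 1 / real (Suc n)" for n by (simp add: dist_commute less_imp_le)
    have lim: "(\<lambda>n. 1 / real (Suc n)) \<longlonglongrightarrow> 0" by (rule LIMSEQ_Suc[OF lim_1_over_n])
    have "(\<lambda>n. dist (k n (i n x)) (\<alpha> x)) \<longlonglongrightarrow> 0"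
    proof (rule tendsto_sandwich[OF _ _ tendsto_const lim])
      show "\<forall>\<^sub>F n in sequentially. 0 \<le> dist (k n (i n x)) (\<alpha> x)" by simp
      show "\<forall>\<^sub>F n in sequentially. dist (k n (i n x)) (\<alpha> x) \<le> 1 / real (Suc n)" using le by (rule eventuallyI)
    qed
    then show "(\<lambda>n. k n (i n x)) \<longlonglongrightarrow> \<alpha> x" by (rule tendsto_dist_iff[THEN iffD2])
  qed
qed

lemma continuous_controls_measurable:
  fixes f :: "real \<times> 'u::metric_space \<times> 'v::metric_space \<Rightarrow> real"
  assumes f: "continuous_on ({a..b} \<times> U \<times> V) f"
    and U: "compact U" "U \<noteq> {}" and V: "compact V" "V \<noteq> {}"
    and \<tau>: "\<tau> \<in> M \<rightarrow>\<^sub>M restrict_space borel {a..b}"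
    and \<alpha>: "\<alpha> \<in> M \<rightarrow>\<^sub>M restrict_space borel U" and \<beta>: "\<beta> \<in> M \<rightarrow>\<^sub>M restrict_space borel V"
  shows "(\<lambda>x. f (\<tau> x, \<alpha> x, \<beta> x)) \<in> borel_measurable M"
proof -
  obtain k i where k: "\<And>n j. k n j \<in> U" "\<And>n. i n \<in> M \<rightarrow>\<^sub>M count_space (UNIV :: nat set)"
    "\<And>x. x \<in> space M \<Longrightarrow> (\<lambda>n. k n (i n x)) \<longlonglongrightarrow> \<alpha> x" by (rule compact_control_approx[OF U \<alpha>]) (rule that)
  obtain l j where l: "\<And>n i. l n i \<in> V" "\<And>n. j n \<in> M \<rightarrow>\<^sub>M count_space (UNIV :: nat set)"
    "\<And>x. x \<in> space M \<Longrightarrow> (\<lambda>n. l n (j n x)) \<longlonglongrightarrow> \<beta> x" by (rule compact_control_approx[OF V \<beta>]) (rule that)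
  have m0: "(\<lambda>x. f (\<tau> x, u, v)) \<in> borel_measurable M" if "u \<in> U" "v \<in> V" for u v
  proof (rule measurable_compose[OF \<tau>], rule borel_measurable_continuous_on_restrict)
    show "continuous_on {a..b} (\<lambda>t. f (t, u, v))"
      using that by (intro continuous_on_compose2[OF f] continuous_intros) auto
  qed
  have m1: "(\<lambda>x. f (\<tau> x, k n (i n x), v)) \<in> borel_measurable M" if "v \<in> V" for n v
    by (rule measurable_compose_countable[where f="\<lambda>i x. f (\<tau> x, k n i, v)", OF _ k(2)]) (rule m0[OF k(1) that])
  have m: "(\<lambda>x. f (\<tau> x, k n (i n x), l n (j n x))) \<in> borel_measurable M" for n
    by (rule measurable_compose_countable[where f="\<lambda>j x. f (\<tau> x, k n (i n x), l n j)", OF _ l(2)]) (rule m1[OF l(1)])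
  show ?thesis
  proof (rule borel_measurable_LIMSEQ_real[OF _ m])
    fix x assume x: "x \<in> space M"
    have mem: "\<tau> x \<in> {a..b}" "\<alpha> x \<in> U" "\<beta> x \<in> V"
      using measurable_space[OF \<tau> x] measurable_space[OF \<alpha> x] measurable_space[OF \<beta> x] by (auto simp: space_restrict_space)
    show "(\<lambda>n. f (\<tau> x, k n (i n x), l n (j n x))) \<longlonglongrightarrow> f (\<tau> x, \<alpha> x, \<beta> x)"
      using mem k(1) l(1) by (intro continuous_on_tendsto_compose[OF f] tendsto_intros k(3) l(3) x) auto
  qed
qed

section \<open>The compensated process along a path\<close>

context test_process
begin

lemma compensated_right_continuous:
  assumes w: "\<omega> \<in> path_space t0 T" and t: "t \<in> {t0..T}" and u: "\<And>n :: nat. u n \<in> {t..T}" "u \<longlonglongrightarrow> t"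
  shows "(\<lambda>n. compensated (u n) \<omega>) \<longlonglongrightarrow> compensated t \<omega>"
proof -
  have "\<forall>\<^sub>F n in sequentially. \<omega> (u n) = \<omega> t"
  proof (cases "t = T")
    case True
    then have "u n = t" for n using u(1)[of n] by simp
    then show ?thesis by simp
  next
    case False
    then have "t0 \<le> t" "t < T" using t by auto
    then obtain v where v: "v > t" "\<forall>s. t \<le> s \<longrightarrow> s < v \<longrightarrow> \<omega> s = \<omega> t"
      using path_space_right[OF w] by blast
    have "\<forall>\<^sub>F n in sequentially. u n < v" using order_tendstoD(2)[OF u(2) v(1)] .
    then show ?thesis by eventually_elim (use v(2) u(1) in auto)
  qed
  moreover have "u n \<in> {t0..T}" for n using u(1)[of n] t by auto
  then have "(\<lambda>n. \<phi> (u n) (\<omega> t)) \<longlonglongrightarrow> \<phi> t (\<omega> t)"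
    by (intro continuous_on_tendsto_compose[OF \<phi>_cont u(2) t] eventuallyI)
  ultimately have 1: "(\<lambda>n. \<phi> (u n) (\<omega> (u n))) \<longlonglongrightarrow> \<phi> t (\<omega> t)"
    by (elim Lim_transform_eventually) (auto elim!: eventually_mono)
  have int: "integrable lborel (\<lambda>r. indicator {t0..T} r *\<^sub>R generator_term r \<omega>)"
    using generator_term_integrable[OF w, of t0 T] by (simp add: set_integrable_def)
  have m: "(\<lambda>r. indicator {t0..s} r *\<^sub>R generator_term r \<omega>) \<in> borel_measurable lborel" if "s \<in> {t0..T}" for s
    using generator_term_integrable[OF w, of t0 s] that unfolding set_integrable_def by (intro borel_measurable_integrable) auto
  have 2: "(\<lambda>n. LINT r:{t0..u n}|lborel. generator_term r \<omega>) \<longlonglongrightarrow> (LINT r:{t0..t}|lborel. generator_term r \<omega>)"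
    unfolding set_lebesgue_integral_def
  proof (rule integral_dominated_convergence[where w="\<lambda>r. \<bar>indicator {t0..T} r *\<^sub>R generator_term r \<omega>\<bar>"])
    show "AE r in lborel. (\<lambda>n. indicator {t0..u n} r *\<^sub>R generator_term r \<omega>) \<longlonglongrightarrow> indicator {t0..t} r *\<^sub>R generator_term r \<omega>"
    proof (rule AE_I2)
      fix r
      have "\<forall>\<^sub>F n in sequentially. indicator {t0..u n} r = (indicator {t0..t} r :: real)"
      proof (cases "r \<le> t")
        case True
        then have "r \<le> u n" for n using u(1)[of n] by auto
        then show ?thesis using True by (simp add: indicator_def)
      next
        case False
        then have "\<forall>\<^sub>F n in sequentially. u n < r" using order_tendstoD(2)[OF u(2), of r] by simp
        then show ?thesis by eventually_elim (use False in \<open>auto simp: indicator_def\<close>)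
      qed
      then show "(\<lambda>n. indicator {t0..u n} r *\<^sub>R generator_term r \<omega>) \<longlonglongrightarrow> indicator {t0..t} r *\<^sub>R generator_term r \<omega>"
        by (intro tendsto_eventually) (auto elim!: eventually_mono)
    qed
    show "AE r in lborel. norm (indicator {t0..u n} r *\<^sub>R generator_term r \<omega>) \<le> \<bar>indicator {t0..T} r *\<^sub>R generator_term r \<omega>\<bar>" for n
      using u(1)[of n] by (intro AE_I2) (auto split: split_indicator)
    show "integrable lborel (\<lambda>r. \<bar>indicator {t0..T} r *\<^sub>R generator_term r \<omega>\<bar>)" using int by (rule integrable_abs)
    show "(\<lambda>r. indicator {t0..u n} r *\<^sub>R generator_term r \<omega>) \<in> borel_measurable lborel" for n
      using u(1)[of n] t by (intro m) auto
  qed (use m t in auto)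
  show ?thesis unfolding compensated_def by (intro tendsto_diff 1 2)
qed

lemma compensated_start: "compensated t0 \<omega> = \<phi> t0 (\<omega> t0)"
proof -
  have "(LINT r:{t0..t0}|lborel. generator_term r \<omega>) = 0"
    unfolding set_lebesgue_integral_def
  proof (rule integral_eq_zero_AE)
    show "AE r in lborel. indicator {t0..t0} r *\<^sub>R generator_term r \<omega> = 0"
      using AE_lborel_singleton[of t0] by eventually_elim (simp add: indicator_def)
  qed
  then show ?thesis by (simp add: compensated_def)
qed

end

text \<open>Passes from integrands given by \<open>deriv\<close>, on whose values at exceptional times nothing is known, to Borel integrands
  that agree with them almost everywhere.\<close>
lemma lebesgue_integral_lborel_cong:
  fixes f f' :: "real \<Rightarrow> real"
  assumes m: "(\<lambda>r. indicator A r *\<^sub>R f' r) \<in> borel_measurable borel" and e: "AE r in lborel. r \<in> A \<longrightarrow> f r = f' r"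
  shows "(LINT r:A|lebesgue. f r) = (LINT r:A|lborel. f' r)"
proof -
  have m': "(\<lambda>r. indicator A r *\<^sub>R f' r) \<in> borel_measurable lebesgue"
    using m by (intro measurable_completion) simp
  have "AE r in lborel. indicator A r *\<^sub>R f' r = indicator A r *\<^sub>R f r"
    using e by eventually_elim (auto split: split_indicator)
  then have ae: "AE r in lebesgue. indicator A r *\<^sub>R f' r = indicator A r *\<^sub>R f r" by (rule AE_completion)
  have "(LINT r|lebesgue. indicator A r *\<^sub>R f r) = (LINT r|lebesgue. indicator A r *\<^sub>R f' r)"
    using ae by (intro integral_cong_AE borel_measurable_AE[OF m' ae] m') (auto elim!: eventually_mono)
  also have "\<dots> = (LINT r|lborel. indicator A r *\<^sub>R f' r)"
    using m by (intro integral_completion) simp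
  finally show ?thesis by (simp add: set_lebesgue_integral_def)
qed

section \<open>The controlled game\<close>

locale stopping_game =
  fixes T :: real
    and U :: "'u::metric_space set"
    and V :: "'v::metric_space set"
    and Q :: "real \<Rightarrow> 'u \<Rightarrow> 'v \<Rightarrow> real^'s::finite^'s"
    and g :: "real \<Rightarrow> 's \<Rightarrow> real"
    and h :: "real \<Rightarrow> 's \<Rightarrow> 'u \<Rightarrow> 'v \<Rightarrow> real"
  assumes T: "T > 0"
    and U: "compact U" "U \<noteq> {}"
    and V: "compact V" "V \<noteq> {}"
    and kolmogorov: "\<And>t u v. t \<in> {0..T} \<Longrightarrow> u \<in> U \<Longrightarrow> v \<in> V \<Longrightarrow> kolmogorov_matrix (Q t u v)"
    and Q_cont: "\<And>i j. continuous_on ({0..T} \<times> U \<times> V) (\<lambda>(t, u, v). Q t u v $ i $ j)"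
    and g_cont: "\<And>i. continuous_on {0..T} (\<lambda>t. g t i)"
    and h_cont: "\<And>i. continuous_on ({0..T} \<times> U \<times> V) (\<lambda>(t, u, v). h t i u v)"
begin

lemma compact_controls: "compact ({0..T} \<times> U \<times> V)"
  using U V by (intro compact_Times) auto

lemma continuous_bounded:
  fixes f :: "real \<times> 'u \<times> 'v \<Rightarrow> 's \<Rightarrow> real"
  assumes "\<And>i. continuous_on ({0..T} \<times> U \<times> V) (\<lambda>x. f x i)"
  shows "\<exists>B>0. \<forall>x\<in>{0..T} \<times> U \<times> V. \<forall>i. \<bar>f x i\<bar> \<le> B"
proof -
  have "\<exists>B. \<forall>x\<in>{0..T} \<times> U \<times> V. \<bar>f x i\<bar> \<le> B" for i
    using compact_imp_bounded[OF compact_continuous_image[OF assms compact_controls], of i]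
    unfolding bounded_iff by (auto simp del: mem_Times_iff)
  then obtain B where B: "\<And>i. \<forall>x\<in>{0..T} \<times> U \<times> V. \<bar>f x i\<bar> \<le> B i" by metis
  have "\<bar>f x i\<bar> \<le> (\<Sum>i\<in>UNIV. \<bar>B i\<bar>) + 1" if "x \<in> {0..T} \<times> U \<times> V" for x i
  proof -
    have "\<bar>f x i\<bar> \<le> \<bar>B i\<bar>" using B that by (meson abs_ge_self order_trans)
    also have "\<bar>B i\<bar> \<le> (\<Sum>i\<in>UNIV. \<bar>B i\<bar>)" by (rule member_le_sum) auto
    finally show ?thesis by simp
  qed
  moreover have "0 < (\<Sum>i\<in>UNIV. \<bar>B i\<bar>) + 1" by (intro add_nonneg_pos sum_nonneg) auto
  ultimately show ?thesis by blast
qed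

lemma progressive_control:
  fixes \<alpha> :: "real \<Rightarrow> (real \<Rightarrow> 's) \<Rightarrow> 'u" and \<beta> :: "real \<Rightarrow> (real \<Rightarrow> 's) \<Rightarrow> 'v"
  assumes f: "continuous_on ({0..T} \<times> U \<times> V) f" and t0: "0 \<le> t0" and t: "t \<in> {t0..T}"
    and \<alpha>: "\<alpha> \<in> memory_strategies T t0 U" and \<beta>: "\<beta> \<in> memory_strategies T t0 V"
  shows "progressive_at T t0 t (\<lambda>s \<omega>. f (s, \<alpha> s \<omega>, \<beta> s \<omega>))"
proof -
  let ?M = "restrict_space borel {t0..t} \<Otimes>\<^sub>M (path_filtration T t0 t :: (real \<Rightarrow> 's) measure)"
  have a: "(\<lambda>x. \<alpha> (fst x) (snd x)) \<in> ?M \<rightarrow>\<^sub>M restrict_space borel U"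
    and b: "(\<lambda>x. \<beta> (fst x) (snd x)) \<in> ?M \<rightarrow>\<^sub>M restrict_space borel V"
    using \<alpha> \<beta> t by (auto simp: memory_strategies_def case_prod_unfold)
  have "(\<lambda>s. s) \<in> restrict_space borel {t0..t} \<rightarrow>\<^sub>M restrict_space borel {0..T}"
    using t t0 by (intro measurable_restrict_space3) auto
  then have f': "fst \<in> ?M \<rightarrow>\<^sub>M restrict_space borel {0..T}"
    using measurable_compose[OF measurable_fst] by blast
  show ?thesis
    unfolding progressive_at_def case_prod_unfold by (rule continuous_controls_measurable[OF f U V f' a b])
qed

definition rate_bound_Q :: real where
  "rate_bound_Q = (SOME C. C > 0 \<and> (\<forall>t\<in>{0..T}. \<forall>u\<in>U. \<forall>v\<in>V. \<forall>i j. \<bar>Q t u v $ i $ j\<bar> \<le> C))"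

lemma rate_bound_Q: "rate_bound_Q > 0"
  "\<And>t u v i j. t \<in> {0..T} \<Longrightarrow> u \<in> U \<Longrightarrow> v \<in> V \<Longrightarrow> \<bar>Q t u v $ i $ j\<bar> \<le> rate_bound_Q"
proof -
  have "\<exists>B>0. \<forall>x\<in>{0..T} \<times> U \<times> V. \<forall>j. \<bar>(case x of (t, u, v) \<Rightarrow> Q t u v $ i $ j)\<bar> \<le> B" for i
    by (rule continuous_bounded[OF Q_cont])
  then obtain B where B: "\<And>i. B i > 0" "\<And>i x j. x\<in>{0..T} \<times> U \<times> V \<Longrightarrow> \<bar>(case x of (t, u, v) \<Rightarrow> Q t u v $ i $ j)\<bar> \<le> B i" by metis
  have "\<bar>Q t u v $ i $ j\<bar> \<le> (\<Sum>i\<in>UNIV. B i)" if "t \<in> {0..T}" "u \<in> U" "v \<in> V" for t u v i j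
  proof -
    have "\<bar>Q t u v $ i $ j\<bar> \<le> B i" using B(2)[of "(t, u, v)" i j] that by simp
    also have "\<dots> \<le> (\<Sum>i\<in>UNIV. B i)" using B(1) by (intro member_le_sum) (auto intro: less_imp_le)
    finally show ?thesis .
  qed
  moreover have "0 < (\<Sum>i\<in>UNIV. B i)" using B(1) by (intro sum_pos) auto
  ultimately have "\<exists>C. C > 0 \<and> (\<forall>t\<in>{0..T}. \<forall>u\<in>U. \<forall>v\<in>V. \<forall>i j. \<bar>Q t u v $ i $ j\<bar> \<le> C)" by blast
  from someI_ex[OF this] show "rate_bound_Q > 0"
    "\<And>t u v i j. t \<in> {0..T} \<Longrightarrow> u \<in> U \<Longrightarrow> v \<in> V \<Longrightarrow> \<bar>Q t u v $ i $ j\<bar> \<le> rate_bound_Q"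
    unfolding rate_bound_Q_def by blast+
qed

lemma rate_control_strategies:
  assumes t0: "t0 \<in> {0..T}" and \<alpha>: "\<alpha> \<in> memory_strategies T t0 U" and \<beta>: "\<beta> \<in> memory_strategies T t0 V"
  shows "rate_control T t0 rate_bound_Q (\<lambda>s \<omega> i j. Q s (\<alpha> s \<omega>) (\<beta> s \<omega>) $ i $ j)"
proof
  have t0T: "t0 \<le> T" "0 \<le> t0" using t0 by auto
  have mem: "s \<in> {0..T}" "\<alpha> s \<omega> \<in> U" "\<beta> s \<omega> \<in> V" if "s \<in> {t0..T}" "\<omega> \<in> path_space t0 T" for s and \<omega> :: "real \<Rightarrow> 's"
    using that t0 memory_strategy_in[OF t0T(1) \<alpha> that] memory_strategy_in[OF t0T(1) \<beta> that] by auto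
  show "t0 \<le> T" "0 < rate_bound_Q" using t0T rate_bound_Q by auto
  show "(\<lambda>(s, \<omega>). Q s (\<alpha> s \<omega>) (\<beta> s \<omega>) $ i $ j) \<in> restrict_space borel {t0..t} \<Otimes>\<^sub>M path_filtration T t0 t \<rightarrow>\<^sub>M borel"
    if "t \<in> {t0..T}" for t i j
    using progressive_control[OF Q_cont[of i j] t0T(2) that \<alpha> \<beta>] by (simp add: progressive_at_def)
  fix s and \<omega> :: "real \<Rightarrow> 's" and i :: 's assume s: "s \<in> {t0..T}" "\<omega> \<in> path_space t0 T"
  have K: "kolmogorov_matrix (Q s (\<alpha> s \<omega>) (\<beta> s \<omega>))" using mem[OF s] by (intro kolmogorov)
  then show "(\<Sum>j\<in>UNIV. Q s (\<alpha> s \<omega>) (\<beta> s \<omega>) $ i $ j) = 0" by (simp add: kolmogorov_matrix_def)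
  fix j :: 's
  show "\<bar>Q s (\<alpha> s \<omega>) (\<beta> s \<omega>) $ i $ j\<bar> \<le> rate_bound_Q" using mem[OF s] by (intro rate_bound_Q)
  show "0 \<le> Q s (\<alpha> s \<omega>) (\<beta> s \<omega>) $ i $ j" if "i \<noteq> j" using K that by (simp add: kolmogorov_matrix_def)
qed

text \<open>One exceptional null set serves all states, because there are finitely many.\<close>
lemma AC_density:
  fixes \<phi> :: "real \<Rightarrow> 's \<Rightarrow> real"
  assumes "\<phi> \<in> AC T"
  obtains d where "\<And>i. integrable lborel (d i)"
    "\<And>i s t. 0 \<le> s \<Longrightarrow> s \<le> t \<Longrightarrow> t \<le> T \<Longrightarrow> \<phi> t i - \<phi> s i = (LINT x:{s..t}|lborel. d i x)"
    "AE x in lborel. 0 < x \<longrightarrow> x < T \<longrightarrow> (\<forall>i. ((\<lambda>t. \<phi> t i) has_real_derivative d i x) (at x))"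
proof -
  define D where "D i d \<longleftrightarrow> integrable lborel d \<and> (\<forall>s t. 0 \<le> s \<longrightarrow> s \<le> t \<longrightarrow> t \<le> T \<longrightarrow> \<phi> t i - \<phi> s i = (LINT x:{s..t}|lborel. d x)) \<and>
    (AE x in lborel. 0 < x \<longrightarrow> x < T \<longrightarrow> ((\<lambda>t. \<phi> t i) has_real_derivative d x) (at x))" for i d
  have "\<exists>d. D i d" for i
  proof -
    have "abs_continuous_on 0 T (\<lambda>t. \<phi> t i)" using assms by (simp add: AC_def)
    then show ?thesis
      by (rule abs_continuous_derivative[OF _ T]) (unfold D_def, rule exI, intro conjI, assumption, blast, assumption)
  qed
  then have "\<exists>d. \<forall>i. D i (d i)" by (intro choice allI)
  then obtain d where "\<And>i. D i (d i)" by blast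
  note d = this[unfolded D_def]
  have "AE x in lborel. \<forall>i\<in>UNIV. 0 < x \<longrightarrow> x < T \<longrightarrow> ((\<lambda>t. \<phi> t i) has_real_derivative d i x) (at x)"
    using d by (intro AE_finite_allI) auto
  then have "AE x in lborel. 0 < x \<longrightarrow> x < T \<longrightarrow> (\<forall>i. ((\<lambda>t. \<phi> t i) has_real_derivative d i x) (at x))"
    by eventually_elim auto
  with d show thesis by (intro that[of d]) auto
qed

lemma AC_test_process:
  assumes t0: "t0 \<in> {0..T}" and \<alpha>: "\<alpha> \<in> memory_strategies T t0 U" and \<beta>: "\<beta> \<in> memory_strategies T t0 V"
    and \<phi>: "\<phi> \<in> AC T" and d: "\<And>i. integrable lborel (d i)"
    "\<And>i s t. 0 \<le> s \<Longrightarrow> s \<le> t \<Longrightarrow> t \<le> T \<Longrightarrow> \<phi> t i - \<phi> s i = (LINT x:{s..t}|lborel. d i x)"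
  shows "test_process T t0 rate_bound_Q (\<lambda>s \<omega> i j. Q s (\<alpha> s \<omega>) (\<beta> s \<omega>) $ i $ j) \<phi> d"
proof -
  interpret rate_control T t0 rate_bound_Q undefined "\<lambda>s \<omega> i j. Q s (\<alpha> s \<omega>) (\<beta> s \<omega>) $ i $ j"
    by (rule rate_control_strategies[OF t0 \<alpha> \<beta>])
  show ?thesis
  proof
    show "continuous_on {t0..T} (\<lambda>t. \<phi> t i)" for i
      using abs_continuous_continuous[of 0 T "\<lambda>t. \<phi> t i"] \<phi> t0 by (auto simp: AC_def intro: continuous_on_subset)
  qed (use d t0 in auto)
qed

lemma compensated_process_eq:
  assumes t0: "t0 \<in> {0..T}" and \<alpha>: "\<alpha> \<in> memory_strategies T t0 U" and \<beta>: "\<beta> \<in> memory_strategies T t0 V"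
    and \<phi>: "\<phi> \<in> AC T" and d: "\<And>i. integrable lborel (d i)"
    "\<And>i s t. 0 \<le> s \<Longrightarrow> s \<le> t \<Longrightarrow> t \<le> T \<Longrightarrow> \<phi> t i - \<phi> s i = (LINT x:{s..t}|lborel. d i x)"
    and der: "AE x in lborel. 0 < x \<longrightarrow> x < T \<longrightarrow> (\<forall>i. ((\<lambda>t. \<phi> t i) has_real_derivative d i x) (at x))"
    and t: "t \<in> {t0..T}" and w: "\<omega> \<in> path_space t0 T"
  shows "compensated_process Q t0 \<alpha> \<beta> \<phi> t \<omega> =
    test_process.compensated t0 (\<lambda>s \<omega> i j. Q s (\<alpha> s \<omega>) (\<beta> s \<omega>) $ i $ j) \<phi> d t \<omega>"
proof -
  interpret test_process T t0 rate_bound_Q undefined "\<lambda>s \<omega> i j. Q s (\<alpha> s \<omega>) (\<beta> s \<omega>) $ i $ j" \<phi> d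
    by (rule AC_test_process[OF t0 \<alpha> \<beta> \<phi> d])
  have "(LINT s:{t0..t}|lebesgue. deriv (\<lambda>r. \<phi> r (\<omega> s)) s + (\<Sum>j\<in>UNIV. Q s (\<alpha> s \<omega>) (\<beta> s \<omega>) $ \<omega> s $ j * \<phi> s j)) =
    (LINT s:{t0..t}|lborel. generator_term s \<omega>)"
  proof (rule lebesgue_integral_lborel_cong)
    show "(\<lambda>r. indicator {t0..t} r *\<^sub>R generator_term r \<omega>) \<in> borel_measurable borel"
      using t by (intro progressive_section[OF progressive_generator_term _ w]) auto
    show "AE s in lborel. s \<in> {t0..t} \<longrightarrow>
      deriv (\<lambda>r. \<phi> r (\<omega> s)) s + (\<Sum>j\<in>UNIV. Q s (\<alpha> s \<omega>) (\<beta> s \<omega>) $ \<omega> s $ j * \<phi> s j) = generator_term s \<omega>"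
      using der AE_lborel_singleton[of 0] AE_lborel_singleton[of T]
    proof eventually_elim
      case (elim s)
      show ?case
      proof
        assume "s \<in> {t0..t}"
        then have "deriv (\<lambda>r. \<phi> r (\<omega> s)) s = d (\<omega> s) s"
          using elim t t0 by (intro DERIV_imp_deriv) auto
        then show "deriv (\<lambda>r. \<phi> r (\<omega> s)) s + (\<Sum>j\<in>UNIV. Q s (\<alpha> s \<omega>) (\<beta> s \<omega>) $ \<omega> s $ j * \<phi> s j) = generator_term s \<omega>"
          by (simp add: generator_term_def rate_term_def)
      qed
    qed
  qed
  then show ?thesis by (simp add: compensated_process_def compensated_def)
qed

text \<open>The chain with rates \<open>Q(s, \<alpha>, \<beta>)\<close> solves the martingale problem, so the choice in \<open>game_prob\<close> picks a
  solution.\<close>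
theorem martingale_problem_solvable:
  assumes t0: "t0 \<in> {0..T}" and \<alpha>: "\<alpha> \<in> memory_strategies T t0 U" and \<beta>: "\<beta> \<in> memory_strategies T t0 V"
  shows "generated_by T Q t0 i0 \<alpha> \<beta> (game_prob T Q t0 i0 \<alpha> \<beta>)"
proof -
  interpret R: rate_control T t0 rate_bound_Q i0 "\<lambda>s \<omega> i j. Q s (\<alpha> s \<omega>) (\<beta> s \<omega>) $ i $ j"
    by (rule rate_control_strategies[OF t0 \<alpha> \<beta>])
  have "is_martingale R.chain_law (path_filtration T t0) t0 T (compensated_process Q t0 \<alpha> \<beta> \<phi>)" if \<phi>: "\<phi> \<in> AC T" for \<phi>
  proof -
    obtain d where d: "\<And>i. integrable lborel (d i)"
      "\<And>i s t. 0 \<le> s \<Longrightarrow> s \<le> t \<Longrightarrow> t \<le> T \<Longrightarrow> \<phi> t i - \<phi> s i = (LINT x:{s..t}|lborel. d i x)"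
      "AE x in lborel. 0 < x \<longrightarrow> x < T \<longrightarrow> (\<forall>i. ((\<lambda>t. \<phi> t i) has_real_derivative d i x) (at x))"
      by (rule AC_density[OF \<phi>]) (rule that)
    interpret test_process T t0 rate_bound_Q i0 "\<lambda>s \<omega> i j. Q s (\<alpha> s \<omega>) (\<beta> s \<omega>) $ i $ j" \<phi> d
      by (rule AC_test_process[OF t0 \<alpha> \<beta> \<phi> d(1,2)])
    have eq: "compensated_process Q t0 \<alpha> \<beta> \<phi> t \<omega> = compensated t \<omega>" if "t \<in> {t0..T}" "\<omega> \<in> path_space t0 T" for t \<omega>
      by (rule compensated_process_eq[OF t0 \<alpha> \<beta> \<phi> d(1) _ d(3) that]) (rule d(2))
    note t0T = R.t0T
    have spF: "space (path_filtration T t0 t) = path_space t0 T" for t by (simp add: path_filtration_def)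
    show ?thesis
    proof (rule is_martingaleI[OF R.prob_space_chain_law])
      show "space (path_filtration T t0 t) = space R.chain_law" for t by (simp add: R.sets_chain_law spF)
      show "sets (path_filtration T t0 t) \<subseteq> sets R.chain_law" if "t \<in> {t0..T}" for t
        unfolding R.sets_chain_law by (rule path_filtration_borel[OF t0T that])
      fix t assume t: "t \<in> {t0..T}"
      show "compensated_process Q t0 \<alpha> \<beta> \<phi> t \<in> borel_measurable (path_filtration T t0 t)"
        using compensated_measurable[OF t] eq[OF t] spF by (subst measurable_cong[where g="compensated t"]) auto
      show "integrable R.chain_law (compensated_process Q t0 \<alpha> \<beta> \<phi> t)"
        using compensated_integrable[OF t] eq[OF t] by (subst Bochner_Integration.integrable_cong[OF refl, where g="compensated t"]) (auto simp: R.sets_chain_law)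
    next
      fix s t and A :: "(real \<Rightarrow> 's) set" assume s: "s \<in> {t0..T}" and t: "t \<in> {s..T}" and A: "A \<in> sets (path_filtration T t0 s)"
      have t': "t \<in> {t0..T}" using s t by auto
      have AP: "A \<in> sets R.chain_law" using A path_filtration_borel[OF t0T s] by (auto simp: R.sets_chain_law)
      have "(LINT \<omega>:A|R.chain_law. compensated_process Q t0 \<alpha> \<beta> \<phi> t \<omega> - compensated_process Q t0 \<alpha> \<beta> \<phi> s \<omega>) =
        (LINT \<omega>:A|R.chain_law. compensated t \<omega> - compensated s \<omega>)"
        using sets.sets_into_space[OF AP] eq[OF t'] eq[OF s] AP
        by (intro set_lebesgue_integral_cong) (auto simp: R.sets_chain_law)
      also have "\<dots> = 0" using s t A by (intro compensated_increment_zero) auto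
      finally show "(LINT \<omega>:A|R.chain_law. compensated_process Q t0 \<alpha> \<beta> \<phi> t \<omega> - compensated_process Q t0 \<alpha> \<beta> \<phi> s \<omega>) = 0" .
    qed
  qed
  then have "generated_by T Q t0 i0 \<alpha> \<beta> R.chain_law"
    unfolding generated_by_def
    using R.prob_space_chain_law R.sets_chain_law R.chain_law_start by auto
  then show ?thesis unfolding game_prob_def by (rule someI)
qed

end

section \<open>Payoffs and compensated processes at stopping times\<close>

lemma stopping_time_measurable:
  assumes \<tau>: "\<tau> \<in> stopping_times T t0" and t0: "t0 \<le> T"
  shows "(\<tau> :: (real \<Rightarrow> 's::finite) \<Rightarrow> real) \<in> borel_measurable (path_borel t0 T)"
  unfolding borel_measurable_iff_le
proof
  fix a
  have range: "\<tau> \<omega> \<in> {t0..T}" if "\<omega> \<in> path_space t0 T" for \<omega> using \<tau> that by (auto simp: stopping_times_def)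
  consider "a < t0" | "a \<in> {t0..T}" | "a > T" by force
  then show "{w \<in> space (path_borel t0 T). \<tau> w \<le> a} \<in> sets (path_borel t0 T)"
  proof cases
    case 1
    then have "\<not> \<tau> w \<le> a" if "w \<in> path_space t0 T" for w using range[OF that] by auto
    then have "{w \<in> space (path_borel t0 T). \<tau> w \<le> a} = {}" by auto
    then show ?thesis by (simp only: sets.empty_sets)
  next
    case 2
    then have "{\<omega> \<in> path_space t0 T. \<tau> \<omega> \<le> a} \<in> sets (path_filtration T t0 a)"
      using \<tau> by (auto simp: stopping_times_def pred_def path_filtration_def)
    then show ?thesis using path_filtration_borel[OF t0 2] by auto
  next
    case 3
    then have "\<tau> w \<le> a" if "w \<in> path_space t0 T" for w using range[OF that] by auto
    then have "{w \<in> space (path_borel t0 T). \<tau> w \<le> a} = space (path_borel t0 T)" by auto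
    then show ?thesis by (simp only: sets.top)
  qed
qed

lemma progressive_integral_stopped:
  fixes f :: "real \<Rightarrow> (real \<Rightarrow> 's::finite) \<Rightarrow> real"
  assumes f: "progressive_at T t0 T f" and t0: "t0 \<le> T" and \<tau>: "\<tau> \<in> stopping_times T t0"
  shows "(\<lambda>\<omega>. LINT r:{t0..\<tau> \<omega>}|lborel. f r \<omega>) \<in> borel_measurable (path_borel t0 T)"
proof -
  let ?M = "path_borel t0 T :: (real \<Rightarrow> 's) measure"
  have [measurable]: "(\<lambda>x. f (max t0 (min T (snd x))) (fst x)) \<in> borel_measurable (?M \<Otimes>\<^sub>M lborel)"
  proof -
    have "sets ((path_filtration T t0 T :: (real \<Rightarrow> 's) measure) \<Otimes>\<^sub>M borel) = sets (?M \<Otimes>\<^sub>M (lborel :: real measure))"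
      by (intro sets_pair_measure_cong path_filtration_T t0) simp
    then show ?thesis
      by (subst measurable_cong_sets[OF _ refl, where M'="path_filtration T t0 T \<Otimes>\<^sub>M borel"])
        (use progressive_clamp[OF f t0] in \<open>simp_all add: case_prod_unfold\<close>)
  qed
  have [measurable]: "(\<lambda>x. \<tau> (fst x)) \<in> borel_measurable (?M \<Otimes>\<^sub>M lborel)"
    by (rule measurable_compose[OF measurable_fst stopping_time_measurable[OF \<tau> t0]])
  have "(\<lambda>x. if t0 \<le> snd x \<and> snd x \<le> \<tau> (fst x) then f (max t0 (min T (snd x))) (fst x) else 0) \<in> borel_measurable (?M \<Otimes>\<^sub>M lborel)"
    by measurable
  then have "(\<lambda>\<omega>. LINT r|lborel. (if t0 \<le> r \<and> r \<le> \<tau> \<omega> then f (max t0 (min T r)) \<omega> else 0)) \<in> borel_measurable ?M"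
    by (intro lborel.borel_measurable_lebesgue_integral) (simp add: case_prod_unfold)
  then show ?thesis
  proof (rule measurable_cong[THEN iffD1, rotated])
    fix \<omega> assume "\<omega> \<in> space ?M"
    then have "\<tau> \<omega> \<in> {t0..T}" using \<tau> by (auto simp: stopping_times_def)
    then show "(LINT r|lborel. (if t0 \<le> r \<and> r \<le> \<tau> \<omega> then f (max t0 (min T r)) \<omega> else 0)) = (LINT r:{t0..\<tau> \<omega>}|lborel. f r \<omega>)"
      unfolding set_lebesgue_integral_def
    proof (intro Bochner_Integration.integral_cong refl)
      fix r
      have "max t0 (min T r) = r" if "t0 \<le> r" "r \<le> \<tau> \<omega>" using that \<open>\<tau> \<omega> \<in> {t0..T}\<close> by auto
      then show "(if t0 \<le> r \<and> r \<le> \<tau> \<omega> then f (max t0 (min T r)) \<omega> else 0) = indicator {t0..\<tau> \<omega>} r *\<^sub>R f r \<omega>"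
        by (simp add: indicator_def)
    qed
  qed
qed

lemma stopped_state_measurable:
  fixes g :: "real \<Rightarrow> 's::finite \<Rightarrow> real"
  assumes g: "\<And>i. continuous_on {t0..T} (\<lambda>t. g t i)" and t0: "t0 \<le> T" and \<tau>: "\<tau> \<in> stopping_times T t0"
  shows "(\<lambda>\<omega>. g (\<tau> \<omega>) (\<omega> (\<tau> \<omega>))) \<in> borel_measurable (path_borel t0 T)"
proof -
  let ?M = "path_borel t0 T :: (real \<Rightarrow> 's) measure"
  have tm: "\<tau> \<in> ?M \<rightarrow>\<^sub>M restrict_space borel {t0..T}"
    using \<tau> by (intro measurable_restrict_space2 stopping_time_measurable[OF \<tau> t0]) (auto simp: stopping_times_def)
  have "(\<lambda>\<omega>. (\<tau> \<omega>, \<omega>)) \<in> ?M \<rightarrow>\<^sub>M restrict_space borel {t0..T} \<Otimes>\<^sub>M path_filtration T t0 T"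
    by (intro measurable_Pair tm) (simp add: measurable_cong_sets[OF refl path_filtration_T[OF t0]])
  from measurable_compose[OF this joint_evaluation[OF t0, of T]] t0
  have s: "(\<lambda>\<omega>. \<omega> (\<tau> \<omega>)) \<in> ?M \<rightarrow>\<^sub>M count_space UNIV" by simp
  have "(\<lambda>\<omega>. g (\<tau> \<omega>) i) \<in> borel_measurable ?M" for i
    by (rule measurable_compose[OF tm borel_measurable_continuous_on_restrict[OF g]])
  from measurable_compose_finite[OF this s] show ?thesis .
qed

context stopping_game
begin

lemma continuous_state_bounded:
  fixes f :: "real \<Rightarrow> 's \<Rightarrow> real"
  assumes "\<And>i. continuous_on {0..T} (\<lambda>t. f t i)"
  shows "\<exists>B\<ge>0. \<forall>t\<in>{0..T}. \<forall>i. \<bar>f t i\<bar> \<le> B"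
proof -
  have "continuous_on ({0..T} \<times> U \<times> V) (\<lambda>x. f (fst x) i)" for i
    by (intro continuous_on_compose2[OF assms] continuous_intros) auto
  then obtain B where B: "B > 0" "\<And>x i. x \<in> {0..T} \<times> U \<times> V \<Longrightarrow> \<bar>f (fst x) i\<bar> \<le> B" using continuous_bounded by metis
  obtain u v where "u \<in> U" "v \<in> V" using U V by blast
  then have "\<bar>f t i\<bar> \<le> B" if "t \<in> {0..T}" for t i using B(2)[of "(t, u, v)" i] that by simp
  then show ?thesis using B(1) by (intro exI[of _ B]) auto
qed

lemma reward_bounded:
  obtains B where "B > 0" "\<And>t u v i. t \<in> {0..T} \<Longrightarrow> u \<in> U \<Longrightarrow> v \<in> V \<Longrightarrow> \<bar>h t i u v\<bar> \<le> B"
proof -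
  obtain B where B: "B > 0" "\<forall>x\<in>{0..T} \<times> U \<times> V. \<forall>i. \<bar>(case x of (t, u, v) \<Rightarrow> h t i u v)\<bar> \<le> B"
    using continuous_bounded[of "\<lambda>x i. case x of (t, u, v) \<Rightarrow> h t i u v", OF h_cont] by blast
  have "\<bar>h t i u v\<bar> \<le> B" if "t \<in> {0..T}" "u \<in> U" "v \<in> V" for t u v i
    using bspec[OF B(2), of "(t, u, v)"] that by simp
  then show thesis using B(1) that by blast
qed

lemma progressive_reward:
  assumes t0: "t0 \<in> {0..T}" and t: "t \<in> {t0..T}" and \<alpha>: "\<alpha> \<in> memory_strategies T t0 U" and \<beta>: "\<beta> \<in> memory_strategies T t0 V"
  shows "progressive_at T t0 t (\<lambda>s \<omega>. h s (\<omega> s) (\<alpha> s \<omega>) (\<beta> s \<omega>))"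
proof -
  have t0': "0 \<le> t0" "t0 \<le> T" using t0 by auto
  let ?M = "restrict_space borel {t0..t} \<Otimes>\<^sub>M (path_filtration T t0 t :: (real \<Rightarrow> 's) measure)"
  have "(\<lambda>x. h (fst x) i (\<alpha> (fst x) (snd x)) (\<beta> (fst x) (snd x))) \<in> borel_measurable ?M" for i
    using progressive_control[OF h_cont[of i] t0'(1) t \<alpha> \<beta>] by (simp add: progressive_at_def case_prod_unfold)
  from measurable_compose_finite[OF this joint_evaluation[OF t0'(2) t, unfolded case_prod_unfold]]
  show ?thesis by (simp add: progressive_at_def case_prod_unfold)
qed

lemma payoff_lborel:
  assumes t0: "t0 \<in> {0..T}" and t: "t \<in> {t0..T}" and \<alpha>: "\<alpha> \<in> memory_strategies T t0 U" and \<beta>: "\<beta> \<in> memory_strategies T t0 V"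
    and w: "\<omega> \<in> path_space t0 T"
  shows "payoff g h t0 \<alpha> \<beta> t \<omega> = g t (\<omega> t) + (LINT s:{t0..t}|lborel. h s (\<omega> s) (\<alpha> s \<omega>) (\<beta> s \<omega>))"
  unfolding payoff_def
  using progressive_section[OF progressive_reward[OF t0 t \<alpha> \<beta>] _ w] t
  by (subst lebesgue_integral_lborel_cong[where f'="\<lambda>s. h s (\<omega> s) (\<alpha> s \<omega>) (\<beta> s \<omega>)"]) auto

lemma reward_integrable:
  assumes t0: "t0 \<in> {0..T}" and t: "t \<in> {t0..T}" and \<alpha>: "\<alpha> \<in> memory_strategies T t0 U" and \<beta>: "\<beta> \<in> memory_strategies T t0 V"
    and w: "\<omega> \<in> path_space t0 T"
  shows "set_integrable lborel {t0..t} (\<lambda>s. h s (\<omega> s) (\<alpha> s \<omega>) (\<beta> s \<omega>))"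
proof -
  obtain Bh where Bh: "Bh > 0" "\<And>t u v i. t \<in> {0..T} \<Longrightarrow> u \<in> U \<Longrightarrow> v \<in> V \<Longrightarrow> \<bar>h t i u v\<bar> \<le> Bh"
    by (rule reward_bounded) (rule that)
  have t0T: "t0 \<le> T" using t0 by simp
  have f: "\<bar>h s (\<omega> s) (\<alpha> s \<omega>) (\<beta> s \<omega>)\<bar> \<le> Bh" if "s \<in> {t0..t}" for s
    using Bh(2)[of s "\<alpha> s \<omega>" "\<beta> s \<omega>" "\<omega> s"] memory_strategy_in[OF t0T \<alpha> _ w, of s] memory_strategy_in[OF t0T \<beta> _ w, of s] that t t0 by auto
  show ?thesis
    unfolding set_integrable_def
  proof (rule Bochner_Integration.integrable_bound[of _ "\<lambda>s. indicator {t0..t} s * Bh"])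
    show "integrable lborel (\<lambda>s. indicator {t0..t} s * Bh)"
      using t by (intro integrable_mult_left integrable_real_indicator) auto
    show "(\<lambda>s. indicator {t0..t} s *\<^sub>R h s (\<omega> s) (\<alpha> s \<omega>) (\<beta> s \<omega>)) \<in> borel_measurable lborel"
      using progressive_section[OF progressive_reward[OF t0 t \<alpha> \<beta>] _ w] t by simp
    show "AE s in lborel. norm (indicator {t0..t} s *\<^sub>R h s (\<omega> s) (\<alpha> s \<omega>) (\<beta> s \<omega>)) \<le> norm (indicator {t0..t} s * Bh)"
      using f by (intro AE_I2) (auto split: split_indicator intro: order_trans[OF _ abs_ge_self])
  qed
qed

lemma payoff_bound: "\<exists>B. \<forall>t0\<in>{0..T}. \<forall>\<alpha>\<in>memory_strategies T t0 U. \<forall>\<beta>\<in>memory_strategies T t0 V.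
    \<forall>t\<in>{t0..T}. \<forall>\<omega>\<in>path_space t0 T. \<bar>payoff g h t0 \<alpha> \<beta> t \<omega>\<bar> \<le> B"
proof -
  obtain Bg where Bg: "\<And>t i. t \<in> {0..T} \<Longrightarrow> \<bar>g t i\<bar> \<le> Bg" using continuous_state_bounded[of g, OF g_cont] by metis
  obtain Bh where Bh: "Bh > 0" "\<And>t u v i. t \<in> {0..T} \<Longrightarrow> u \<in> U \<Longrightarrow> v \<in> V \<Longrightarrow> \<bar>h t i u v\<bar> \<le> Bh"
    by (rule reward_bounded) (rule that)
  have "\<bar>payoff g h t0 \<alpha> \<beta> t \<omega>\<bar> \<le> Bg + Bh * T"
    if t0: "t0 \<in> {0..T}" and \<alpha>: "\<alpha> \<in> memory_strategies T t0 U" and \<beta>: "\<beta> \<in> memory_strategies T t0 V"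
      and t: "t \<in> {t0..T}" and w: "\<omega> \<in> path_space t0 T" for t0 \<alpha> \<beta> t \<omega>
  proof -
    let ?f = "\<lambda>s. h s (\<omega> s) (\<alpha> s \<omega>) (\<beta> s \<omega>)"
    have t0T: "t0 \<le> T" using t0 by simp
    have f: "\<bar>?f s\<bar> \<le> Bh" if "s \<in> {t0..t}" for s
      using Bh(2)[of s "\<alpha> s \<omega>" "\<beta> s \<omega>" "\<omega> s"] memory_strategy_in[OF t0T \<alpha> _ w, of s] memory_strategy_in[OF t0T \<beta> _ w, of s] that t t0 by auto
    have "\<bar>LINT s:{t0..t}|lborel. ?f s\<bar> \<le> (LINT s|lborel. \<bar>indicator {t0..t} s *\<^sub>R ?f s\<bar>)"
      unfolding set_lebesgue_integral_def by (rule integral_abs_bound)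
    also have "\<dots> \<le> (LINT s|lborel. indicator {t0..t} s * Bh)"
    proof (rule integral_mono)
      show "integrable lborel (\<lambda>s. \<bar>indicator {t0..t} s *\<^sub>R ?f s\<bar>)"
        using reward_integrable[OF t0 t \<alpha> \<beta> w] unfolding set_integrable_def by (rule integrable_abs)
      show "integrable lborel (\<lambda>s. indicator {t0..t} s * Bh)"
        using t by (intro integrable_mult_left integrable_real_indicator) auto
      show "\<bar>indicator {t0..t} s *\<^sub>R ?f s\<bar> \<le> indicator {t0..t} s * Bh" for s
        using f by (auto split: split_indicator)
    qed
    also have "\<dots> = Bh * (t - t0)" using t by simp
    also have "\<dots> \<le> Bh * T" using t t0 Bh(1) by (intro mult_left_mono) auto
    finally have "\<bar>LINT s:{t0..t}|lborel. ?f s\<bar> \<le> Bh * T" .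
    moreover have "\<bar>g t (\<omega> t)\<bar> \<le> Bg" using Bg t t0 by auto
    ultimately show ?thesis unfolding payoff_lborel[OF t0 t \<alpha> \<beta> w] by linarith
  qed
  then show ?thesis by blast
qed

lemma stopped_payoff_integrable:
  assumes t0: "t0 \<in> {0..T}" and \<alpha>: "\<alpha> \<in> memory_strategies T t0 U" and \<beta>: "\<beta> \<in> memory_strategies T t0 V"
    and \<tau>: "\<tau> \<in> stopping_times T t0"
  shows "integrable (game_prob T Q t0 i0 \<alpha> \<beta>) (\<lambda>\<omega>. payoff g h t0 \<alpha> \<beta> (\<tau> \<omega>) \<omega>)"
proof -
  let ?P = "game_prob T Q t0 i0 \<alpha> \<beta>"
  have gen: "prob_space ?P" "space ?P = path_space t0 T" "sets ?P = sets (path_borel t0 T)"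
    using martingale_problem_solvable[OF t0 \<alpha> \<beta>, of i0] by (auto simp: generated_by_def)
  interpret prob_space ?P by (rule gen)
  have t0T: "t0 \<le> T" using t0 by simp
  have range: "\<tau> \<omega> \<in> {t0..T}" if "\<omega> \<in> path_space t0 T" for \<omega> using \<tau> that by (auto simp: stopping_times_def)
  obtain B where B: "\<And>t \<omega>. t\<in>{t0..T} \<Longrightarrow> \<omega>\<in>path_space t0 T \<Longrightarrow> \<bar>payoff g h t0 \<alpha> \<beta> t \<omega>\<bar> \<le> B"
    using payoff_bound t0 \<alpha> \<beta> by blast
  have "(\<lambda>\<omega>. g (\<tau> \<omega>) (\<omega> (\<tau> \<omega>)) + (LINT s:{t0..\<tau> \<omega>}|lborel. h s (\<omega> s) (\<alpha> s \<omega>) (\<beta> s \<omega>))) \<in> borel_measurable (path_borel t0 T)"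
    using t0 t0T by (intro borel_measurable_add stopped_state_measurable progressive_integral_stopped progressive_reward \<alpha> \<beta> \<tau> continuous_on_subset[OF g_cont]) auto
  then have m: "(\<lambda>\<omega>. g (\<tau> \<omega>) (\<omega> (\<tau> \<omega>)) + (LINT s:{t0..\<tau> \<omega>}|lborel. h s (\<omega> s) (\<alpha> s \<omega>) (\<beta> s \<omega>))) \<in> borel_measurable ?P"
    by (simp add: measurable_cong_sets[OF gen(3) refl])
  have "(\<lambda>\<omega>. payoff g h t0 \<alpha> \<beta> (\<tau> \<omega>) \<omega>) \<in> borel_measurable ?P"
    by (rule measurable_cong[THEN iffD2, OF _ m]) (use payoff_lborel[OF t0 range \<alpha> \<beta>] gen(2) in auto)
  then show ?thesis
    using B range gen(2) by (intro integrable_const_bound[where B=B]) (auto intro!: AE_I2)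
qed

text \<open>The running reward and the generator combine to the integrand whose sign the Zachrisson inequalities control.\<close>
lemma payoff_compensated:
  assumes t0: "t0 \<in> {0..T}" and \<alpha>: "\<alpha> \<in> memory_strategies T t0 U" and \<beta>: "\<beta> \<in> memory_strategies T t0 V"
    and \<phi>: "\<phi> \<in> AC T" and d: "\<And>i. integrable lborel (d i)"
    "\<And>i s t. 0 \<le> s \<Longrightarrow> s \<le> t \<Longrightarrow> t \<le> T \<Longrightarrow> \<phi> t i - \<phi> s i = (LINT x:{s..t}|lborel. d i x)"
    and der: "AE x in lborel. 0 < x \<longrightarrow> x < T \<longrightarrow> (\<forall>i. ((\<lambda>t. \<phi> t i) has_real_derivative d i x) (at x))"
    and t: "t \<in> {t0..T}" and w: "\<omega> \<in> path_space t0 T"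
  shows "set_integrable lborel {t0..t} (\<lambda>s. d (\<omega> s) s + pre_hamiltonian Q h s (\<omega> s) (\<chi> j. \<phi> s j) (\<alpha> s \<omega>) (\<beta> s \<omega>))"
    and "payoff g h t0 \<alpha> \<beta> t \<omega> - compensated_process Q t0 \<alpha> \<beta> \<phi> t \<omega> = g t (\<omega> t) - \<phi> t (\<omega> t) +
    (LINT s:{t0..t}|lborel. d (\<omega> s) s + pre_hamiltonian Q h s (\<omega> s) (\<chi> j. \<phi> s j) (\<alpha> s \<omega>) (\<beta> s \<omega>))"
proof -
  interpret test_process T t0 rate_bound_Q undefined "\<lambda>s \<omega> i j. Q s (\<alpha> s \<omega>) (\<beta> s \<omega>) $ i $ j" \<phi> d
    by (rule AC_test_process[OF t0 \<alpha> \<beta> \<phi> d])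
  let ?h = "\<lambda>s. h s (\<omega> s) (\<alpha> s \<omega>) (\<beta> s \<omega>)"
  have e: "d (\<omega> s) s + pre_hamiltonian Q h s (\<omega> s) (\<chi> j. \<phi> s j) (\<alpha> s \<omega>) (\<beta> s \<omega>) = ?h s + generator_term s \<omega>" for s
    by (simp add: pre_hamiltonian_def generator_term_def rate_term_def)
  have i: "set_integrable lborel {t0..t} ?h" "set_integrable lborel {t0..t} (\<lambda>s. generator_term s \<omega>)"
    using reward_integrable[OF t0 t \<alpha> \<beta> w] generator_term_integrable[OF w, of t0 t] t by auto
  show "set_integrable lborel {t0..t} (\<lambda>s. d (\<omega> s) s + pre_hamiltonian Q h s (\<omega> s) (\<chi> j. \<phi> s j) (\<alpha> s \<omega>) (\<beta> s \<omega>))"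
    unfolding e using i by (rule set_integral_add)
  have "compensated_process Q t0 \<alpha> \<beta> \<phi> t \<omega> = compensated t \<omega>"
    by (rule compensated_process_eq[OF t0 \<alpha> \<beta> \<phi> d(1) _ der t w]) (rule d(2))
  then show "payoff g h t0 \<alpha> \<beta> t \<omega> - compensated_process Q t0 \<alpha> \<beta> \<phi> t \<omega> = g t (\<omega> t) - \<phi> t (\<omega> t) +
    (LINT s:{t0..t}|lborel. d (\<omega> s) s + pre_hamiltonian Q h s (\<omega> s) (\<chi> j. \<phi> s j) (\<alpha> s \<omega>) (\<beta> s \<omega>))"
    unfolding e set_integral_add(2)[OF i] payoff_lborel[OF t0 t \<alpha> \<beta> w] by (simp add: compensated_def)
qed

text \<open>The one expectation that the comparison needs; everything else is estimated path by path.\<close>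
theorem stopped_compensated_process:
  fixes i0 :: 's
  assumes t0: "t0 \<in> {0..T}" and \<alpha>: "\<alpha> \<in> memory_strategies T t0 U" and \<beta>: "\<beta> \<in> memory_strategies T t0 V"
    and \<phi>: "\<phi> \<in> AC T" and \<tau>: "\<tau> \<in> stopping_times T t0"
  defines "P \<equiv> game_prob T Q t0 i0 \<alpha> \<beta>"
  shows "integrable P (\<lambda>\<omega>. compensated_process Q t0 \<alpha> \<beta> \<phi> (\<tau> \<omega>) \<omega>)"
    and "(LINT \<omega>|P. compensated_process Q t0 \<alpha> \<beta> \<phi> (\<tau> \<omega>) \<omega>) = \<phi> t0 i0"
proof -
  have gen: "prob_space P" "space P = path_space t0 T" "sets P = sets (path_borel t0 T)"
    "measure P {\<omega> \<in> path_space t0 T. \<omega> t0 = i0} = 1"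
    and mart: "is_martingale P (path_filtration T t0) t0 T (compensated_process Q t0 \<alpha> \<beta> \<phi>)"
    using martingale_problem_solvable[OF t0 \<alpha> \<beta>, of i0] \<phi> by (auto simp: generated_by_def P_def)
  interpret P: prob_space P by (rule gen)
  have t0T: "t0 \<le> T" using t0 by simp
  obtain d where d: "\<And>i. integrable lborel (d i)"
    "\<And>i s t. 0 \<le> s \<Longrightarrow> s \<le> t \<Longrightarrow> t \<le> T \<Longrightarrow> \<phi> t i - \<phi> s i = (LINT x:{s..t}|lborel. d i x)"
    "AE x in lborel. 0 < x \<longrightarrow> x < T \<longrightarrow> (\<forall>i. ((\<lambda>t. \<phi> t i) has_real_derivative d i x) (at x))"
    by (rule AC_density[OF \<phi>]) (rule that)
  interpret test_process T t0 rate_bound_Q i0 "\<lambda>s \<omega> i j. Q s (\<alpha> s \<omega>) (\<beta> s \<omega>) $ i $ j" \<phi> d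
    by (rule AC_test_process[OF t0 \<alpha> \<beta> \<phi> d(1,2)])
  have eq: "compensated_process Q t0 \<alpha> \<beta> \<phi> t \<omega> = compensated t \<omega>" if "t \<in> {t0..T}" "\<omega> \<in> path_space t0 T" for t \<omega>
    by (rule compensated_process_eq[OF t0 \<alpha> \<beta> \<phi> d(1) _ d(3) that]) (rule d(2))
  obtain B where B: "\<And>t \<omega>. t \<in> {t0..T} \<Longrightarrow> \<omega> \<in> path_space t0 T \<Longrightarrow> \<bar>compensated t \<omega>\<bar> \<le> B" using compensated_bounded by blast
  have spF: "space (path_filtration T t0 t) = space P" for t by (simp add: path_filtration_def gen(2))
  have subF: "sets (path_filtration T t0 t) \<subseteq> sets P" if "t \<in> {t0..T}" for t
    unfolding gen(3) by (rule path_filtration_borel[OF t0T that])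
  have monoF: "sets (path_filtration T t0 s :: (real \<Rightarrow> 's) measure) \<subseteq> sets (path_filtration T t0 t)" if "t0 \<le> s" "s \<le> t" "t \<le> T" for s t
    using that by (intro path_filtration_subset[OF t0T]) auto
  have \<tau>1: "Measurable.pred (path_filtration T t0 t) (\<lambda>\<omega>. \<tau> \<omega> \<le> t)" if "t \<in> {t0..T}" for t
    using \<tau> that by (auto simp: stopping_times_def)
  have \<tau>2: "\<tau> \<omega> \<in> {t0..T}" if "\<omega> \<in> space P" for \<omega> using \<tau> that gen(2) by (auto simp: stopping_times_def)
  have right: "(\<lambda>n. compensated_process Q t0 \<alpha> \<beta> \<phi> (u n) \<omega>) \<longlonglongrightarrow> compensated_process Q t0 \<alpha> \<beta> \<phi> t \<omega>"
    if "\<omega> \<in> space P" "t \<in> {t0..T}" "\<And>n :: nat. u n \<in> {t..T}" "u \<longlonglongrightarrow> t" for \<omega> t u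
  proof -
    have w: "\<omega> \<in> path_space t0 T" using that gen(2) by simp
    have "u n \<in> {t0..T}" for n using that(2) that(3)[of n] by auto
    then show ?thesis using compensated_right_continuous[OF w that(2-4)] eq[OF _ w] that(2) by simp
  qed
  have bound: "\<bar>compensated_process Q t0 \<alpha> \<beta> \<phi> t \<omega>\<bar> \<le> B" if "\<omega> \<in> space P" "t \<in> {t0..T}" for \<omega> t
    using B eq that gen(2) by simp
  note os = optional_stopping[OF mart gen(1) t0T spF subF monoF \<tau>1 \<tau>2 right bound]
  show "integrable P (\<lambda>\<omega>. compensated_process Q t0 \<alpha> \<beta> \<phi> (\<tau> \<omega>) \<omega>)" by (rule os(1))
  have "AE \<omega> in P. \<omega> t0 = i0"
  proof -
    have "{\<omega> \<in> path_space t0 T. \<omega> t0 = i0} \<in> sets P" unfolding gen(3) using t0T by (intro evaluation_sets_borel) auto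
    then show ?thesis using gen(4) P.prob_Collect_eq_1[of "\<lambda>\<omega>. \<omega> t0 = i0"] gen(2) by simp
  qed
  then have ae: "AE \<omega> in P. compensated_process Q t0 \<alpha> \<beta> \<phi> t0 \<omega> = \<phi> t0 i0"
    using AE_space by eventually_elim (use eq[of t0] compensated_start t0T gen(2) in auto)
  have "integrable P (compensated_process Q t0 \<alpha> \<beta> \<phi> t0)"
    using mart t0T by (auto simp: is_martingale_def)
  then have "(LINT \<omega>|P. compensated_process Q t0 \<alpha> \<beta> \<phi> t0 \<omega>) = (LINT \<omega>|P. \<phi> t0 i0)"
    using ae by (intro integral_cong_AE) auto
  also have "\<dots> = \<phi> t0 i0" by (simp add: P.prob_space)
  finally have start: "(LINT \<omega>|P. compensated_process Q t0 \<alpha> \<beta> \<phi> t0 \<omega>) = \<phi> t0 i0" .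
  show "(LINT \<omega>|P. compensated_process Q t0 \<alpha> \<beta> \<phi> (\<tau> \<omega>) \<omega>) = \<phi> t0 i0"
    by (rule trans[OF os(2) start])
qed

end

section \<open>Feedback strategies and stopping rules\<close>

lemma with_memory_strategy:
  fixes u :: "real \<Rightarrow> 's::finite \<Rightarrow> 'c::metric_space"
  assumes u: "u \<in> feedback_strategies T A" and t0: "t0 \<in> {0..T}"
  shows "with_memory u \<in> memory_strategies T t0 A"
  unfolding memory_strategies_def with_memory_def
proof (intro CollectI ballI)
  fix t assume t: "t \<in> {t0..T}"
  let ?M = "restrict_space borel {t0..t} \<Otimes>\<^sub>M (path_filtration T t0 t :: (real \<Rightarrow> 's) measure)"
  have "(\<lambda>s. s) \<in> restrict_space borel {t0..t} \<rightarrow>\<^sub>M restrict_space borel {0..T}"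
    using t t0 by (intro measurable_restrict_space3) auto
  then have f: "fst \<in> ?M \<rightarrow>\<^sub>M restrict_space borel {0..T}" using measurable_compose[OF measurable_fst] by blast
  have "(\<lambda>x. u (fst x) i) \<in> ?M \<rightarrow>\<^sub>M restrict_space borel A" for i
    using u by (intro measurable_compose[OF f]) (simp add: feedback_strategies_def)
  moreover have "(\<lambda>x. snd x (fst x)) \<in> ?M \<rightarrow>\<^sub>M count_space UNIV"
    using joint_evaluation[OF _ t] t0 by (simp add: case_prod_unfold)
  ultimately show "(\<lambda>(s, \<omega>). u s (\<omega> s)) \<in> ?M \<rightarrow>\<^sub>M restrict_space borel A"
    unfolding case_prod_unfold by (rule measurable_compose_finite)
qed

lemma finite_grid: "finite (grid a b n)"
  by (simp add: grid_def)

text \<open>A function of the cell takes finitely many values, hence is measurable whatever the choice of \<open>c\<close>.\<close>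
lemma grid_feedback:
  assumes T: "0 < T" and c: "\<And>t i. t \<in> grid 0 T n \<Longrightarrow> c t i \<in> A"
  shows "(\<lambda>t i. c (grid_floor 0 T n t) i) \<in> feedback_strategies T A"
  unfolding feedback_strategies_def
proof (intro CollectI allI)
  fix i
  have "mono (grid_floor 0 T n)" using grid_floor_mono[OF T] by (auto simp: mono_def)
  then have b: "grid_floor 0 T n \<in> borel_measurable (restrict_space borel {0..T})"
    by (intro measurable_restrict_space1 borel_measurable_mono)
  have "grid_floor 0 T n \<in> restrict_space borel {0..T} \<rightarrow>\<^sub>M count_space (grid 0 T n)"
    unfolding measurable_count_space_eq2[OF finite_grid]
  proof (intro conjI ballI)
    show "grid_floor 0 T n \<in> space (restrict_space borel {0..T}) \<rightarrow> grid 0 T n"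
      using grid_floor_in_grid[OF T] by (auto simp: space_restrict_space)
    show "grid_floor 0 T n -` {a} \<inter> space (restrict_space borel {0..T}) \<in> sets (restrict_space borel {0..T})" for a
      by (rule measurable_sets[OF b]) simp
  qed
  moreover have "(\<lambda>t. c t i) \<in> count_space (grid 0 T n) \<rightarrow>\<^sub>M restrict_space borel A"
    using c by (auto simp: space_restrict_space)
  ultimately show "(\<lambda>t. c (grid_floor 0 T n t) i) \<in> restrict_space borel {0..T} \<rightarrow>\<^sub>M restrict_space borel A"
    by (rule measurable_compose)
qed

lemma grid_stopping_rule:
  assumes T: "0 < T"
  shows "(\<lambda>t i. if P (grid_floor 0 T n t) i then 1 else 0) \<in> stopping_rules T"
  unfolding stopping_rules_def cadlag_on_def
proof (intro CollectI allI conjI ballI)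
  fix i t
  let ?f = "\<lambda>t. if P (grid_floor 0 T n t) i then 1 else 0 :: nat"
  show "?f t \<in> topspace (discrete_topology {0, 1})" by (cases "P (grid_floor 0 T n t) i") simp_all
  obtain u where u: "u > t" "\<forall>s. t \<le> s \<longrightarrow> s < u \<longrightarrow> grid_floor 0 T n s = grid_floor 0 T n t"
    using grid_floor_right_const[OF T] by blast
  have "\<forall>\<^sub>F s in at_right t. ?f s = ?f t"
    unfolding eventually_at_right_field
  proof (intro exI[of _ u] conjI allI impI)
    fix s assume "t < s" "s < u"
    then have "grid_floor 0 T n s = grid_floor 0 T n t" using u(2) less_imp_le by blast
    then show "?f s = ?f t" by (simp only:)
  qed (rule u(1))
  then show "limitin (discrete_topology {0, 1}) ?f (?f t) (at_right t)"
    by (intro limitin_eventually) auto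
  obtain u l where u: "u < t" "\<forall>s. u < s \<longrightarrow> s < t \<longrightarrow> grid_floor 0 T n s = l"
    using grid_floor_left_const[OF T] by blast
  have "\<forall>\<^sub>F s in at_left t. ?f s = (if P l i then 1 else 0)"
    unfolding eventually_at_left_field
  proof (intro exI[of _ u] conjI allI impI)
    fix s assume "u < s" "s < t"
    then have "grid_floor 0 T n s = l" using u(2) by blast
    then show "?f s = (if P l i then 1 else 0)" by (simp only:)
  qed (rule u(1))
  then show "\<exists>l. limitin (discrete_topology {0, 1}) ?f l (at_left t)"
    by (intro exI[of _ "if P l i then 1 else 0"] limitin_eventually) auto
qed

context
  fixes T t0 :: real and \<theta> :: "real \<Rightarrow> 's::finite \<Rightarrow> nat"
  assumes t0: "t0 \<in> {0..T}" and \<theta>: "\<theta> \<in> stopping_rules T"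
begin

lemma stopping_rule_values: "t \<in> {0..T} \<Longrightarrow> \<theta> t i = 0 \<or> \<theta> t i = 1"
  using \<theta> by (auto simp: stopping_rules_def cadlag_on_def)

lemma stopping_rule_right:
  assumes w: "\<omega> \<in> path_space t0 T" and t: "t0 \<le> t" "t < T"
  shows "\<exists>u>t. \<forall>s. t \<le> s \<longrightarrow> s < u \<longrightarrow> \<theta> s (\<omega> s) = \<theta> t (\<omega> t)"
proof -
  obtain u where u: "u > t" "\<forall>s. t \<le> s \<longrightarrow> s < u \<longrightarrow> \<omega> s = \<omega> t" using path_space_right[OF w t] by blast
  have "t \<in> {0..<T}" using t t0 by auto
  then have "limitin (discrete_topology {0, 1}) (\<lambda>t. \<theta> t (\<omega> t')) (\<theta> t (\<omega> t')) (at_right t)" for t'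
    using \<theta> unfolding stopping_rules_def cadlag_on_def by blast
  moreover have "openin (discrete_topology {0, 1}) {\<theta> t (\<omega> t)}"
    using stopping_rule_values[of t "\<omega> t"] t t0 by auto
  ultimately have "\<forall>\<^sub>F s in at_right t. \<theta> s (\<omega> t) \<in> {\<theta> t (\<omega> t)}" by (rule limitinD) simp
  then have "\<forall>\<^sub>F s in at_right t. \<theta> s (\<omega> t) = \<theta> t (\<omega> t)" by simp
  then obtain u' where u': "u' > t" "\<forall>s>t. s < u' \<longrightarrow> \<theta> s (\<omega> t) = \<theta> t (\<omega> t)"
    unfolding eventually_at_right_field by blast
  show ?thesis
  proof (intro exI[of _ "min u u'"] conjI allI impI)
    fix s assume s: "t \<le> s" "s < min u u'"
    then have "\<omega> s = \<omega> t" by (intro u(2)[rule_format]) auto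
    moreover have "\<theta> s (\<omega> t) = \<theta> t (\<omega> t)"
    proof (cases "s = t")
      case False
      then show ?thesis using u'(2)[rule_format, of s] s by simp
    qed simp
    ultimately show "\<theta> s (\<omega> s) = \<theta> t (\<omega> t)" by (simp only:)
  qed (use u(1) u'(1) in simp)
qed

text \<open>By right continuity of the rule along the path, the set of times at which it is 1 contains its infimum; hence the least
  element in \<open>rule_time\<close> exists.\<close>
lemma rule_time_attained:
  assumes w: "\<omega> \<in> path_space t0 T" and ex: "\<exists>t\<in>{t0..T}. \<theta> t (\<omega> t) = 1"
  shows "rule_time T t0 \<theta> \<omega> \<in> {t0..T}" "\<theta> (rule_time T t0 \<theta> \<omega>) (\<omega> (rule_time T t0 \<theta> \<omega>)) = 1"
    "\<And>t. t \<in> {t0..T} \<Longrightarrow> \<theta> t (\<omega> t) = 1 \<Longrightarrow> rule_time T t0 \<theta> \<omega> \<le> t"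
proof -
  define S where "S = {t \<in> {t0..T}. \<theta> t (\<omega> t) = 1}"
  have ne: "S \<noteq> {}" using ex by (auto simp: S_def)
  have bdd: "bdd_below S" by (rule bdd_belowI[of _ t0]) (auto simp: S_def)
  have ge: "t0 \<le> Inf S" using ne by (intro cInf_greatest) (auto simp: S_def)
  have le: "Inf S \<le> t" if "t \<in> S" for t using that bdd by (rule cInf_lower)
  have mem: "Inf S \<in> S"
  proof (rule ccontr)
    assume no: "Inf S \<notin> S"
    obtain r where r: "r \<in> S" using ne by blast
    then have "Inf S < r" "r \<le> T" using le[OF r] no by (auto simp: S_def less_le)
    then have T: "Inf S < T" by simp
    then have "\<theta> (Inf S) (\<omega> (Inf S)) \<noteq> 1" using no ge by (auto simp: S_def)
    then obtain u where u: "u > Inf S" "\<forall>s. Inf S \<le> s \<longrightarrow> s < u \<longrightarrow> \<theta> s (\<omega> s) \<noteq> 1"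
      using stopping_rule_right[OF w ge T] by metis
    have "u \<le> s" if "s \<in> S" for s using u(2) le[OF that] that by (force simp: S_def)
    then have "u \<le> Inf S" using ne by (intro cInf_greatest)
    then show False using u(1) by simp
  qed
  have "rule_time T t0 \<theta> \<omega> = Inf S"
    unfolding rule_time_def using ex mem le by (auto simp: S_def intro!: Least_equality)
  then show "rule_time T t0 \<theta> \<omega> \<in> {t0..T}" "\<theta> (rule_time T t0 \<theta> \<omega>) (\<omega> (rule_time T t0 \<theta> \<omega>)) = 1"
    "\<And>t. t \<in> {t0..T} \<Longrightarrow> \<theta> t (\<omega> t) = 1 \<Longrightarrow> rule_time T t0 \<theta> \<omega> \<le> t"
    using mem le by (auto simp: S_def)
qed

lemma rule_time_range: "\<omega> \<in> path_space t0 T \<Longrightarrow> rule_time T t0 \<theta> \<omega> \<in> {t0..T}"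
  using rule_time_attained(1) t0 by (cases "\<exists>t\<in>{t0..T}. \<theta> t (\<omega> t) = 1") (auto simp: rule_time_def)

lemma rule_time_before:
  assumes w: "\<omega> \<in> path_space t0 T" and s: "t0 \<le> s" "s < rule_time T t0 \<theta> \<omega>"
  shows "\<theta> s (\<omega> s) = 0"
proof (rule ccontr)
  assume "\<theta> s (\<omega> s) \<noteq> 0"
  moreover have sT: "s \<in> {t0..T}" using rule_time_range[OF w] s by auto
  ultimately have "\<theta> s (\<omega> s) = 1" using stopping_rule_values[of s "\<omega> s"] t0 by auto
  then have "rule_time T t0 \<theta> \<omega> \<le> s" using sT by (intro rule_time_attained(3)[OF w _ sT]) auto
  then show False using s by simp
qed

text \<open>Before \<open>t\<close> the rule switches on for a whole interval, so it suffices to look at rational times and at \<open>t\<close> itself.\<close>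
lemma rule_time_stopping_time: "rule_time T t0 \<theta> \<in> stopping_times T t0"
  unfolding stopping_times_def
proof (intro CollectI conjI ballI)
  show "rule_time T t0 \<theta> \<in> path_space t0 T \<rightarrow> {t0..T}" using rule_time_range by auto
  fix t assume t: "t \<in> {t0..T}"
  let ?F = "path_filtration T t0 t :: (real \<Rightarrow> 's) measure"
  have t0T: "t0 \<le> T" using t0 by simp
  have spF: "space ?F = path_space t0 T" by (simp add: path_filtration_def)
  show "Measurable.pred ?F (\<lambda>\<omega>. rule_time T t0 \<theta> \<omega> \<le> t)"
  proof (cases "t = T")
    case True
    have "{\<omega> \<in> space ?F. rule_time T t0 \<theta> \<omega> \<le> t} = space ?F" unfolding spF using rule_time_range True by auto
    then show ?thesis unfolding pred_def by (simp only: sets.top)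
  next
    case False
    define D where "D = insert t (\<rat> \<inter> {t0..t})"
    have D: "countable D" "D \<subseteq> {t0..t}" using t by (auto simp: D_def countable_rat intro: countable_subset[OF _ countable_rat])
    have "rule_time T t0 \<theta> \<omega> \<le> t \<longleftrightarrow> (\<exists>s\<in>D. \<theta> s (\<omega> s) = 1)" if w: "\<omega> \<in> path_space t0 T" for \<omega>
    proof
      assume "\<exists>s\<in>D. \<theta> s (\<omega> s) = 1"
      then obtain s where s: "s \<in> {t0..t}" "\<theta> s (\<omega> s) = 1" using D by blast
      have sT: "s \<in> {t0..T}" using s t by auto
      show "rule_time T t0 \<theta> \<omega> \<le> t" using rule_time_attained(3)[OF w _ sT] s sT by force
    next
      let ?r = "rule_time T t0 \<theta> \<omega>"
      assume le: "?r \<le> t"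
      then have "\<exists>t\<in>{t0..T}. \<theta> t (\<omega> t) = 1" using False t by (auto simp: rule_time_def split: if_splits)
      note r = rule_time_attained[OF w this]
      show "\<exists>s\<in>D. \<theta> s (\<omega> s) = 1"
      proof (cases "?r = t")
        case True
        then show ?thesis using r(2) by (auto simp: D_def)
      next
        case ne: False
        have "t0 \<le> ?r" "?r < T" using r(1) ne le t by auto
        then obtain u where u: "u > ?r" "\<forall>s. ?r \<le> s \<longrightarrow> s < u \<longrightarrow> \<theta> s (\<omega> s) = 1"
          using stopping_rule_right[OF w] r(2) by metis
        obtain s where s: "s \<in> \<rat>" "?r < s" "s < min u t" using Rats_dense_in_real[of ?r "min u t"] u(1) le ne by auto
        then have "s \<in> D" using r(1) by (auto simp: D_def)
        moreover have "\<theta> s (\<omega> s) = 1" using u(2) s by (simp add: less_imp_le)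
        ultimately show ?thesis by blast
      qed
    qed
    then have "{\<omega> \<in> space ?F. rule_time T t0 \<theta> \<omega> \<le> t} = (\<Union>s\<in>D. \<Union>i\<in>{i. \<theta> s i = 1}. {\<omega> \<in> path_space t0 T. \<omega> s = i})"
      unfolding spF by blast
    also have "\<dots> \<in> sets ?F"
    proof (rule sets.countable_UN''[OF D(1)])
      fix s assume "s \<in> D"
      then have "s \<in> {t0..t}" using D by blast
      then show "(\<Union>i\<in>{i. \<theta> s i = 1}. {\<omega> \<in> path_space t0 T. \<omega> s = i}) \<in> sets ?F"
        using t by (intro sets.finite_UN path_filtration_eval[OF t0T]) auto
    qed
    finally show ?thesis unfolding pred_def .
  qed
qed

end

section \<open>Near-optimal feedback\<close>

context
  fixes U :: "'u set" and V :: "'v set" and f :: "'u \<Rightarrow> 'v \<Rightarrow> real" and B :: real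
  assumes U: "U \<noteq> {}" and V: "V \<noteq> {}" and B: "\<And>u v. u \<in> U \<Longrightarrow> v \<in> V \<Longrightarrow> \<bar>f u v\<bar> \<le> B"
begin

lemma minimax_le:
  assumes "u \<in> U" "\<And>v. v \<in> V \<Longrightarrow> f u v \<le> c" shows "(INF u\<in>U. SUP v\<in>V. f u v) \<le> c"
proof -
  have "\<bar>SUP v\<in>V. f u v\<bar> \<le> B" if "u \<in> U" for u using V B[OF that] by (intro cSup_abs_le) auto
  then have "bdd_below ((\<lambda>u. SUP v\<in>V. f u v) ` U)" by (intro bdd_belowI2[of _ "-B"]) (force simp: abs_le_iff)
  then have "(INF u\<in>U. SUP v\<in>V. f u v) \<le> (SUP v\<in>V. f u v)" using assms(1) by (rule cINF_lower)
  also have "\<dots> \<le> c" using V assms(2) by (rule cSUP_least)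
  finally show ?thesis .
qed

lemma maximin_ge:
  assumes "v \<in> V" "\<And>u. u \<in> U \<Longrightarrow> c \<le> f u v" shows "c \<le> (SUP v\<in>V. INF u\<in>U. f u v)"
proof -
  have "\<bar>INF u\<in>U. f u v\<bar> \<le> B" if "v \<in> V" for v using U B[OF _ that] by (intro cInf_abs_ge) auto
  then have "bdd_above ((\<lambda>v. INF u\<in>U. f u v) ` V)" by (intro bdd_aboveI2[of _ _ B]) (force simp: abs_le_iff)
  then have "(INF u\<in>U. f u v) \<le> (SUP v\<in>V. INF u\<in>U. f u v)" using assms(1) by (intro cSUP_upper)
  moreover have "c \<le> (INF u\<in>U. f u v)" using U assms(2) by (rule cINF_greatest)
  ultimately show ?thesis by simp
qed

lemma minimax_approx:
  assumes "e > 0" shows "\<exists>u\<in>U. \<forall>v\<in>V. f u v \<le> (INF u\<in>U. SUP v\<in>V. f u v) + e"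
proof -
  have "\<exists>x\<in>(\<lambda>u. SUP v\<in>V. f u v) ` U. x < (INF u\<in>U. SUP v\<in>V. f u v) + e"
    using assms U by (intro cInf_lessD) auto
  then obtain u where u: "u \<in> U" "(SUP v\<in>V. f u v) < (INF u\<in>U. SUP v\<in>V. f u v) + e" by blast
  have "f u v \<le> (SUP v\<in>V. f u v)" if "v \<in> V" for v
    using that B[OF u(1)] by (intro cSUP_upper bdd_aboveI2[of _ _ B]) (auto simp: abs_le_iff)
  then show ?thesis using u by force
qed

lemma maximin_approx:
  assumes "e > 0" shows "\<exists>v\<in>V. \<forall>u\<in>U. (SUP v\<in>V. INF u\<in>U. f u v) - e \<le> f u v"
proof -
  have "\<exists>x\<in>(\<lambda>v. INF u\<in>U. f u v) ` V. (SUP v\<in>V. INF u\<in>U. f u v) - e < x"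
    using assms V by (intro less_cSupD) auto
  then obtain v where v: "v \<in> V" "(SUP v\<in>V. INF u\<in>U. f u v) - e < (INF u\<in>U. f u v)" by blast
  have "(INF u\<in>U. f u v) \<le> f u v" if "u \<in> U" for u
    using that B[OF _ v(1)] by (intro cINF_lower bdd_belowI2[of _ "-B"]) (force simp: abs_le_iff)+
  then show ?thesis using v by force
qed

end

context stopping_game
begin

context
  fixes \<phi> :: "real \<Rightarrow> 's \<Rightarrow> real"
  assumes \<phi>_cont: "\<And>i. continuous_on {0..T} (\<lambda>t. \<phi> t i)"
begin

abbreviation "state_vector t \<equiv> (\<chi> j. \<phi> t j)"

lemma pre_hamiltonian_continuous:
  "continuous_on ({0..T} \<times> U \<times> V) (\<lambda>(t, u, v). pre_hamiltonian Q h t i (state_vector t) u v)"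
proof -
  have "continuous_on ({0..T} \<times> U \<times> V) (\<lambda>x. \<phi> (fst x) j)" for j
    by (rule continuous_on_compose2[OF \<phi>_cont, of _ fst]) (auto intro!: continuous_intros)
  moreover have "continuous_on ({0..T} \<times> U \<times> V) (\<lambda>x. Q (fst x) (fst (snd x)) (snd (snd x)) $ i $ j)" for j
    using Q_cont[of i j] by (simp add: case_prod_unfold)
  moreover have "continuous_on ({0..T} \<times> U \<times> V) (\<lambda>x. h (fst x) i (fst (snd x)) (snd (snd x)))"
    using h_cont[of i] by (simp add: case_prod_unfold)
  ultimately show ?thesis
    unfolding pre_hamiltonian_def case_prod_unfold vec_lambda_beta by (intro continuous_on_add continuous_on_sum continuous_on_mult)
qed

lemma pre_hamiltonian_bounded:
  obtains B where "\<And>t i u v. t \<in> {0..T} \<Longrightarrow> u \<in> U \<Longrightarrow> v \<in> V \<Longrightarrow> \<bar>pre_hamiltonian Q h t i (state_vector t) u v\<bar> \<le> B"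
proof -
  obtain B where B: "\<forall>x\<in>{0..T} \<times> U \<times> V. \<forall>i. \<bar>(case x of (t, u, v) \<Rightarrow> pre_hamiltonian Q h t i (state_vector t) u v)\<bar> \<le> B"
    using continuous_bounded[of "\<lambda>x i. case x of (t, u, v) \<Rightarrow> pre_hamiltonian Q h t i (state_vector t) u v", OF pre_hamiltonian_continuous] by blast
  show thesis by (rule that[of B]) (use B in force)
qed

lemma pre_hamiltonian_uniform:
  assumes "e > 0"
  shows "\<exists>\<delta>>0. \<forall>s\<in>{0..T}. \<forall>t\<in>{0..T}. \<bar>s - t\<bar> < \<delta> \<longrightarrow> (\<forall>i. \<forall>u\<in>U. \<forall>v\<in>V.
    \<bar>pre_hamiltonian Q h s i (state_vector s) u v - pre_hamiltonian Q h t i (state_vector t) u v\<bar> < e)"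
proof -
  let ?p = "\<lambda>i. \<lambda>(t, u, v). pre_hamiltonian Q h t i (state_vector t) u v"
  have "\<exists>\<delta>>0. \<forall>x\<in>{0..T} \<times> U \<times> V. \<forall>y\<in>{0..T} \<times> U \<times> V. dist y x < \<delta> \<longrightarrow> dist (?p i y) (?p i x) < e" for i
    using compact_uniformly_continuous[OF pre_hamiltonian_continuous compact_controls, of i] assms
    unfolding uniformly_continuous_on_def by blast
  then have "\<exists>\<delta>. \<forall>i. \<delta> i > 0 \<and> (\<forall>x\<in>{0..T} \<times> U \<times> V. \<forall>y\<in>{0..T} \<times> U \<times> V. dist y x < \<delta> i \<longrightarrow> dist (?p i y) (?p i x) < e)"
    by (intro choice allI)
  then obtain \<delta> where \<delta>: "\<And>i. \<delta> i > 0"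
    "\<And>i x y. x \<in> {0..T} \<times> U \<times> V \<Longrightarrow> y \<in> {0..T} \<times> U \<times> V \<Longrightarrow> dist y x < \<delta> i \<Longrightarrow> dist (?p i y) (?p i x) < e" by blast
  have "\<bar>pre_hamiltonian Q h s i (state_vector s) u v - pre_hamiltonian Q h t i (state_vector t) u v\<bar> < e"
    if "s \<in> {0..T}" "t \<in> {0..T}" "\<bar>s - t\<bar> < Min (range \<delta>)" "u \<in> U" "v \<in> V" for s t i u v
  proof -
    have "Min (range \<delta>) \<le> \<delta> i" by (rule Min_le) auto
    then have "dist (s, u, v) (t, u, v) < \<delta> i" using that(3) by (simp add: dist_Pair_Pair dist_real_def)
    then show ?thesis using \<delta>(2)[of "(t, u, v)" "(s, u, v)" i] that by (simp add: dist_real_def)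
  qed
  moreover have "Min (range \<delta>) > 0" using \<delta>(1) by simp
  ultimately show ?thesis by blast
qed

lemma fine_grid: "\<delta> > 0 \<Longrightarrow> \<exists>n. T / Suc n < \<delta>"
  using reals_Archimedean[of "\<delta> / T"] T by (auto simp: field_simps)

text \<open>A control that is nearly optimal at the left end of a cell stays so on the cell, since both the expression and its min-max are
  uniformly continuous in time.\<close>
lemma upper_feedback:
  assumes e: "e > 0"
  shows "\<exists>u\<in>feedback_strategies T U. \<forall>t\<in>{0..T}. \<forall>i. \<forall>v\<in>V.
    pre_hamiltonian Q h t i (state_vector t) (u t i) v \<le> hamiltonian U V Q h t i (state_vector t) + e"
proof -
  let ?p = "\<lambda>t i. pre_hamiltonian Q h t i (state_vector t)" and ?H = "\<lambda>t i. hamiltonian U V Q h t i (state_vector t)"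
  obtain B where B: "\<And>t i u v. t \<in> {0..T} \<Longrightarrow> u \<in> U \<Longrightarrow> v \<in> V \<Longrightarrow> \<bar>?p t i u v\<bar> \<le> B"
    by (rule pre_hamiltonian_bounded) (rule that)
  have "e / 4 > 0" using e by simp
  then obtain \<delta> where \<delta>: "\<delta> > 0" "\<And>s t i u v. s \<in> {0..T} \<Longrightarrow> t \<in> {0..T} \<Longrightarrow> \<bar>s - t\<bar> < \<delta> \<Longrightarrow> u \<in> U \<Longrightarrow> v \<in> V \<Longrightarrow>
    \<bar>?p s i u v - ?p t i u v\<bar> < e / 4" using pre_hamiltonian_uniform by metis
  obtain n where n: "T / Suc n < \<delta>" using fine_grid \<delta> by blast
  have best: "\<exists>u\<in>U. \<forall>v\<in>V. ?p t i u v \<le> ?H t i + e / 4" if "t \<in> {0..T}" for t i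
    unfolding hamiltonian_def using minimax_approx[OF U(2) V(2), of "?p t i", OF B[OF that] \<open>e / 4 > 0\<close>] by blast
  then obtain c where c: "\<And>t i. t \<in> {0..T} \<Longrightarrow> c t i \<in> U" "\<And>t i v. t \<in> {0..T} \<Longrightarrow> v \<in> V \<Longrightarrow> ?p t i (c t i) v \<le> ?H t i + e / 4"
    by metis
  show ?thesis
  proof (intro bexI[of _ "\<lambda>t i. c (grid_floor 0 T n t) i"] ballI allI)
    show "(\<lambda>t i. c (grid_floor 0 T n t) i) \<in> feedback_strategies T U"
      using c(1) grid_subset[OF T] by (intro grid_feedback[OF T]) blast
    fix t i v assume t: "t \<in> {0..T}" and v: "v \<in> V"
    define s where "s = grid_floor 0 T n t"
    have s: "s \<in> {0..T}" using grid_floor_mem[OF T t] by (simp add: s_def)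
    have close: "\<bar>s - t\<bar> < \<delta>" using grid_floor_bounds[OF T, where t=t and n=n] n by (simp add: s_def)
    obtain u where u: "u \<in> U" "\<And>v. v \<in> V \<Longrightarrow> ?p t i u v \<le> ?H t i + e / 4" using best[OF t] by blast
    have "?H s i \<le> ?H t i + e / 2"
      unfolding hamiltonian_def[of _ _ _ _ s]
    proof (rule minimax_le[OF U(2) V(2) B[OF s] u(1)])
      show "?p s i u v \<le> ?H t i + e / 2" if "v \<in> V" for v
        using u(2)[OF that] \<delta>(2)[OF s t close u(1) that, of i] by linarith
    qed
    then show "?p t i (c (grid_floor 0 T n t) i) v \<le> ?H t i + e"
      using c(2)[OF s v, of i] \<delta>(2)[OF s t close c(1)[OF s] v, of i i] unfolding s_def[symmetric] by linarith
  qed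
qed

text \<open>As for the first player, with the order of the players and of the inequalities exchanged.\<close>
lemma lower_feedback:
  assumes e: "e > 0"
  shows "\<exists>v\<in>feedback_strategies T V. \<forall>t\<in>{0..T}. \<forall>i. \<forall>u\<in>U.
    lower_hamiltonian U V Q h t i (state_vector t) - e \<le> pre_hamiltonian Q h t i (state_vector t) u (v t i)"
proof -
  let ?p = "\<lambda>t i. pre_hamiltonian Q h t i (state_vector t)" and ?H = "\<lambda>t i. lower_hamiltonian U V Q h t i (state_vector t)"
  obtain B where B: "\<And>t i u v. t \<in> {0..T} \<Longrightarrow> u \<in> U \<Longrightarrow> v \<in> V \<Longrightarrow> \<bar>?p t i u v\<bar> \<le> B"
    by (rule pre_hamiltonian_bounded) (rule that)
  have "e / 4 > 0" using e by simp
  then obtain \<delta> where \<delta>: "\<delta> > 0" "\<And>s t i u v. s \<in> {0..T} \<Longrightarrow> t \<in> {0..T} \<Longrightarrow> \<bar>s - t\<bar> < \<delta> \<Longrightarrow> u \<in> U \<Longrightarrow> v \<in> V \<Longrightarrow>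
    \<bar>?p s i u v - ?p t i u v\<bar> < e / 4" using pre_hamiltonian_uniform by metis
  obtain n where n: "T / Suc n < \<delta>" using fine_grid \<delta> by blast
  have best: "\<exists>v\<in>V. \<forall>u\<in>U. ?H t i - e / 4 \<le> ?p t i u v" if "t \<in> {0..T}" for t i
    unfolding lower_hamiltonian_def using maximin_approx[OF U(2) V(2), of "?p t i", OF B[OF that] \<open>e / 4 > 0\<close>] by blast
  then obtain c where c: "\<And>t i. t \<in> {0..T} \<Longrightarrow> c t i \<in> V" "\<And>t i u. t \<in> {0..T} \<Longrightarrow> u \<in> U \<Longrightarrow> ?H t i - e / 4 \<le> ?p t i u (c t i)"
    by metis
  show ?thesis
  proof (intro bexI[of _ "\<lambda>t i. c (grid_floor 0 T n t) i"] ballI allI)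
    show "(\<lambda>t i. c (grid_floor 0 T n t) i) \<in> feedback_strategies T V"
      using c(1) grid_subset[OF T] by (intro grid_feedback[OF T]) blast
    fix t i u assume t: "t \<in> {0..T}" and u: "u \<in> U"
    define s where "s = grid_floor 0 T n t"
    have s: "s \<in> {0..T}" using grid_floor_mem[OF T t] by (simp add: s_def)
    have close: "\<bar>s - t\<bar> < \<delta>" using grid_floor_bounds[OF T, where t=t and n=n] n by (simp add: s_def)
    obtain v where v: "v \<in> V" "\<And>u. u \<in> U \<Longrightarrow> ?H t i - e / 4 \<le> ?p t i u v" using best[OF t] by blast
    have "?H t i - e / 2 \<le> ?H s i"
      unfolding lower_hamiltonian_def[of _ _ _ _ s]
    proof (rule maximin_ge[OF U(2) V(2) B[OF s] v(1)])
      show "?H t i - e / 2 \<le> ?p s i u v" if "u \<in> U" for u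
        using v(2)[OF that] \<delta>(2)[OF s t close that v(1), of i] by linarith
    qed
    then show "?H t i - e \<le> ?p t i u (c (grid_floor 0 T n t) i)"
      using c(2)[OF s u, of i] \<delta>(2)[OF s t close u c(1)[OF s], of i i] unfolding s_def[symmetric] by linarith
  qed
qed

text \<open>The rule stops on a whole cell as soon as \<open>\<phi>\<close> meets \<open>g\<close> somewhere in the cell. On other cells \<open>\<phi> < g\<close> throughout, and on
  a stopping cell \<open>g - \<phi>\<close> is small by uniform continuity. Stopping may thus happen slightly before contact, which costs at most
  \<open>e\<close>.\<close>
lemma contact_stopping_rule:
  assumes e: "e > 0" and le: "\<And>t i. t \<in> {0..T} \<Longrightarrow> \<phi> t i \<le> g t i" and fin: "\<And>i. \<phi> T i = g T i"
  shows "\<exists>\<theta>\<in>stopping_rules T. (\<forall>t\<in>{0..T}. \<forall>i. (\<theta> t i = 0 \<longrightarrow> \<phi> t i < g t i) \<and> (\<theta> t i = 1 \<longrightarrow> g t i \<le> \<phi> t i + e)) \<and> (\<forall>i. \<theta> T i = 1)"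
proof -
  have "\<exists>\<delta>>0. \<forall>t\<in>{0..T}. \<forall>s\<in>{0..T}. dist s t < \<delta> \<longrightarrow> dist (g s i - \<phi> s i) (g t i - \<phi> t i) < e" for i
    using compact_uniformly_continuous[of "{0..T}" "\<lambda>t. g t i - \<phi> t i", OF continuous_on_diff[OF g_cont \<phi>_cont]] e
    unfolding uniformly_continuous_on_def by simp
  then obtain \<delta> where \<delta>: "\<And>i. \<delta> i > 0"
    "\<And>i s t. t \<in> {0..T} \<Longrightarrow> s \<in> {0..T} \<Longrightarrow> dist s t < \<delta> i \<Longrightarrow> dist (g s i - \<phi> s i) (g t i - \<phi> t i) < e" by metis
  have "Min (range \<delta>) > 0" using \<delta>(1) by simp
  then obtain n where n: "T / Suc n < Min (range \<delta>)" using fine_grid by blast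
  define P where "P r i \<longleftrightarrow> (\<exists>s\<in>{0..T}. grid_floor 0 T n s = r \<and> \<phi> s i = g s i)" for r i
  let ?\<theta> = "\<lambda>t i. if P (grid_floor 0 T n t) i then 1 else 0 :: nat"
  have "g t i \<le> \<phi> t i + e" if t: "t \<in> {0..T}" and P: "P (grid_floor 0 T n t) i" for t i
  proof -
    obtain s where s: "s \<in> {0..T}" "grid_floor 0 T n s = grid_floor 0 T n t" "\<phi> s i = g s i" using P by (auto simp: P_def)
    have "dist s t < T / Suc n"
      using grid_floor_bounds[OF T, where t=s and n=n] grid_floor_bounds[OF T, where t=t and n=n] s(2) by (simp add: dist_real_def abs_less_iff)
    also have "\<dots> < \<delta> i" using n Min_le[of "range \<delta>" "\<delta> i"] by simp
    finally have "dist (g s i - \<phi> s i) (g t i - \<phi> t i) < e" by (rule \<delta>(2)[OF t s(1)])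
    then show ?thesis using s(3) by (simp add: dist_real_def)
  qed
  moreover have "\<phi> t i < g t i" if "t \<in> {0..T}" "\<not> P (grid_floor 0 T n t) i" for t i
    using le[OF that(1), of i] that by (auto simp: P_def less_le)
  moreover have "P (grid_floor 0 T n T) i" for i using T fin by (auto simp: P_def intro!: bexI[of _ T])
  ultimately show ?thesis by (intro bexI[of _ ?\<theta>] grid_stopping_rule[OF T]) auto
qed

end

end

section \<open>Comparison and the value\<close>

context stopping_game
begin

lemma expected_payoff_bounded:
  assumes t0: "t0 \<in> {0..T}"
  obtains B where "\<And>\<alpha> \<beta> \<tau>. \<alpha> \<in> memory_strategies T t0 U \<Longrightarrow> \<beta> \<in> memory_strategies T t0 V \<Longrightarrow> \<tau> \<in> stopping_times T t0 \<Longrightarrow>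
    \<bar>expected_payoff T Q g h t0 i0 \<alpha> \<beta> \<tau>\<bar> \<le> B"
proof -
  obtain B where B: "\<And>\<alpha> \<beta> t \<omega>. \<alpha> \<in> memory_strategies T t0 U \<Longrightarrow> \<beta> \<in> memory_strategies T t0 V \<Longrightarrow>
    t \<in> {t0..T} \<Longrightarrow> \<omega> \<in> path_space t0 T \<Longrightarrow> \<bar>payoff g h t0 \<alpha> \<beta> t \<omega>\<bar> \<le> B"
    using payoff_bound t0 by blast
  show thesis
  proof (rule that[of B])
    fix \<alpha> :: "real \<Rightarrow> (real \<Rightarrow> 's) \<Rightarrow> 'u" and \<beta> :: "real \<Rightarrow> (real \<Rightarrow> 's) \<Rightarrow> 'v" and \<tau> :: "(real \<Rightarrow> 's) \<Rightarrow> real"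
    assume \<alpha>: "\<alpha> \<in> memory_strategies T t0 U" and \<beta>: "\<beta> \<in> memory_strategies T t0 V" and \<tau>: "\<tau> \<in> stopping_times T t0"
    let ?P = "game_prob T Q t0 i0 \<alpha> \<beta>"
    have gen: "prob_space ?P" "space ?P = path_space t0 T"
      using martingale_problem_solvable[OF t0 \<alpha> \<beta>, of i0] by (auto simp: generated_by_def)
    interpret prob_space ?P by (rule gen)
    have int: "integrable ?P (\<lambda>\<omega>. payoff g h t0 \<alpha> \<beta> (\<tau> \<omega>) \<omega>)" by (rule stopped_payoff_integrable[OF t0 \<alpha> \<beta> \<tau>])
    have b: "\<bar>payoff g h t0 \<alpha> \<beta> (\<tau> \<omega>) \<omega>\<bar> \<le> B" if "\<omega> \<in> space ?P" for \<omega>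
      using that gen(2) \<tau> by (intro B[OF \<alpha> \<beta>]) (auto simp: stopping_times_def)
    have "\<bar>expected_payoff T Q g h t0 i0 \<alpha> \<beta> \<tau>\<bar> \<le> (LINT \<omega>|?P. \<bar>payoff g h t0 \<alpha> \<beta> (\<tau> \<omega>) \<omega>\<bar>)"
      unfolding expected_payoff_def by (rule integral_abs_bound)
    also have "\<dots> \<le> (LINT \<omega>|?P. B)" using int b by (intro integral_mono integrable_abs) auto
    also have "\<dots> = B" by (simp add: prob_space)
    finally show "\<bar>expected_payoff T Q g h t0 i0 \<alpha> \<beta> \<tau>\<bar> \<le> B" .
  qed
qed

context
  fixes \<phi> :: "real \<Rightarrow> 's \<Rightarrow> real" and t0 :: real and i0 :: 's
  assumes \<phi>: "\<phi> \<in> AC T" and zachrisson: "zachrisson T U V Q g h \<phi>" and t0: "t0 \<in> {0..T}"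
begin

lemma zachrisson_D:
  "\<phi> T i = g T i" "t \<in> {0..T} \<Longrightarrow> \<phi> t i \<le> g t i"
  "t \<in> {0..T} \<Longrightarrow> ((\<lambda>s. \<phi> s i) has_real_derivative D) (at t within {0..T}) \<Longrightarrow> \<phi> t i < g t i \<Longrightarrow>
    D \<le> - hamiltonian U V Q h t i (state_vector \<phi> t)"
  "t \<in> {0..T} \<Longrightarrow> ((\<lambda>s. \<phi> s i) has_real_derivative D) (at t within {0..T}) \<Longrightarrow>
    - hamiltonian U V Q h t i (state_vector \<phi> t) \<le> D"
proof -
  note z = zachrisson[unfolded zachrisson_def, rule_format, of i]
  show "\<phi> T i = g T i" using z by (rule conjunct1)
  show "\<phi> t i \<le> g t i" if "t \<in> {0..T}" using z[THEN conjunct2, THEN conjunct1] that by (rule bspec)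
  show "D \<le> - hamiltonian U V Q h t i (state_vector \<phi> t)"
    if "t \<in> {0..T}" "((\<lambda>s. \<phi> s i) has_real_derivative D) (at t within {0..T})" "\<phi> t i < g t i"
    by (rule z[THEN conjunct2, THEN conjunct2, THEN conjunct1, rule_format, OF that])
  show "- hamiltonian U V Q h t i (state_vector \<phi> t) \<le> D"
    if "t \<in> {0..T}" "((\<lambda>s. \<phi> s i) has_real_derivative D) (at t within {0..T})"
    by (rule z[THEN conjunct2, THEN conjunct2, THEN conjunct2, rule_format, OF that])
qed

lemma zachrisson_density:
  assumes "AE x in lborel. 0 < x \<longrightarrow> x < T \<longrightarrow> (\<forall>i. ((\<lambda>t. \<phi> t i) has_real_derivative d i x) (at x))"
  shows "AE x in lborel. x \<in> {0..T} \<longrightarrow> (\<forall>i. - hamiltonian U V Q h x i (state_vector \<phi> x) \<le> d i x \<and>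
    (\<phi> x i < g x i \<longrightarrow> d i x \<le> - hamiltonian U V Q h x i (state_vector \<phi> x)))"
  using assms AE_lborel_singleton[of 0] AE_lborel_singleton[of T]
proof eventually_elim
  case (elim x)
  show ?case
  proof (intro impI allI)
    fix i assume x: "x \<in> {0..T}"
    have "((\<lambda>t. \<phi> t i) has_real_derivative d i x) (at x within {0..T})"
      by (rule has_field_derivative_at_within) (use elim x in auto)
    then show "- hamiltonian U V Q h x i (state_vector \<phi> x) \<le> d i x \<and>
      (\<phi> x i < g x i \<longrightarrow> d i x \<le> - hamiltonian U V Q h x i (state_vector \<phi> x))"
      using zachrisson_D(3,4)[OF x] by blast
  qed
qed

text \<open>The second player's guarantee: along every path the payoff exceeds the compensated process minus the accumulated error.\<close>
lemma expected_payoff_ge: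
  assumes \<alpha>: "\<alpha> \<in> memory_strategies T t0 U" and \<beta>: "\<beta> \<in> memory_strategies T t0 V" and \<tau>: "\<tau> \<in> stopping_times T t0" and e: "e \<ge> 0"
    and near: "\<And>s \<omega>. s \<in> {t0..T} \<Longrightarrow> \<omega> \<in> path_space t0 T \<Longrightarrow>
      hamiltonian U V Q h s (\<omega> s) (state_vector \<phi> s) - e \<le> pre_hamiltonian Q h s (\<omega> s) (state_vector \<phi> s) (\<alpha> s \<omega>) (\<beta> s \<omega>)"
  shows "\<phi> t0 i0 - e * T \<le> expected_payoff T Q g h t0 i0 \<alpha> \<beta> \<tau>"
proof -
  let ?P = "game_prob T Q t0 i0 \<alpha> \<beta>"
  obtain d where d: "\<And>i. integrable lborel (d i)"
    "\<And>i s t. 0 \<le> s \<Longrightarrow> s \<le> t \<Longrightarrow> t \<le> T \<Longrightarrow> \<phi> t i - \<phi> s i = (LINT x:{s..t}|lborel. d i x)"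
    "AE x in lborel. 0 < x \<longrightarrow> x < T \<longrightarrow> (\<forall>i. ((\<lambda>t. \<phi> t i) has_real_derivative d i x) (at x))"
    by (rule AC_density[OF \<phi>]) (rule that)
  have gen: "prob_space ?P" "space ?P = path_space t0 T"
    using martingale_problem_solvable[OF t0 \<alpha> \<beta>, of i0] by (auto simp: generated_by_def)
  interpret prob_space ?P by (rule gen)
  have path: "compensated_process Q t0 \<alpha> \<beta> \<phi> (\<tau> \<omega>) \<omega> - e * T \<le> payoff g h t0 \<alpha> \<beta> (\<tau> \<omega>) \<omega>" if w: "\<omega> \<in> path_space t0 T" for \<omega>
  proof -
    let ?k = "\<lambda>s. d (\<omega> s) s + pre_hamiltonian Q h s (\<omega> s) (state_vector \<phi> s) (\<alpha> s \<omega>) (\<beta> s \<omega>)"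
    have t: "\<tau> \<omega> \<in> {t0..T}" using \<tau> w by (auto simp: stopping_times_def)
    have k: "set_integrable lborel {t0..\<tau> \<omega>} ?k" by (rule payoff_compensated(1)[OF t0 \<alpha> \<beta> \<phi> d(1) _ d(3) t w]) (rule d(2))
    have "(LINT s:{t0..\<tau> \<omega>}|lborel. - e) \<le> (LINT s:{t0..\<tau> \<omega>}|lborel. ?k s)"
    proof (rule set_integral_mono_AE[OF _ k])
      show "set_integrable lborel {t0..\<tau> \<omega>} (\<lambda>s. - e)" using t unfolding set_integrable_def by (intro integrable_scaleR_left) simp
      show "AE s\<in>{t0..\<tau> \<omega>} in lborel. - e \<le> ?k s"
        using zachrisson_density[OF d(3)]
      proof eventually_elim
        case (elim s)
        show ?case
        proof
          assume "s \<in> {t0..\<tau> \<omega>}"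
          then have s: "s \<in> {t0..T}" "s \<in> {0..T}" using t t0 by auto
          then have "- hamiltonian U V Q h s (\<omega> s) (state_vector \<phi> s) \<le> d (\<omega> s) s" using elim by blast
          then show "- e \<le> ?k s" using near[OF s(1) w] by linarith
        qed
      qed
    qed
    moreover have "(LINT s:{t0..\<tau> \<omega>}|lborel. - e) = - (e * (\<tau> \<omega> - t0))"
      using t by (simp add: set_lebesgue_integral_def)
    moreover have "e * (\<tau> \<omega> - t0) \<le> e * T" using t t0 e by (intro mult_left_mono) auto
    moreover have "\<phi> (\<tau> \<omega>) (\<omega> (\<tau> \<omega>)) \<le> g (\<tau> \<omega>) (\<omega> (\<tau> \<omega>))" using t t0 by (intro zachrisson_D) auto
    moreover have "payoff g h t0 \<alpha> \<beta> (\<tau> \<omega>) \<omega> - compensated_process Q t0 \<alpha> \<beta> \<phi> (\<tau> \<omega>) \<omega> =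
      g (\<tau> \<omega>) (\<omega> (\<tau> \<omega>)) - \<phi> (\<tau> \<omega>) (\<omega> (\<tau> \<omega>)) + (LINT s:{t0..\<tau> \<omega>}|lborel. ?k s)"
      by (rule payoff_compensated(2)[OF t0 \<alpha> \<beta> \<phi> d(1) _ d(3) t w]) (rule d(2))
    ultimately show ?thesis by linarith
  qed
  note comp = stopped_compensated_process[OF t0 \<alpha> \<beta> \<phi> \<tau>, of i0]
  have "\<phi> t0 i0 - e * T = (LINT \<omega>|?P. compensated_process Q t0 \<alpha> \<beta> \<phi> (\<tau> \<omega>) \<omega> - e * T)"
    using comp by (simp add: prob_space)
  also have "\<dots> \<le> expected_payoff T Q g h t0 i0 \<alpha> \<beta> \<tau>"
    unfolding expected_payoff_def using comp(1) path gen(2)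
    by (intro integral_mono stopped_payoff_integrable[OF t0 \<alpha> \<beta> \<tau>]) auto
  finally show ?thesis .
qed

text \<open>The first player's guarantee: strict inequality \<open>\<phi> < g\<close> before stopping activates the upper differential inequality.\<close>
lemma expected_payoff_le:
  assumes \<alpha>: "\<alpha> \<in> memory_strategies T t0 U" and \<beta>: "\<beta> \<in> memory_strategies T t0 V" and \<tau>: "\<tau> \<in> stopping_times T t0" and e: "e \<ge> 0"
    and near: "\<And>s \<omega>. s \<in> {t0..T} \<Longrightarrow> \<omega> \<in> path_space t0 T \<Longrightarrow>
      pre_hamiltonian Q h s (\<omega> s) (state_vector \<phi> s) (\<alpha> s \<omega>) (\<beta> s \<omega>) \<le> hamiltonian U V Q h s (\<omega> s) (state_vector \<phi> s) + e"
    and before: "\<And>s \<omega>. \<omega> \<in> path_space t0 T \<Longrightarrow> t0 \<le> s \<Longrightarrow> s < \<tau> \<omega> \<Longrightarrow> \<phi> s (\<omega> s) < g s (\<omega> s)"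
    and stop: "\<And>\<omega>. \<omega> \<in> path_space t0 T \<Longrightarrow> g (\<tau> \<omega>) (\<omega> (\<tau> \<omega>)) \<le> \<phi> (\<tau> \<omega>) (\<omega> (\<tau> \<omega>)) + e"
  shows "expected_payoff T Q g h t0 i0 \<alpha> \<beta> \<tau> \<le> \<phi> t0 i0 + e * (1 + T)"
proof -
  let ?P = "game_prob T Q t0 i0 \<alpha> \<beta>"
  obtain d where d: "\<And>i. integrable lborel (d i)"
    "\<And>i s t. 0 \<le> s \<Longrightarrow> s \<le> t \<Longrightarrow> t \<le> T \<Longrightarrow> \<phi> t i - \<phi> s i = (LINT x:{s..t}|lborel. d i x)"
    "AE x in lborel. 0 < x \<longrightarrow> x < T \<longrightarrow> (\<forall>i. ((\<lambda>t. \<phi> t i) has_real_derivative d i x) (at x))"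
    by (rule AC_density[OF \<phi>]) (rule that)
  have gen: "prob_space ?P" "space ?P = path_space t0 T"
    using martingale_problem_solvable[OF t0 \<alpha> \<beta>, of i0] by (auto simp: generated_by_def)
  interpret prob_space ?P by (rule gen)
  have path: "payoff g h t0 \<alpha> \<beta> (\<tau> \<omega>) \<omega> \<le> compensated_process Q t0 \<alpha> \<beta> \<phi> (\<tau> \<omega>) \<omega> + e * (1 + T)" if w: "\<omega> \<in> path_space t0 T" for \<omega>
  proof -
    let ?k = "\<lambda>s. d (\<omega> s) s + pre_hamiltonian Q h s (\<omega> s) (state_vector \<phi> s) (\<alpha> s \<omega>) (\<beta> s \<omega>)"
    have t: "\<tau> \<omega> \<in> {t0..T}" using \<tau> w by (auto simp: stopping_times_def)
    have k: "set_integrable lborel {t0..\<tau> \<omega>} ?k" by (rule payoff_compensated(1)[OF t0 \<alpha> \<beta> \<phi> d(1) _ d(3) t w]) (rule d(2))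
    have "(LINT s:{t0..\<tau> \<omega>}|lborel. ?k s) \<le> (LINT s:{t0..\<tau> \<omega>}|lborel. e)"
    proof (rule set_integral_mono_AE[OF k])
      show "set_integrable lborel {t0..\<tau> \<omega>} (\<lambda>s. e)" using t unfolding set_integrable_def by (intro integrable_scaleR_left) simp
      show "AE s\<in>{t0..\<tau> \<omega>} in lborel. ?k s \<le> e"
        using zachrisson_density[OF d(3)] AE_lborel_singleton[of "\<tau> \<omega>"]
      proof eventually_elim
        case (elim s)
        show ?case
        proof
          assume "s \<in> {t0..\<tau> \<omega>}"
          then have s: "s \<in> {t0..T}" "s \<in> {0..T}" "t0 \<le> s" "s < \<tau> \<omega>" using t t0 elim by auto
          then have "d (\<omega> s) s \<le> - hamiltonian U V Q h s (\<omega> s) (state_vector \<phi> s)" using elim before[OF w s(3,4)] by blast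
          then show "?k s \<le> e" using near[OF s(1) w] by linarith
        qed
      qed
    qed
    moreover have "(LINT s:{t0..\<tau> \<omega>}|lborel. e) = e * (\<tau> \<omega> - t0)"
      using t by (simp add: set_lebesgue_integral_def)
    moreover have "e * (\<tau> \<omega> - t0) \<le> e * T" using t t0 e by (intro mult_left_mono) auto
    moreover have "e * (1 + T) = e + e * T" by (simp add: algebra_simps)
    moreover have "payoff g h t0 \<alpha> \<beta> (\<tau> \<omega>) \<omega> - compensated_process Q t0 \<alpha> \<beta> \<phi> (\<tau> \<omega>) \<omega> =
      g (\<tau> \<omega>) (\<omega> (\<tau> \<omega>)) - \<phi> (\<tau> \<omega>) (\<omega> (\<tau> \<omega>)) + (LINT s:{t0..\<tau> \<omega>}|lborel. ?k s)"
      by (rule payoff_compensated(2)[OF t0 \<alpha> \<beta> \<phi> d(1) _ d(3) t w]) (rule d(2))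
    ultimately show ?thesis using stop[OF w] by linarith
  qed
  note comp = stopped_compensated_process[OF t0 \<alpha> \<beta> \<phi> \<tau>, of i0]
  have "expected_payoff T Q g h t0 i0 \<alpha> \<beta> \<tau> \<le> (LINT \<omega>|?P. compensated_process Q t0 \<alpha> \<beta> \<phi> (\<tau> \<omega>) \<omega> + e * (1 + T))"
    unfolding expected_payoff_def using comp(1) path gen(2)
    by (intro integral_mono stopped_payoff_integrable[OF t0 \<alpha> \<beta> \<tau>]) auto
  also have "\<dots> = \<phi> t0 i0 + e * (1 + T)" using comp by (simp add: prob_space)
  finally show ?thesis .
qed

lemma epsilon_saddle_point:
  assumes isaacs: "\<And>t i w. t \<in> {0..T} \<Longrightarrow> hamiltonian U V Q h t i w = lower_hamiltonian U V Q h t i w" and e: "e > 0"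
  obtains u v \<theta> where "u \<in> feedback_strategies T U" "v \<in> feedback_strategies T V" "\<theta> \<in> stopping_rules T"
    "\<And>\<alpha> \<tau>. \<alpha> \<in> memory_strategies T t0 U \<Longrightarrow> \<tau> \<in> stopping_times T t0 \<Longrightarrow>
      \<phi> t0 i0 - e \<le> expected_payoff T Q g h t0 i0 \<alpha> (with_memory v) \<tau>"
    "\<And>\<beta>. \<beta> \<in> memory_strategies T t0 V \<Longrightarrow>
      expected_payoff T Q g h t0 i0 (with_memory u) \<beta> (rule_time T t0 \<theta>) \<le> \<phi> t0 i0 + e"
proof -
  \<comment> \<open>Both errors have to fit into \<open>e\<close>: rate \<open>r\<close> over a time of at most \<open>T\<close>, and \<open>r\<close> once more at stopping.\<close>
  define r where "r = e / (1 + T)"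
  have r: "r > 0" "r * (1 + T) = e" using e T by (auto simp: r_def)
  have rT: "r * T \<le> e" using r by (simp add: algebra_simps)
  have cont: "continuous_on {0..T} (\<lambda>t. \<phi> t i)" for i
    using abs_continuous_continuous[of 0 T "\<lambda>t. \<phi> t i"] \<phi> by (auto simp: AC_def)
  have t0T: "t0 \<le> T" using t0 by simp
  obtain u where u: "u \<in> feedback_strategies T U" "\<And>t i v. t \<in> {0..T} \<Longrightarrow> v \<in> V \<Longrightarrow>
    pre_hamiltonian Q h t i (state_vector \<phi> t) (u t i) v \<le> hamiltonian U V Q h t i (state_vector \<phi> t) + r"
    using upper_feedback[of \<phi>, OF cont r(1)] by blast
  obtain v where v: "v \<in> feedback_strategies T V" "\<And>t i u. t \<in> {0..T} \<Longrightarrow> u \<in> U \<Longrightarrow>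
    lower_hamiltonian U V Q h t i (state_vector \<phi> t) - r \<le> pre_hamiltonian Q h t i (state_vector \<phi> t) u (v t i)"
    using lower_feedback[of \<phi>, OF cont r(1)] by blast
  obtain \<theta> where \<theta>: "\<theta> \<in> stopping_rules T" "\<And>t i. t \<in> {0..T} \<Longrightarrow> \<theta> t i = 0 \<Longrightarrow> \<phi> t i < g t i"
    "\<And>t i. t \<in> {0..T} \<Longrightarrow> \<theta> t i = 1 \<Longrightarrow> g t i \<le> \<phi> t i + r" "\<And>i. \<theta> T i = 1"
    using contact_stopping_rule[of \<phi>, OF cont r(1) zachrisson_D(2,1)] by blast
  have um: "with_memory u \<in> memory_strategies T t0 U" and vm: "with_memory v \<in> memory_strategies T t0 V"
    using with_memory_strategy t0 u(1) v(1) by blast+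
  show thesis
  proof (rule that[OF u(1) v(1) \<theta>(1)])
    fix \<alpha> :: "real \<Rightarrow> (real \<Rightarrow> 's) \<Rightarrow> 'u" and \<tau> :: "(real \<Rightarrow> 's) \<Rightarrow> real"
    assume \<alpha>: "\<alpha> \<in> memory_strategies T t0 U" and \<tau>: "\<tau> \<in> stopping_times T t0"
    have "\<phi> t0 i0 - r * T \<le> expected_payoff T Q g h t0 i0 \<alpha> (with_memory v) \<tau>"
    proof (rule expected_payoff_ge[OF \<alpha> vm \<tau>])
      fix s and \<omega> :: "real \<Rightarrow> 's" assume s: "s \<in> {t0..T}" and w: "\<omega> \<in> path_space t0 T"
      have "s \<in> {0..T}" using s t0 by auto
      then show "hamiltonian U V Q h s (\<omega> s) (state_vector \<phi> s) - r \<le>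
        pre_hamiltonian Q h s (\<omega> s) (state_vector \<phi> s) (\<alpha> s \<omega>) (with_memory v s \<omega>)"
        unfolding with_memory_def isaacs[OF \<open>s \<in> {0..T}\<close>] by (intro v(2) memory_strategy_in[OF t0T \<alpha> s w])
    qed (use r in simp)
    then show "\<phi> t0 i0 - e \<le> expected_payoff T Q g h t0 i0 \<alpha> (with_memory v) \<tau>" using rT by linarith
  next
    fix \<beta> :: "real \<Rightarrow> (real \<Rightarrow> 's) \<Rightarrow> 'v" assume \<beta>: "\<beta> \<in> memory_strategies T t0 V"
    have "expected_payoff T Q g h t0 i0 (with_memory u) \<beta> (rule_time T t0 \<theta>) \<le> \<phi> t0 i0 + r * (1 + T)"
    proof (rule expected_payoff_le[OF um \<beta> rule_time_stopping_time[OF t0 \<theta>(1)]])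
      fix s and \<omega> :: "real \<Rightarrow> 's" assume s: "s \<in> {t0..T}" and w: "\<omega> \<in> path_space t0 T"
      have "s \<in> {0..T}" using s t0 by auto
      then show "pre_hamiltonian Q h s (\<omega> s) (state_vector \<phi> s) (with_memory u s \<omega>) (\<beta> s \<omega>) \<le>
        hamiltonian U V Q h s (\<omega> s) (state_vector \<phi> s) + r"
        unfolding with_memory_def by (intro u(2) memory_strategy_in[OF t0T \<beta> s w])
    next
      fix s and \<omega> :: "real \<Rightarrow> 's" assume w: "\<omega> \<in> path_space t0 T" and s: "t0 \<le> s" "s < rule_time T t0 \<theta> \<omega>"
      have "s \<in> {0..T}" using rule_time_range[OF t0 \<theta>(1) w] s t0 by auto
      then show "\<phi> s (\<omega> s) < g s (\<omega> s)" by (intro \<theta>(2) rule_time_before[OF t0 \<theta>(1) w s])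
    next
      fix \<omega> :: "real \<Rightarrow> 's" assume w: "\<omega> \<in> path_space t0 T"
      have "rule_time T t0 \<theta> \<omega> \<in> {0..T}" using rule_time_range[OF t0 \<theta>(1) w] t0 by auto
      moreover have "\<theta> (rule_time T t0 \<theta> \<omega>) (\<omega> (rule_time T t0 \<theta> \<omega>)) = 1"
        using t0T \<theta>(4) by (intro rule_time_attained(2)[OF t0 \<theta>(1) w] bexI[of _ T]) auto
      ultimately show "g (rule_time T t0 \<theta> \<omega>) (\<omega> (rule_time T t0 \<theta> \<omega>)) \<le> \<phi> (rule_time T t0 \<theta> \<omega>) (\<omega> (rule_time T t0 \<theta> \<omega>)) + r"
        by (rule \<theta>(3))
    qed (use r in simp)
    then show "expected_payoff T Q g h t0 i0 (with_memory u) \<beta> (rule_time T t0 \<theta>) \<le> \<phi> t0 i0 + e" using r by simp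
  qed
qed

theorem values_eq:
  assumes isaacs: "\<And>t i w. t \<in> {0..T} \<Longrightarrow> hamiltonian U V Q h t i w = lower_hamiltonian U V Q h t i w"
  shows "upper_value T U V Q g h t0 i0 = \<phi> t0 i0" "lower_value T U V Q g h t0 i0 = \<phi> t0 i0"
proof -
  let ?J = "expected_payoff T Q g h t0 i0"
  let ?Ufb = "feedback_strategies T U :: (real \<Rightarrow> 's \<Rightarrow> 'u) set" and ?Vfb = "feedback_strategies T V :: (real \<Rightarrow> 's \<Rightarrow> 'v) set"
  let ?Um = "memory_strategies T t0 U :: (real \<Rightarrow> (real \<Rightarrow> 's) \<Rightarrow> 'u) set" and ?Vm = "memory_strategies T t0 V :: (real \<Rightarrow> (real \<Rightarrow> 's) \<Rightarrow> 'v) set"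
  let ?\<Theta> = "stopping_rules T :: (real \<Rightarrow> 's \<Rightarrow> nat) set" and ?S = "stopping_times T t0 :: ((real \<Rightarrow> 's) \<Rightarrow> real) set"
  obtain B where B: "\<And>\<alpha> \<beta> \<tau>. \<alpha> \<in> ?Um \<Longrightarrow> \<beta> \<in> ?Vm \<Longrightarrow> \<tau> \<in> ?S \<Longrightarrow> \<bar>?J \<alpha> \<beta> \<tau>\<bar> \<le> B"
    using expected_payoff_bounded[OF t0] by metis
  have wm: "with_memory u \<in> ?Um" if "u \<in> ?Ufb" for u using that t0 by (rule with_memory_strategy)
  have wm': "with_memory v \<in> ?Vm" if "v \<in> ?Vfb" for v using that t0 by (rule with_memory_strategy)
  have rt: "rule_time T t0 \<theta> \<in> ?S" if "\<theta> \<in> ?\<Theta>" for \<theta> using t0 that by (rule rule_time_stopping_time)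
  obtain u1 v1 \<theta>1 where "u1 \<in> ?Ufb" "v1 \<in> ?Vfb" "\<theta>1 \<in> ?\<Theta>"
    by (rule epsilon_saddle_point[OF isaacs zero_less_one], assumption) (rule that)
  then have ne: "?Ufb \<noteq> {}" "?Vfb \<noteq> {}" "?\<Theta> \<noteq> {}" "?Um \<noteq> {}" "?Vm \<noteq> {}" "?S \<noteq> {}"
    using wm wm' rt by blast+
  have bL: "\<bar>INF \<tau>\<in>?S. ?J \<alpha> \<beta> \<tau>\<bar> \<le> B" if "\<alpha> \<in> ?Um" "\<beta> \<in> ?Vm" for \<alpha> \<beta>
    using B[OF that] ne by (intro cInf_abs_ge) auto
  have bL': "\<bar>INF \<alpha>\<in>?Um. INF \<tau>\<in>?S. ?J \<alpha> \<beta> \<tau>\<bar> \<le> B" if "\<beta> \<in> ?Vm" for \<beta>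
    using bL[OF _ that] ne by (intro cInf_abs_ge) auto
  have bU: "\<bar>SUP \<beta>\<in>?Vm. ?J (with_memory u) \<beta> (rule_time T t0 \<theta>)\<bar> \<le> B" if "u \<in> ?Ufb" "\<theta> \<in> ?\<Theta>" for u \<theta>
    using B[OF wm[OF that(1)] _ rt[OF that(2)]] ne by (intro cSup_abs_le) auto
  have bU': "\<bar>INF \<theta>\<in>?\<Theta>. SUP \<beta>\<in>?Vm. ?J (with_memory u) \<beta> (rule_time T t0 \<theta>)\<bar> \<le> B" if "u \<in> ?Ufb" for u
    using bU[OF that] ne by (intro cInf_abs_ge) auto
  have below: "bdd_below (f ` A)" and above: "bdd_above (f ` A)" if "\<And>x. x \<in> A \<Longrightarrow> \<bar>f x\<bar> \<le> B"
    for f :: "'z \<Rightarrow> real" and A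
    using that by (auto simp: abs_le_iff intro!: bdd_belowI2[of _ "-B"] bdd_aboveI2[of _ _ B]) force
  have est: "upper_value T U V Q g h t0 i0 \<le> \<phi> t0 i0 + e" "\<phi> t0 i0 - e \<le> upper_value T U V Q g h t0 i0"
    "lower_value T U V Q g h t0 i0 \<le> \<phi> t0 i0 + e" "\<phi> t0 i0 - e \<le> lower_value T U V Q g h t0 i0" if e: "e > 0" for e
  proof -
    obtain u v \<theta> where u: "u \<in> ?Ufb" and v: "v \<in> ?Vfb" and \<theta>: "\<theta> \<in> ?\<Theta>"
      and low: "\<And>\<alpha> \<tau>. \<alpha> \<in> ?Um \<Longrightarrow> \<tau> \<in> ?S \<Longrightarrow> \<phi> t0 i0 - e \<le> ?J \<alpha> (with_memory v) \<tau>"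
      and up: "\<And>\<beta>. \<beta> \<in> ?Vm \<Longrightarrow> ?J (with_memory u) \<beta> (rule_time T t0 \<theta>) \<le> \<phi> t0 i0 + e"
      using epsilon_saddle_point[OF isaacs e] by metis
    have "upper_value T U V Q g h t0 i0 \<le> (INF \<theta>\<in>?\<Theta>. SUP \<beta>\<in>?Vm. ?J (with_memory u) \<beta> (rule_time T t0 \<theta>))"
      unfolding upper_value_def by (intro cINF_lower below bU' u)
    also have "\<dots> \<le> (SUP \<beta>\<in>?Vm. ?J (with_memory u) \<beta> (rule_time T t0 \<theta>))"
      by (intro cINF_lower below bU u \<theta>)
    also have "\<dots> \<le> \<phi> t0 i0 + e" by (intro cSUP_least ne up)
    finally show "upper_value T U V Q g h t0 i0 \<le> \<phi> t0 i0 + e" .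
    have "\<phi> t0 i0 - e \<le> (SUP \<beta>\<in>?Vm. ?J (with_memory u') \<beta> (rule_time T t0 \<theta>'))" if "u' \<in> ?Ufb" "\<theta>' \<in> ?\<Theta>" for u' \<theta>'
      by (rule order_trans[OF low[OF wm[OF that(1)] rt[OF that(2)]]])
        (intro cSUP_upper above B wm wm' rt that v)
    then show "\<phi> t0 i0 - e \<le> upper_value T U V Q g h t0 i0"
      unfolding upper_value_def by (intro cINF_greatest ne)
    have "(INF \<alpha>\<in>?Um. INF \<tau>\<in>?S. ?J \<alpha> (with_memory v') \<tau>) \<le> \<phi> t0 i0 + e" if v': "v' \<in> ?Vfb" for v'
    proof -
      have "(INF \<alpha>\<in>?Um. INF \<tau>\<in>?S. ?J \<alpha> (with_memory v') \<tau>) \<le> (INF \<tau>\<in>?S. ?J (with_memory u) (with_memory v') \<tau>)"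
        by (intro cINF_lower below bL wm wm' u v')
      also have "\<dots> \<le> ?J (with_memory u) (with_memory v') (rule_time T t0 \<theta>)"
        by (intro cINF_lower below B wm wm' rt u v' \<theta>)
      also have "\<dots> \<le> \<phi> t0 i0 + e" by (intro up wm' v')
      finally show ?thesis .
    qed
    then show "lower_value T U V Q g h t0 i0 \<le> \<phi> t0 i0 + e"
      unfolding lower_value_def by (intro cSUP_least ne)
    have "\<phi> t0 i0 - e \<le> (INF \<alpha>\<in>?Um. INF \<tau>\<in>?S. ?J \<alpha> (with_memory v) \<tau>)"
      by (intro cINF_greatest ne low)
    also have "\<dots> \<le> lower_value T U V Q g h t0 i0"
      unfolding lower_value_def by (intro cSUP_upper above bL' wm' v)
    finally show "\<phi> t0 i0 - e \<le> lower_value T U V Q g h t0 i0" .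
  qed
  have "\<phi> t0 i0 \<le> upper_value T U V Q g h t0 i0" "\<phi> t0 i0 \<le> lower_value T U V Q g h t0 i0"
    by (rule field_le_epsilon, use est(2,4) in \<open>simp add: diff_le_eq\<close>)+
  moreover have "upper_value T U V Q g h t0 i0 \<le> \<phi> t0 i0" "lower_value T U V Q g h t0 i0 \<le> \<phi> t0 i0"
    by (rule field_le_epsilon, rule est, assumption)+
  ultimately show "upper_value T U V Q g h t0 i0 = \<phi> t0 i0" "lower_value T U V Q g h t0 i0 = \<phi> t0 i0"
    by (simp_all only: order_antisym)
qed

end

end

theorem mainTheorem1:
  fixes T :: real
    and U :: "'u::metric_space set"
    and V :: "'v::metric_space set"
    and Q :: "real \<Rightarrow> 'u \<Rightarrow> 'v \<Rightarrow> real^'s::finite^'s"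
    and g :: "real \<Rightarrow> 's \<Rightarrow> real"
    and h :: "real \<Rightarrow> 's \<Rightarrow> 'u \<Rightarrow> 'v \<Rightarrow> real"
    and \<phi> :: "real \<Rightarrow> 's \<Rightarrow> real"
  assumes "T > 0"
    and "compact U" and "U \<noteq> {}"
    and "compact V" and "V \<noteq> {}"
    and "\<And>t u v. t \<in> {0..T} \<Longrightarrow> u \<in> U \<Longrightarrow> v \<in> V \<Longrightarrow> kolmogorov_matrix (Q t u v)"
    and "\<And>i j. continuous_on ({0..T} \<times> U \<times> V) (\<lambda>(t, u, v). Q t u v $ i $ j)"
    and "\<And>i. continuous_on {0..T} (\<lambda>t. g t i)"
    and "\<And>i. continuous_on ({0..T} \<times> U \<times> V) (\<lambda>(t, u, v). h t i u v)"
    and "\<And>i. \<exists>L. L-lipschitz_on {0..T} (\<lambda>t. g t i)"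
    and "\<And>t i w. t \<in> {0..T} \<Longrightarrow> hamiltonian U V Q h t i w = lower_hamiltonian U V Q h t i w"
    and "\<phi> \<in> AC T"
    and "zachrisson T U V Q g h \<phi>"
  shows "\<forall>t0\<in>{0..T}. \<forall>i0. upper_value T U V Q g h t0 i0 = lower_value T U V Q g h t0 i0
           \<and> lower_value T U V Q g h t0 i0 = \<phi> t0 i0"
proof -
  interpret stopping_game T U V Q g h
    by standard (fact assms)+
  show ?thesis
  proof (intro ballI allI)
    fix t0 and i0 :: 's assume t0: "t0 \<in> {0..T}"
    show "upper_value T U V Q g h t0 i0 = lower_value T U V Q g h t0 i0 \<and> lower_value T U V Q g h t0 i0 = \<phi> t0 i0"
      using values_eq[OF \<open>\<phi> \<in> AC T\<close> \<open>zachrisson T U V Q g h \<phi>\<close> t0 assms(11)] by simp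
  qed
qed

end
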